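(* Let $(\mathcal A,\nabla,\sigma)$ be a differential structure whose quantum Markov semigroup $(\mathscr P_t)_t$ is ergodic, and suppose that it satisfies the modified logarithmic Sobolev inequality $\mathrm{MLSI}(\lambda)$ for some $\lambda>0$, i.e. $\mathrm{Ent}_\sigma(\rho)\le\frac1{2\lambda}\mathcal I_\sigma(\rho)$ for all $\rho\in\mathfrak P$. Then the Talagrand inequality $\mathrm T_{\mathcal W}(\lambda)$ holds as well: for all $\rho\in\mathfrak P$, $$\mathcal W(\rho,\sigma)\le\sqrt{\frac2\lambda\,\mathrm{Ent}_\sigma(\rho)} .$$
   Context: Differential structure $(\mathcal A,\nabla,\sigma)$: $\mathcal A$ is a finite-dimensional von Neumann algebra with faithful tracial positive linear functional $\tau$, together with (1) a finite index set $\mathcal J$ and, for each $j\in\mathcal J$, a finite-dimensional von Neumann algebra $\mathcal B_j$ with faithful tracial positive linear functional $\tau_j$; (2) for each $j$, unital $*$-homomorphisms $\ell_j,r_j:\mathcal A\to\mathcal B_j$ with $\tau_j(\ell_j(A))=\tau_j(r_j(A))=\tau(A)$ for all $A\in\mathcal A$, and a non-zero $V_j\in\mathcal B_j$; (3) for each $j$ there is a unique $j^*\in\mathcal J$ with $V_{j^*}=V_j^*$, and $\mathcal B_{j^*}=\mathcal B_j$, $\tau_{j^*}=\tau_j$; moreover $\tau_j[V_j^*\ell_j(A_1)V_jr_j(A_2)]=\tau_j[V_j^*r_{j^*}(A_1)V_j\ell_{j^*}(A_2)]$ for all $A_1,A_2\in\mathcal A$; (4) an invertible density matrix $\sigma\in\mathcal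 A$ and numbers $\omega_j\in\mathbb R$ with $\ell_j(\sigma)V_jr_j(\sigma)^{-1}=e^{-\omega_j}V_j$. Set $\partial_jA:=V_jr_j(A)-\ell_j(A)V_j\in\mathcal B_j$, $\nabla A:=(\partial_jA)_{j\in\mathcal J}$. The associated generator $\mathscr L$ is defined by $\sum_{j}\tau_j[(\partial_jA_1)^*\ell_j(\sigma^{1/2})(\partial_jA_2)r_j(\sigma^{1/2})]=-\tau[A_1^*\sigma^{1/2}(\mathscr LA_2)\sigma^{1/2}]$ for all $A_1,A_2\in\mathcal A$; $\mathscr P_t=e^{t\mathscr L}$; $\dagger$ denotes adjoints with respect to $\tau[A^*B]$ on $\mathcal A$ and $\tau_j[A^*B]$ on $\mathcal B_j$. Ergodic means $\ker\mathscr L=\mathrm{lin}\{\mathbf 1\}$. $\mathfrak P$ (resp. $\mathfrak P_+$): positive semidefinite (resp. positive definite) $\rho\in\mathcal A$ with $\tau[\rho]=1$. $\mathcal A_0:=\{A\in\mathcal A: A=A^*,\ \tau[A]=0\}$. Put $\theta_j(r,s):=\Lambda(e^{\omega_j/2}r,e^{-\omega_j/2}s)$ with $\Lambda(r,s)=\frac{r-s}{\log r-\log s}$, $\Lambda(r,r)=r$, extended continuously to $[0,\infty)^2$. For $\rho=\sum_k\lambda_kE_k$ (spectral decomposition), $\widehat\rho_j:=\sum_{k,m}\theta_j(\lambda_k,\lambda_m)\ell_j(E_k)\otimes r_j(E_m)$, $(A\otimes B)\#C:=ACB$, and $\mathscr K_\rho A:=\sum_j\partial_j^\dagger(\widehat\rho_j\#\partial_jA)$.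 For $\rho\in\mathfrak P_+$, $\mathscr K_\rho$ is a bijection of $\mathcal A_0$ and defines the Riemannian metric $g_\rho(x,y)=\tau[(\mathscr K_\rho^{-1}x)y]$ on $\mathfrak P_+$. $\mathcal W$ is its Riemannian distance, $\mathcal W(\rho_0,\rho_1)^2=\inf\int_0^1\tau[A_t\mathscr K_{\rho_t}A_t]\,dt$ over smooth curves $(\rho_t)$ in $\mathfrak P_+$ from $\rho_0$ to $\rho_1$ and $(A_t)$ in $\mathcal A_0$ with $\partial_t\rho_t=\mathscr K_{\rho_t}A_t$; $\mathcal W$ extends continuously to a metric on $\mathfrak P$. $\mathrm{Ent}_\sigma(\rho)=\tau[\rho(\log\rho-\log\sigma)]$; $\mathcal I_\sigma(\rho)=-\tau[(\log\rho-\log\sigma)\mathscr L^\dagger\rho]$ for $\rho\in\mathfrak P_+$, with the convention $\mathcal I_\sigma(\rho)=+\infty$ for $\rho\in\mathfrak P\setminus\mathfrak P_+$. *)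

theory Defs
  imports "HOL-Analysis.Analysis"
begin

section \<open>Complex matrices\<close>

definition adj :: "complex^'n^'n \<Rightarrow> complex^'n^'n" where
  "adj X = (\<chi> i k. cnj (X $ k $ i))"

definition cscale :: "complex \<Rightarrow> complex^'n^'n \<Rightarrow> complex^'n^'n" where
  "cscale c X = (\<chi> i k. c * X $ i $ k)"

definition qform :: "complex^'n^'n \<Rightarrow> complex^'n \<Rightarrow> complex" where
  "qform X v = (\<Sum>i\<in>UNIV. cnj (v $ i) * (X *v v) $ i)"

definition pos_semidef :: "complex^'n^'n \<Rightarrow> bool" where
  "pos_semidef X \<longleftrightarrow> adj X = X \<and> (\<forall>v. 0 \<le> Re (qform X v))"

definition pos_def :: "complex^'n^'n \<Rightarrow> bool" where
  "pos_def X \<longleftrightarrow> adj X = X \<and> (\<forall>v. v \<noteq> 0 \<longrightarrow> 0 < Re (qform X v))"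

text \<open>Spectral decomposition of a self-adjoint matrix: \<open>X = (\<Sum>a\<in>spec X. a E\<^sub>a)\<close>, where \<open>E\<^sub>a\<close>
  is the orthogonal projection onto the eigenspace of \<open>a\<close>, and the functional calculus
  \<open>f(X) = (\<Sum>a\<in>spec X. f(a) E\<^sub>a)\<close>.\<close>

definition spec :: "complex^'n^'n \<Rightarrow> real set" where
  "spec X = {a. \<exists>v. v \<noteq> 0 \<and> X *v v = of_real a *s v}"

definition eproj :: "complex^'n^'n \<Rightarrow> real \<Rightarrow> complex^'n^'n" where
  "eproj X a = (THE P. adj P = P \<and> P ** P = P \<and>
     {v. P *v v = v} = {v. X *v v = of_real a *s v})"

definition fcalc :: "(real \<Rightarrow> real) \<Rightarrow> complex^'n^'n \<Rightarrow> complex^'n^'n" where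
  "fcalc f X = (\<Sum>a\<in>spec X. cscale (of_real (f a)) (eproj X a))"

section \<open>Finite-dimensional von Neumann algebras\<close>

text \<open>A *-algebra \<open>M\<close> of matrices with unit \<open>e\<close>. Then \<open>e\<close> is automatically an orthogonal projection
  and \<open>M\<close> is a von Neumann algebra of operators on the Hilbert space \<open>ran e\<close>, closedness in
  the weak operator topology being automatic in finite dimension. Allowing \<open>e \<noteq> mat 1\<close> lets
  algebras acting on Hilbert spaces of different dimensions live in one matrix type.\<close>

definition vN_algebra :: "complex^'n^'n \<Rightarrow> (complex^'n^'n) set \<Rightarrow> bool" where
  "vN_algebra e M \<longleftrightarrow>
     e \<in> M \<and> (\<forall>X\<in>M. e ** X = X \<and> X ** e = X) \<and>
     (\<forall>X\<in>M. \<forall>Y\<in>M. X + Y \<in> M) \<and>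
     (\<forall>c. \<forall>X\<in>M. cscale c X \<in> M) \<and>
     (\<forall>X\<in>M. \<forall>Y\<in>M. X ** Y \<in> M) \<and>
     (\<forall>X\<in>M. adj X \<in> M)"

text \<open>Inverse in the algebra \<open>M\<close> with unit \<open>e\<close>.\<close>

definition inv_in :: "complex^'n^'n \<Rightarrow> (complex^'n^'n) set \<Rightarrow> complex^'n^'n \<Rightarrow> complex^'n^'n" where
  "inv_in e M X = (THE Y. Y \<in> M \<and> X ** Y = e \<and> Y ** X = e)"

definition faithful_trace :: "(complex^'n^'n) set \<Rightarrow> (complex^'n^'n \<Rightarrow> complex) \<Rightarrow> bool" where
  "faithful_trace M \<tau> \<longleftrightarrow>
     (\<forall>X\<in>M. \<forall>Y\<in>M. \<tau> (X + Y) = \<tau> X + \<tau> Y) \<and>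
     (\<forall>c. \<forall>X\<in>M. \<tau> (cscale c X) = c * \<tau> X) \<and>
     (\<forall>X\<in>M. \<tau> (adj X ** X) \<in> \<real>\<^sub>\<ge>\<^sub>0) \<and>
     (\<forall>X\<in>M. \<tau> (adj X ** X) = 0 \<longrightarrow> X = 0) \<and>
     (\<forall>X\<in>M. \<forall>Y\<in>M. \<tau> (X ** Y) = \<tau> (Y ** X))"

definition star_hom :: "complex^'n^'n \<Rightarrow> (complex^'n^'n) set \<Rightarrow> complex^'m^'m \<Rightarrow> (complex^'m^'m) set \<Rightarrow>
    (complex^'n^'n \<Rightarrow> complex^'m^'m) \<Rightarrow> bool" where
  "star_hom e M e' M' h \<longleftrightarrow>
     (\<forall>X\<in>M. h X \<in> M') \<and>
     (\<forall>X\<in>M. \<forall>Y\<in>M. h (X + Y) = h X + h Y) \<and>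
     (\<forall>c. \<forall>X\<in>M. h (cscale c X) = cscale c (h X)) \<and>
     (\<forall>X\<in>M. \<forall>Y\<in>M. h (X ** Y) = h X ** h Y) \<and>
     (\<forall>X\<in>M. h (adj X) = adj (h X)) \<and>
     h e = e'"

text \<open>Value at \<open>Y\<close> of the adjoint of \<open>T : M \<rightarrow> M'\<close> with respect to the inner products
  \<open>\<tau>[A\<^sup>*B]\<close> on \<open>M\<close> and \<open>\<tau>'[A\<^sup>*B]\<close> on \<open>M'\<close>.\<close>

definition adjoint_map :: "(complex^'n^'n) set \<Rightarrow> (complex^'n^'n \<Rightarrow> complex) \<Rightarrow> (complex^'m^'m \<Rightarrow> complex) \<Rightarrow>
    (complex^'n^'n \<Rightarrow> complex^'m^'m) \<Rightarrow> complex^'m^'m \<Rightarrow> complex^'n^'n" where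
  "adjoint_map M \<tau> \<tau>' T Y = (THE X. X \<in> M \<and> (\<forall>Z\<in>M. \<tau> (adj X ** Z) = \<tau>' (adj Y ** T Z)))"

section \<open>Differential structures\<close>

text \<open>Data \<open>(\<A>, \<tau>)\<close>, \<open>\<J>\<close>, \<open>(\<B>\<^sub>j, 1, \<tau>\<^sub>j)\<close>, \<open>\<ell>\<^sub>j\<close>, \<open>r\<^sub>j\<close>, \<open>V\<^sub>j\<close>, \<open>\<sigma>\<close>, \<open>\<omega>\<^sub>j\<close>, in this order; maps and functionals on
  an algebra are only relevant on that algebra.\<close>

record ('n, 'm, 'j) diff_struct =
  alg :: "(complex^'n^'n) set"
  tr :: "complex^'n^'n \<Rightarrow> complex"
  idx :: "'j set"
  balg :: "'j \<Rightarrow> (complex^'m^'m) set"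
  bunit :: "'j \<Rightarrow> complex^'m^'m"
  btr :: "'j \<Rightarrow> complex^'m^'m \<Rightarrow> complex"
  lhom :: "'j \<Rightarrow> complex^'n^'n \<Rightarrow> complex^'m^'m"
  rhom :: "'j \<Rightarrow> complex^'n^'n \<Rightarrow> complex^'m^'m"
  vee :: "'j \<Rightarrow> complex^'m^'m"
  dens :: "complex^'n^'n"
  freq :: "'j \<Rightarrow> real"

definition is_dual_index :: "('n::finite, 'm::finite, 'j) diff_struct \<Rightarrow> 'j \<Rightarrow> 'j \<Rightarrow> bool" where
  "is_dual_index D j j' \<longleftrightarrow>
     j' \<in> idx D \<and> vee D j' = adj (vee D j) \<and>
     balg D j' = balg D j \<and> (\<forall>X\<in>balg D j. btr D j' X = btr D j X)"

definition differential_structure :: "('n::finite, 'm::finite, 'j) diff_struct \<Rightarrow> bool" where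
  "differential_structure D \<longleftrightarrow>
     vN_algebra (mat 1) (alg D) \<and> faithful_trace (alg D) (tr D) \<and>
     finite (idx D) \<and>
     (\<forall>j\<in>idx D.
        vN_algebra (bunit D j) (balg D j) \<and> faithful_trace (balg D j) (btr D j) \<and>
        star_hom (mat 1) (alg D) (bunit D j) (balg D j) (lhom D j) \<and>
        star_hom (mat 1) (alg D) (bunit D j) (balg D j) (rhom D j) \<and>
        (\<forall>A\<in>alg D. btr D j (lhom D j A) = tr D A \<and> btr D j (rhom D j A) = tr D A) \<and>
        vee D j \<in> balg D j \<and> vee D j \<noteq> 0) \<and>
     (\<forall>j\<in>idx D.
        (\<exists>!j'. is_dual_index D j j') \<and>
        (\<forall>j'. is_dual_index D j j' \<longrightarrow>
           (\<forall>A\<^sub>1\<in>alg D. \<forall>A\<^sub>2\<in>alg D.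
              btr D j (adj (vee D j) ** lhom D j A\<^sub>1 ** vee D j ** rhom D j A\<^sub>2) =
              btr D j (adj (vee D j) ** rhom D j' A\<^sub>1 ** vee D j ** lhom D j' A\<^sub>2)))) \<and>
     dens D \<in> alg D \<and> pos_semidef (dens D) \<and> tr D (dens D) = 1 \<and> invertible (dens D) \<and>
     (\<forall>j\<in>idx D.
        lhom D j (dens D) ** vee D j ** inv_in (bunit D j) (balg D j) (rhom D j (dens D)) =
        cscale (of_real (exp (- freq D j))) (vee D j))"

definition pderiv_op :: "('n::finite, 'm::finite, 'j) diff_struct \<Rightarrow> 'j \<Rightarrow> complex^'n^'n \<Rightarrow> complex^'m^'m" where
  "pderiv_op D j A = vee D j ** rhom D j A - lhom D j A ** vee D j"

definition pderiv_adj :: "('n::finite, 'm::finite, 'j) diff_struct \<Rightarrow> 'j \<Rightarrow> complex^'m^'m \<Rightarrow> complex^'n^'n" where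
  "pderiv_adj D j = adjoint_map (alg D) (tr D) (btr D j) (pderiv_op D j)"

definition sqrt_dens :: "('n::finite, 'm::finite, 'j) diff_struct \<Rightarrow> complex^'n^'n" where
  "sqrt_dens D = fcalc sqrt (dens D)"

definition generator :: "('n::finite, 'm::finite, 'j) diff_struct \<Rightarrow> complex^'n^'n \<Rightarrow> complex^'n^'n" where
  "generator D A\<^sub>2 = (THE X. X \<in> alg D \<and>
     (\<forall>A\<^sub>1\<in>alg D.
        (\<Sum>j\<in>idx D. btr D j (adj (pderiv_op D j A\<^sub>1) ** lhom D j (sqrt_dens D) **
                               pderiv_op D j A\<^sub>2 ** rhom D j (sqrt_dens D))) =
        - tr D (adj A\<^sub>1 ** sqrt_dens D ** X ** sqrt_dens D)))"

definition generator_adj :: "('n::finite, 'm::finite, 'j) diff_struct \<Rightarrow> complex^'n^'n \<Rightarrow> complex^'n^'n" where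
  "generator_adj D = adjoint_map (alg D) (tr D) (tr D) (generator D)"

text \<open>Ergodicity of the semigroup \<open>e\<^sup>t\<^sup>L\<close> generated by \<open>L = generator D\<close>: the kernel of \<open>L\<close> is
  spanned by the unit.\<close>

definition ergodic :: "('n::finite, 'm::finite, 'j) diff_struct \<Rightarrow> bool" where
  "ergodic D \<longleftrightarrow> {A \<in> alg D. generator D A = 0} = range (\<lambda>c. cscale c (mat 1))"

definition states :: "('n::finite, 'm::finite, 'j) diff_struct \<Rightarrow> (complex^'n^'n) set" where
  "states D = {\<rho> \<in> alg D. pos_semidef \<rho> \<and> tr D \<rho> = 1}"

definition pos_states :: "('n::finite, 'm::finite, 'j) diff_struct \<Rightarrow> (complex^'n^'n) set" where
  "pos_states D = {\<rho> \<in> alg D. pos_def \<rho> \<and> tr D \<rho> = 1}"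

definition traceless :: "('n::finite, 'm::finite, 'j) diff_struct \<Rightarrow> (complex^'n^'n) set" where
  "traceless D = {A \<in> alg D. adj A = A \<and> tr D A = 0}"

section \<open>The transport metric\<close>

text \<open>The boundary values are those of the continuous extension to \<open>[0,\<infinity>)\<^sup>2\<close>; they need a separate
  case since \<open>ln 0 = 0\<close> in the library.\<close>

definition log_mean :: "real \<Rightarrow> real \<Rightarrow> real" where
  "log_mean r s = (if r = 0 \<or> s = 0 then 0 else if r = s then r else (r - s) / (ln r - ln s))"

definition theta :: "('n::finite, 'm::finite, 'j) diff_struct \<Rightarrow> 'j \<Rightarrow> real \<Rightarrow> real \<Rightarrow> real" where
  "theta D j r s = log_mean (exp (freq D j / 2) * r) (exp (- freq D j / 2) * s)"

text \<open>\<open>hat_mult D \<rho> j C\<close> is the contraction of the tensor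
  \<open>\<Sum> \<theta>\<^sub>j(a,b) \<ell>\<^sub>j(E\<^sub>a) \<otimes> r\<^sub>j(E\<^sub>b)\<close> with \<open>C\<close>, where \<open>(A \<otimes> B) # C = A C B\<close>.\<close>

definition hat_mult :: "('n::finite, 'm::finite, 'j) diff_struct \<Rightarrow> complex^'n^'n \<Rightarrow> 'j \<Rightarrow>
    complex^'m^'m \<Rightarrow> complex^'m^'m" where
  "hat_mult D \<rho> j C = (\<Sum>a\<in>spec \<rho>. \<Sum>b\<in>spec \<rho>.
     cscale (of_real (theta D j a b)) (lhom D j (eproj \<rho> a) ** C ** rhom D j (eproj \<rho> b)))"

definition K_op :: "('n::finite, 'm::finite, 'j) diff_struct \<Rightarrow> complex^'n^'n \<Rightarrow> complex^'n^'n \<Rightarrow> complex^'n^'n" where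
  "K_op D \<rho> A = (\<Sum>j\<in>idx D. pderiv_adj D j (hat_mult D \<rho> j (pderiv_op D j A)))"

text \<open>\<open>C\<^sup>\<infinity>\<close> on \<open>[0,1]\<close>, with one-sided derivatives at the end points; \<open>G k\<close> is the \<open>k\<close>-th derivative.\<close>

definition smooth01 :: "(real \<Rightarrow> 'a::real_normed_vector) \<Rightarrow> bool" where
  "smooth01 f \<longleftrightarrow> (\<exists>G :: nat \<Rightarrow> real \<Rightarrow> 'a.
     (\<forall>t\<in>{0..1}. G 0 t = f t) \<and>
     (\<forall>k. \<forall>t\<in>{0..1}. (G k has_vector_derivative G (Suc k) t) (at t within {0..1})))"

definition admissible :: "('n::finite, 'm::finite, 'j) diff_struct \<Rightarrow> complex^'n^'n \<Rightarrow> complex^'n^'n \<Rightarrow>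
    (real \<Rightarrow> complex^'n^'n) \<Rightarrow> (real \<Rightarrow> complex^'n^'n) \<Rightarrow> bool" where
  "admissible D \<rho>\<^sub>0 \<rho>\<^sub>1 \<rho> A \<longleftrightarrow>
     smooth01 \<rho> \<and> smooth01 A \<and>
     (\<forall>t\<in>{0..1}. \<rho> t \<in> pos_states D \<and> A t \<in> traceless D \<and>
        (\<rho> has_vector_derivative K_op D (\<rho> t) (A t)) (at t within {0..1})) \<and>
     \<rho> 0 = \<rho>\<^sub>0 \<and> \<rho> 1 = \<rho>\<^sub>1"

text \<open>The trace below is real, hence the real part.\<close>

definition action :: "('n::finite, 'm::finite, 'j) diff_struct \<Rightarrow>
    (real \<Rightarrow> complex^'n^'n) \<Rightarrow> (real \<Rightarrow> complex^'n^'n) \<Rightarrow> real" where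
  "action D \<rho> A = integral {0..1} (\<lambda>t. Re (tr D (A t ** K_op D (\<rho> t) (A t))))"

definition riem_dist :: "('n::finite, 'm::finite, 'j) diff_struct \<Rightarrow> complex^'n^'n \<Rightarrow> complex^'n^'n \<Rightarrow> real" where
  "riem_dist D \<rho>\<^sub>0 \<rho>\<^sub>1 = sqrt (Inf {action D \<rho> A |\<rho> A. admissible D \<rho>\<^sub>0 \<rho>\<^sub>1 \<rho> A})"

text \<open>Continuous extension of the Riemannian distance from \<open>pos_states D\<close> to its closure \<open>states D\<close>.\<close>

definition transport_dist :: "('n::finite, 'm::finite, 'j) diff_struct \<Rightarrow> complex^'n^'n \<Rightarrow> complex^'n^'n \<Rightarrow> real" where
  "transport_dist D \<rho>\<^sub>0 \<rho>\<^sub>1 =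
     (if \<rho>\<^sub>0 \<in> pos_states D \<and> \<rho>\<^sub>1 \<in> pos_states D then riem_dist D \<rho>\<^sub>0 \<rho>\<^sub>1
      else Lim (at (\<rho>\<^sub>0, \<rho>\<^sub>1) within pos_states D \<times> pos_states D) (\<lambda>(\<mu>, \<nu>). riem_dist D \<mu> \<nu>))"

section \<open>Entropy, Fisher information, and the modified logarithmic Sobolev inequality\<close>

text \<open>For singular \<open>\<rho>\<close> the library convention \<open>ln 0 = 0\<close> makes \<open>\<rho> ** fcalc ln \<rho>\<close> equal to
  \<open>\<rho> log \<rho>\<close> with the usual convention \<open>0 log 0 = 0\<close>. The traces are real.\<close>

definition rel_ent :: "('n::finite, 'm::finite, 'j) diff_struct \<Rightarrow> complex^'n^'n \<Rightarrow> real" where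
  "rel_ent D \<rho> = Re (tr D (\<rho> ** (fcalc ln \<rho> - fcalc ln (dens D))))"

definition fisher_info :: "('n::finite, 'm::finite, 'j) diff_struct \<Rightarrow> complex^'n^'n \<Rightarrow> ereal" where
  "fisher_info D \<rho> =
     (if \<rho> \<in> pos_states D
      then ereal (- Re (tr D ((fcalc ln \<rho> - fcalc ln (dens D)) ** generator_adj D \<rho>)))
      else \<infinity>)"

definition MLSI :: "('n::finite, 'm::finite, 'j) diff_struct \<Rightarrow> real \<Rightarrow> bool" where
  "MLSI D lam \<longleftrightarrow> (\<forall>\<rho>\<in>states D. ereal (rel_ent D \<rho>) \<le> ereal (1 / (2 * lam)) * fisher_info D \<rho>)"

definition talagrand :: "('n::finite, 'm::finite, 'j) diff_struct \<Rightarrow> real \<Rightarrow> bool" where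
  "talagrand D lam \<longleftrightarrow>
     (\<forall>\<rho>\<in>states D. transport_dist D \<rho> (dens D) \<le> sqrt (2 / lam * rel_ent D \<rho>))"

end

theory Submission
  imports Defs
begin

text \<open>The twisted chain rule turns \<open>\<rho>' = L\<^sup>\<dagger> \<rho>\<close> into the gradient flow of the entropy, so along it the entropy
  \<open>F\<close> decreases at rate \<open>I\<^sub>\<sigma>(\<rho>) = g\<^sub>\<rho>(\<rho>', \<rho>')\<close>. Cauchy-Schwarz gives \<open>W(\<rho>\<^sub>t, \<rho>\<^sub>t\<^sub>+\<^sub>h)\<^sup>2 \<le> h (F(t) - F(t + h))\<close>, and the
  logarithmic Sobolev inequality turns this into
  \<open>W(\<rho>\<^sub>t, \<rho>\<^sub>t\<^sub>+\<^sub>h) \<le> sqrt (2 / \<lambda> + 4 h) (sqrt F(t) - sqrt F(t + h))\<close>; summing over a grid of step \<open>h\<close> and letting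
  \<open>h \<rightarrow> 0\<close> yields the claim, because \<open>F \<rightarrow> 0\<close> forces \<open>\<rho>\<^sub>t \<rightarrow> \<sigma>\<close>. The flow never reaches a singular state, since
  \<open>\<tau>[log \<rho>\<^sub>t]\<close> decreases at most linearly. Singular initial states follow by continuity: \<open>W\<close> is
  Hoelder continuous of exponent 1/2, and the entropy is convex.\<close>

text \<open>The distance is an infimum over pairs of smooth functions, so every competitor needs a
  smooth potential. \<open>K_op\<close> is built from spectral data, which need not be smooth where
  eigenvalues cross; smoothness is recovered because the reciprocal of the logarithmic mean is an
  integral of inverses of affine expressions, and solving linear equations preserves
  differentiability classes. For the same reason the triangle inequality needs a concatenation whose
  derivatives all vanish at the junction. Ergodicity enters through the common kernel of the
  derivations: it makes \<open>K_op\<close> coercive on traceless elements, with a constant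
  proportional to the smallest eigenvalue of the state. Condition (3) makes \<open>K_op\<close>
  preserve self-adjointness, as the index duality permutes the summands. The grid avoids
  differentiating the distance, or \<open>sqrt F\<close> where F vanishes; the slack 4 h pays for
  comparing F at the two ends of one step. At singular states the distance is a \<open>Lim\<close>,
  so the existence of that limit has to be established before it can be bounded.\<close>

section \<open>Smooth functions on the unit interval\<close>

text \<open>\<open>Ck k f\<close>: \<open>k\<close> derivatives in the first argument, jointly continuous on the unit square. The second
  argument is a parameter over which such functions get integrated.\<close>

primrec Ck :: "nat \<Rightarrow> (real \<Rightarrow> real \<Rightarrow> 'a::real_normed_vector) \<Rightarrow> bool" where
  "Ck 0 f \<longleftrightarrow> continuous_on ({0..1} \<times> {0..1}) (\<lambda>p. f (fst p) (snd p))"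
| "Ck (Suc k) f \<longleftrightarrow> continuous_on ({0..1} \<times> {0..1}) (\<lambda>p. f (fst p) (snd p)) \<and>
     (\<exists>f'. (\<forall>t\<in>{0..1}. \<forall>u\<in>{0..1}. ((\<lambda>t. f t u) has_vector_derivative f' t u) (at t within {0..1})) \<and> Ck k f')"

lemma Ck_cont: "Ck k f \<Longrightarrow> continuous_on ({0..1} \<times> {0..1}) (\<lambda>p. f (fst p) (snd p))"
  by (cases k) auto

lemma Ck_SucE:
  assumes "Ck (Suc k) f"
  obtains f' where "\<And>t u. t \<in> {0..1} \<Longrightarrow> u \<in> {0..1} \<Longrightarrow>
      ((\<lambda>t. f t u) has_vector_derivative f' t u) (at t within {0..1})" "Ck k f'"
  using assms unfolding Ck.simps by blast

lemma Ck_SucI: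
  assumes "continuous_on ({0..1} \<times> {0..1}) (\<lambda>p. f (fst p) (snd p))"
    and "\<And>t u. t \<in> {0..1} \<Longrightarrow> u \<in> {0..1} \<Longrightarrow>
      ((\<lambda>t. f t u) has_vector_derivative f' t u) (at t within {0..1})" "Ck k f'"
  shows "Ck (Suc k) f"
  using assms unfolding Ck.simps by blast

lemma Ck_SucD: "Ck (Suc k) f \<Longrightarrow> Ck k f"
proof (induction k arbitrary: f)
  case (Suc k)
  then obtain f' where "\<And>t u. t \<in> {0..1} \<Longrightarrow> u \<in> {0..1} \<Longrightarrow>
      ((\<lambda>t. f t u) has_vector_derivative f' t u) (at t within {0..1})" "Ck (Suc k) f'"
    using Ck_SucE[OF Suc.prems] by blast
  with Suc.IH[of f'] Ck_cont[OF Suc.prems] show ?case by (intro Ck_SucI[of _ f'])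
qed auto

text \<open>Values off the unit square are ignored, so a function known only through
  \<open>THE\<close>, or linear only on an algebra, can be exchanged for a total formula.\<close>

lemma Ck_cong:
  assumes "Ck k f" and eq: "\<And>t u. t \<in> {0..1} \<Longrightarrow> u \<in> {0..1} \<Longrightarrow> g t u = f t u"
  shows "Ck k g"
proof -
  have c: "continuous_on ({0..1} \<times> {0..1}) (\<lambda>p. g (fst p) (snd p))"
    using Ck_cont[OF assms(1)] by (rule continuous_on_eq) (auto simp: eq)
  show ?thesis
  proof (cases k)
    case (Suc n)
    with assms(1) obtain f' where f': "\<And>t u. t \<in> {0..1} \<Longrightarrow> u \<in> {0..1} \<Longrightarrow>
      ((\<lambda>t. f t u) has_vector_derivative f' t u) (at t within {0..1})" "Ck n f'"
      using Ck_SucE by blast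
    show ?thesis unfolding Suc using f' c eq
      by (intro Ck_SucI[of _ f']) (auto intro: has_vector_derivative_transform)
  qed (use c in auto)
qed

lemma fst_box: "fst ` ({0..1} \<times> {0..1}) \<subseteq> {0..1::real}"
  by auto

lemma Ck_const: "Ck k (\<lambda>t u. c)"
proof (induction k arbitrary: c)
  case (Suc k)
  show ?case by (rule Ck_SucI[of _ "\<lambda>t u. 0"]) (auto intro: Suc)
qed auto

lemma Ck_fst: "Ck k (\<lambda>t u. t)"
proof (cases k)
  case (Suc n)
  show ?thesis unfolding Suc
    by (rule Ck_SucI[of _ "\<lambda>t u. 1"]) (auto intro: Ck_const continuous_intros)
qed (auto intro: continuous_intros)

lemma Ck_snd: "Ck k (\<lambda>t u. u)"
proof (cases k)
  case (Suc n)
  show ?thesis unfolding Suc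
    by (rule Ck_SucI[of _ "\<lambda>t u. 0"]) (auto intro: Ck_const continuous_intros)
qed (auto intro: continuous_intros)

lemma Ck_bounded_linear:
  assumes "bounded_linear h" "Ck k f"
  shows "Ck k (\<lambda>t u. h (f t u))"
  using assms(2)
proof (induction k arbitrary: f)
  case 0
  then show ?case using bounded_linear.continuous_on[OF assms(1)] by auto
next
  case (Suc k)
  obtain f' where f': "\<And>t u. t \<in> {0..1} \<Longrightarrow> u \<in> {0..1} \<Longrightarrow>
      ((\<lambda>t. f t u) has_vector_derivative f' t u) (at t within {0..1})" "Ck k f'"
    using Ck_SucE[OF Suc.prems] by blast
  show ?case
    using f' Suc.IH bounded_linear.continuous_on[OF assms(1) Ck_cont[OF Suc.prems]]
    by (intro Ck_SucI[of _ "\<lambda>t u. h (f' t u)"]) (auto intro: bounded_linear.has_vector_derivative[OF assms(1)])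
qed

lemma Ck_add:
  assumes "Ck k f" "Ck k g"
  shows "Ck k (\<lambda>t u. f t u + g t u)"
  using assms
proof (induction k arbitrary: f g)
  case (Suc k)
  obtain f' where f': "\<And>t u. t \<in> {0..1} \<Longrightarrow> u \<in> {0..1} \<Longrightarrow>
      ((\<lambda>t. f t u) has_vector_derivative f' t u) (at t within {0..1})" "Ck k f'"
    using Ck_SucE[OF Suc.prems(1)] by blast
  obtain g' where g': "\<And>t u. t \<in> {0..1} \<Longrightarrow> u \<in> {0..1} \<Longrightarrow>
      ((\<lambda>t. g t u) has_vector_derivative g' t u) (at t within {0..1})" "Ck k g'"
    using Ck_SucE[OF Suc.prems(2)] by blast
  show ?case
    using f' g' Suc.IH Ck_cont[OF Suc.prems(1)] Ck_cont[OF Suc.prems(2)]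
    by (intro Ck_SucI[of _ "\<lambda>t u. f' t u + g' t u"]) (auto intro!: continuous_intros has_vector_derivative_add)
qed (auto intro: continuous_intros)

lemma Ck_bilinear:
  assumes "bounded_bilinear h" "Ck k f" "Ck k g"
  shows "Ck k (\<lambda>t u. h (f t u) (g t u))"
  using assms(2,3)
proof (induction k arbitrary: f g)
  case 0
  then show ?case using bounded_bilinear.continuous_on[OF assms(1)] by auto
next
  case (Suc k)
  obtain f' where f': "\<And>t u. t \<in> {0..1} \<Longrightarrow> u \<in> {0..1} \<Longrightarrow>
      ((\<lambda>t. f t u) has_vector_derivative f' t u) (at t within {0..1})" "Ck k f'"
    using Ck_SucE[OF Suc.prems(1)] by blast
  obtain g' where g': "\<And>t u. t \<in> {0..1} \<Longrightarrow> u \<in> {0..1} \<Longrightarrow>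
      ((\<lambda>t. g t u) has_vector_derivative g' t u) (at t within {0..1})" "Ck k g'"
    using Ck_SucE[OF Suc.prems(2)] by blast
  show ?case
    using f' g' Suc.IH[of f g', OF Ck_SucD[OF Suc.prems(1)]] Suc.IH[of f' g, OF _ Ck_SucD[OF Suc.prems(2)]]
      bounded_bilinear.continuous_on[OF assms(1) Ck_cont[OF Suc.prems(1)] Ck_cont[OF Suc.prems(2)]]
    by (intro Ck_SucI[of _ "\<lambda>t u. h (f t u) (g' t u) + h (f' t u) (g t u)"])
      (auto intro: bounded_bilinear.has_vector_derivative[OF assms(1)] Ck_add)
qed

lemma Ck_scaleR: "Ck k f \<Longrightarrow> Ck k g \<Longrightarrow> Ck k (\<lambda>t u. f t u *\<^sub>R g t u)"
  by (rule Ck_bilinear[OF bounded_bilinear_scaleR])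

lemma Ck_diff:
  assumes "Ck k f" "Ck k g"
  shows "Ck k (\<lambda>t u. f t u - g t u)"
  using Ck_add[OF assms(1) Ck_bounded_linear[OF bounded_linear_minus[OF bounded_linear_ident] assms(2)]] by simp

lemma Ck_sum: "(\<And>i. i \<in> A \<Longrightarrow> Ck k (f i)) \<Longrightarrow> Ck k (\<lambda>t u. \<Sum>i\<in>A. f i t u)"
  by (induction A rule: infinite_finite_induct) (auto intro: Ck_const Ck_add)

lemma Ck_compose:
  fixes \<phi> :: "real \<Rightarrow> real"
  assumes "Ck k f" "Ck k (\<lambda>t u. \<phi> t)" and im: "\<phi> ` {0..1} \<subseteq> {0..1}"
  shows "Ck k (\<lambda>t u. f (\<phi> t) u)"
  using assms(1,2)
proof (induction k arbitrary: f)
  have c: "continuous_on ({0..1} \<times> {0..1}) (\<lambda>p. f (\<phi> (fst p)) (snd p))"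
    if "Ck k f" "Ck k (\<lambda>t u. \<phi> t)" for k f
  proof -
    have "continuous_on ({0..1} \<times> {0..1}) (\<lambda>p::real\<times>real. (\<phi> (fst p), snd p))"
      using Ck_cont[OF that(2)] by (intro continuous_intros)
    moreover have "(\<lambda>p. (\<phi> (fst p), snd p)) ` ({0..1} \<times> {0..1}) \<subseteq> {0..1} \<times> {0..1}"
      using im by (auto simp: image_subset_iff)
    ultimately show ?thesis
      using continuous_on_compose2[OF Ck_cont[OF that(1)], of _ "\<lambda>p. (\<phi> (fst p), snd p)"] by simp
  qed
  case (Suc k)
  obtain f' where f': "\<And>t u. t \<in> {0..1} \<Longrightarrow> u \<in> {0..1} \<Longrightarrow>
      ((\<lambda>t. f t u) has_vector_derivative f' t u) (at t within {0..1})" "Ck k f'"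
    using Ck_SucE[OF Suc.prems(1)] by blast
  obtain \<phi>' where \<phi>': "\<And>t u. t \<in> {0..1} \<Longrightarrow> u \<in> {0..1} \<Longrightarrow>
      (\<phi> has_vector_derivative \<phi>' t u) (at t within {0..1})" "Ck k \<phi>'"
    using Ck_SucE[OF Suc.prems(2)] by blast
  have d: "((\<lambda>t. f (\<phi> t) u) has_vector_derivative (\<phi>' t u *\<^sub>R f' (\<phi> t) u)) (at t within {0..1})"
    if "t \<in> {0..1}" "u \<in> {0..1}" for t u
  proof -
    have "((\<lambda>t. f t u) has_vector_derivative f' (\<phi> t) u) (at (\<phi> t) within \<phi> ` {0..1})"
      using f'(1)[of "\<phi> t" u] that im has_vector_derivative_within_subset by blast
    from vector_derivative_diff_chain_within[OF \<phi>'(1)[OF that] this[unfolded has_vector_derivative_def]]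
    show ?thesis by (simp add: o_def)
  qed
  show ?case
    using c[OF Suc.prems] d Ck_scaleR[OF \<phi>'(2) Suc.IH[OF f'(2) Ck_SucD[OF Suc.prems(2)]]]
    by (rule Ck_SucI)
next
  case 0
  have "continuous_on ({0..1} \<times> {0..1}) (\<lambda>p::real\<times>real. (\<phi> (fst p), snd p))"
    using Ck_cont[OF 0(2)] by (intro continuous_intros)
  moreover have "(\<lambda>p. (\<phi> (fst p), snd p)) ` ({0..1} \<times> {0..1}) \<subseteq> {0..1} \<times> {0..1}"
    using im by (auto simp: image_subset_iff)
  ultimately show ?case
    using continuous_on_compose2[OF Ck_cont[OF 0(1)], of _ "\<lambda>p. (\<phi> (fst p), snd p)"] by simp
qed

text \<open>Leibniz rule, one derivative at a time. The integrated parameter survives as a dummy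
  second argument, which keeps the result within the same predicate.\<close>

lemma Ck_integral:
  fixes f :: "real \<Rightarrow> real \<Rightarrow> 'a::banach"
  assumes "Ck k f"
  shows "Ck k (\<lambda>t u. integral {0..1} (f t))"
  using assms
proof (induction k arbitrary: f)
  have *: "continuous_on ({0..1} \<times> {0..1}) (\<lambda>p::real\<times>real. integral {0..1} (f (fst p)))"
    if "Ck k f" for k and f :: "real \<Rightarrow> real \<Rightarrow> 'a"
  proof -
    have "continuous_on {0..1} (\<lambda>t. integral (cbox 0 1) (f t))"
      by (rule integral_continuous_on_param) (use Ck_cont[OF that] in \<open>simp add: split_beta\<close>)
    from continuous_on_compose2[OF this continuous_on_fst[OF continuous_on_id] fst_box]
    show ?thesis by simp
  qed
  { case 0 then show ?case using *[of 0 f] by simp }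
  case (Suc k)
  obtain f' where f': "\<And>t u. t \<in> {0..1} \<Longrightarrow> u \<in> {0..1} \<Longrightarrow>
      ((\<lambda>t. f t u) has_vector_derivative f' t u) (at t within {0..1})" "Ck k f'"
    using Ck_SucE[OF Suc.prems(1)] by blast
  have int: "f t integrable_on cbox 0 1" if "t \<in> {0..1}" for t
  proof (rule integrable_continuous)
    have "continuous_on (cbox 0 1) (\<lambda>u::real. (t, u))"
      by (intro continuous_intros)
    from continuous_on_compose2[OF Ck_cont[OF Suc.prems] this] show "continuous_on (cbox 0 1) (f t)"
      using that by (simp add: image_subset_iff)
  qed
  show ?case
  proof (rule Ck_SucI[OF *[OF Suc.prems] _ Suc.IH[OF f'(2)]])
    fix t u :: real assume t: "t \<in> {0..1}"
    show "((\<lambda>t. integral {0..1} (f t)) has_vector_derivative integral {0..1} (f' t)) (at t within {0..1})"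
      using leibniz_rule_vector_derivative[of "{0..1}" 0 1 f f' t] f'(1) int t Ck_cont[OF f'(2)]
      by (auto simp: split_beta)
  qed
qed

text \<open>The quotient form lets derivatives be estimated directly and be located in closed
  subspaces.\<close>

lemma has_vector_derivative_quotient:
  "(f has_vector_derivative d) (at t within S) \<longleftrightarrow> ((\<lambda>s. (f s - f t) /\<^sub>R (s - t)) \<longlongrightarrow> d) (at t within S)"
proof -
  have eq: "\<forall>\<^sub>F s in at t within S. norm ((f s - f t - (s - t) *\<^sub>R d) /\<^sub>R norm (s - t)) =
      norm ((f s - f t) /\<^sub>R (s - t) - d)"
    unfolding eventually_at_filter
  proof (intro always_eventually allI impI)
    fix s assume "s \<noteq> t"
    then have "(f s - f t) /\<^sub>R (s - t) - d = (f s - f t - (s - t) *\<^sub>R d) /\<^sub>R (s - t)"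
      by (simp add: scaleR_diff_right)
    then show "norm ((f s - f t - (s - t) *\<^sub>R d) /\<^sub>R norm (s - t)) = norm ((f s - f t) /\<^sub>R (s - t) - d)"
      by simp
  qed
  have "(f has_vector_derivative d) (at t within S) \<longleftrightarrow>
      ((\<lambda>s. norm ((f s - f t - (s - t) *\<^sub>R d) /\<^sub>R norm (s - t))) \<longlongrightarrow> 0) (at t within S)"
    unfolding has_vector_derivative_def has_derivative_within tendsto_norm_zero_iff
    by (simp add: bounded_linear_scaleR_left diff_diff_eq divide_inverse)
  also have "\<dots> \<longleftrightarrow> ((\<lambda>s. norm ((f s - f t) /\<^sub>R (s - t) - d)) \<longlongrightarrow> 0) (at t within S)"
    by (rule tendsto_cong[OF eq])
  finally show ?thesis by (simp add: tendsto_norm_zero_iff LIM_zero_iff)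
qed

text \<open>Implicit differentiation: from M x = y one gets M x' = y' - M' x, an equation of the
  same kind with one derivative less, to which the induction applies. Nothing is assumed on
  \<open>x\<close> beyond solving the equation pointwise; its continuity comes from a bound on the
  inverses that is uniform by compactness.\<close>

lemma Ck_solve_blinfun:
  fixes M :: "real \<Rightarrow> real \<Rightarrow> ('a::euclidean_space \<Rightarrow>\<^sub>L 'a)"
  assumes "Ck k M" "Ck k y"
    and inj: "\<And>t u v. t \<in> {0..1} \<Longrightarrow> u \<in> {0..1} \<Longrightarrow> blinfun_apply (M t u) v = 0 \<Longrightarrow> v = 0"
    and sol: "\<And>t u. t \<in> {0..1} \<Longrightarrow> u \<in> {0..1} \<Longrightarrow> blinfun_apply (M t u) (x t u) = y t u"
  shows "Ck k x"
  using assms(1,2) sol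
proof (induction k arbitrary: x y)
  let ?I = "{0..1::real} \<times> {0..1::real}"
  define S where "S = ?I \<times> sphere (0::'a) 1"
  have cM: "continuous_on ?I (\<lambda>p. M (fst p) (snd p))" using Ck_cont[OF assms(1)] .
  have "compact S" unfolding S_def by (intro compact_Times compact_sphere) auto
  moreover have "S \<noteq> {}" unfolding S_def using vector_choose_size[of 1, where 'a='a] by auto
  moreover have "continuous_on S (\<lambda>q. norm (blinfun_apply (M (fst (fst q)) (snd (fst q))) (snd q)))"
  proof -
    have "fst ` S \<subseteq> ?I"
      unfolding S_def by (rule image_subsetI) (erule mem_Times_iff[THEN iffD1, THEN conjunct1])
    from continuous_on_compose2[OF cM continuous_on_fst[OF continuous_on_id] this]
    have "continuous_on S (\<lambda>q. M (fst (fst q)) (snd (fst q)))" .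
    then show ?thesis
      by (rule continuous_on_norm[OF bounded_bilinear.continuous_on[OF bounded_bilinear_blinfun_apply _
            continuous_on_snd[OF continuous_on_id]]])
  qed
  ultimately have "\<exists>q\<in>S. \<forall>q'\<in>S. norm (blinfun_apply (M (fst (fst q)) (snd (fst q))) (snd q))
        \<le> norm (blinfun_apply (M (fst (fst q')) (snd (fst q'))) (snd q'))"
    by (rule continuous_attains_inf)
  then obtain q where q: "q \<in> S"
    "\<And>q'. q' \<in> S \<Longrightarrow> norm (blinfun_apply (M (fst (fst q)) (snd (fst q))) (snd q))
        \<le> norm (blinfun_apply (M (fst (fst q')) (snd (fst q'))) (snd q'))"
    by (elim bexE) (simp only: Ball_def)
  \<comment> \<open>The minimum of norm (M t u v) over the unit square times the unit sphere;
    injectivity makes it positive, and 1 / c bounds all the inverses.\<close>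
  define c where "c = norm (blinfun_apply (M (fst (fst q)) (snd (fst q))) (snd q))"
  have c0: "c > 0"
  proof -
    have "snd q \<noteq> 0" using q(1) unfolding S_def by auto
    then have "blinfun_apply (M (fst (fst q)) (snd (fst q))) (snd q) \<noteq> 0"
      using inj[of "fst (fst q)" "snd (fst q)" "snd q"] q(1) unfolding S_def mem_Times_iff by blast
    then show ?thesis unfolding c_def by simp
  qed
  have bd: "norm v \<le> norm (blinfun_apply (M t u) v) / c" if "t \<in> {0..1}" "u \<in> {0..1}" for t u v
  proof (cases "v = 0")
    case False
    have "c \<le> norm (blinfun_apply (M t u) (v /\<^sub>R norm v))"
      unfolding c_def using q(2)[of "((t,u), v /\<^sub>R norm v)"] that False unfolding S_def by auto
    also have "\<dots> = norm (blinfun_apply (M t u) v) / norm v"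
      by (simp add: blinfun.scaleR_right divide_inverse mult.commute)
    finally show ?thesis using False c0 by (simp add: field_simps)
  qed simp
  have cont: "continuous_on ?I (\<lambda>p. x (fst p) (snd p))"
    if y: "continuous_on ?I (\<lambda>p. y (fst p) (snd p))" and
      sol: "\<And>t u. t \<in> {0..1} \<Longrightarrow> u \<in> {0..1} \<Longrightarrow> blinfun_apply (M t u) (x t u) = y t u" for x y
    unfolding continuous_on_def
  proof
    fix p assume p: "p \<in> ?I"
    let ?g = "\<lambda>q. y (fst q) (snd q) - blinfun_apply (M (fst q) (snd q)) (x (fst p) (snd p))"
    have "continuous_on ?I ?g" using y cM by (intro continuous_intros)
    with p have "(?g \<longlongrightarrow> ?g p) (at p within ?I)" unfolding continuous_on_def by blast
    moreover have "?g p = 0" using sol p by auto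
    ultimately have "((\<lambda>q. norm (?g q) / c) \<longlongrightarrow> 0) (at p within ?I)"
      using tendsto_divide[OF tendsto_norm[of ?g 0] tendsto_const[of c]] c0 by auto
    moreover have "\<forall>\<^sub>F q in at p within ?I. norm (x (fst q) (snd q) - x (fst p) (snd p)) \<le> norm (?g q) / c"
      unfolding eventually_at_filter
    proof (intro always_eventually allI impI)
      fix q assume "q \<in> ?I"
      then have q: "fst q \<in> {0..1}" "snd q \<in> {0..1}" by auto
      have "blinfun_apply (M (fst q) (snd q)) (x (fst q) (snd q) - x (fst p) (snd p)) = ?g q"
        using sol[OF q] by (simp add: blinfun.diff_right)
      then show "norm (x (fst q) (snd q) - x (fst p) (snd p)) \<le> norm (?g q) / c"
        using bd[OF q] by metis
    qed
    ultimately have "((\<lambda>q. x (fst q) (snd q) - x (fst p) (snd p)) \<longlongrightarrow> 0) (at p within ?I)"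
      by (rule Lim_null_comparison[rotated])
    then show "((\<lambda>p. x (fst p) (snd p)) \<longlongrightarrow> x (fst p) (snd p)) (at p within ?I)"
      by (simp add: LIM_zero_iff)
  qed
  { case 0 show ?case using cont[OF Ck_cont[OF 0(2)] 0(3)] by simp }
  case (Suc k)
  obtain M' where M': "\<And>t u. t \<in> {0..1} \<Longrightarrow> u \<in> {0..1} \<Longrightarrow>
      ((\<lambda>t. M t u) has_vector_derivative M' t u) (at t within {0..1})" "Ck k M'"
    using Ck_SucE[OF Suc.prems(1)] by blast
  obtain y' where y': "\<And>t u. t \<in> {0..1} \<Longrightarrow> u \<in> {0..1} \<Longrightarrow>
      ((\<lambda>t. y t u) has_vector_derivative y' t u) (at t within {0..1})" "Ck k y'"
    using Ck_SucE[OF Suc.prems(2)] by blast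
  note sol = Suc.prems(3)
  have Ckx: "Ck k x" using Suc.IH[OF Ck_SucD Ck_SucD] Suc.prems by blast
  \<comment> \<open>The candidate for the derivative of \<open>x\<close> is the solution of the
    differentiated equation.\<close>
  have "\<exists>z. blinfun_apply (M t u) z = y' t u - blinfun_apply (M' t u) (x t u)" if "t \<in> {0..1}" "u \<in> {0..1}" for t u
  proof -
    have "linear (blinfun_apply (M t u))" by (simp add: blinfun.bounded_linear_right bounded_linear.linear)
    moreover then have "inj (blinfun_apply (M t u))" using inj[OF that] by (simp add: linear_injective_0)
    ultimately have "surj (blinfun_apply (M t u))" by (rule linear_inj_imp_surj)
    then show ?thesis by (metis surjD)
  qed
  then obtain z where z: "\<And>t u. t \<in> {0..1} \<Longrightarrow> u \<in> {0..1} \<Longrightarrow>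
     blinfun_apply (M t u) (z t u) = y' t u - blinfun_apply (M' t u) (x t u)" by metis
  have Ckz: "Ck k z"
    using z by (intro Suc.IH[OF Ck_SucD[OF Suc.prems(1)] Ck_diff[OF y'(2) Ck_bilinear[OF bounded_bilinear_blinfun_apply M'(2) Ckx]]])
  show ?case
  proof (rule Ck_SucI[OF cont[OF Ck_cont[OF Suc.prems(2)] sol] _ Ckz])
    fix t u :: real assume t: "t \<in> {0..1}" and u: "u \<in> {0..1}"
    let ?g = "\<lambda>s. y s u - blinfun_apply (M s u) (x t u)"
    have "(?g has_vector_derivative (y' t u - blinfun_apply (M' t u) (x t u))) (at t within {0..1})"
      using y'(1)[OF t u] bounded_linear.has_vector_derivative[OF blinfun.bounded_linear_left M'(1)[OF t u], of "x t u"]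
      by (intro has_vector_derivative_diff)
    then have "((\<lambda>s. (?g s - ?g t) /\<^sub>R (s - t)) \<longlongrightarrow> blinfun_apply (M t u) (z t u)) (at t within {0..1})"
      using z[OF t u] by (simp add: has_vector_derivative_quotient)
    then have g1: "((\<lambda>s. ?g s /\<^sub>R (s - t)) \<longlongrightarrow> blinfun_apply (M t u) (z t u)) (at t within {0..1})"
      using sol[OF t u] by simp
    have "((\<lambda>s. M s u) \<longlongrightarrow> M t u) (at t within {0..1})"
      using has_vector_derivative_continuous[OF M'(1)[OF t u]] by (simp add: continuous_within)
    then have g2: "((\<lambda>s. blinfun_apply (M s u) (z t u)) \<longlongrightarrow> blinfun_apply (M t u) (z t u)) (at t within {0..1})"
      by (intro tendsto_intros)
    let ?h = "\<lambda>s. ?g s /\<^sub>R (s - t) - blinfun_apply (M s u) (z t u)"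
    have "(?h \<longlongrightarrow> 0) (at t within {0..1})" using tendsto_diff[OF g1 g2] by simp
    then have lim: "((\<lambda>s. norm (?h s) / c) \<longlongrightarrow> 0) (at t within {0..1})"
      using tendsto_divide[OF tendsto_norm[of ?h 0] tendsto_const[of c]] c0 by auto
    have ev: "\<forall>\<^sub>F s in at t within {0..1}. norm ((x s u - x t u) /\<^sub>R (s - t) - z t u) \<le> norm (?h s) / c"
      unfolding eventually_at_filter
    proof (intro always_eventually allI impI)
      fix s assume s: "s \<in> {0..1::real}" "s \<noteq> t"
      have "blinfun_apply (M s u) ((x s u - x t u) /\<^sub>R (s - t) - z t u) = ?h s"
        using sol[OF s(1) u] by (simp add: blinfun.diff_right blinfun.scaleR_right)
      then show "norm ((x s u - x t u) /\<^sub>R (s - t) - z t u) \<le> norm (?h s) / c"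
        using bd[OF s(1) u] by metis
    qed
    have "((\<lambda>s. (x s u - x t u) /\<^sub>R (s - t) - z t u) \<longlongrightarrow> 0) (at t within {0..1})"
      by (rule Lim_null_comparison[OF ev lim])
    then have "((\<lambda>s. (x s u - x t u) /\<^sub>R (s - t)) \<longlongrightarrow> z t u) (at t within {0..1})"
      by (simp add: LIM_zero_iff)
    then show "((\<lambda>t. x t u) has_vector_derivative z t u) (at t within {0..1})"
      by (simp add: has_vector_derivative_quotient)
  qed
qed

text \<open>The operator is assembled from its values on a basis, so that smoothness has to be
  checked only for \<open>m t u b\<close> with fixed \<open>b\<close>.\<close>

lemma Ck_solve:
  fixes m :: "real \<Rightarrow> real \<Rightarrow> 'a::euclidean_space \<Rightarrow> 'a"
  assumes lin: "\<And>t u. t \<in> {0..1} \<Longrightarrow> u \<in> {0..1} \<Longrightarrow> linear (m t u)" and Ckm: "\<And>b. Ck k (\<lambda>t u. m t u b)" and "Ck k y"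
    and inj: "\<And>t u v. t \<in> {0..1} \<Longrightarrow> u \<in> {0..1} \<Longrightarrow> m t u v = 0 \<Longrightarrow> v = 0"
    and sol: "\<And>t u. t \<in> {0..1} \<Longrightarrow> u \<in> {0..1} \<Longrightarrow> m t u (x t u) = y t u"
  shows "Ck k x"
proof (rule Ck_solve_blinfun[OF _ assms(3)])
  define \<Phi> :: "'a \<Rightarrow> 'a \<Rightarrow> 'a \<Rightarrow>\<^sub>L 'a" where "\<Phi> b v = Blinfun (\<lambda>x. (x \<bullet> b) *\<^sub>R v)" for b v
  have bl: "bounded_linear (\<lambda>x. (x \<bullet> b) *\<^sub>R v)" for b v :: 'a
    by (intro bounded_linear_intros)
  have \<Phi>: "blinfun_apply (\<Phi> b v) x = (x \<bullet> b) *\<^sub>R v" for b v x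
    unfolding \<Phi>_def using bounded_linear_Blinfun_apply[OF bl] by metis
  have "linear (\<Phi> b)" for b
    by (rule linearI) (auto intro!: blinfun_eqI simp: \<Phi> blinfun.add_left blinfun.scaleR_left scaleR_add_right)
  then have bl\<Phi>: "bounded_linear (\<Phi> b)" for b by (simp add: linear_linear)
  define M where "M t u = (\<Sum>b\<in>Basis. \<Phi> b (m t u b))" for t u
  have M: "blinfun_apply (M t u) x = m t u x" if "t \<in> {0..1}" "u \<in> {0..1}" for t u x
  proof -
    have "blinfun_apply (M t u) x = (\<Sum>b\<in>Basis. (x \<bullet> b) *\<^sub>R m t u b)"
      unfolding M_def by (simp add: blinfun.sum_left \<Phi>)
    also have "\<dots> = m t u (\<Sum>b\<in>Basis. (x \<bullet> b) *\<^sub>R b)"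
      by (simp add: linear_sum[OF lin[OF that]] linear_scale[OF lin[OF that]])
    finally show ?thesis by (simp add: euclidean_representation)
  qed
  show "Ck k M" unfolding M_def by (intro Ck_sum Ck_bounded_linear[OF bl\<Phi>] Ckm)
  show "v = 0" if "t \<in> {0..1}" "u \<in> {0..1}" "blinfun_apply (M t u) v = 0" for t u v
    using inj[OF that(1,2)] that(3) M[OF that(1,2)] by metis
  show "blinfun_apply (M t u) (x t u) = y t u" if "t \<in> {0..1}" "u \<in> {0..1}" for t u
    using sol[OF that] M[OF that] by metis
qed

section \<open>Passage between one-variable smoothness and the classes \<open>Ck k\<close>\<close>

lemma smooth01_Ck:
  assumes "smooth01 f"
  shows "Ck k (\<lambda>t u. f t)"
proof -
  obtain G where G: "\<forall>t\<in>{0..1}. G 0 t = f t"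
     "\<And>k t. t\<in>{0..1} \<Longrightarrow> (G k has_vector_derivative G (Suc k) t) (at t within {0..1})"
    using assms unfolding smooth01_def by blast
  have "Ck k (\<lambda>t u. G i t)" for i
  proof (induction k arbitrary: i)
    have c: "continuous_on ({0..1} \<times> {0..1}) (\<lambda>p::real\<times>real. G i (fst p))" for i
    proof -
      have "continuous_on {0..1} (G i)"
        using G(2) has_vector_derivative_continuous continuous_on_eq_continuous_within by blast
      from continuous_on_compose2[OF this continuous_on_fst[OF continuous_on_id] fst_box]
    show ?thesis by simp
    qed
    { case 0 show ?case using c by simp }
    case (Suc k)
    show ?case by (rule Ck_SucI[OF c _ Suc.IH]) (rule G)
  qed
  from Ck_cong[OF this[of 0]] show ?thesis using G(1) by auto
qed

text \<open>The classes \<open>Ck k\<close> for different \<open>k\<close> may come with unrelated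
  derivatives, while \<open>smooth01\<close> asks for one sequence. Uniqueness of derivatives on an
  interval makes the witnesses agree.\<close>

lemma Ck_smooth01:
  fixes f :: "real \<Rightarrow> 'a::euclidean_space"
  assumes "\<And>k. Ck k (\<lambda>t u. f t)"
  shows "smooth01 f"
proof -
  define G where "G = rec_nat f (\<lambda>k g t. vector_derivative g (at t within {0..1}))"
  have G0: "G 0 = f" and GS: "G (Suc k) = (\<lambda>t. vector_derivative (G k) (at t within {0..1}))" for k
    unfolding G_def by auto
  have *: "\<forall>t\<in>{0..1}. (g has_vector_derivative vector_derivative g (at t within {0..1})) (at t within {0..1})"
     "Ck n (\<lambda>t u. vector_derivative g (at t within {0..1}))"
    if g: "Ck (Suc n) (\<lambda>t u. g t)" for g :: "real \<Rightarrow> 'a" and n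
  proof -
    obtain g' where g': "\<And>t u. t \<in> {0..1} \<Longrightarrow> u \<in> {0..1} \<Longrightarrow>
      (g has_vector_derivative g' t u) (at t within {0..1})" "Ck n g'"
      using Ck_SucE[OF g] by blast
    have e: "vector_derivative g (at t within {0..1}) = g' t u" if "t \<in> {0..1}" "u \<in> {0..1}" for t u
      using vector_derivative_within_closed_interval[OF _ _ g'(1)[OF that]] that by auto
    show "Ck n (\<lambda>t u. vector_derivative g (at t within {0..1}))"
      by (rule Ck_cong[OF g'(2)]) (rule e)
    show "\<forall>t\<in>{0..1}. (g has_vector_derivative vector_derivative g (at t within {0..1})) (at t within {0..1})"
      using e[of _ 0] g'(1)[of _ 0] by auto
  qed
  have "Ck n (\<lambda>t u. G k t)" for k n
    by (induction k arbitrary: n) (auto simp: G0 GS assms intro!: *(2))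
  then show ?thesis
    unfolding smooth01_def using G0 *(1) GS by (intro exI[of _ G]) (auto simp del: Ck.simps)
qed

section \<open>Flat reparametrizations\<close>

text \<open>The k-th derivative of exp (- \<delta> / x) for positive x is
  \<open>flat_poly \<delta> k\<close> at 1 / x times exp (- \<delta> / x). In y = 1 / x the product
  rule reads p -> \<delta> y^2 p - y^2 p', which is the recursion. \<open>flat \<delta> k\<close>
  extends this derivative by 0.\<close>

primrec flat_poly :: "real \<Rightarrow> nat \<Rightarrow> real poly" where
  "flat_poly \<delta> 0 = 1"
| "flat_poly \<delta> (Suc k) = [:0, 0, \<delta>:] * flat_poly \<delta> k - [:0, 0, 1:] * pderiv (flat_poly \<delta> k)"

definition flat :: "real \<Rightarrow> nat \<Rightarrow> real \<Rightarrow> real" where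
  "flat \<delta> k x = (if x \<le> 0 then 0 else poly (flat_poly \<delta> k) (1 / x) * exp (- \<delta> / x))"

lemma tendsto_power_exp_neg:
  assumes "\<delta> > (0::real)"
  shows "((\<lambda>y. y ^ n * exp (- \<delta> * y)) \<longlongrightarrow> 0) at_top"
proof -
  have "filterlim (\<lambda>y. \<delta> * y) at_top at_top"
    using assms by (simp add: filterlim_tendsto_pos_mult_at_top[OF tendsto_const] filterlim_ident)
  from filterlim_compose[OF tendsto_power_div_exp_0[of n] this]
  have "((\<lambda>y. (1 / \<delta> ^ n) * ((\<delta> * y) ^ n / exp (\<delta> * y))) \<longlongrightarrow> (1 / \<delta> ^ n) * 0) at_top"
    by (intro tendsto_mult tendsto_const)
  then show ?thesis
    using assms by (simp add: power_mult_distrib exp_minus field_simps)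
qed

lemma tendsto_poly_exp_neg:
  assumes "\<delta> > (0::real)"
  shows "((\<lambda>y. poly p y * exp (- \<delta> * y)) \<longlongrightarrow> 0) at_top"
proof -
  \<comment> \<open>The extra power of y carries the induction over the coefficients:
    \<open>pCons\<close> multiplies the remaining polynomial by y.\<close>
  have "((\<lambda>y. y ^ n * poly p y * exp (- \<delta> * y)) \<longlongrightarrow> 0) at_top" for n
  proof (induction p arbitrary: n)
    case (pCons a p)
    have "((\<lambda>y. a * (y ^ n * exp (- \<delta> * y)) + y ^ Suc n * poly p y * exp (- \<delta> * y)) \<longlongrightarrow> a * 0 + 0) at_top"
      by (intro tendsto_add tendsto_mult tendsto_const tendsto_power_exp_neg assms pCons)
    then show ?case by (simp add: algebra_simps)
  qed auto
  from this[of 0] show ?thesis by simp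
qed

text \<open>Away from 0 the formula can be differentiated locally. At 0 the right difference
  quotient becomes, in the variable 1 / x, a polynomial times a decaying exponential.\<close>

lemma flat_deriv:
  assumes d: "\<delta> > 0"
  shows "(flat \<delta> k has_real_derivative flat \<delta> (Suc k) x) (at x)"
proof -
  consider "x < 0" | "x = 0" | "x > 0" by linarith
  then show ?thesis
  proof cases
    case 1
    have "((\<lambda>_. 0) has_real_derivative flat \<delta> (Suc k) x) (at x)"
      using 1 by (simp add: flat_def)
    then show ?thesis
      by (rule has_field_derivative_transform_within_open[of _ _ _ "{..<0}"]) (use 1 in \<open>auto simp: flat_def\<close>)
  next
    case 3
    have "((\<lambda>x. poly (flat_poly \<delta> k) (1 / x) * exp (- \<delta> / x)) has_real_derivative flat \<delta> (Suc k) x) (at x)"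
      using 3 by (auto simp: flat_def field_simps power2_eq_square intro!: derivative_eq_intros DERIV_chain2[OF poly_DERIV])
    then show ?thesis
      by (rule has_field_derivative_transform_within_open[of _ _ _ "{0<..}"]) (use 3 in \<open>auto simp: flat_def\<close>)
  next
    case 2
    have l: "((\<lambda>y. (flat \<delta> k y - flat \<delta> k 0) / (y - 0)) \<longlongrightarrow> 0) (at_left 0)"
      by (rule tendsto_eventually) (auto simp: flat_def eventually_at_filter)
    have "((\<lambda>y. poly ([:0, 1:] * flat_poly \<delta> k) (inverse y) * exp (- \<delta> * inverse y)) \<longlongrightarrow> 0) (at_right 0)"
      by (rule filterlim_compose[OF tendsto_poly_exp_neg[OF d] filterlim_inverse_at_top_right])
    moreover have "\<forall>\<^sub>F y in at_right 0. poly ([:0, 1:] * flat_poly \<delta> k) (inverse y) * exp (- \<delta> * inverse y)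
        = (flat \<delta> k y - flat \<delta> k 0) / (y - 0)"
      by (auto simp: flat_def eventually_at_filter divide_inverse mult.commute)
    ultimately have r: "((\<lambda>y. (flat \<delta> k y - flat \<delta> k 0) / (y - 0)) \<longlongrightarrow> 0) (at_right 0)"
      by (rule Lim_transform_eventually)
    show ?thesis
      using filterlim_at_split[THEN iffD2, OF conjI[OF l r]] 2
      by (simp add: has_field_derivative_iff flat_def)
  qed
qed

text \<open>Closed under differentiation, hence consisting of smooth functions.\<close>

inductive_set flat_alg :: "real \<Rightarrow> (real \<Rightarrow> real) set" for \<delta> where
  base: "(\<lambda>s. flat \<delta> i s * flat \<delta> j (1 - s)) \<in> flat_alg \<delta>"
| diff: "f \<in> flat_alg \<delta> \<Longrightarrow> g \<in> flat_alg \<delta> \<Longrightarrow> (\<lambda>s. f s - g s) \<in> flat_alg \<delta>"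

lemma flat_alg_deriv:
  assumes d: "\<delta> > 0" and "f \<in> flat_alg \<delta>"
  shows "\<exists>g\<in>flat_alg \<delta>. \<forall>s. (f has_real_derivative g s) (at s)"
  using assms(2)
proof induction
  case (base i j)
  have "((\<lambda>s. flat \<delta> i s * flat \<delta> j (1 - s)) has_real_derivative
      (flat \<delta> (Suc i) s * flat \<delta> j (1 - s) - flat \<delta> i s * flat \<delta> (Suc j) (1 - s))) (at s)" for s
    by (rule derivative_eq_intros flat_deriv[OF d] DERIV_chain2[OF flat_deriv[OF d]] refl | simp)+
  then show ?case
    by (intro bexI[of _ "\<lambda>s. flat \<delta> (Suc i) s * flat \<delta> j (1 - s) - flat \<delta> i s * flat \<delta> (Suc j) (1 - s)"])
      (auto intro: flat_alg.intros)
next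
  case (diff f g)
  then obtain f' g' where "f' \<in> flat_alg \<delta>" "\<forall>s. (f has_real_derivative f' s) (at s)"
     "g' \<in> flat_alg \<delta>" "\<forall>s. (g has_real_derivative g' s) (at s)" by blast
  then show ?case
    by (intro bexI[of _ "\<lambda>s. f' s - g' s"]) (auto intro: flat_alg.intros derivative_intros)
qed

lemma flat_alg_smooth:
  assumes d: "\<delta> > 0" and f: "f \<in> flat_alg \<delta>"
  obtains H :: "nat \<Rightarrow> real \<Rightarrow> real" where "H 0 = f" "\<And>k s. (H k has_real_derivative H (Suc k) s) (at s)"
proof -
  obtain D where D: "\<And>f. f \<in> flat_alg \<delta> \<Longrightarrow> D f \<in> flat_alg \<delta> \<and> (\<forall>s. (f has_real_derivative D f s) (at s))"
    using flat_alg_deriv[OF d] by metis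
  define H where "H k = (D ^^ k) f" for k
  have "H k \<in> flat_alg \<delta>" for k unfolding H_def by (induction k) (use f D in auto)
  with D have "(H k has_real_derivative H (Suc k) s) (at s)" for k s
    unfolding H_def by simp
  then show thesis using that[of H] unfolding H_def by simp
qed

text \<open>A smooth monotone reparametrization that is constant near both ends but nowhere much
  faster than the identity, so that it changes actions only by a factor close to one.\<close>

lemma flat_reparametrization:
  assumes "\<epsilon> > (0::real)"
  obtains G :: "nat \<Rightarrow> real \<Rightarrow> real" where
    "\<And>k s. (G k has_real_derivative G (Suc k) s) (at s)"
    "\<And>s. s \<le> 0 \<Longrightarrow> G 0 s = 0" "\<And>s. s \<ge> 1 \<Longrightarrow> G 0 s = 1"
    "\<And>s. 0 \<le> G 1 s" "\<And>s. G 1 s \<le> 1 + \<epsilon>"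
    "\<And>s. s \<le> 0 \<Longrightarrow> G 1 s = 0" "\<And>s. s \<ge> 1 \<Longrightarrow> G 1 s = 0"
proof -
  \<comment> \<open>The bump \<open>q\<close> will be at least r on an interval of length r, so its
    mass is at least r * r = 1 / (1 + \<epsilon>). As \<open>q\<close> is at most 1, dividing by the
    mass keeps the speed below 1 + \<epsilon>.\<close>
  define r where "r = 1 / sqrt (1 + \<epsilon>)"
  have r: "0 < r" "r < 1" "r * r = 1 / (1 + \<epsilon>)"
    unfolding r_def using assms by (auto simp: field_simps real_sqrt_mult[symmetric])
  define \<eta> where "\<eta> = (1 - r) / 2"
  have eta: "0 < \<eta>" "\<eta> < 1 - \<eta>" "1 - 2 * \<eta> = r" unfolding \<eta>_def using r by (auto simp: field_simps)
  \<comment> \<open>For x \<ge> \<eta> this gives exp (- \<delta> / x) \<ge> exp (- \<eta>), so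
    \<open>q\<close> is at least exp (- 2 \<eta>) \<ge> 1 - 2 \<eta> = r on the middle
    interval.\<close>
  define \<delta> where "\<delta> = \<eta>\<^sup>2"
  have d: "\<delta> > 0" unfolding \<delta>_def using eta by simp
  define q where "q s = flat \<delta> 0 s * flat \<delta> 0 (1 - s)" for s
  have "q \<in> flat_alg \<delta>" unfolding q_def by (rule flat_alg.base)
  then obtain H where H: "H 0 = q" "\<And>k s. (H k has_real_derivative H (Suc k) s) (at s)"
    using flat_alg_smooth[OF d] by blast
  have "isCont q s" for s using H(1) H(2)[of 0] DERIV_isCont by metis
  \<comment> \<open>The antiderivative is taken on the whole line, so that \<open>G\<close> may
    later be composed with affine maps that leave the unit interval.\<close>
  then have "\<exists>F. \<forall>x::real. -\<infinity> < ereal x \<longrightarrow> ereal x < \<infinity> \<longrightarrow> (F has_vector_derivative q x) (at x)"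
    by (intro einterval_antiderivative) auto
  then obtain F where F: "\<And>s. (F has_real_derivative q s) (at s)"
    by (auto simp: has_real_derivative_iff_has_vector_derivative)
  have q0: "0 \<le> q s" "q s \<le> 1" for s
    unfolding q_def flat_def using d by (auto intro!: mult_le_one)
  have mono: "F a \<le> F b" if "a \<le> b" for a b
    using DERIV_nonneg_imp_nondecreasing[OF that, of F] F q0 by blast
  have qr: "q s \<ge> r" if s: "\<eta> \<le> s" "s \<le> 1 - \<eta>" for s
  proof -
    have ex: "exp (- \<eta>) \<le> exp (- \<delta> / x)" if "\<eta> \<le> x" for x
      using that eta unfolding \<delta>_def by (auto simp: field_simps power2_eq_square)
    have "r \<le> exp (- 2 * \<eta>)" using exp_ge_add_one_self[of "- 2 * \<eta>"] eta by simp
    also have "\<dots> = exp (- \<eta>) * exp (- \<eta>)" by (simp add: exp_add[symmetric])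
    also have "\<dots> \<le> exp (- \<delta> / s) * exp (- \<delta> / (1 - s))"
      using s by (intro mult_mono ex) auto
    also have "\<dots> = q s" using s eta unfolding q_def flat_def by auto
    finally show ?thesis .
  qed
  define c where "c = F 1 - F 0"
  have c: "r * r \<le> c"
  proof -
    obtain z where z: "\<eta> < z" "z < 1 - \<eta>" "F (1 - \<eta>) - F \<eta> = (1 - \<eta> - \<eta>) * q z"
      using MVT2[OF eta(2), of F q] F by blast
    have "r * r \<le> (1 - \<eta> - \<eta>) * q z" using qr[of z] z eta r by (intro mult_mono) auto
    also have "\<dots> \<le> c" unfolding c_def z(3)[symmetric] using mono[of 0 \<eta>] mono[of "1 - \<eta>" 1] eta by auto
    finally show ?thesis .
  qed
  have c0: "c > 0" using c mult_pos_pos[OF r(1) r(1)] by linarith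
  define G where "G k s = (case k of 0 \<Rightarrow> (F s - F 0) / c | Suc n \<Rightarrow> H n s / c)" for k s
  have G1: "G 1 s = q s / c" for s unfolding G_def using H(1) by simp
  show thesis
  proof (rule that[of G])
    show "(G k has_real_derivative G (Suc k) s) (at s)" for k s
      using F[of s] H c0 by (cases k) (auto simp: G_def[abs_def] intro!: derivative_eq_intros)
    show "0 \<le> G 1 s" for s unfolding G1 using q0 c0 by simp
    show "G 1 s \<le> 1 + \<epsilon>" for s
    proof -
      have "q s \<le> (1 + \<epsilon>) * c"
        using q0[of s] c r(3) assms mult_left_mono[OF c, of "1 + \<epsilon>"] by auto
      then show ?thesis unfolding G1 using c0 by (simp add: divide_le_eq)
    qed
    show z: "G 1 s = 0" if "s \<le> 0" for s unfolding G1 q_def flat_def using that by simp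
    show z': "G 1 s = 0" if "s \<ge> 1" for s unfolding G1 q_def flat_def using that by simp
    show "G 0 s = 0" if "s \<le> 0" for s
    proof (cases "s = 0")
      case False
      with that have "s < 0" by simp
      then obtain z where "z < 0" "F 0 - F s = (0 - s) * q z" using MVT2[of s 0 F q] F by blast
      then show ?thesis unfolding G_def by (auto simp: q_def flat_def)
    qed (auto simp: G_def)
    show "G 0 s = 1" if "s \<ge> 1" for s
    proof (cases "s = 1")
      case False
      with that have "1 < s" by simp
      then obtain z where "z > 1" "F s - F 1 = (s - 1) * q z" using MVT2[of 1 s F q] F by blast
      then show ?thesis unfolding G_def using c0 by (auto simp: q_def flat_def c_def)
    qed (use c0 in \<open>auto simp: G_def c_def\<close>)
  qed
qed

section \<open>Matrix algebra\<close>

lemma bounded_bilinear_matrix_mult: "bounded_bilinear ((**) :: complex^'n^'n \<Rightarrow> complex^'n^'n \<Rightarrow> complex^'n^'n)"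
proof -
  have "bilinear ((**) :: complex^'n^'n \<Rightarrow> complex^'n^'n \<Rightarrow> complex^'n^'n)"
    unfolding bilinear_def
    by (intro conjI allI linearI)
      (auto simp: matrix_matrix_mult_def vec_eq_iff sum.distrib[symmetric] scaleR_sum_right algebra_simps)
  then show ?thesis by (simp add: bilinear_conv_bounded_bilinear)
qed

lemma bounded_bilinear_matrix_vector_mult: "bounded_bilinear ((*v) :: complex^'n^'n \<Rightarrow> complex^'n \<Rightarrow> complex^'n)"
proof -
  have "bilinear ((*v) :: complex^'n^'n \<Rightarrow> complex^'n \<Rightarrow> complex^'n)"
    unfolding bilinear_def
    by (intro conjI allI linearI)
      (auto simp: matrix_vector_mult_def vec_eq_iff sum.distrib[symmetric] scaleR_sum_right algebra_simps)
  then show ?thesis by (simp add: bilinear_conv_bounded_bilinear)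
qed

interpretation mm: bounded_bilinear "(**) :: complex^'n^'n \<Rightarrow> complex^'n^'n \<Rightarrow> complex^'n^'n"
  by (rule bounded_bilinear_matrix_mult)

interpretation mv: bounded_bilinear "(*v) :: complex^'n^'n \<Rightarrow> complex^'n \<Rightarrow> complex^'n"
  by (rule bounded_bilinear_matrix_vector_mult)

lemma adj_add: "adj (X + Y) = adj X + adj Y"
  by (simp add: adj_def vec_eq_iff)

lemma adj_scaleR: "adj (r *\<^sub>R X) = r *\<^sub>R adj X"
  by (simp add: adj_def vec_eq_iff)

lemma bounded_linear_adj: "bounded_linear (adj :: complex^'n^'n \<Rightarrow> _)"
  unfolding linear_conv_bounded_linear[symmetric] by (intro linearI adj_add adj_scaleR)

lemma adj_zero [simp]: "adj 0 = 0" by (simp add: adj_def vec_eq_iff)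

lemmas adj_diff = linear_diff[OF bounded_linear.linear[OF bounded_linear_adj]]
lemmas adj_minus = linear_neg[OF bounded_linear.linear[OF bounded_linear_adj]]
lemmas adj_sum = linear_sum[OF bounded_linear.linear[OF bounded_linear_adj]]

lemma adj_adj [simp]: "adj (adj X) = X"
  by (simp add: adj_def vec_eq_iff)

lemma adj_mult: "adj (X ** Y) = adj Y ** adj X"
  by (simp add: adj_def matrix_matrix_mult_def vec_eq_iff mult.commute)

lemma adj_one [simp]: "adj (mat 1) = mat 1"
  by (simp add: adj_def mat_def vec_eq_iff)

lemma cscale_real: "cscale (complex_of_real r) X = r *\<^sub>R X"
  by (simp add: cscale_def vec_eq_iff scaleR_conv_of_real[of _ "_ :: complex"])

lemma inner_complex_mult: "(a::complex) \<bullet> (b * c) = (cnj b * a) \<bullet> c"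
  by (simp add: inner_complex_def algebra_simps)

text \<open>The library's inner product on complex vectors is the real part of the Hermitian one;
  \<open>adj\<close> is an adjoint for it too, so the spectral theory can be developed over the
  reals.\<close>

lemma inner_mv_adj: "v \<bullet> (X *v w) = (adj X *v v) \<bullet> (w :: complex^'n)"
proof -
  have "v \<bullet> (X *v w) = (\<Sum>i\<in>UNIV. \<Sum>k\<in>UNIV. v $ i \<bullet> (X $ i $ k * w $ k))"
    by (simp add: inner_vec_def matrix_vector_mult_def inner_sum_right)
  also have "\<dots> = (\<Sum>k\<in>UNIV. \<Sum>i\<in>UNIV. (cnj (X $ i $ k) * v $ i) \<bullet> w $ k)"
    by (subst sum.swap) (simp add: inner_complex_mult)
  also have "\<dots> = (adj X *v v) \<bullet> w"
    by (simp add: inner_vec_def matrix_vector_mult_def inner_sum_left adj_def)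
  finally show ?thesis .
qed

lemma inner_mm_left: "X \<bullet> (A ** Y) = (adj A ** X) \<bullet> (Y :: complex^'n^'n)"
proof -
  have "X \<bullet> (A ** Y) = (\<Sum>i\<in>UNIV. \<Sum>j\<in>UNIV. \<Sum>k\<in>UNIV. X $ i $ j \<bullet> (A $ i $ k * Y $ k $ j))"
    by (simp add: inner_vec_def matrix_matrix_mult_def inner_sum_right)
  also have "\<dots> = (\<Sum>i\<in>UNIV. \<Sum>k\<in>UNIV. \<Sum>j\<in>UNIV. X $ i $ j \<bullet> (A $ i $ k * Y $ k $ j))"
    by (rule sum.cong[OF refl sum.swap])
  also have "\<dots> = (\<Sum>k\<in>UNIV. \<Sum>i\<in>UNIV. \<Sum>j\<in>UNIV. (cnj (A $ i $ k) * X $ i $ j) \<bullet> Y $ k $ j)"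
    by (subst sum.swap) (simp add: inner_complex_mult)
  also have "\<dots> = (\<Sum>k\<in>UNIV. \<Sum>j\<in>UNIV. \<Sum>i\<in>UNIV. (cnj (A $ i $ k) * X $ i $ j) \<bullet> Y $ k $ j)"
    by (rule sum.cong[OF refl sum.swap])
  also have "\<dots> = (adj A ** X) \<bullet> Y"
    by (simp add: inner_vec_def matrix_matrix_mult_def inner_sum_left adj_def)
  finally show ?thesis .
qed

lemma inner_adj_adj: "adj X \<bullet> adj Y = X \<bullet> (Y :: complex^'n^'n)"
  unfolding inner_vec_def adj_def
  by (subst sum.swap) (simp add: inner_complex_def)

lemma inner_mm_right: "X \<bullet> (Y ** A) = (X ** adj A) \<bullet> (Y :: complex^'n^'n)"
  using inner_mm_left[of "adj X" "adj A" "adj Y"] inner_adj_adj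
  by (metis adj_adj adj_mult)

lemma qform_inner: "Re (qform X v) = v \<bullet> (X *v v)"
  by (simp add: qform_def inner_vec_def inner_complex_def)

lemma smult_real: "complex_of_real a *s v = a *\<^sub>R (v :: complex^'n)"
  by (simp add: vec_eq_iff scaleR_conv_of_real[of _ "_ :: complex"])

section \<open>Spectral theory of self-adjoint matrices\<close>

text \<open>On the orthogonal complement of all eigenvectors, a maximizer of the Rayleigh quotient would be
  one more eigenvector.\<close>

lemma selfadjoint_span_eigenvectors:
  fixes f :: "'a::euclidean_space \<Rightarrow> 'a"
  assumes lin: "linear f" and sa: "\<And>v w. v \<bullet> f w = f v \<bullet> w"
  shows "span {v. \<exists>a. f v = a *\<^sub>R v} = UNIV"
proof (rule ccontr)
  let ?E = "{v. \<exists>a. f v = a *\<^sub>R v}"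
  assume "span ?E \<noteq> UNIV"
  then have "span ?E \<subset> UNIV" by blast
  then obtain x0 where x0: "x0 \<noteq> 0" "\<And>y. y \<in> span ?E \<Longrightarrow> orthogonal x0 y"
    using orthogonal_to_subspace_exists_gen[of ?E UNIV] by auto
  define T where "T = {x. \<forall>e\<in>?E. e \<bullet> x = 0}"
  have Ts: "subspace T" unfolding T_def subspace_def by (auto simp: inner_add_right)
  have Tf: "f x \<in> T" if "x \<in> T" for x using that unfolding T_def by (auto simp: sa)
  have Tc: "closed T"
  proof -
    have "T = (\<Inter>e\<in>?E. {x. e \<bullet> x = 0})" unfolding T_def by auto
    then show ?thesis by (auto intro!: closed_INT closed_hyperplane)
  qed
  have x0T: "x0 \<in> T" unfolding T_def using x0(2)[OF span_base] by (auto simp: orthogonal_def inner_commute)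
  have "compact (T \<inter> sphere 0 1)" using Tc by (intro closed_Int_compact compact_sphere)
  moreover have "x0 /\<^sub>R norm x0 \<in> T \<inter> sphere 0 1"
    using x0 x0T Ts by (auto simp: subspace_scale)
  then have "T \<inter> sphere 0 1 \<noteq> {}" by blast
  moreover have "continuous_on (T \<inter> sphere 0 1) (\<lambda>x. x \<bullet> f x)"
    using lin by (intro continuous_intros linear_continuous_on) (simp add: linear_linear)
  ultimately have "\<exists>v\<in>T \<inter> sphere 0 1. \<forall>y\<in>T \<inter> sphere 0 1. y \<bullet> f y \<le> v \<bullet> f v"
    by (rule continuous_attains_sup)
  then obtain v where v: "v \<in> T" "norm v = 1" and max: "\<And>y. y \<in> T \<Longrightarrow> norm y = 1 \<Longrightarrow> y \<bullet> f y \<le> v \<bullet> f v"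
    by auto
  define l where "l = v \<bullet> f v"
  \<comment> \<open>The component of \<open>f v\<close> orthogonal to the maximizer; it has to
    vanish for \<open>v\<close> to be an eigenvector.\<close>
  define w where "w = f v - l *\<^sub>R v"
  have wT: "w \<in> T" unfolding w_def using v Ts Tf by (intro subspace_diff subspace_scale) auto
  have vv: "v \<bullet> v = 1" using v(2) by (simp add: norm_eq_1)
  have vw: "v \<bullet> w = 0" unfolding w_def l_def using vv by (simp add: inner_diff_right)
  have le: "y \<bullet> f y \<le> l * (y \<bullet> y)" if "y \<in> T" for y
  proof (cases "y = 0")
    case False
    have "(y /\<^sub>R norm y) \<bullet> f (y /\<^sub>R norm y) \<le> l"
      unfolding l_def using False that Ts by (intro max) (auto simp: subspace_scale)
    then have "(y \<bullet> f y) / (norm y)\<^sup>2 \<le> l"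
      by (simp add: linear_scale[OF lin] power2_eq_square divide_inverse algebra_simps)
    then show ?thesis using False by (simp add: divide_le_eq power2_norm_eq_inner)
  qed (simp add: linear_0[OF lin])
  have wfv: "w \<bullet> f v = w \<bullet> w" using vw by (simp add: w_def inner_diff_right inner_commute algebra_simps)
  \<comment> \<open>Comparing the Rayleigh quotients at \<open>v\<close> and at
    \<open>v + t w\<close>: the gain is linear in t and the loss quadratic, so a small t contradicts
    maximality unless w = 0.\<close>
  have bd: "2 * (w \<bullet> w) \<le> t * (l * (w \<bullet> w) - w \<bullet> f w)" if t: "t > 0" for t
  proof -
    have "(v + t *\<^sub>R w) \<bullet> f (v + t *\<^sub>R w) \<le> l * ((v + t *\<^sub>R w) \<bullet> (v + t *\<^sub>R w))"
      using v wT Ts by (intro le subspace_add subspace_scale)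
    moreover have "(v + t *\<^sub>R w) \<bullet> f (v + t *\<^sub>R w) = l + 2 * t * (w \<bullet> w) + t * t * (w \<bullet> f w)"
    proof -
      have "v \<bullet> f w = w \<bullet> w" using sa[of v w] wfv by (simp add: inner_commute)
      then show ?thesis using wfv
        by (simp add: linear_add[OF lin] linear_scale[OF lin] inner_add_left inner_add_right l_def algebra_simps)
    qed
    moreover have "(v + t *\<^sub>R w) \<bullet> (v + t *\<^sub>R w) = 1 + t * t * (w \<bullet> w)"
      using vv vw by (simp add: inner_add_left inner_add_right inner_commute[of w v] algebra_simps)
    ultimately have "l + 2 * t * (w \<bullet> w) + t * t * (w \<bullet> f w) \<le> l * (1 + t * t * (w \<bullet> w))"
      by (simp only:)
    then have "t * (2 * (w \<bullet> w)) \<le> t * (t * (l * (w \<bullet> w) - w \<bullet> f w))"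
      by (simp add: algebra_simps)
    then show ?thesis using t by simp
  qed
  have "w \<bullet> w \<le> 0"
  proof (rule ccontr)
    assume n: "\<not> w \<bullet> w \<le> 0"
    define c where "c = l * (w \<bullet> w) - w \<bullet> f w"
    have p: "0 < (w \<bullet> w) / (\<bar>c\<bar> + 1)" using n by (intro divide_pos_pos) auto
    have "2 * (w \<bullet> w) \<le> ((w \<bullet> w) / (\<bar>c\<bar> + 1)) * c" using bd[OF p] unfolding c_def[symmetric] .
    also have "\<dots> \<le> w \<bullet> w"
    proof -
      have "(w \<bullet> w) * c \<le> (w \<bullet> w) * (\<bar>c\<bar> + 1)" using n by (intro mult_left_mono) auto
      then show ?thesis by (simp add: field_simps)
    qed
    finally show False using n by simp
  qed
  then have "w = 0" by (metis inner_eq_zero_iff inner_ge_zero order_antisym)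
  then have "f v = l *\<^sub>R v" unfolding w_def by simp
  then have "v \<in> ?E" by blast
  then have "v \<bullet> v = 0" using v(1) unfolding T_def by blast
  then show False using vv by simp
qed

lemma eigenvectors_orthogonal:
  assumes "adj X = X" "X *v v = a *\<^sub>R v" "X *v w = b *\<^sub>R w" "a \<noteq> b"
  shows "v \<bullet> (w :: complex^'n) = 0"
proof -
  have "b * (v \<bullet> w) = a * (v \<bullet> w)" using inner_mv_adj[of v X w] assms by simp
  then show ?thesis using assms(4) by simp
qed

lemma span_eigenvectors:
  assumes "adj X = X"
  shows "span {v :: complex^'n. \<exists>a. X *v v = a *\<^sub>R v} = UNIV"
  using assms
  by (intro selfadjoint_span_eigenvectors)
    (auto simp: inner_mv_adj intro: bounded_linear.linear[OF mv.bounded_linear_right])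

text \<open>Eigenvectors of a self-adjoint matrix span the space, so identities of the functional
  calculus reduce to scalar identities on a single eigenvector.\<close>

lemma mat_eq_on_eigenvectors:
  fixes X :: "complex^'n^'n"
  assumes "adj X = X" and eq: "\<And>v a. X *v v = a *\<^sub>R v \<Longrightarrow> A *v v = B *v v"
  shows "A = B"
proof -
  have "A *v v = B *v v" for v
  proof (rule linear_eq_on_span[of "(*v) A" "(*v) B" "{v. \<exists>a. X *v v = a *\<^sub>R v}"])
    show "v \<in> span {v. \<exists>a. X *v v = a *\<^sub>R v}" using span_eigenvectors[OF assms(1)] by simp
  qed (auto intro: eq bounded_linear.linear[OF mv.bounded_linear_right])
  then show ?thesis by (simp add: matrix_eq)
qed

lemma spec_eq: "spec X = {a. \<exists>v. v \<noteq> 0 \<and> X *v v = a *\<^sub>R v}"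
  unfolding spec_def smult_real ..

lemma finite_spec:
  fixes X :: "complex^'n^'n"
  assumes "adj X = X"
  shows "finite (spec X)"
proof -
  obtain v where v: "\<And>a. a \<in> spec X \<Longrightarrow> v a \<noteq> 0 \<and> X *v v a = a *\<^sub>R v a"
    using bchoice[of "spec X" "\<lambda>a v. v \<noteq> 0 \<and> X *v v = a *\<^sub>R v"] unfolding spec_eq by blast
  have "pairwise orthogonal (v ` spec X)"
    unfolding pairwise_def orthogonal_def by (metis (no_types, opaque_lifting) eigenvectors_orthogonal[OF assms] v imageE)
  moreover have "0 \<notin> v ` spec X" using v by auto
  ultimately have "finite (v ` spec X)"
    using pairwise_orthogonal_independent independent_imp_finite by blast
  moreover have "inj_on v (spec X)"
    by (rule inj_onI) (metis v scaleR_cancel_right)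
  ultimately show ?thesis using finite_imageD by blast
qed

lemma vN_subspace: "vN_algebra e M \<Longrightarrow> subspace M"
proof -
  assume M: "vN_algebra e M"
  then have r: "r *\<^sub>R X \<in> M" if "X \<in> M" for r X
    using that unfolding vN_algebra_def by (metis cscale_real)
  have "0 \<in> M" using r[of e 0] M unfolding vN_algebra_def by auto
  then show ?thesis using M r unfolding subspace_def vN_algebra_def by blast
qed

text \<open>Lagrange interpolation: a product of factors (X - b) / (a - b), which stays inside the
  algebra and acts on each eigenvector of \<open>X\<close> as a scalar.\<close>

lemma eigen_separating_polynomial:
  assumes M: "vN_algebra (mat 1) M" and "X \<in> M" "finite F" "a \<notin> F"
  shows "\<exists>P\<in>M. \<exists>q. (\<forall>c v. X *v v = c *\<^sub>R v \<longrightarrow> P *v v = q c *\<^sub>R v) \<and> q a = (1::real) \<and> (\<forall>b\<in>F. q b = 0)"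
  using assms(3,4)
proof (induction F)
  case empty
  show ?case using M unfolding vN_algebra_def
    by (intro bexI[of _ "mat 1"] exI[of _ "\<lambda>_. 1"]) auto
next
  case (insert b F)
  then obtain P q where P: "P \<in> M" "\<And>c v. X *v v = c *\<^sub>R v \<Longrightarrow> P *v v = q c *\<^sub>R v" "q a = 1" "\<And>b. b \<in> F \<Longrightarrow> q b = 0"
    by blast
  let ?Q = "(1 / (a - b)) *\<^sub>R ((X - b *\<^sub>R mat 1) ** P)"
  have "X - b *\<^sub>R mat 1 \<in> M" using vN_subspace[OF M] M assms(2) unfolding vN_algebra_def
    by (simp add: subspace_diff subspace_scale)
  then have "?Q \<in> M" using vN_subspace[OF M] M P(1) unfolding vN_algebra_def by (simp add: subspace_scale)
  moreover have "?Q *v v = ((c - b) / (a - b) * q c) *\<^sub>R v" if "X *v v = c *\<^sub>R v" for c v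
  proof -
    have "(X - b *\<^sub>R mat 1) *v (q c *\<^sub>R v) = ((c - b) * q c) *\<^sub>R v"
      using that by (simp add: mv.diff_left mv.scaleR_left mv.scaleR_right algebra_simps)
    then show ?thesis
      using P(2)[OF that] by (simp add: mv.scaleR_left matrix_vector_mul_assoc[symmetric])
  qed
  ultimately show ?case
    using P(3,4) insert.prems by (intro bexI[of _ ?Q] exI[of _ "\<lambda>c. (c - b) / (a - b) * q c"]) auto
qed

text \<open>The polynomial in \<open>X\<close> that is 1 at \<open>a\<close> and 0 on the rest of
  the spectrum is the projection described by \<open>eproj\<close>; for \<open>a\<close> outside the
  spectrum it is 0. This settles well-definedness and membership in the algebra together.\<close>

lemma eproj_exists:
  assumes sa: "adj X = X" and M: "vN_algebra (mat 1) M" "X \<in> M"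
  shows "eproj X a \<in> M \<and> adj (eproj X a) = eproj X a \<and>
    (\<forall>c v. X *v v = c *\<^sub>R v \<longrightarrow> eproj X a *v v = (if c = a then v else 0))"
proof -
  obtain P q where P: "P \<in> M" "\<And>c v. X *v v = c *\<^sub>R v \<Longrightarrow> P *v v = q c *\<^sub>R v" "q a = 1" "\<And>b. b \<in> spec X - {a} \<Longrightarrow> q b = 0"
    using eigen_separating_polynomial[OF M, of "spec X - {a}" a] finite_spec[OF sa] by blast
  have Pe: "P *v v = (if c = a then v else 0)" if "X *v v = c *\<^sub>R v" for c v
  proof (cases "v = 0 \<or> c = a")
    case False
    then have "c \<in> spec X - {a}" using that unfolding spec_eq by auto
    then show ?thesis using P(2)[OF that] P(4) False by auto
  qed (use P(2)[OF that] P(3) in auto)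
  have adjP: "adj P = P"
  proof (rule mat_eq_on_eigenvectors[OF sa])
    fix v c assume v: "X *v v = c *\<^sub>R v"
    \<comment> \<open>Testing against eigenvectors suffices: \<open>P\<close> multiplies
      \<open>v\<close> and \<open>w\<close> by 0 or 1, and where these factors differ the
      eigenvalues differ, so the vectors are orthogonal.\<close>
    have "(adj P *v v) \<bullet> w = (P *v v) \<bullet> w" for w
    proof (rule linear_eq_on_span[of "\<lambda>w. (adj P *v v) \<bullet> w" "\<lambda>w. (P *v v) \<bullet> w" "{v. \<exists>a. X *v v = a *\<^sub>R v}"])
      show "w \<in> span {v. \<exists>a. X *v v = a *\<^sub>R v}" using span_eigenvectors[OF sa] by simp
      fix w assume "w \<in> {v. \<exists>a. X *v v = a *\<^sub>R v}"
      then obtain d where d: "X *v w = d *\<^sub>R w" by blast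
      have "(adj P *v v) \<bullet> w = v \<bullet> (P *v w)" by (simp add: inner_mv_adj)
      then show "(adj P *v v) \<bullet> w = (P *v v) \<bullet> w"
        using Pe[OF v] Pe[OF d] eigenvectors_orthogonal[OF sa v d] by auto
    qed (auto intro: bounded_linear.linear[OF bounded_linear_inner_right])
    then show "adj P *v v = P *v v" by (metis vector_eq_rdot)
  qed
  have idem: "P ** P = P"
  proof (rule mat_eq_on_eigenvectors[OF sa])
    fix v c assume v: "X *v v = c *\<^sub>R v"
    show "(P ** P) *v v = P *v v" by (simp add: matrix_vector_mul_assoc[symmetric] Pe[OF v])
  qed
  have XP: "X ** P = a *\<^sub>R P"
  proof (rule mat_eq_on_eigenvectors[OF sa])
    fix v c assume v: "X *v v = c *\<^sub>R v"
    show "(X ** P) *v v = (a *\<^sub>R P) *v v"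
      by (auto simp: matrix_vector_mul_assoc[symmetric] Pe[OF v] mv.scaleR_left v)
  qed
  have fixs: "{v. P *v v = v} = {v. X *v v = of_real a *s v}"
  proof -
    have "X *v v = a *\<^sub>R v" if "P *v v = v" for v
      using XP that by (metis matrix_vector_mul_assoc mv.scaleR_left)
    then show ?thesis unfolding smult_real using Pe[of _ a] by auto
  qed
  have "eproj X a = P"
    unfolding eproj_def
  proof (rule the_equality)
    fix Q assume Q: "adj Q = Q \<and> Q ** Q = Q \<and> {v. Q *v v = v} = {v. X *v v = of_real a *s v}"
    then have "{v. Q *v v = v} = {v. P *v v = v}" using fixs by argo
    then have QP_iff: "Q *v v = v \<longleftrightarrow> P *v v = v" for v by blast
    \<comment> \<open>Projections with equal fixed spaces act as the identity on each other's range;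
      taking the adjoint of \<open>P ** Q = Q\<close> then identifies them.\<close>
    have "Q *v (P *v v) = P *v v" for v
      unfolding QP_iff by (simp add: matrix_vector_mul_assoc idem)
    then have QP: "Q ** P = P" by (simp add: matrix_eq matrix_vector_mul_assoc)
    have "P *v (Q *v v) = Q *v v" for v
      unfolding QP_iff[symmetric] using Q by (simp add: matrix_vector_mul_assoc)
    then have PQ: "P ** Q = Q" by (simp add: matrix_eq matrix_vector_mul_assoc)
    have "Q = adj (P ** Q)" using PQ Q by simp
    also have "\<dots> = P" using Q adjP QP by (simp add: adj_mult)
    finally show "Q = P" .
  qed (use adjP idem fixs in auto)
  then show ?thesis using P(1) adjP Pe by auto
qed

lemma vN_UNIV: "vN_algebra (mat 1) UNIV"
  unfolding vN_algebra_def by auto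

lemma eproj_eigen:
  assumes "adj X = X" "X *v v = c *\<^sub>R v"
  shows "eproj X a *v v = (if c = a then v else 0)"
  using eproj_exists[OF assms(1) vN_UNIV UNIV_I] assms(2) by blast

lemma eproj_mem: "adj X = X \<Longrightarrow> vN_algebra (mat 1) M \<Longrightarrow> X \<in> M \<Longrightarrow> eproj X a \<in> M"
  using eproj_exists by blast

lemma adj_eproj: "adj X = X \<Longrightarrow> adj (eproj X a) = eproj X a"
  using eproj_exists[OF _ vN_UNIV UNIV_I] by blast

lemma eproj_mult:
  assumes "adj X = X"
  shows "eproj X a ** eproj X b = (if a = b then eproj X a else 0)"
proof (rule mat_eq_on_eigenvectors[OF assms])
  fix v c assume v: "X *v v = c *\<^sub>R v"
  show "(eproj X a ** eproj X b) *v v = (if a = b then eproj X a else 0) *v v"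
    by (auto simp: matrix_vector_mul_assoc[symmetric] eproj_eigen[OF assms v])
qed

lemma eproj_nonzero:
  assumes "adj X = X" "a \<in> spec X"
  shows "eproj X a \<noteq> 0"
  using assms eproj_eigen[OF assms(1), of _ a a] unfolding spec_eq by auto

section \<open>Functional calculus and positivity\<close>

lemma fcalc_eq: "fcalc f X = (\<Sum>a\<in>spec X. f a *\<^sub>R eproj X a)"
  unfolding fcalc_def cscale_real ..

lemma fcalc_eigen:
  assumes "adj X = X" "X *v v = c *\<^sub>R v"
  shows "fcalc f X *v v = f c *\<^sub>R v"
proof (cases "v = 0")
  case False
  then have "c \<in> spec X" using assms unfolding spec_eq by auto
  then show ?thesis unfolding fcalc_eq
    by (simp add: mv.sum_left mv.scaleR_left eproj_eigen[OF assms] finite_spec[OF assms(1)] if_distrib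
        sum.delta cong: if_cong)
qed simp

lemma fcalc_cong: "(\<And>a. a \<in> spec X \<Longrightarrow> f a = g a) \<Longrightarrow> fcalc f X = fcalc g X"
  unfolding fcalc_eq by auto

lemma fcalc_id:
  assumes "adj X = X"
  shows "fcalc (\<lambda>a. a) X = X"
  by (rule mat_eq_on_eigenvectors[OF assms]) (metis fcalc_eigen[OF assms])

lemma fcalc_one:
  assumes "adj X = X"
  shows "fcalc (\<lambda>a. 1) X = mat 1"
  by (rule mat_eq_on_eigenvectors[OF assms]) (metis fcalc_eigen[OF assms] matrix_vector_mul_lid scaleR_one)

lemma fcalc_mult:
  assumes "adj X = X"
  shows "fcalc f X ** fcalc g X = fcalc (\<lambda>a. f a * g a) X"
proof (rule mat_eq_on_eigenvectors[OF assms])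
  fix v c assume v: "X *v v = c *\<^sub>R v"
  show "(fcalc f X ** fcalc g X) *v v = fcalc (\<lambda>a. f a * g a) X *v v"
    by (simp add: matrix_vector_mul_assoc[symmetric] fcalc_eigen[OF assms v] mv.scaleR_right mult.commute)
qed

lemma adj_fcalc: "adj X = X \<Longrightarrow> adj (fcalc f X) = fcalc f X"
  unfolding fcalc_eq by (simp add: adj_sum adj_scaleR adj_eproj)

lemma fcalc_mem:
  assumes "adj X = X" "vN_algebra (mat 1) M" "X \<in> M"
  shows "fcalc f X \<in> M"
  unfolding fcalc_eq using eproj_mem[OF assms] vN_subspace[OF assms(2)]
  by (intro subspace_sum subspace_scale)

lemma spec_pos:
  assumes "pos_def X" "a \<in> spec X"
  shows "0 < a"
proof -
  obtain v where v: "v \<noteq> 0" "X *v v = a *\<^sub>R v" using assms(2) unfolding spec_eq by blast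
  then have "0 < a * (v \<bullet> v)" using assms(1) unfolding pos_def_def qform_inner by (metis inner_scaleR_right)
  moreover have "0 < v \<bullet> v" using v(1) by simp
  ultimately show ?thesis by (rule zero_less_mult_pos2)
qed

lemma spec_nonneg:
  assumes "pos_semidef X" "a \<in> spec X"
  shows "0 \<le> a"
proof -
  obtain v where v: "v \<noteq> 0" "X *v v = a *\<^sub>R v" using assms(2) unfolding spec_eq by blast
  then have "0 \<le> a * (v \<bullet> v)" using assms(1) unfolding pos_semidef_def qform_inner by (metis inner_scaleR_right)
  moreover have "0 < v \<bullet> v" using v(1) by simp
  ultimately show ?thesis using zero_le_mult_iff not_le by (metis less_le_not_le)
qed

lemma inner_eproj:
  assumes "adj X = X"
  shows "v \<bullet> (eproj X a *v v) = (norm (eproj X a *v v))\<^sup>2"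
proof -
  have "v \<bullet> (eproj X a *v v) = v \<bullet> (eproj X a *v (eproj X a *v v))"
    by (simp add: matrix_vector_mul_assoc eproj_mult[OF assms])
  then show ?thesis by (simp add: inner_mv_adj adj_eproj[OF assms] power2_norm_eq_inner)
qed

lemma inner_fcalc:
  assumes "adj X = X"
  shows "v \<bullet> (fcalc f X *v v) = (\<Sum>a\<in>spec X. f a * (norm (eproj X a *v v))\<^sup>2)"
  by (simp add: fcalc_eq mv.sum_left mv.scaleR_left inner_sum_right inner_eproj[OF assms])

lemma norm_eproj_sum:
  assumes "adj X = X"
  shows "(\<Sum>a\<in>spec X. (norm (eproj X a *v v))\<^sup>2) = (norm v)\<^sup>2"
  using inner_fcalc[OF assms, of v "\<lambda>_. 1"] by (simp add: fcalc_one[OF assms] power2_norm_eq_inner)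

section \<open>Tracial algebras\<close>

text \<open>Traces and homomorphisms are specified on their algebras only. Replacing them by
  globally linear maps makes boundedness and continuity available.\<close>

lemma linear_extension:
  fixes f :: "'a::real_vector \<Rightarrow> 'b::real_vector"
  assumes S: "subspace S" and add: "\<And>x y. x \<in> S \<Longrightarrow> y \<in> S \<Longrightarrow> f (x + y) = f x + f y"
    and scale: "\<And>r x. x \<in> S \<Longrightarrow> f (r *\<^sub>R x) = r *\<^sub>R f x"
  shows "\<exists>g. linear g \<and> (\<forall>x\<in>S. g x = f x)"
proof -
  obtain B where B: "B \<subseteq> S" "independent B" "S \<subseteq> span B" using maximal_independent_subset by blast
  obtain g where g: "linear g" "\<forall>x\<in>B. g x = f x" using linear_independent_extend[OF B(2)] by blast
  have "subspace {x \<in> S. g x = f x}"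
    using S add scale scale[of 0 0] unfolding subspace_def
    by (auto simp: linear_add[OF g(1)] linear_scale[OF g(1)] linear_0[OF g(1)])
  moreover have "B \<subseteq> {x \<in> S. g x = f x}" using B g by auto
  ultimately have "span B \<subseteq> {x \<in> S. g x = f x}" by (rule span_minimal[rotated])
  then show ?thesis using g(1) B by blast
qed

text \<open>The form may be asymmetric. In an orthonormal basis of \<open>S\<close> it becomes the
  linear map \<open>G\<close> of \<open>S\<close> into itself, which nondegeneracy makes injective,
  hence onto by dimension.\<close>

lemma riesz_subspace:
  fixes S :: "'a::euclidean_space set" and \<beta> :: "'a \<Rightarrow> 'a \<Rightarrow> real"
  assumes S: "subspace S" and l: "\<And>z. linear (\<lambda>x. \<beta> x z)" and r: "\<And>x. linear (\<beta> x)"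
    and nondeg: "\<And>x. x \<in> S \<Longrightarrow> (\<And>z. z \<in> S \<Longrightarrow> \<beta> x z = 0) \<Longrightarrow> x = 0" and \<phi>: "linear \<phi>"
  shows "\<exists>x\<in>S. \<forall>z\<in>S. \<beta> x z = \<phi> z"
proof -
  obtain B where B: "B \<subseteq> S" "pairwise orthogonal B" "\<And>x. x \<in> B \<Longrightarrow> norm x = 1" "independent B"
    "card B = dim S" "span B = S" using orthonormal_basis_subspace[OF S] by metis
  have fin: "finite B" using B(4) independent_imp_finite by blast
  have coeff: "(\<Sum>b\<in>B. c b *\<^sub>R b) \<bullet> b' = c b'" if "b' \<in> B" for b' c
  proof -
    have "(\<Sum>b\<in>B. c b *\<^sub>R b) \<bullet> b' = (\<Sum>b\<in>B. if b = b' then c b else 0)"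
      unfolding inner_sum_left
      using B(2,3) that by (intro sum.cong refl) (auto simp: pairwise_def orthogonal_def norm_eq_1)
    then show ?thesis using fin that by simp
  qed
  define G where "G x = (\<Sum>b\<in>B. \<beta> x b *\<^sub>R b)" for x
  have lG: "linear G" unfolding G_def
    by (intro linearI) (auto simp: linear_add[OF l] linear_scale[OF l] scaleR_add_left sum.distrib scaleR_sum_right)
  have ext: "\<beta> x z = \<psi> z" if "z \<in> S" "linear \<psi>" "\<And>b. b \<in> B \<Longrightarrow> \<beta> x b = \<psi> b" for x z \<psi>
    by (rule linear_eq_on_span[OF r that(2), of B]) (use that B(6) in auto)
  have inj: "inj_on G (span S)"
  proof -
    have "x = 0" if x: "x \<in> S" "G x = 0" for x
    proof (rule nondeg[OF x(1)])
      have "\<beta> x b = 0" if "b \<in> B" for b using coeff[OF that, of "\<beta> x"] x(2) unfolding G_def by simp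
      then show "\<beta> x z = 0" if "z \<in> S" for z
        using ext[OF that, of "\<lambda>_. 0" x] by (simp add: linear_zero)
    qed
    then show ?thesis using linear_inj_on_iff_eq_0[OF lG] S subspace_span by (metis span_eq_iff)
  qed
  have GS: "G ` S \<subseteq> S" unfolding G_def using B(1) S by (auto intro!: subspace_sum subspace_scale)
  have "dim (G ` S) = dim S" by (rule dim_image_eq[OF lG inj])
  then have "G ` S = S" using subspace_dim_equal[OF _ S GS] lG S by (simp add: linear_subspace_image)
  moreover have "(\<Sum>b\<in>B. \<phi> b *\<^sub>R b) \<in> S" using B(1) S by (auto intro!: subspace_sum subspace_scale)
  ultimately obtain x where x: "x \<in> S" "G x = (\<Sum>b\<in>B. \<phi> b *\<^sub>R b)" by (metis imageE)
  have "\<beta> x b = \<phi> b" if "b \<in> B" for b using coeff[OF that, of "\<beta> x"] coeff[OF that, of \<phi>] x(2) unfolding G_def by simp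
  then show ?thesis using ext[OF _ \<phi>] x(1) by blast
qed

lemma cscale_mult_right: "A ** cscale c X = cscale c (A ** X)"
  by (simp add: cscale_def matrix_matrix_mult_def vec_eq_iff sum_distrib_left algebra_simps)

lemma cscale_mult_left: "cscale c A ** X = cscale c (A ** X)"
  by (simp add: cscale_def matrix_matrix_mult_def vec_eq_iff sum_distrib_left algebra_simps)

lemma adj_cscale: "adj (cscale c X) = cscale (cnj c) (adj X)"
  by (simp add: cscale_def adj_def vec_eq_iff)

locale tracial =
  fixes e :: "complex^'n^'n" and M :: "(complex^'n^'n) set" and \<tau> :: "complex^'n^'n \<Rightarrow> complex"
  assumes vN: "vN_algebra e M" and ft: "faithful_trace M \<tau>"
begin

lemma sub: "subspace M" by (rule vN_subspace[OF vN])

lemma mem [simp, intro]: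
  "e \<in> M" "0 \<in> M" "X \<in> M \<Longrightarrow> Y \<in> M \<Longrightarrow> X + Y \<in> M" "X \<in> M \<Longrightarrow> Y \<in> M \<Longrightarrow> X - Y \<in> M"
  "X \<in> M \<Longrightarrow> - X \<in> M" "X \<in> M \<Longrightarrow> r *\<^sub>R X \<in> M" "X \<in> M \<Longrightarrow> cscale c X \<in> M"
  "X \<in> M \<Longrightarrow> Y \<in> M \<Longrightarrow> X ** Y \<in> M" "X \<in> M \<Longrightarrow> adj X \<in> M"
  using vN sub unfolding vN_algebra_def
  by (auto simp: subspace_0 subspace_add subspace_diff subspace_neg subspace_scale)

lemma mem_sum [simp, intro]: "(\<And>i. i \<in> A \<Longrightarrow> f i \<in> M) \<Longrightarrow> sum f A \<in> M"
  by (rule subspace_sum[OF sub])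

lemma unit: "X \<in> M \<Longrightarrow> e ** X = X" "X \<in> M \<Longrightarrow> X ** e = X"
  using vN unfolding vN_algebra_def by auto

lemma adj_e: "adj e = e"
proof -
  have u: "adj e ** e = adj e" by (rule unit) auto
  have "adj (adj e ** e) = adj e ** e" by (simp add: adj_mult)
  then show ?thesis unfolding u by simp
qed

lemma closed_M: "closed M" by (rule closed_subspace[OF sub])

lemma tr_add: "X \<in> M \<Longrightarrow> Y \<in> M \<Longrightarrow> \<tau> (X + Y) = \<tau> X + \<tau> Y"
  and tr_cscale: "X \<in> M \<Longrightarrow> \<tau> (cscale c X) = c * \<tau> X"
  and tr_cyc: "X \<in> M \<Longrightarrow> Y \<in> M \<Longrightarrow> \<tau> (X ** Y) = \<tau> (Y ** X)"
  and tr_nonneg: "X \<in> M \<Longrightarrow> \<tau> (adj X ** X) \<in> \<real>\<^sub>\<ge>\<^sub>0"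
  and tr_faithful: "X \<in> M \<Longrightarrow> \<tau> (adj X ** X) = 0 \<Longrightarrow> X = 0"
  using ft unfolding faithful_trace_def by auto

lemma tr_scaleR: "X \<in> M \<Longrightarrow> \<tau> (r *\<^sub>R X) = r *\<^sub>R \<tau> X"
  using tr_cscale[of X "complex_of_real r"] by (simp add: cscale_real scaleR_conv_of_real)

lemma tr_linear_ext: "\<exists>T. bounded_linear T \<and> (\<forall>X\<in>M. \<tau> X = T X)"
  using linear_extension[OF sub, of \<tau>] tr_add tr_scaleR linear_conv_bounded_linear by metis

lemma tr_zero [simp]: "\<tau> 0 = 0"
  using tr_scaleR[of 0 0] by simp

lemma tr_diff: "X \<in> M \<Longrightarrow> Y \<in> M \<Longrightarrow> \<tau> (X - Y) = \<tau> X - \<tau> Y"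
  using tr_add[of "X - Y" Y] by simp

lemma tr_minus: "X \<in> M \<Longrightarrow> \<tau> (- X) = - \<tau> X"
  using tr_diff[of 0 X] by simp

lemma tr_sum: "(\<And>i. i \<in> A \<Longrightarrow> f i \<in> M) \<Longrightarrow> \<tau> (sum f A) = (\<Sum>i\<in>A. \<tau> (f i))"
  by (induction A rule: infinite_finite_induct) (auto simp: tr_add)

text \<open>Positivity concerns only elements \<open>adj Y ** Y\<close>. Taking imaginary parts at Y
  = X + e and at Y = X + i e gives the two real equations.\<close>

lemma tr_adj:
  assumes X: "X \<in> M"
  shows "\<tau> (adj X) = cnj (\<tau> X)"
proof -
  have re: "Im (\<tau> (adj Y ** Y)) = 0" if "Y \<in> M" for Y
    using tr_nonneg[OF that] by (auto simp: nonneg_Reals_def)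
  have "adj (X + e) ** (X + e) = adj X ** X + adj X + X + e"
    using X by (simp add: adj_add adj_e mm.add_left mm.add_right unit)
  then have "\<tau> (adj (X + e) ** (X + e)) = \<tau> (adj X ** X) + \<tau> (adj X) + \<tau> X + \<tau> e"
    using X by (simp add: tr_add)
  moreover have "Im (\<tau> e) = 0" using re[of e] by (simp add: adj_e unit)
  ultimately have 1: "Im (\<tau> (adj X)) + Im (\<tau> X) = 0"
    using re[of "X + e"] re[of X] X by simp
  have "adj (X + cscale \<i> e) ** (X + cscale \<i> e) = adj X ** X + cscale \<i> (adj X) - cscale \<i> X + e"
    using X by (simp add: adj_add adj_e mm.add_left mm.add_right unit adj_cscale cscale_mult_left cscale_mult_right)
      (simp add: cscale_def vec_eq_iff algebra_simps)
  then have "\<tau> (adj (X + cscale \<i> e) ** (X + cscale \<i> e)) = \<tau> (adj X ** X) + \<i> * \<tau> (adj X) - \<i> * \<tau> X + \<tau> e"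
    using X by (simp add: tr_add tr_diff tr_cscale)
  then have 2: "Re (\<tau> (adj X)) - Re (\<tau> X) = 0"
    using re[of "X + cscale \<i> e"] re[of X] X \<open>Im (\<tau> e) = 0\<close> by simp
  show ?thesis using 1 2 by (simp add: complex_eq_iff)
qed

lemma tr_pos: "X \<in> M \<Longrightarrow> 0 \<le> Re (\<tau> (adj X ** X))"
  using tr_nonneg[of X] by (auto simp: nonneg_Reals_def)

lemma tr_pos_eq0: "X \<in> M \<Longrightarrow> Re (\<tau> (adj X ** X)) = 0 \<Longrightarrow> X = 0"
  using tr_nonneg[of X] tr_faithful[of X] by (auto simp: nonneg_Reals_def)

lemma tr_norm_upper: "\<exists>C>0. \<forall>X\<in>M. \<forall>Y\<in>M. \<bar>Re (\<tau> (X ** Y))\<bar> \<le> C * norm X * norm Y"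
proof -
  obtain T where T: "bounded_linear T" "\<And>X. X \<in> M \<Longrightarrow> \<tau> X = T X" using tr_linear_ext by metis
  have "\<exists>K>0. \<forall>(X :: complex^'n^'n) Y :: complex^'n^'n. norm (X ** Y) \<le> norm X * norm Y * K" by (rule mm.pos_bounded)
  then obtain K where K: "K > 0" "\<And>(X :: complex^'n^'n) Y :: complex^'n^'n. norm (X ** Y) \<le> norm X * norm Y * K"
    by blast
  obtain L where L: "L > 0" "\<And>X. norm (T X) \<le> norm X * L"
    using bounded_linear.pos_bounded[OF T(1)] by (elim exE conjE) (rule that, assumption, erule allE)
  have "\<bar>Re (\<tau> (X ** Y))\<bar> \<le> (K * L) * norm X * norm Y" if "X \<in> M" "Y \<in> M" for X Y
  proof -
    have "\<bar>Re (\<tau> (X ** Y))\<bar> \<le> norm (T (X ** Y))" using that T(2) by (simp add: abs_Re_le_cmod)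
    also have "\<dots> \<le> norm (X ** Y) * L" by (rule L)
    also have "\<dots> \<le> (norm X * norm Y * K) * L" using K L by (intro mult_right_mono) auto
    finally show ?thesis by (simp add: algebra_simps)
  qed
  then show ?thesis using K L by (intro exI[of _ "K * L"]) auto
qed

text \<open>Faithfulness makes the form positive on the compact unit sphere of \<open>M\<close>, so
  the trace norm dominates the matrix norm there and, by scaling, on all of
  \<open>M\<close>.\<close>

lemma tr_norm_lower: "\<exists>c>0. \<forall>X\<in>M. c * (norm X)\<^sup>2 \<le> Re (\<tau> (adj X ** X))"
proof (cases "M = {0}")
  case True
  then show ?thesis by (intro exI[of _ 1]) auto
next
  case False
  obtain T where T: "bounded_linear T" "\<And>X. X \<in> M \<Longrightarrow> \<tau> X = T X" using tr_linear_ext by metis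
  obtain X0 where X0: "X0 \<in> M" "X0 \<noteq> 0" using False mem(2) by blast
  have "compact (M \<inter> sphere 0 1)" using closed_M by (intro closed_Int_compact compact_sphere)
  moreover have "X0 /\<^sub>R norm X0 \<in> M \<inter> sphere 0 1" using X0 by auto
  then have "M \<inter> sphere 0 1 \<noteq> {}" by blast
  moreover have "continuous_on (M \<inter> sphere 0 1) (\<lambda>X. Re (T (adj X ** X)))"
    by (intro continuous_intros bounded_linear.continuous_on[OF T(1)] mm.continuous_on
        bounded_linear.continuous_on[OF bounded_linear_adj])
  ultimately have "\<exists>X\<in>M \<inter> sphere 0 1. \<forall>Y\<in>M \<inter> sphere 0 1. Re (T (adj X ** X)) \<le> Re (T (adj Y ** Y))"
    by (rule continuous_attains_inf)
  then obtain X where X: "X \<in> M" "norm X = 1" "\<And>Y. Y \<in> M \<Longrightarrow> norm Y = 1 \<Longrightarrow> Re (\<tau> (adj X ** X)) \<le> Re (\<tau> (adj Y ** Y))"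
    using T(2) by auto
  have "X \<noteq> 0" using X(2) by auto
  then have pos: "0 < Re (\<tau> (adj X ** X))" using tr_pos[OF X(1)] tr_pos_eq0[OF X(1)] by (metis less_eq_real_def)
  have "Re (\<tau> (adj X ** X)) * (norm Y)\<^sup>2 \<le> Re (\<tau> (adj Y ** Y))" if Y: "Y \<in> M" for Y
  proof (cases "Y = 0")
    case False
    have "Re (\<tau> (adj X ** X)) \<le> Re (\<tau> (adj (Y /\<^sub>R norm Y) ** (Y /\<^sub>R norm Y)))"
      using False Y by (intro X(3)) auto
    also have "\<dots> = Re (\<tau> (adj Y ** Y)) / (norm Y)\<^sup>2"
      using Y by (simp add: adj_scaleR mm.scaleR_left mm.scaleR_right tr_scaleR power2_eq_square divide_inverse)
    finally show ?thesis using False by (simp add: field_simps)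
  qed simp
  then show ?thesis using pos by blast
qed

text \<open>The real part of \<phi> is represented through the real form; testing with
  \<open>cscale \<i> Z\<close> recovers the imaginary part by complex linearity. Uniqueness is
  faithfulness.\<close>

lemma riesz:
  assumes add: "\<And>X Y. X \<in> M \<Longrightarrow> Y \<in> M \<Longrightarrow> \<phi> (X + Y) = \<phi> X + \<phi> Y"
    and scale: "\<And>c X. X \<in> M \<Longrightarrow> \<phi> (cscale c X) = c * \<phi> X"
  shows "\<exists>!X. X \<in> M \<and> (\<forall>Z\<in>M. \<tau> (adj X ** Z) = \<phi> Z)"
proof -
  obtain T where T: "bounded_linear T" "\<And>X. X \<in> M \<Longrightarrow> \<tau> X = T X" using tr_linear_ext by metis
  have "\<phi> (r *\<^sub>R X) = r *\<^sub>R \<phi> X" if "X \<in> M" for r X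
    using scale[OF that, of "complex_of_real r"] by (simp add: cscale_real scaleR_conv_of_real)
  then obtain g where g: "linear g" "\<And>X. X \<in> M \<Longrightarrow> g X = Re (\<phi> X)"
    using linear_extension[OF sub, of "\<lambda>X. Re (\<phi> X)"] add by auto
  have l: "linear (\<lambda>X. Re (T (adj X ** Z)))" for Z
    by (intro bounded_linear.linear bounded_linear_compose[OF bounded_linear_Re]
        bounded_linear_compose[OF T(1)] bounded_linear_compose[OF mm.bounded_linear_left] bounded_linear_adj)
  have r: "linear (\<lambda>Z. Re (T (adj X ** Z)))" for X
    by (intro bounded_linear.linear bounded_linear_compose[OF bounded_linear_Re]
        bounded_linear_compose[OF T(1)] mm.bounded_linear_right)
  have "\<exists>X\<in>M. \<forall>Z\<in>M. Re (T (adj X ** Z)) = g Z"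
  proof (rule riesz_subspace[OF sub l r _ g(1)])
    fix X assume "X \<in> M" "\<And>Z. Z \<in> M \<Longrightarrow> Re (T (adj X ** Z)) = 0"
    then show "X = 0" using tr_pos_eq0[of X] T(2) by auto
  qed
  then obtain X where X: "X \<in> M" "\<And>Z. Z \<in> M \<Longrightarrow> Re (\<tau> (adj X ** Z)) = Re (\<phi> Z)"
    using g(2) T(2) by auto
  have eq: "\<tau> (adj X ** Z) = \<phi> Z" if Z: "Z \<in> M" for Z
  proof -
    have "Im (\<tau> (adj X ** Z)) = Im (\<phi> Z)"
      using X(2)[of "cscale \<i> Z"] X(1) Z by (simp add: cscale_mult_right tr_cscale scale)
    then show ?thesis using X(2)[OF Z] by (simp add: complex_eq_iff)
  qed
  show ?thesis
  proof (rule ex1I[of _ X])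
    fix Y assume Y: "Y \<in> M \<and> (\<forall>Z\<in>M. \<tau> (adj Y ** Z) = \<phi> Z)"
    have "\<tau> (adj (Y - X) ** (Y - X)) = 0"
      using eq[of "Y - X"] Y X(1) by (simp add: adj_diff mm.diff_left tr_diff)
    then show "Y = X" using tr_faithful[of "Y - X"] X(1) Y by simp
  qed (use eq X(1) in blast)
qed

lemma adjoint_map:
  assumes "\<And>X Y. X \<in> M \<Longrightarrow> Y \<in> M \<Longrightarrow> \<tau>' (adj W ** T (X + Y)) = \<tau>' (adj W ** T X) + \<tau>' (adj W ** T Y)"
    and "\<And>c X. X \<in> M \<Longrightarrow> \<tau>' (adj W ** T (cscale c X)) = c * \<tau>' (adj W ** T X)"
  shows "adjoint_map M \<tau> \<tau>' T W \<in> M \<and> (\<forall>Z\<in>M. \<tau> (adj (adjoint_map M \<tau> \<tau>' T W) ** Z) = \<tau>' (adj W ** T Z))"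
  unfolding adjoint_map_def by (rule theI'[OF riesz[OF assms]])

lemma eq_by_trace:
  assumes "X \<in> M" "Y \<in> M" "\<And>Z. Z \<in> M \<Longrightarrow> \<tau> (adj X ** Z) = \<tau> (adj Y ** Z)"
  shows "X = Y"
proof -
  have "\<tau> (adj (X - Y) ** (X - Y)) = 0"
    using assms by (simp add: adj_diff mm.diff_left tr_diff)
  then show ?thesis using tr_faithful[of "X - Y"] assms by simp
qed

end

section \<open>Trace inequalities for pairs of self-adjoint matrices\<close>

locale tracial1 = tracial "mat 1" M \<tau> for M :: "(complex^'n^'n) set" and \<tau>
begin

text \<open>Traces built from two self-adjoint matrices are sums over pairs of eigenvalues with nonnegative
  weights, so inequalities between numbers carry over to traces.\<close>

definition wt :: "complex^'n^'n \<Rightarrow> complex^'n^'n \<Rightarrow> real \<Rightarrow> real \<Rightarrow> real" where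
  "wt X Y a b = Re (\<tau> (eproj X a ** eproj Y b))"

definition mixed :: "complex^'n^'n \<Rightarrow> complex^'n^'n \<Rightarrow> (real \<Rightarrow> real \<Rightarrow> real) \<Rightarrow> real" where
  "mixed X Y h = (\<Sum>a\<in>spec X. \<Sum>b\<in>spec Y. h a b * wt X Y a b)"

lemma ep [simp, intro]: "X \<in> M \<Longrightarrow> adj X = X \<Longrightarrow> eproj X a \<in> M"
  using eproj_mem[OF _ vN] by blast

lemma fc [simp, intro]: "X \<in> M \<Longrightarrow> adj X = X \<Longrightarrow> fcalc f X \<in> M"
  using fcalc_mem[OF _ vN] by blast

context
  fixes X Y assumes X: "X \<in> M" "adj X = X" and Y: "Y \<in> M" "adj Y = Y"
begin

text \<open>By idempotence and cyclicity the weight is the squared trace norm of the product of the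
  two projections.\<close>

lemma wt_nonneg: "0 \<le> wt X Y a b"
proof -
  let ?E = "eproj X a" and ?F = "eproj Y b"
  have "\<tau> (adj (?F ** ?E) ** (?F ** ?E)) = \<tau> (?E ** (?F ** ?E))"
  proof -
    have "adj (?F ** ?E) ** (?F ** ?E) = ?E ** (?F ** ?F ** ?E)"
      using X Y by (simp add: adj_mult adj_eproj matrix_mul_assoc)
    then show ?thesis using Y by (simp add: eproj_mult)
  qed
  also have "\<dots> = \<tau> ((?F ** ?E) ** ?E)" using X Y by (intro tr_cyc) auto
  also have "\<dots> = \<tau> (?F ** ?E)" using X by (simp add: matrix_mul_assoc[symmetric] eproj_mult)
  also have "\<dots> = \<tau> (?E ** ?F)" using X Y by (intro tr_cyc) auto
  finally show ?thesis using tr_pos[of "?F ** ?E"] X Y unfolding wt_def by simp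
qed

lemma mixed_mono:
  assumes "\<And>a b. a \<in> spec X \<Longrightarrow> b \<in> spec Y \<Longrightarrow> h a b \<le> h' a b"
  shows "mixed X Y h \<le> mixed X Y h'"
  unfolding mixed_def by (intro sum_mono mult_right_mono assms wt_nonneg)

lemma mixed_add: "mixed X Y (\<lambda>a b. h a b + h' a b) = mixed X Y h + mixed X Y h'"
  unfolding mixed_def by (simp add: distrib_right sum.distrib)

lemma mixed_diff: "mixed X Y (\<lambda>a b. h a b - h' a b) = mixed X Y h - mixed X Y h'"
  unfolding mixed_def by (simp add: left_diff_distrib sum_subtractf)

lemma mixed_scale: "mixed X Y (\<lambda>a b. c * h a b) = c * mixed X Y h"
  unfolding mixed_def by (simp add: sum_distrib_left mult.assoc)

lemma mixed_trace: "Re (\<tau> (fcalc f X ** fcalc g Y)) = mixed X Y (\<lambda>a b. f a * g b)"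
proof -
  have "fcalc f X ** fcalc g Y = (\<Sum>a\<in>spec X. \<Sum>b\<in>spec Y. (f a * g b) *\<^sub>R (eproj X a ** eproj Y b))"
    by (simp add: fcalc_eq mm.sum_left mm.sum_right mm.scaleR_left mm.scaleR_right scaleR_sum_right mult.commute)
      (rule sum.swap)
  also have "\<tau> \<dots> = (\<Sum>a\<in>spec X. \<Sum>b\<in>spec Y. (f a * g b) *\<^sub>R \<tau> (eproj X a ** eproj Y b))"
    using X Y by (simp add: tr_sum tr_scaleR)
  finally show ?thesis unfolding mixed_def wt_def by simp
qed

lemma mixed_left: "Re (\<tau> (fcalc f X)) = mixed X Y (\<lambda>a b. f a)"
  using mixed_trace[of f "\<lambda>_. 1"] Y by (simp add: fcalc_one)

lemma mixed_right: "Re (\<tau> (fcalc g Y)) = mixed X Y (\<lambda>a b. g b)"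
  using mixed_trace[of "\<lambda>_. 1" g] X by (simp add: fcalc_one)

lemma mixed_square:
  "Re (\<tau> ((fcalc f X - fcalc g Y) ** (fcalc f X - fcalc g Y))) = mixed X Y (\<lambda>a b. (f a - g b)\<^sup>2)"
proof -
  have "(fcalc f X - fcalc g Y) ** (fcalc f X - fcalc g Y) =
     fcalc (\<lambda>a. f a * f a) X - fcalc f X ** fcalc g Y - fcalc g Y ** fcalc f X + fcalc (\<lambda>b. g b * g b) Y"
    using X Y by (simp add: mm.diff_left mm.diff_right fcalc_mult algebra_simps)
  then have "Re (\<tau> ((fcalc f X - fcalc g Y) ** (fcalc f X - fcalc g Y))) =
      Re (\<tau> (fcalc (\<lambda>a. f a * f a) X)) - 2 * Re (\<tau> (fcalc f X ** fcalc g Y)) + Re (\<tau> (fcalc (\<lambda>b. g b * g b) Y))"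
    using X Y tr_cyc[of "fcalc f X" "fcalc g Y"] by (simp add: tr_add tr_diff)
  also have "\<dots> = mixed X Y (\<lambda>a b. f a * f a - 2 * (f a * g b) + g b * g b)"
    unfolding mixed_left mixed_right mixed_trace mixed_add mixed_diff mixed_scale ..
  finally show ?thesis by (simp add: power2_eq_square algebra_simps)
qed

text \<open>Klein's inequality: a scalar bound on the remainder of a tangent, summed against the
  nonnegative weights. The term with \<open>k\<close> records strong convexity.\<close>

lemma klein:
  assumes "\<And>a b. a \<in> spec X \<Longrightarrow> b \<in> spec Y \<Longrightarrow> k * (a - b)\<^sup>2 \<le> f b - f a - f' a * (b - a)"
  shows "Re (\<tau> (fcalc f' X ** (Y - X))) + k * Re (\<tau> ((X - Y) ** (X - Y))) \<le> Re (\<tau> (fcalc f Y)) - Re (\<tau> (fcalc f X))"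
proof -
  have "fcalc f' X ** (Y - X) = fcalc f' X ** fcalc (\<lambda>b. b) Y - fcalc (\<lambda>a. f' a * a) X"
    using X Y fcalc_mult[OF X(2), of f' "\<lambda>a. a"] by (simp add: mm.diff_right fcalc_id)
  then have "Re (\<tau> (fcalc f' X ** (Y - X))) = mixed X Y (\<lambda>a b. f' a * b - f' a * a)"
    using X Y by (simp add: tr_diff mixed_trace mixed_left mixed_diff)
  moreover have "Re (\<tau> ((X - Y) ** (X - Y))) = mixed X Y (\<lambda>a b. (a - b)\<^sup>2)"
    using mixed_square[of "\<lambda>a. a" "\<lambda>a. a"] X Y by (simp add: fcalc_id)
  ultimately have "Re (\<tau> (fcalc f' X ** (Y - X))) + k * Re (\<tau> ((X - Y) ** (X - Y)))
      = mixed X Y (\<lambda>a b. (f' a * b - f' a * a) + k * (a - b)\<^sup>2)"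
    by (simp add: mixed_add mixed_scale)
  also have "\<dots> \<le> mixed X Y (\<lambda>a b. f b - f a)"
    by (rule mixed_mono) (use assms in \<open>simp add: algebra_simps\<close>)
  finally show ?thesis by (simp add: mixed_diff mixed_left mixed_right)
qed

text \<open>In the Hilbert-Schmidt norm of the trace the scalar Lipschitz constant survives without
  loss, since both sides are sums of squares over the same weights.\<close>

lemma fcalc_lipschitz:
  assumes "\<And>a b. a \<in> spec X \<Longrightarrow> b \<in> spec Y \<Longrightarrow> \<bar>f a - f b\<bar> \<le> L * \<bar>a - b\<bar>"
  shows "Re (\<tau> ((fcalc f X - fcalc f Y) ** (fcalc f X - fcalc f Y))) \<le> L\<^sup>2 * Re (\<tau> ((X - Y) ** (X - Y)))"
proof -
  have "Re (\<tau> ((fcalc f X - fcalc f Y) ** (fcalc f X - fcalc f Y))) \<le> mixed X Y (\<lambda>a b. L\<^sup>2 * (a - b)\<^sup>2)"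
    unfolding mixed_square
  proof (rule mixed_mono)
    fix a b assume "a \<in> spec X" "b \<in> spec Y"
    from power_mono[OF assms[OF this], of 2] show "(f a - f b)\<^sup>2 \<le> L\<^sup>2 * (a - b)\<^sup>2"
      by (simp add: power_mult_distrib)
  qed
  also have "\<dots> = L\<^sup>2 * Re (\<tau> ((X - Y) ** (X - Y)))"
    using mixed_square[of "\<lambda>a. a" "\<lambda>a. a"] X Y by (simp add: fcalc_id mixed_scale)
  finally show ?thesis .
qed

end

end

section \<open>Differential structures\<close>

lemma pos_defI_spec:
  fixes X :: "complex^'n^'n"
  assumes "adj X = X" "\<And>a. a \<in> spec X \<Longrightarrow> 0 < a"
  shows "pos_def X"
  unfolding pos_def_def
proof (intro conjI allI impI)
  fix v :: "complex^'n" assume v: "v \<noteq> 0"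
  have eq: "Re (qform X v) = (\<Sum>a\<in>spec X. a * (norm (eproj X a *v v))\<^sup>2)"
    using inner_fcalc[OF assms(1), of v "\<lambda>a. a"] by (simp add: qform_inner fcalc_id[OF assms(1)])
  have "\<exists>a\<in>spec X. eproj X a *v v \<noteq> 0"
  proof (rule ccontr)
    assume "\<not> ?thesis"
    then have "(norm v)\<^sup>2 = 0" using norm_eproj_sum[OF assms(1), of v] by simp
    then show False using v by simp
  qed
  then show "0 < Re (qform X v)" unfolding eq
    using assms finite_spec[OF assms(1)]
    by (metis (no_types, lifting) less_eq_real_def mult_nonneg_nonneg mult_pos_pos sum_pos2 zero_le_power2 zero_less_norm_iff zero_less_power)
qed (use assms in auto)

lemma log_mean_ln:
  assumes "0 < x" "0 < y"
  shows "log_mean x y * (ln x - ln y) = x - y"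
proof (cases "x = y")
  case False
  then have "ln x - ln y \<noteq> 0" using assms by simp
  then show ?thesis unfolding log_mean_def using False assms by simp
qed (simp add: log_mean_def)

locale dstruct =
  fixes D :: "('n::finite, 'm::finite, 'j) diff_struct"
  assumes ds: "differential_structure D"
begin

sublocale A: tracial1 "alg D" "tr D"
  using ds unfolding differential_structure_def by unfold_locales auto

lemma fin_idx: "finite (idx D)"
  using ds unfolding differential_structure_def by auto

lemma dens [simp, intro]: "dens D \<in> alg D" "adj (dens D) = dens D" "tr D (dens D) = 1"
  using ds unfolding differential_structure_def pos_semidef_def by auto

lemma spec_dens: "a \<in> spec (dens D) \<Longrightarrow> 0 < a"
proof -
  assume a: "a \<in> spec (dens D)"
  have "0 \<le> a" using spec_nonneg[OF _ a] ds unfolding differential_structure_def by auto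
  moreover have "a \<noteq> 0"
  proof
    assume "a = 0"
    then obtain v where v: "v \<noteq> 0" "dens D *v v = 0" using a unfolding spec_eq by auto
    have "invertible (dens D)" using ds unfolding differential_structure_def by auto
    then obtain Y where "Y ** dens D = mat 1" unfolding invertible_def by blast
    then have "v = Y *v (dens D *v v)" by (simp add: matrix_vector_mul_assoc)
    then show False using v by simp
  qed
  ultimately show "0 < a" by simp
qed

lemma pos_def_dens: "pos_def (dens D)"
  by (rule pos_defI_spec) (auto intro: spec_dens)

lemma dens_pos_states: "dens D \<in> pos_states D"
  unfolding pos_states_def using pos_def_dens by auto

text \<open>Condition (3) says that passing to the dual index swaps the arguments of this form.\<close>

definition cform :: "'j \<Rightarrow> complex^'n^'n \<Rightarrow> complex^'n^'n \<Rightarrow> complex" where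
  "cform j X Y = btr D j (adj (vee D j) ** lhom D j X ** vee D j ** rhom D j Y)"

definition dop :: "'j \<Rightarrow> complex^'n^'n \<Rightarrow> (real \<Rightarrow> real \<Rightarrow> real) \<Rightarrow> complex^'m^'m \<Rightarrow> complex^'m^'m" where
  "dop j \<rho> h C = (\<Sum>a\<in>spec \<rho>. \<Sum>b\<in>spec \<rho>. h a b *\<^sub>R (lhom D j (eproj \<rho> a) ** C ** rhom D j (eproj \<rho> b)))"

lemma hat_mult_dop: "hat_mult D \<rho> j C = dop j \<rho> (theta D j) C"
  unfolding hat_mult_def dop_def cscale_real ..

text \<open>The value of the hat multiplication on the derivative of log \<rho> - log \<sigma>,
  freed of logarithms. It is linear in \<rho>.\<close>

definition Qop :: "'j \<Rightarrow> complex^'n^'n \<Rightarrow> complex^'m^'m" where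
  "Qop j \<rho> = exp (- freq D j / 2) *\<^sub>R (vee D j ** rhom D j \<rho>) - exp (freq D j / 2) *\<^sub>R (lhom D j \<rho> ** vee D j)"

end

locale dstruct_j = dstruct D for D :: "('n::finite, 'm::finite, 'j) diff_struct" +
  fixes j :: 'j
  assumes j: "j \<in> idx D"
begin

abbreviation "l \<equiv> lhom D j"
abbreviation "r \<equiv> rhom D j"
abbreviation "V \<equiv> vee D j"
abbreviation "d \<equiv> pderiv_op D j"
abbreviation "d' \<equiv> pderiv_adj D j"
abbreviation "B \<equiv> balg D j"

sublocale B: tracial "bunit D j" "balg D j" "btr D j"
  using ds j unfolding differential_structure_def by unfold_locales auto

lemma V [simp, intro]: "V \<in> B" "V \<noteq> 0"
  using ds j unfolding differential_structure_def by auto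

lemma hom: "star_hom (mat 1) (alg D) (bunit D j) B l" "star_hom (mat 1) (alg D) (bunit D j) B r"
  using ds j unfolding differential_structure_def by auto

lemma l: "X \<in> alg D \<Longrightarrow> l X \<in> B" "X \<in> alg D \<Longrightarrow> Y \<in> alg D \<Longrightarrow> l (X + Y) = l X + l Y"
  "X \<in> alg D \<Longrightarrow> l (cscale c X) = cscale c (l X)" "X \<in> alg D \<Longrightarrow> Y \<in> alg D \<Longrightarrow> l (X ** Y) = l X ** l Y"
  "X \<in> alg D \<Longrightarrow> l (adj X) = adj (l X)" "l (mat 1) = bunit D j"
  using hom(1) unfolding star_hom_def by auto

lemma r: "X \<in> alg D \<Longrightarrow> r X \<in> B" "X \<in> alg D \<Longrightarrow> Y \<in> alg D \<Longrightarrow> r (X + Y) = r X + r Y"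
  "X \<in> alg D \<Longrightarrow> r (cscale c X) = cscale c (r X)" "X \<in> alg D \<Longrightarrow> Y \<in> alg D \<Longrightarrow> r (X ** Y) = r X ** r Y"
  "X \<in> alg D \<Longrightarrow> r (adj X) = adj (r X)" "r (mat 1) = bunit D j"
  using hom(2) unfolding star_hom_def by auto

lemmas l_mem [simp, intro] = l(1)
lemmas r_mem [simp, intro] = r(1)

lemma l_scaleR: "X \<in> alg D \<Longrightarrow> l (c *\<^sub>R X) = c *\<^sub>R l X" and r_scaleR: "X \<in> alg D \<Longrightarrow> r (c *\<^sub>R X) = c *\<^sub>R r X"
  using l(3)[of X "complex_of_real c"] r(3)[of X "complex_of_real c"] by (simp_all add: cscale_real)

lemma l_zero [simp]: "l 0 = 0" and r_zero [simp]: "r 0 = 0"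
  using l_scaleR[of 0 0] r_scaleR[of 0 0] by simp_all

lemma r_diff: "X \<in> alg D \<Longrightarrow> Y \<in> alg D \<Longrightarrow> r (X - Y) = r X - r Y"
  using r(2)[of "X - Y" Y] by simp

lemma l_sum: "(\<And>i. i \<in> S \<Longrightarrow> f i \<in> alg D) \<Longrightarrow> l (sum f S) = (\<Sum>i\<in>S. l (f i))"
  by (induction S rule: infinite_finite_induct) (auto simp: l(2))

lemma r_sum: "(\<And>i. i \<in> S \<Longrightarrow> f i \<in> alg D) \<Longrightarrow> r (sum f S) = (\<Sum>i\<in>S. r (f i))"
  by (induction S rule: infinite_finite_induct) (auto simp: r(2))

lemma d_mem [simp, intro]: "X \<in> alg D \<Longrightarrow> d X \<in> B"
  unfolding pderiv_op_def by auto

lemma d_add: "X \<in> alg D \<Longrightarrow> Y \<in> alg D \<Longrightarrow> d (X + Y) = d X + d Y"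
  unfolding pderiv_op_def by (simp add: l r mm.add_left mm.add_right)

lemma d_cscale: "X \<in> alg D \<Longrightarrow> d (cscale c X) = cscale c (d X)"
  unfolding pderiv_op_def by (simp add: l r cscale_mult_left cscale_mult_right)
    (simp add: cscale_def vec_eq_iff algebra_simps)

lemma d_scaleR: "X \<in> alg D \<Longrightarrow> d (c *\<^sub>R X) = c *\<^sub>R d X"
  using d_cscale[of X "complex_of_real c"] by (simp add: cscale_real)

lemma d_diff: "X \<in> alg D \<Longrightarrow> Y \<in> alg D \<Longrightarrow> d (X - Y) = d X - d Y"
  using d_add[of "X - Y" Y] by simp

lemma d_one: "d (mat 1) = 0"
  unfolding pderiv_op_def by (simp add: l r B.unit)

lemma d': 
  assumes "Y \<in> B"
  shows "d' Y \<in> alg D" "Z \<in> alg D \<Longrightarrow> tr D (adj (d' Y) ** Z) = btr D j (adj Y ** d Z)"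
proof -
  have "adjoint_map (alg D) (tr D) (btr D j) d Y \<in> alg D \<and>
     (\<forall>Z\<in>alg D. tr D (adj (adjoint_map (alg D) (tr D) (btr D j) d Y) ** Z) = btr D j (adj Y ** d Z))"
    using assms by (intro A.adjoint_map) (auto simp: d_add d_cscale mm.add_right cscale_mult_right B.tr_add B.tr_cscale)
  then show "d' Y \<in> alg D" "Z \<in> alg D \<Longrightarrow> tr D (adj (d' Y) ** Z) = btr D j (adj Y ** d Z)"
    unfolding pderiv_adj_def by auto
qed

lemmas d'_mem [simp, intro] = d'(1)

lemma d'_add: "Y \<in> B \<Longrightarrow> W \<in> B \<Longrightarrow> d' (Y + W) = d' Y + d' W"
  by (rule A.eq_by_trace) (auto simp: d' adj_add mm.add_left A.tr_add B.tr_add)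

lemma d'_cscale: "Y \<in> B \<Longrightarrow> d' (cscale c Y) = cscale c (d' Y)"
  by (rule A.eq_by_trace) (auto simp: d' adj_cscale cscale_mult_left A.tr_cscale B.tr_cscale)

lemma d'_scaleR: "Y \<in> B \<Longrightarrow> d' (c *\<^sub>R Y) = c *\<^sub>R d' Y"
  using d'_cscale[of Y "complex_of_real c"] by (simp add: cscale_real)

context
  fixes \<rho> assumes \<rho>: "\<rho> \<in> alg D" "adj \<rho> = \<rho>"
begin

lemma ep_mult:
  "l (eproj \<rho> a) ** l (eproj \<rho> b) = (if a = b then l (eproj \<rho> a) else 0)"
  "r (eproj \<rho> a) ** r (eproj \<rho> b) = (if a = b then r (eproj \<rho> a) else 0)"
  using \<rho> eproj_mult[OF \<rho>(2), of a b] by (auto simp flip: l(4) r(4))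

lemma ep_adj: "adj (l (eproj \<rho> a)) = l (eproj \<rho> a)" "adj (r (eproj \<rho> a)) = r (eproj \<rho> a)"
  using \<rho> adj_eproj[OF \<rho>(2), of a] by (auto simp flip: l(5) r(5))

lemma dop_mem [simp, intro]: "C \<in> B \<Longrightarrow> dop j \<rho> h C \<in> B"
  unfolding dop_def using \<rho> by auto

lemma dop_block:
  assumes "C \<in> B" "a \<in> spec \<rho>" "b \<in> spec \<rho>"
  shows "l (eproj \<rho> a) ** dop j \<rho> h C ** r (eproj \<rho> b) = h a b *\<^sub>R (l (eproj \<rho> a) ** C ** r (eproj \<rho> b))"
proof -
  have "l (eproj \<rho> a) ** dop j \<rho> h C ** r (eproj \<rho> b) =
    (\<Sum>a'\<in>spec \<rho>. \<Sum>b'\<in>spec \<rho>. h a' b' *\<^sub>R ((l (eproj \<rho> a) ** l (eproj \<rho> a')) ** C ** (r (eproj \<rho> b') ** r (eproj \<rho> b))))"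
    unfolding dop_def
    by (simp add: mm.sum_left mm.sum_right mm.scaleR_left mm.scaleR_right matrix_mul_assoc)
  also have "\<dots> = (\<Sum>a'\<in>spec \<rho>. \<Sum>b'\<in>spec \<rho>. if a' = a then if b' = b then h a b *\<^sub>R (l (eproj \<rho> a) ** C ** r (eproj \<rho> b)) else 0 else 0)"
    unfolding ep_mult by (intro sum.cong refl) auto
  also have "\<dots> = (\<Sum>a'\<in>spec \<rho>. if a' = a then (\<Sum>b'\<in>spec \<rho>. if b' = b then h a b *\<^sub>R (l (eproj \<rho> a) ** C ** r (eproj \<rho> b)) else 0) else 0)"
    by (intro sum.cong refl) auto
  finally show ?thesis using assms finite_spec[OF \<rho>(2)] by simp
qed

lemma dop_dop:
  assumes "C \<in> B"
  shows "dop j \<rho> g (dop j \<rho> h C) = dop j \<rho> (\<lambda>a b. g a b * h a b) C"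
  unfolding dop_def[of j \<rho> g] dop_def[of j \<rho> "\<lambda>a b. g a b * h a b"]
  by (intro sum.cong refl) (simp add: dop_block[OF assms])

lemma l_fcalc: "l (fcalc f \<rho>) = (\<Sum>a\<in>spec \<rho>. f a *\<^sub>R l (eproj \<rho> a))"
  using \<rho> unfolding fcalc_eq by (simp add: l_sum l_scaleR)

lemma r_fcalc: "r (fcalc f \<rho>) = (\<Sum>a\<in>spec \<rho>. f a *\<^sub>R r (eproj \<rho> a))"
  using \<rho> unfolding fcalc_eq by (simp add: r_sum r_scaleR)

lemma dop_fcalc: "dop j \<rho> (\<lambda>a b. f a * g b) C = l (fcalc f \<rho>) ** C ** r (fcalc g \<rho>)"
  unfolding dop_def l_fcalc r_fcalc
  by (subst sum.swap) (simp add: mm.sum_left mm.sum_right mm.scaleR_left mm.scaleR_right scaleR_sum_right mult.commute)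

lemma dop_left: "C \<in> B \<Longrightarrow> dop j \<rho> (\<lambda>a b. f a) C = l (fcalc f \<rho>) ** C"
  using dop_fcalc[of f "\<lambda>_. 1" C] \<rho> by (simp add: fcalc_one r B.unit)

lemma dop_right: "C \<in> B \<Longrightarrow> dop j \<rho> (\<lambda>a b. g b) C = C ** r (fcalc g \<rho>)"
  using dop_fcalc[of "\<lambda>_. 1" g C] \<rho> by (simp add: fcalc_one l B.unit)

lemma dop_one: "C \<in> B \<Longrightarrow> dop j \<rho> (\<lambda>a b. c) C = c *\<^sub>R C"
  using dop_left[of C "\<lambda>_. c"] dop_left[of C "\<lambda>_. 1"] \<rho>
  by (simp add: dop_def fcalc_one l B.unit scaleR_sum_right[symmetric] flip: scaleR_sum_right)

lemma dop_add: "dop j \<rho> (\<lambda>a b. g a b + h a b) C = dop j \<rho> g C + dop j \<rho> h C"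
  unfolding dop_def by (simp add: scaleR_add_left sum.distrib)

lemma dop_diff: "dop j \<rho> (\<lambda>a b. g a b - h a b) C = dop j \<rho> g C - dop j \<rho> h C"
  unfolding dop_def by (simp add: scaleR_diff_left sum_subtractf)

lemma dop_scale: "dop j \<rho> (\<lambda>a b. c * h a b) C = c *\<^sub>R dop j \<rho> h C"
  unfolding dop_def by (simp add: scaleR_sum_right)

lemma dop_cong: "(\<And>a b. a \<in> spec \<rho> \<Longrightarrow> b \<in> spec \<rho> \<Longrightarrow> g a b = h a b) \<Longrightarrow> dop j \<rho> g C = dop j \<rho> h C"
  unfolding dop_def by (intro sum.cong refl) simp

text \<open>Cyclicity and idempotence turn each summand into the squared trace norm of one block of
  \<open>C\<close>, so bounds on the symbol become bounds on the form.\<close>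

lemma dop_trace:
  assumes C: "C \<in> B"
  shows "btr D j (adj C ** dop j \<rho> h C) = (\<Sum>a\<in>spec \<rho>. \<Sum>b\<in>spec \<rho>. h a b *\<^sub>R
     btr D j (adj (l (eproj \<rho> a) ** C ** r (eproj \<rho> b)) ** (l (eproj \<rho> a) ** C ** r (eproj \<rho> b))))"
proof -
  have blk: "btr D j (adj (l (eproj \<rho> a) ** C ** r (eproj \<rho> b)) ** (l (eproj \<rho> a) ** C ** r (eproj \<rho> b)))
      = btr D j (adj C ** (l (eproj \<rho> a) ** C ** r (eproj \<rho> b)))" for a b
  proof -
    let ?E = "l (eproj \<rho> a)" and ?F = "r (eproj \<rho> b)"
    have "adj (?E ** C ** ?F) ** (?E ** C ** ?F) = ?F ** (adj C ** (?E ** ?E) ** C ** ?F)"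
      by (simp add: adj_mult ep_adj matrix_mul_assoc)
    also have "\<dots> = ?F ** (adj C ** ?E ** C ** ?F)" by (simp add: ep_mult)
    also have "btr D j \<dots> = btr D j ((adj C ** ?E ** C ** ?F) ** ?F)"
      using \<rho> C by (intro B.tr_cyc) auto
    also have "(adj C ** ?E ** C ** ?F) ** ?F = adj C ** (?E ** C ** ?F)"
      by (simp add: matrix_mul_assoc[symmetric] ep_mult)
    finally show ?thesis .
  qed
  have "adj C ** dop j \<rho> h C = (\<Sum>a\<in>spec \<rho>. \<Sum>b\<in>spec \<rho>. h a b *\<^sub>R (adj C ** (l (eproj \<rho> a) ** C ** r (eproj \<rho> b))))"
    unfolding dop_def by (simp add: mm.sum_right mm.scaleR_right)
  then show ?thesis unfolding blk using \<rho> C by (simp add: B.tr_sum B.tr_scaleR)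
qed

lemma dop_lower:
  assumes "C \<in> B" "\<And>a b. a \<in> spec \<rho> \<Longrightarrow> b \<in> spec \<rho> \<Longrightarrow> k \<le> h a b"
  shows "k * Re (btr D j (adj C ** C)) \<le> Re (btr D j (adj C ** dop j \<rho> h C))"
proof -
  let ?w = "\<lambda>a b. Re (btr D j (adj (l (eproj \<rho> a) ** C ** r (eproj \<rho> b)) ** (l (eproj \<rho> a) ** C ** r (eproj \<rho> b))))"
  have t: "Re (btr D j (adj C ** dop j \<rho> h C)) = (\<Sum>a\<in>spec \<rho>. \<Sum>b\<in>spec \<rho>. h a b * ?w a b)" for h
    by (simp add: dop_trace[OF assms(1)])
  have w: "0 \<le> ?w a b" for a b using \<rho> assms(1) by (intro B.tr_pos) auto
  have "k * Re (btr D j (adj C ** C)) = Re (btr D j (adj C ** dop j \<rho> (\<lambda>a b. k) C))"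
    using assms(1) by (simp add: dop_one mm.scaleR_right B.tr_scaleR)
  also have "\<dots> \<le> Re (btr D j (adj C ** dop j \<rho> h C))"
    unfolding t using w by (intro sum_mono mult_right_mono assms(2))
  finally show ?thesis .
qed

end

text \<open>Reduces a pairing of two derivatives to four values of \<open>cform\<close>, the form in
  which condition (3) allows left and right to be exchanged.\<close>

lemma cform_expand:
  assumes "E \<in> alg D" "F \<in> alg D" "X \<in> alg D" "Z \<in> alg D"
  shows "btr D j (adj (d Z) ** (l E ** d X ** r F)) =
    cform j E (X ** F ** adj Z) - cform j (E ** X) (F ** adj Z) - cform j (adj Z ** E) (X ** F) + cform j (adj Z ** E ** X) F"
proof -
  have 1: "btr D j (r (adj Z) ** (adj V ** l E ** V ** r G)) = cform j E (G ** adj Z)"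
    if "E \<in> alg D" "G \<in> alg D" for E G
    using that assms B.tr_cyc[of "r (adj Z)" "adj V ** l E ** V ** r G"]
    by (simp add: cform_def r matrix_mul_assoc)
  have "adj (d Z) = r (adj Z) ** adj V - adj V ** l (adj Z)"
    using assms unfolding pderiv_op_def by (simp add: adj_diff adj_mult l r)
  moreover have "l E ** d X ** r F = l E ** V ** r (X ** F) - l (E ** X) ** V ** r F"
    using assms unfolding pderiv_op_def by (simp add: mm.diff_left mm.diff_right l r matrix_mul_assoc)
  ultimately have "adj (d Z) ** (l E ** d X ** r F) =
     r (adj Z) ** (adj V ** l E ** V ** r (X ** F)) - r (adj Z) ** (adj V ** l (E ** X) ** V ** r F)
     - adj V ** l (adj Z ** E) ** V ** r (X ** F) + adj V ** l (adj Z ** E ** X) ** V ** r F"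
    using assms by (simp add: mm.diff_left mm.diff_right l r matrix_mul_assoc)
  then have "btr D j (adj (d Z) ** (l E ** d X ** r F)) =
     btr D j (r (adj Z) ** (adj V ** l E ** V ** r (X ** F))) - btr D j (r (adj Z) ** (adj V ** l (E ** X) ** V ** r F))
     - btr D j (adj V ** l (adj Z ** E) ** V ** r (X ** F)) + btr D j (adj V ** l (adj Z ** E ** X) ** V ** r F)"
    using assms by (simp add: B.tr_add B.tr_diff)
  then show ?thesis using assms by (simp add: 1 cform_def)
qed

lemma cform_cnj:
  assumes "X \<in> alg D" "Y \<in> alg D"
  shows "cnj (cform j X Y) = cform j (adj X) (adj Y)"
proof -
  have "cnj (cform j X Y) = btr D j (adj (adj V ** l X ** V ** r Y))"
    using assms unfolding cform_def by (subst B.tr_adj) auto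
  also have "adj (adj V ** l X ** V ** r Y) = r (adj Y) ** (adj V ** l (adj X) ** V)"
    using assms by (simp add: adj_mult l r matrix_mul_assoc)
  also have "btr D j \<dots> = cform j (adj X) (adj Y)"
    using assms B.tr_cyc[of "r (adj Y)" "adj V ** l (adj X) ** V"] unfolding cform_def by simp
  finally show ?thesis .
qed

text \<open>Condition (4) without the inverse. The inverse in \<open>B\<close> is the image under
  \<open>r\<close> of the functional calculus inverse, which exists because the spectrum of the
  density is positive.\<close>

lemma dens_V: "l (dens D) ** V = exp (- freq D j) *\<^sub>R (V ** r (dens D))"
proof -
  define Y where "Y = r (fcalc inverse (dens D))"
  have Yi: "dens D ** fcalc inverse (dens D) = mat 1" "fcalc inverse (dens D) ** dens D = mat 1"
  proof -
    have "fcalc (\<lambda>a. a * inverse a) (dens D) = fcalc (\<lambda>a. 1) (dens D)"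
      "fcalc (\<lambda>a. inverse a * a) (dens D) = fcalc (\<lambda>a. 1) (dens D)"
      using spec_dens by (auto intro!: fcalc_cong simp: less_imp_neq[symmetric])
    then show "dens D ** fcalc inverse (dens D) = mat 1" "fcalc inverse (dens D) ** dens D = mat 1"
      using fcalc_mult[of "dens D" "\<lambda>a. a" inverse] fcalc_mult[of "dens D" inverse "\<lambda>a. a"]
      by (simp_all add: fcalc_id fcalc_one)
  qed
  have Y: "Y \<in> B" "r (dens D) ** Y = bunit D j" "Y ** r (dens D) = bunit D j"
    unfolding Y_def using Yi by (auto simp: r(6) simp flip: r(4))
  have "inv_in (bunit D j) B (r (dens D)) = Y"
    unfolding inv_in_def
  proof (rule the_equality)
    fix W assume W: "W \<in> B \<and> r (dens D) ** W = bunit D j \<and> W ** r (dens D) = bunit D j"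
    then have "W = W ** (r (dens D) ** Y)" using Y by (simp add: B.unit)
    also have "\<dots> = (W ** r (dens D)) ** Y" by (rule matrix_mul_assoc)
    also have "\<dots> = Y" using W Y by (simp add: B.unit)
    finally show "W = Y" .
  qed (use Y in auto)
  then have "l (dens D) ** V ** Y = exp (- freq D j) *\<^sub>R V"
    using ds j unfolding differential_structure_def by (auto simp: cscale_real)
  then have "l (dens D) ** V ** (Y ** r (dens D)) = exp (- freq D j) *\<^sub>R (V ** r (dens D))"
    by (metis matrix_mul_assoc mm.scaleR_left)
  then show ?thesis using Y by (simp add: B.unit)
qed

text \<open>The multiplier with symbol a - exp (- \<omega>) b annihilates \<open>V\<close>, so
  \<open>V\<close> links only eigenvalues of the density in the ratio exp (- \<omega>). On
  \<open>V\<close>, a function of the left eigenvalue is therefore a function of the right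
  one.\<close>

lemma dens_block:
  assumes "a \<in> spec (dens D)" "b \<in> spec (dens D)" "a \<noteq> exp (- freq D j) * b"
  shows "l (eproj (dens D) a) ** V ** r (eproj (dens D) b) = 0"
proof -
  have "dop j (dens D) (\<lambda>a b. a - exp (- freq D j) * b) V = 0"
    using dens_V dop_left[of "dens D" V "\<lambda>a. a"] dop_right[of "dens D" V "\<lambda>a. a"]
    by (simp add: dop_diff dop_scale fcalc_id)
  with dop_block[OF _ _ V(1) assms(1,2), of "\<lambda>a b. a - exp (- freq D j) * b"]
  have "(a - exp (- freq D j) * b) *\<^sub>R (l (eproj (dens D) a) ** V ** r (eproj (dens D) b)) = 0"
    by simp
  then show ?thesis using assms(3) by simp
qed

lemma dens_fcalc:
  "l (fcalc f (dens D)) ** V = V ** r (fcalc (\<lambda>b. f (exp (- freq D j) * b)) (dens D))"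
proof -
  have "dop j (dens D) (\<lambda>a b. f a) V = dop j (dens D) (\<lambda>a b. f (exp (- freq D j) * b)) V"
    unfolding dop_def
  proof (intro sum.cong refl)
    fix a b assume "a \<in> spec (dens D)" "b \<in> spec (dens D)"
    from dens_block[OF this] show "f a *\<^sub>R (l (eproj (dens D) a) ** V ** r (eproj (dens D) b)) =
        f (exp (- freq D j) * b) *\<^sub>R (l (eproj (dens D) a) ** V ** r (eproj (dens D) b))"
      by (cases "a = exp (- freq D j) * b") auto
  qed
  then show ?thesis by (simp add: dop_left dop_right)
qed

lemma dens_sqrt: "l (sqrt_dens D) ** V = exp (- freq D j / 2) *\<^sub>R (V ** r (sqrt_dens D))"
proof -
  have "exp (- freq D j) = (exp (- freq D j / 2))\<^sup>2" by (simp add: power2_eq_square flip: exp_add)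
  then have "sqrt (exp (- freq D j) * b) = exp (- freq D j / 2) * sqrt b" for b
    by (simp add: real_sqrt_mult)
  then have "fcalc (\<lambda>b. sqrt (exp (- freq D j) * b)) (dens D) = exp (- freq D j / 2) *\<^sub>R sqrt_dens D"
    unfolding sqrt_dens_def fcalc_eq by (simp add: scaleR_sum_right)
  then show ?thesis
    using dens_fcalc[of sqrt] unfolding sqrt_dens_def by (simp add: r_scaleR mm.scaleR_right)
qed

lemma d_log_dens: "d (fcalc ln (dens D)) = freq D j *\<^sub>R V"
proof -
  have "fcalc (\<lambda>b. ln (exp (- freq D j) * b)) (dens D) = fcalc (\<lambda>b. ln b - freq D j) (dens D)"
    using spec_dens by (intro fcalc_cong) (auto simp: ln_mult)
  also have "\<dots> = fcalc ln (dens D) - freq D j *\<^sub>R fcalc (\<lambda>b. 1) (dens D)"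
    unfolding fcalc_eq by (simp add: scaleR_diff_left sum_subtractf scaleR_sum_right)
  finally show ?thesis
    using dens_fcalc[of ln] unfolding pderiv_op_def
    by (simp add: fcalc_one r_diff r_scaleR r B.unit mm.diff_right mm.scaleR_right)
qed

text \<open>The logarithmic mean is chosen so that the twisted chain rule removes the logarithm.\<close>

lemma hat_d_log:
  assumes \<rho>: "\<rho> \<in> pos_states D"
  shows "dop j \<rho> (theta D j) (d (fcalc ln \<rho> - fcalc ln (dens D))) = Qop j \<rho>"
proof -
  have r1: "\<rho> \<in> alg D" "adj \<rho> = \<rho>" and pos: "\<And>a. a \<in> spec \<rho> \<Longrightarrow> 0 < a"
    using \<rho> spec_pos unfolding pos_states_def pos_def_def by auto
  let ?w = "freq D j"
  have "d (fcalc ln \<rho> - fcalc ln (dens D)) = V ** r (fcalc ln \<rho>) - l (fcalc ln \<rho>) ** V - ?w *\<^sub>R V"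
    using r1 by (simp add: d_diff d_log_dens) (simp add: pderiv_op_def)
  also have "\<dots> = dop j \<rho> (\<lambda>a b. ln b - ln a - ?w) V"
    by (simp only: dop_diff[OF r1] dop_one[OF r1 V(1)] dop_left[OF r1 V(1)] dop_right[OF r1 V(1)])
  finally have "dop j \<rho> (theta D j) (d (fcalc ln \<rho> - fcalc ln (dens D))) =
      dop j \<rho> (\<lambda>a b. theta D j a b * (ln b - ln a - ?w)) V"
    by (simp add: dop_dop[OF r1])
  also have "\<dots> = dop j \<rho> (\<lambda>a b. exp (- ?w / 2) * b - exp (?w / 2) * a) V"
  proof (rule dop_cong[OF r1])
    fix a b assume "a \<in> spec \<rho>" "b \<in> spec \<rho>"
    then have ab: "0 < a" "0 < b" using pos by auto
    let ?x = "exp (?w / 2) * a" and ?y = "exp (- ?w / 2) * b"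
    have "ln ?x = ?w / 2 + ln a" "ln ?y = - ?w / 2 + ln b" using ab by (auto simp: ln_mult)
    \<comment> \<open>Up to sign this is the difference of the logarithms of the two arguments of
      the logarithmic mean, so it cancels the denominator.\<close>
    then have e: "ln b - ln a - ?w = - (ln ?x - ln ?y)" by simp
    have p: "0 < ?x" "0 < ?y" using ab by auto
    show "theta D j a b * (ln b - ln a - ?w) = ?y - ?x"
      unfolding e theta_def using log_mean_ln[OF p] by (simp add: algebra_simps)
  qed
  also have "\<dots> = Qop j \<rho>"
    using dop_left[OF r1 V(1), of "\<lambda>a. a"] dop_right[OF r1 V(1), of "\<lambda>a. a"]
    by (simp add: dop_diff[OF r1] dop_scale[OF r1] fcalc_id[OF r1(2)] Qop_def)
  finally show ?thesis .
qed

end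

text \<open>For self-adjoint \<open>X\<close> this says that the spectrum lies above
  \<open>m\<close>. Stated through quadratic forms, it behaves well under convex combinations,
  perturbations and limits.\<close>

definition lb :: "real \<Rightarrow> complex^'n^'n \<Rightarrow> bool" where
  "lb m X \<longleftrightarrow> (\<forall>v. m * (v \<bullet> v) \<le> v \<bullet> (X *v v))"

lemma lb_add: "lb a X \<Longrightarrow> lb b Y \<Longrightarrow> lb (a + b) (X + Y)"
  unfolding lb_def by (simp add: mv.add_left inner_add_right distrib_right add_mono)

lemma lb_scale: "lb a X \<Longrightarrow> 0 \<le> c \<Longrightarrow> lb (c * a) (c *\<^sub>R X)"
  unfolding lb_def by (simp add: mv.scaleR_left mult.assoc mult_left_mono)

lemma lb_mono: "lb a X \<Longrightarrow> b \<le> a \<Longrightarrow> lb b X"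
  unfolding lb_def by (meson inner_ge_zero mult_right_mono order_trans)

lemma lb_spec: "lb m X \<Longrightarrow> a \<in> spec X \<Longrightarrow> m \<le> a"
  unfolding lb_def spec_eq
proof clarify
  fix v assume v: "\<forall>v. m * (v \<bullet> v) \<le> v \<bullet> (X *v v)" "v \<noteq> 0" "X *v v = a *\<^sub>R v"
  then have "m * (v \<bullet> v) \<le> a * (v \<bullet> v)" by (metis inner_scaleR_right)
  moreover have "0 < v \<bullet> v" using v(2) by simp
  ultimately show "m \<le> a" by simp
qed

lemma lbI_spec:
  fixes X :: "complex^'n^'n"
  assumes "adj X = X" "\<And>a. a \<in> spec X \<Longrightarrow> m \<le> a"
  shows "lb m X"
  unfolding lb_def
proof
  fix v :: "complex^'n"
  have "m * (v \<bullet> v) = (\<Sum>a\<in>spec X. m * (norm (eproj X a *v v))\<^sup>2)"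
    using norm_eproj_sum[OF assms(1), of v] by (simp add: sum_distrib_left[symmetric] power2_norm_eq_inner)
  also have "\<dots> \<le> (\<Sum>a\<in>spec X. a * (norm (eproj X a *v v))\<^sup>2)"
    using assms(2) by (intro sum_mono mult_right_mono) auto
  also have "\<dots> = v \<bullet> (X *v v)"
    using inner_fcalc[OF assms(1), of v "\<lambda>a. a"] by (simp add: fcalc_id[OF assms(1)])
  finally show "m * (v \<bullet> v) \<le> v \<bullet> (X *v v)" .
qed

lemma pos_def_lb: "pos_def X \<longleftrightarrow> adj X = X \<and> (\<exists>m>0. lb m X)"
proof
  assume p: "pos_def X"
  then have h: "adj X = X" unfolding pos_def_def by simp
  show "adj X = X \<and> (\<exists>m>0. lb m X)"
  proof (intro conjI exI[of _ "Min (insert 1 (spec X))"])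
    show "0 < Min (insert 1 (spec X))" using finite_spec[OF h] spec_pos[OF p] by auto
    show "lb (Min (insert 1 (spec X))) X" using finite_spec[OF h] by (intro lbI_spec[OF h]) auto
  qed (rule h)
next
  assume "adj X = X \<and> (\<exists>m>0. lb m X)"
  then show "pos_def X" unfolding pos_def_def qform_inner lb_def
    by (meson inner_gt_zero_iff less_le_trans mult_pos_pos)
qed

lemma pos_semidef_lb: "pos_semidef X \<longleftrightarrow> adj X = X \<and> lb 0 X"
  unfolding pos_semidef_def lb_def qform_inner by simp

lemma lb_perturb:
  "\<exists>K>0. \<forall>(X :: complex^'n^'n) Y m. lb m X \<longrightarrow> lb (m - K * norm (X - Y)) Y"
proof -
  have "\<exists>K>0. \<forall>(X :: complex^'n^'n) (v :: complex^'n). norm (X *v v) \<le> norm X * norm v * K"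
    by (rule mv.pos_bounded)
  then obtain K where K: "K > 0" "\<And>(X :: complex^'n^'n) (v :: complex^'n). norm (X *v v) \<le> norm X * norm v * K"
    by blast
  have *: "lb (- (K * norm (X - Y))) (Y - X)" for X Y :: "complex^'n^'n"
    unfolding lb_def
  proof
    fix v :: "complex^'n"
    have "\<bar>v \<bullet> ((Y - X) *v v)\<bar> \<le> norm v * norm ((Y - X) *v v)" by (rule Cauchy_Schwarz_ineq2)
    also have "\<dots> \<le> norm v * (norm (Y - X) * norm v * K)" by (intro mult_left_mono K) auto
    also have "\<dots> = K * norm (X - Y) * (v \<bullet> v)"
      by (simp add: norm_minus_commute dot_square_norm power2_eq_square)
    finally show "- (K * norm (X - Y)) * (v \<bullet> v) \<le> v \<bullet> ((Y - X) *v v)" by simp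
  qed
  have "lb (m - K * norm (X - Y)) Y" if "lb m X" for X Y :: "complex^'n^'n" and m
    using lb_add[OF that *[of X Y]] by simp
  then show ?thesis using K(1) by blast
qed

lemma log_mean_sym: "log_mean x y = log_mean y x"
  unfolding log_mean_def using minus_divide_divide[of "x - y" "ln x - ln y"] by auto

text \<open>From ln z \<le> z - 1 at the ratio of the arguments. This bound turns a lower bound of
  the state into coercivity of the metric.\<close>

lemma log_mean_ge_min:
  assumes "0 < x" "0 < y"
  shows "min x y \<le> log_mean x y"
proof -
  have *: "x \<le> log_mean x y" if "0 < x" "x < y" for x y :: real
  proof -
    have "ln y - ln x \<le> (y - x) / x"
      using ln_le_minus_one[of "y / x"] that by (simp add: ln_div diff_divide_distrib)
    moreover have "0 < ln y - ln x" using that by simp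
    ultimately have "x \<le> (y - x) / (ln y - ln x)" using that by (simp add: field_simps)
    then show ?thesis using that minus_divide_divide[of "x - y" "ln x - ln y"] unfolding log_mean_def by simp
  qed
  consider "x < y" | "x = y" | "y < x" by linarith
  then show ?thesis
    using *[of x y] *[of y x] assms log_mean_sym[of x y] by cases (auto simp: log_mean_def)
qed

context dstruct
begin

lemma J: "j \<in> idx D \<Longrightarrow> dstruct_j D j"
  by (intro dstruct_j.intro dstruct_axioms dstruct_j_axioms.intro)

lemma pos_statesD:
  assumes "\<rho> \<in> pos_states D"
  shows "\<rho> \<in> alg D" "adj \<rho> = \<rho>" "tr D \<rho> = 1" "\<And>a. a \<in> spec \<rho> \<Longrightarrow> 0 < a"
  using assms spec_pos unfolding pos_states_def pos_def_def by auto

lemma dop_add_right: "dop j \<rho> h (C + C') = dop j \<rho> h C + dop j \<rho> h C'"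
  unfolding dop_def by (simp add: mm.add_left mm.add_right scaleR_add_right sum.distrib)

lemma dop_scaleR_right: "dop j \<rho> h (c *\<^sub>R C) = c *\<^sub>R dop j \<rho> h C"
  unfolding dop_def by (simp add: mm.scaleR_left mm.scaleR_right scaleR_sum_right mult.commute)

definition sqi :: "complex^'n^'n" where "sqi = fcalc (\<lambda>a. inverse (sqrt a)) (dens D)"

lemma sq [simp, intro]: "sqrt_dens D \<in> alg D" "sqi \<in> alg D"
  unfolding sqrt_dens_def sqi_def by auto

lemma adj_sq: "adj (sqrt_dens D) = sqrt_dens D" "adj sqi = sqi"
  unfolding sqrt_dens_def sqi_def by (auto intro: adj_fcalc)

lemma sq_sqi: "sqrt_dens D ** sqi = mat 1" "sqi ** sqrt_dens D = mat 1" "sqrt_dens D ** sqrt_dens D = dens D"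
proof -
  have "fcalc (\<lambda>a. sqrt a * inverse (sqrt a)) (dens D) = fcalc (\<lambda>a. 1) (dens D)"
    "fcalc (\<lambda>a. inverse (sqrt a) * sqrt a) (dens D) = fcalc (\<lambda>a. 1) (dens D)"
    "fcalc (\<lambda>a. sqrt a * sqrt a) (dens D) = fcalc (\<lambda>a. a) (dens D)"
    using spec_dens by (auto intro!: fcalc_cong simp: less_imp_neq[symmetric] less_imp_le)
  then show "sqrt_dens D ** sqi = mat 1" "sqi ** sqrt_dens D = mat 1" "sqrt_dens D ** sqrt_dens D = dens D"
    unfolding sqrt_dens_def sqi_def by (simp_all add: fcalc_mult fcalc_one fcalc_id)
qed

lemma sq_cancel: "sqrt_dens D ** (sqi ** X) = X" "sqi ** (sqrt_dens D ** X) = X"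
  "X ** sqrt_dens D ** sqi = X" "X ** sqi ** sqrt_dens D = X"
  by (simp_all add: matrix_mul_assoc sq_sqi) (simp_all add: matrix_mul_assoc[symmetric] sq_sqi)

section \<open>Duality of the index set\<close>

definition dual :: "'j \<Rightarrow> 'j" where "dual j = (THE j'. is_dual_index D j j')"

lemma dual: "j \<in> idx D \<Longrightarrow> is_dual_index D j (dual j)"
  using ds unfolding dual_def differential_structure_def by (blast intro: theI')

lemma dual_unique: "j \<in> idx D \<Longrightarrow> is_dual_index D j k \<Longrightarrow> k = dual j"
  using ds dual[of j] unfolding differential_structure_def by blast

lemma dual_idx: "j \<in> idx D \<Longrightarrow> dual j \<in> idx D"
  using dual unfolding is_dual_index_def by blast

lemma dual_dual: "j \<in> idx D \<Longrightarrow> dual (dual j) = j"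
proof -
  assume j: "j \<in> idx D"
  have "is_dual_index D (dual j) j" using dual[OF j] j unfolding is_dual_index_def by auto
  then show ?thesis using dual_unique[OF dual_idx[OF j]] by metis
qed

lemma bij_dual: "bij_betw dual (idx D) (idx D)"
  by (rule bij_betw_byWitness[where f' = dual]) (auto simp: dual_dual dual_idx)

text \<open>Condition (3) keeps \<open>V\<close> of the index \<open>j\<close> but uses the
  homomorphisms of its dual. As \<open>V\<close> of the dual index is the adjoint, cyclicity
  rewrites the right-hand side as \<open>cform\<close> at the dual index.\<close>

lemma cform_swap:
  assumes j: "j \<in> idx D" and X: "X \<in> alg D" and Y: "Y \<in> alg D"
  shows "cform j X Y = cform (dual j) Y X"
proof -
  interpret p: dstruct_j D j by (rule J[OF j])
  interpret q: dstruct_j D "dual j" by (rule J[OF dual_idx[OF j]])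
  have eq: "vee D (dual j) = adj (vee D j)" "balg D (dual j) = balg D j"
    "\<And>X. X \<in> balg D j \<Longrightarrow> btr D (dual j) X = btr D j X"
    using dual[OF j] unfolding is_dual_index_def by auto
  have V: "vee D j = adj (vee D (dual j))" using eq(1) by simp
  have "cform j X Y = btr D j (adj (vee D j) ** rhom D (dual j) X ** vee D j ** lhom D (dual j) Y)"
    using ds j X Y dual[OF j] unfolding cform_def differential_structure_def by blast
  also have "\<dots> = btr D (dual j) (vee D (dual j) ** rhom D (dual j) X ** adj (vee D (dual j)) ** lhom D (dual j) Y)"
    using X Y eq(2) q.l_mem[OF Y] q.r_mem[OF X] unfolding eq(1) by (subst eq(3)) auto
  also have "\<dots> = btr D (dual j) ((vee D (dual j) ** rhom D (dual j) X) ** (adj (vee D (dual j)) ** lhom D (dual j) Y))"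
    by (simp add: matrix_mul_assoc)
  also have "\<dots> = btr D (dual j) ((adj (vee D (dual j)) ** lhom D (dual j) Y) ** (vee D (dual j) ** rhom D (dual j) X))"
    using X Y by (intro q.B.tr_cyc) auto
  finally show ?thesis unfolding cform_def by (simp add: matrix_mul_assoc)
qed

lemma cform_dens:
  assumes j: "j \<in> idx D"
  shows "cform j (dens D) (mat 1) = exp (- freq D j) *\<^sub>R cform j (mat 1) (dens D)" "cform j (dens D) (mat 1) \<noteq> 0"
proof -
  interpret p: dstruct_j D j by (rule J[OF j])
  have e: "cform j (dens D) (mat 1) = btr D j (adj p.V ** (p.l (dens D) ** p.V))"
    unfolding cform_def by (simp add: p.r p.B.unit matrix_mul_assoc)
  have "\<dots> = exp (- freq D j) *\<^sub>R btr D j (adj p.V ** (p.V ** p.r (dens D)))"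
    unfolding p.dens_V by (simp add: mm.scaleR_right p.B.tr_scaleR)
  then show "cform j (dens D) (mat 1) = exp (- freq D j) *\<^sub>R cform j (mat 1) (dens D)"
    unfolding e unfolding cform_def by (simp add: p.l p.B.unit matrix_mul_assoc)
  \<comment> \<open>The value of \<open>cform\<close> in question is the squared trace norm of
    \<open>?W\<close>, which is nonzero because \<open>V\<close> is recovered from it by the inverse
    square root of the density.\<close>
  let ?W = "p.l (sqrt_dens D) ** p.V"
  have adjl: "adj (p.l (sqrt_dens D)) = p.l (sqrt_dens D)" using p.l(5)[of "sqrt_dens D"] by (simp add: adj_sq)
  have "adj ?W ** ?W = adj p.V ** (p.l (dens D) ** p.V)"
    by (simp add: adj_mult adjl matrix_mul_assoc) (simp add: matrix_mul_assoc[symmetric] sq_sqi(3) flip: p.l(4))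
  moreover have "?W \<noteq> 0"
  proof
    assume "?W = 0"
    then have "p.l sqi ** (p.l (sqrt_dens D) ** p.V) = 0" by simp
    then have "p.V = 0" by (simp add: matrix_mul_assoc sq_sqi p.l(6) p.B.unit flip: p.l(4))
    then show False by simp
  qed
  ultimately show "cform j (dens D) (mat 1) \<noteq> 0"
    unfolding e using p.B.tr_faithful[of ?W] by auto
qed

text \<open>The density relations at \<open>j\<close> and at its dual move the density across and
  back; the nonzero value of \<open>cform\<close> is thereby multiplied by both exponentials, whose
  product must be 1.\<close>

lemma freq_dual: "j \<in> idx D \<Longrightarrow> freq D (dual j) = - freq D j"
proof -
  assume j: "j \<in> idx D"
  have "cform (dual j) (dens D) (mat 1) = cform j (mat 1) (dens D)"
       "cform (dual j) (mat 1) (dens D) = cform j (dens D) (mat 1)"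
    using cform_swap[OF j] by auto
  then have "cform j (mat 1) (dens D) = exp (- freq D (dual j)) *\<^sub>R cform j (dens D) (mat 1)"
    using cform_dens(1)[OF dual_idx[OF j]] by simp
  then have "cform j (dens D) (mat 1) = (exp (- freq D j) * exp (- freq D (dual j))) *\<^sub>R cform j (dens D) (mat 1)"
    using cform_dens(1)[OF j] by (metis scaleR_scaleR)
  then have "exp (- freq D j) * exp (- freq D (dual j)) = 1"
    using cform_dens(2)[OF j] by (metis scaleR_cancel_right scaleR_one)
  then show ?thesis by (simp add: exp_add[symmetric])
qed

lemma theta_dual: "j \<in> idx D \<Longrightarrow> theta D (dual j) a b = theta D j b a"
  unfolding theta_def by (simp add: freq_dual log_mean_sym)

section \<open>The operator K\<close>

definition Kform :: "'j \<Rightarrow> complex^'n^'n \<Rightarrow> complex^'n^'n \<Rightarrow> complex^'n^'n \<Rightarrow> complex" where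
  "Kform j \<rho> X Z = btr D j (adj (pderiv_op D j Z) ** dop j \<rho> (theta D j) (pderiv_op D j X))"

lemma Kform_expand:
  assumes j: "j \<in> idx D" and \<rho>: "\<rho> \<in> alg D" "adj \<rho> = \<rho>" and X: "X \<in> alg D" and Z: "Z \<in> alg D"
  shows "Kform j \<rho> X Z = (\<Sum>a\<in>spec \<rho>. \<Sum>b\<in>spec \<rho>. theta D j a b *\<^sub>R
    (cform j (eproj \<rho> a) (X ** eproj \<rho> b ** adj Z) - cform j (eproj \<rho> a ** X) (eproj \<rho> b ** adj Z)
     - cform j (adj Z ** eproj \<rho> a) (X ** eproj \<rho> b) + cform j (adj Z ** eproj \<rho> a ** X) (eproj \<rho> b)))"
proof -
  interpret p: dstruct_j D j by (rule J[OF j])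
  have "Kform j \<rho> X Z = (\<Sum>a\<in>spec \<rho>. \<Sum>b\<in>spec \<rho>. theta D j a b *\<^sub>R
      btr D j (adj (p.d Z) ** (p.l (eproj \<rho> a) ** p.d X ** p.r (eproj \<rho> b))))"
    unfolding Kform_def dop_def using \<rho> X Z
    by (simp add: mm.sum_right mm.scaleR_right p.B.tr_sum p.B.tr_scaleR)
  then show ?thesis using \<rho> X Z by (simp add: p.cform_expand)
qed

text \<open>Conjugation takes adjoints of both arguments of \<open>cform\<close>, the swap exchanges
  them, and interchanging the two eigenvalue sums absorbs the resulting exchange of the arguments of
  \<open>theta\<close>.\<close>

lemma Kform_dual:
  assumes j: "j \<in> idx D" and \<rho>: "\<rho> \<in> alg D" "adj \<rho> = \<rho>" and X: "X \<in> alg D" "adj X = X" and Z: "Z \<in> alg D"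
  shows "cnj (Kform j \<rho> X (adj Z)) = Kform (dual j) \<rho> X Z"
proof -
  interpret p: dstruct_j D j by (rule J[OF j])
  let ?c = "cform (dual j)" and ?E = "eproj \<rho>"
  have E [simp]: "adj (?E a) = ?E a" for a by (rule adj_eproj[OF \<rho>(2)])
  have "cnj (Kform j \<rho> X (adj Z)) = (\<Sum>a\<in>spec \<rho>. \<Sum>b\<in>spec \<rho>. theta D (dual j) b a *\<^sub>R
      (?c (adj Z ** ?E b ** X) (?E a) - ?c (adj Z ** ?E b) (X ** ?E a)
       - ?c (?E b ** X) (?E a ** adj Z) + ?c (?E b) (X ** ?E a ** adj Z)))"
    using \<rho> X Z
    by (simp add: Kform_expand[OF j \<rho>] p.cform_cnj theta_dual[OF j] adj_mult matrix_mul_assoc)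
      (simp add: cform_swap[OF j])
  also have "\<dots> = (\<Sum>b\<in>spec \<rho>. \<Sum>a\<in>spec \<rho>. theta D (dual j) b a *\<^sub>R
      (?c (adj Z ** ?E b ** X) (?E a) - ?c (adj Z ** ?E b) (X ** ?E a)
       - ?c (?E b ** X) (?E a ** adj Z) + ?c (?E b) (X ** ?E a ** adj Z)))"
    by (rule sum.swap)
  also have "\<dots> = Kform (dual j) \<rho> X Z"
    unfolding Kform_expand[OF dual_idx[OF j] \<rho> X(1) Z]
    by (intro sum.cong refl) (simp add: algebra_simps)
  finally show ?thesis .
qed

context
  fixes \<rho> assumes \<rho>: "\<rho> \<in> alg D" "adj \<rho> = \<rho>"
begin

lemma K_alt: "K_op D \<rho> X = (\<Sum>j\<in>idx D. pderiv_adj D j (dop j \<rho> (theta D j) (pderiv_op D j X)))"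
  unfolding K_op_def hat_mult_dop ..

lemma hat_mem: "j \<in> idx D \<Longrightarrow> X \<in> alg D \<Longrightarrow> dop j \<rho> h (pderiv_op D j X) \<in> balg D j"
  by (rule dstruct_j.dop_mem[OF J _ _ dstruct_j.d_mem[OF J]]) (auto simp: \<rho>)

lemma K_mem [simp, intro]: "X \<in> alg D \<Longrightarrow> K_op D \<rho> X \<in> alg D"
  unfolding K_alt using dstruct_j.d'_mem[OF J] hat_mem by (intro A.mem_sum) auto

lemma K_trace:
  assumes X: "X \<in> alg D" and Z: "Z \<in> alg D"
  shows "tr D (adj Z ** K_op D \<rho> X) = (\<Sum>j\<in>idx D. Kform j \<rho> X Z)"
proof -
  let ?W = "\<lambda>j. dop j \<rho> (theta D j) (pderiv_op D j X)"
  have "adj Z ** K_op D \<rho> X = (\<Sum>j\<in>idx D. adj Z ** pderiv_adj D j (?W j))"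
    unfolding K_alt by (simp add: mm.sum_right)
  then have "tr D (adj Z ** K_op D \<rho> X) = (\<Sum>j\<in>idx D. tr D (adj Z ** pderiv_adj D j (?W j)))"
    using X Z hat_mem dstruct_j.d'_mem[OF J] by (simp add: A.tr_sum)
  also have "\<dots> = (\<Sum>j\<in>idx D. Kform j \<rho> X Z)"
  proof (rule sum.cong[OF refl])
    fix j assume j: "j \<in> idx D"
    interpret p: dstruct_j D j by (rule J[OF j])
    have W: "?W j \<in> p.B" using hat_mem[OF j X] .
    have "tr D (adj Z ** p.d' (?W j)) = tr D (adj (adj (p.d' (?W j)) ** Z))" by (simp add: adj_mult)
    also have "\<dots> = cnj (tr D (adj (p.d' (?W j)) ** Z))" using W Z by (intro A.tr_adj) auto
    also have "\<dots> = cnj (btr D j (adj (?W j) ** p.d Z))" using W Z by (simp add: p.d')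
    also have "\<dots> = btr D j (adj (adj (?W j) ** p.d Z))" using W Z by (intro p.B.tr_adj[symmetric]) auto
    finally show "tr D (adj Z ** p.d' (?W j)) = Kform j \<rho> X Z" by (simp add: adj_mult Kform_def)
  qed
  finally show ?thesis .
qed

lemma K_add: "X \<in> alg D \<Longrightarrow> Y \<in> alg D \<Longrightarrow> K_op D \<rho> (X + Y) = K_op D \<rho> X + K_op D \<rho> Y"
  unfolding K_alt sum.distrib[symmetric]
  by (intro sum.cong refl)
    (simp add: dstruct_j.d_add[OF J] dop_add_right dstruct_j.d'_add[OF J] hat_mem)

lemma K_scaleR: "X \<in> alg D \<Longrightarrow> K_op D \<rho> (c *\<^sub>R X) = c *\<^sub>R K_op D \<rho> X"
  unfolding K_alt scaleR_sum_right
  by (intro sum.cong refl)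
    (simp add: dstruct_j.d_scaleR[OF J] dop_scaleR_right dstruct_j.d'_scaleR[OF J] hat_mem)

text \<open>Taking adjoints sends the contribution of \<open>j\<close> to that of its dual index, so
  the sum is invariant because duality is a bijection of the index set.\<close>

lemma K_self_adjoint:
  assumes X: "X \<in> alg D" "adj X = X"
  shows "adj (K_op D \<rho> X) = K_op D \<rho> X"
proof -
  have eq: "tr D (adj Z ** adj (K_op D \<rho> X)) = tr D (adj Z ** K_op D \<rho> X)" if Z: "Z \<in> alg D" for Z
  proof -
    have "tr D (adj Z ** adj (K_op D \<rho> X)) = tr D (adj (K_op D \<rho> X ** Z))" by (simp add: adj_mult)
    also have "\<dots> = cnj (tr D (K_op D \<rho> X ** Z))" using X Z by (intro A.tr_adj) auto
    also have "tr D (K_op D \<rho> X ** Z) = tr D (adj (adj Z) ** K_op D \<rho> X)" using X Z A.tr_cyc by simp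
    also have "cnj \<dots> = (\<Sum>j\<in>idx D. cnj (Kform j \<rho> X (adj Z)))"
      using Z by (subst K_trace[OF X(1)]) auto
    also have "\<dots> = (\<Sum>j\<in>idx D. Kform (dual j) \<rho> X Z)"
      using Kform_dual[OF _ \<rho> X Z] by (intro sum.cong) auto
    also have "\<dots> = (\<Sum>j\<in>idx D. Kform j \<rho> X Z)" by (rule sum.reindex_bij_betw[OF bij_dual])
    finally show ?thesis using X Z by (simp add: K_trace)
  qed
  let ?W = "adj (K_op D \<rho> X) - K_op D \<rho> X"
  have "tr D (adj ?W ** ?W) = 0" using eq[of ?W] X by (simp add: mm.diff_right A.tr_diff)
  then show ?thesis using A.tr_faithful[of ?W] X by simp
qed

lemma K_trace_zero:
  assumes X: "X \<in> alg D"
  shows "tr D (K_op D \<rho> X) = 0"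
proof -
  have "Kform j \<rho> X (mat 1) = 0" if j: "j \<in> idx D" for j
  proof -
    interpret p: dstruct_j D j by (rule J[OF j])
    show ?thesis unfolding Kform_def p.d_one by simp
  qed
  then show ?thesis using K_trace[OF X, of "mat 1"] A.mem(1) by simp
qed

lemma K_traceless: "X \<in> alg D \<Longrightarrow> adj X = X \<Longrightarrow> K_op D \<rho> X \<in> traceless D"
  unfolding traceless_def using K_self_adjoint K_trace_zero by auto

end

lemma traceless_subspace: "subspace (traceless D)"
  unfolding traceless_def subspace_def by (auto simp: adj_add adj_scaleR A.tr_add A.tr_scaleR)

lemma tracelessD: "X \<in> traceless D \<Longrightarrow> X \<in> alg D" "X \<in> traceless D \<Longrightarrow> adj X = X" "X \<in> traceless D \<Longrightarrow> tr D X = 0"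
  unfolding traceless_def by auto

section \<open>The generator\<close>

text \<open>On the algebra this is \<open>sqrt_dens D ** generator D X ** sqrt_dens D\<close>, read
  off from the weak equation that defines the generator.\<close>

definition gform :: "complex^'n^'n \<Rightarrow> complex^'n^'n" where
  "gform X = - (\<Sum>j\<in>idx D. pderiv_adj D j (lhom D j (sqrt_dens D) ** pderiv_op D j X ** rhom D j (sqrt_dens D)))"

lemma gform_arg: "j \<in> idx D \<Longrightarrow> X \<in> alg D \<Longrightarrow>
    lhom D j (sqrt_dens D) ** pderiv_op D j X ** rhom D j (sqrt_dens D) \<in> balg D j"
proof -
  assume j: "j \<in> idx D" and X: "X \<in> alg D"
  interpret p: dstruct_j D j by (rule J[OF j])
  show ?thesis using X by auto
qed

lemma gform_mem [simp, intro]: "X \<in> alg D \<Longrightarrow> gform X \<in> alg D"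
  unfolding gform_def using dstruct_j.d'_mem[OF J] gform_arg by (intro A.mem(5) A.mem_sum) auto

lemma gform_add: "X \<in> alg D \<Longrightarrow> Y \<in> alg D \<Longrightarrow> gform (X + Y) = gform X + gform Y"
  unfolding gform_def minus_add_distrib[symmetric] sum.distrib[symmetric]
  by (intro arg_cong[where f = uminus] sum.cong refl)
    (simp add: dstruct_j.d_add[OF J] mm.add_left mm.add_right dstruct_j.d'_add[OF J] gform_arg)

lemma gform_cscale: "X \<in> alg D \<Longrightarrow> gform (cscale c X) = cscale c (gform X)"
proof -
  assume X: "X \<in> alg D"
  have c: "cscale c (- sum f S) = - (\<Sum>i\<in>S. cscale c (f i))" for f :: "'j \<Rightarrow> complex^'n^'n" and S
    by (simp add: cscale_def vec_eq_iff sum_distrib_left)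
  show ?thesis unfolding gform_def c using X
    by (intro arg_cong[where f = uminus] sum.cong refl)
      (simp add: dstruct_j.d_cscale[OF J] cscale_mult_left cscale_mult_right dstruct_j.d'_cscale[OF J] gform_arg)
qed

lemma gform_trace:
  assumes X: "X \<in> alg D" and Z: "Z \<in> alg D"
  shows "tr D (adj Z ** gform X) = - (\<Sum>j\<in>idx D. btr D j (adj (pderiv_op D j Z) ** lhom D j (sqrt_dens D) **
     pderiv_op D j X ** rhom D j (sqrt_dens D)))"
proof -
  let ?W = "\<lambda>j. lhom D j (sqrt_dens D) ** pderiv_op D j X ** rhom D j (sqrt_dens D)"
  have "adj Z ** gform X = - (\<Sum>j\<in>idx D. adj Z ** pderiv_adj D j (?W j))"
    unfolding gform_def by (simp add: mm.sum_right mm.minus_right)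
  then have "tr D (adj Z ** gform X) = - (\<Sum>j\<in>idx D. tr D (adj Z ** pderiv_adj D j (?W j)))"
    using X Z gform_arg dstruct_j.d'_mem[OF J] by (simp add: A.tr_sum A.tr_minus)
  also have "(\<Sum>j\<in>idx D. tr D (adj Z ** pderiv_adj D j (?W j))) = (\<Sum>j\<in>idx D. btr D j (adj (pderiv_op D j Z) ** ?W j))"
  proof (rule sum.cong[OF refl])
    fix j assume j: "j \<in> idx D"
    interpret p: dstruct_j D j by (rule J[OF j])
    have W: "?W j \<in> p.B" using gform_arg[OF j X] .
    have "tr D (adj Z ** p.d' (?W j)) = tr D (adj (adj (p.d' (?W j)) ** Z))" by (simp add: adj_mult)
    also have "\<dots> = cnj (tr D (adj (p.d' (?W j)) ** Z))" using W Z by (intro A.tr_adj) auto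
    also have "\<dots> = cnj (btr D j (adj (?W j) ** p.d Z))" using W Z by (simp add: p.d')
    also have "\<dots> = btr D j (adj (adj (?W j) ** p.d Z))" using W Z by (intro p.B.tr_adj[symmetric]) auto
    finally show "tr D (adj Z ** p.d' (?W j)) = btr D j (adj (p.d Z) ** ?W j)" by (simp add: adj_mult)
  qed
  finally show ?thesis by (simp add: matrix_mul_assoc)
qed

lemma generator_eq:
  assumes X: "X \<in> alg D"
  shows "generator D X = sqi ** gform X ** sqi"
  unfolding generator_def
proof (rule the_equality)
  let ?G = "sqi ** gform X ** sqi" and ?s = "sqrt_dens D"
  have G: "adj Z ** ?s ** ?G ** ?s = adj Z ** gform X" for Z
    by (simp add: matrix_mul_assoc[symmetric] sq_cancel sq_sqi)
  show "?G \<in> alg D \<and> (\<forall>Z\<in>alg D. (\<Sum>j\<in>idx D. btr D j (adj (pderiv_op D j Z) ** lhom D j ?s ** pderiv_op D j X ** rhom D j ?s)) =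
      - tr D (adj Z ** ?s ** ?G ** ?s))"
    using X by (simp add: G gform_trace)
  fix Y assume Y: "Y \<in> alg D \<and> (\<forall>Z\<in>alg D. (\<Sum>j\<in>idx D. btr D j (adj (pderiv_op D j Z) ** lhom D j ?s ** pderiv_op D j X ** rhom D j ?s)) =
      - tr D (adj Z ** ?s ** Y ** ?s))"
  have eq: "tr D (adj Z ** (?s ** Y ** ?s)) = tr D (adj Z ** gform X)" if "Z \<in> alg D" for Z
    using Y X that by (simp add: gform_trace[OF X that] matrix_mul_assoc)
  let ?W = "?s ** Y ** ?s - gform X"
  have "tr D (adj ?W ** ?W) = 0" using eq[of ?W] X Y by (simp add: mm.diff_right A.tr_diff)
  then have "?s ** Y ** ?s = gform X" using A.tr_faithful[of ?W] X Y by simp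
  then have "sqi ** (?s ** Y ** ?s) ** sqi = ?G" by simp
  then show "Y = ?G" by (simp add: matrix_mul_assoc sq_sqi sq_cancel)
qed

text \<open>An explicit linear formula for the adjoint generator; it agrees with
  \<open>generator_adj\<close> on self-adjoint elements of the algebra.\<close>

definition Lop :: "complex^'n^'n \<Rightarrow> complex^'n^'n" where
  "Lop \<rho> = - (\<Sum>j\<in>idx D. pderiv_adj D j (Qop j \<rho>))"

lemma Q_mem: "j \<in> idx D \<Longrightarrow> \<rho> \<in> alg D \<Longrightarrow> Qop j \<rho> \<in> balg D j"
proof -
  assume j: "j \<in> idx D" and X: "\<rho> \<in> alg D"
  interpret p: dstruct_j D j by (rule J[OF j])
  show ?thesis unfolding Qop_def using X by auto
qed

lemma Q_add: "j \<in> idx D \<Longrightarrow> X \<in> alg D \<Longrightarrow> Y \<in> alg D \<Longrightarrow> Qop j (X + Y) = Qop j X + Qop j Y"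
  unfolding Qop_def
  by (simp add: dstruct_j.l[OF J] dstruct_j.r[OF J] mm.add_left mm.add_right scaleR_add_right)

lemma Q_scaleR: "j \<in> idx D \<Longrightarrow> X \<in> alg D \<Longrightarrow> Qop j (c *\<^sub>R X) = c *\<^sub>R Qop j X"
  unfolding Qop_def
  by (simp add: dstruct_j.l_scaleR[OF J] dstruct_j.r_scaleR[OF J] mm.scaleR_left mm.scaleR_right
      scaleR_diff_right mult.commute)

lemma Lop_mem [simp, intro]: "\<rho> \<in> alg D \<Longrightarrow> Lop \<rho> \<in> alg D"
  unfolding Lop_def using dstruct_j.d'_mem[OF J] Q_mem by (intro A.mem(5) A.mem_sum) auto

lemma Lop_add: "X \<in> alg D \<Longrightarrow> Y \<in> alg D \<Longrightarrow> Lop (X + Y) = Lop X + Lop Y"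
  unfolding Lop_def minus_add_distrib[symmetric] sum.distrib[symmetric]
  by (intro arg_cong[where f = uminus] sum.cong refl) (simp add: Q_add dstruct_j.d'_add[OF J] Q_mem)

lemma Lop_scaleR: "X \<in> alg D \<Longrightarrow> Lop (c *\<^sub>R X) = c *\<^sub>R Lop X"
  unfolding Lop_def scaleR_minus_right scaleR_sum_right
  by (intro arg_cong[where f = uminus] sum.cong refl) (simp add: Q_scaleR dstruct_j.d'_scaleR[OF J] Q_mem)

lemma Lop_trace:
  assumes X: "X \<in> alg D" and Z: "Z \<in> alg D"
  shows "tr D (adj (Lop X) ** Z) = - (\<Sum>j\<in>idx D. btr D j (adj (Qop j X) ** pderiv_op D j Z))"
proof -
  have "adj (Lop X) ** Z = - (\<Sum>j\<in>idx D. adj (pderiv_adj D j (Qop j X)) ** Z)"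
    unfolding Lop_def by (simp add: mm.sum_left mm.minus_left adj_minus adj_sum)
  then have "tr D (adj (Lop X) ** Z) = - (\<Sum>j\<in>idx D. tr D (adj (pderiv_adj D j (Qop j X)) ** Z))"
    using X Z Q_mem dstruct_j.d'_mem[OF J] by (simp add: A.tr_sum A.tr_minus)
  also have "(\<Sum>j\<in>idx D. tr D (adj (pderiv_adj D j (Qop j X)) ** Z)) = (\<Sum>j\<in>idx D. btr D j (adj (Qop j X) ** pderiv_op D j Z))"
    using X Z Q_mem by (intro sum.cong refl) (simp add: dstruct_j.d'[OF J])
  finally show ?thesis .
qed

text \<open>Conjugating \<rho> by the inverse square root of the density moves the adjoint generator
  into the defining form of the generator. Pulling the square roots through \<open>V\<close> costs
  the factors exp (- \<omega> / 2) and exp (\<omega> / 2) that appear in \<open>Qop\<close>.\<close>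

lemma generator_adj_eq:
  assumes \<rho>: "\<rho> \<in> alg D" "adj \<rho> = \<rho>"
  shows "generator_adj D \<rho> = Lop \<rho>"
proof -
  have ga: "generator_adj D \<rho> \<in> alg D \<and> (\<forall>Z\<in>alg D. tr D (adj (generator_adj D \<rho>) ** Z) = tr D (adj \<rho> ** generator D Z))"
    unfolding generator_adj_def using \<rho>
    by (intro A.adjoint_map)
      (auto simp: generator_eq gform_add gform_cscale mm.add_left mm.add_right cscale_mult_left cscale_mult_right A.tr_add A.tr_cscale)
  show ?thesis
  proof (rule A.eq_by_trace)
    fix Z assume Z: "Z \<in> alg D"
    \<comment> \<open>The square roots that flank the derivative of \<open>?Y\<close> cancel one
      inverse square root on each side; the other one meets \<open>V\<close>.\<close>
    let ?Y = "sqi ** \<rho> ** sqi" and ?s = "sqrt_dens D"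
    have Y: "?Y \<in> alg D" "adj ?Y = ?Y" using \<rho> by (auto simp: adj_mult adj_sq matrix_mul_assoc)
    have "tr D (adj (generator_adj D \<rho>) ** Z) = tr D ((\<rho> ** sqi ** gform Z) ** sqi)"
      using ga Z \<rho> by (simp add: generator_eq matrix_mul_assoc)
    also have "\<dots> = tr D (sqi ** (\<rho> ** sqi ** gform Z))" using \<rho> Z by (intro A.tr_cyc) auto
    also have "\<dots> = tr D (adj ?Y ** gform Z)" using Y by (simp add: matrix_mul_assoc)
    also have "\<dots> = - (\<Sum>j\<in>idx D. btr D j (adj (pderiv_op D j ?Y) ** lhom D j ?s ** pderiv_op D j Z ** rhom D j ?s))"
      by (rule gform_trace[OF Z Y(1)])
    also have "(\<Sum>j\<in>idx D. btr D j (adj (pderiv_op D j ?Y) ** lhom D j ?s ** pderiv_op D j Z ** rhom D j ?s))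
       = (\<Sum>j\<in>idx D. btr D j (adj (Qop j \<rho>) ** pderiv_op D j Z))"
    proof (rule sum.cong[OF refl])
      fix j assume j: "j \<in> idx D"
      interpret p: dstruct_j D j by (rule J[OF j])
      have adjlr: "adj (p.l ?s) = p.l ?s" "adj (p.r ?s) = p.r ?s"
        using p.l(5)[of ?s] p.r(5)[of ?s] by (simp_all add: adj_sq)
      have l1: "p.l ?s ** p.l ?Y = p.l \<rho> ** p.l sqi"
        using Y \<rho> by (simp add: sq_cancel matrix_mul_assoc[symmetric] flip: p.l(4))
      have r1: "p.r ?Y ** p.r ?s = p.r sqi ** p.r \<rho>"
        using Y \<rho> by (simp add: sq_cancel matrix_mul_assoc sq_sqi flip: p.r(4))
      have e1: "p.l ?s ** p.V ** p.r sqi = exp (- freq D j / 2) *\<^sub>R p.V"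
      proof -
        have "p.l ?s ** p.V ** p.r sqi = exp (- freq D j / 2) *\<^sub>R (p.V ** (p.r ?s ** p.r sqi))"
          by (simp add: p.dens_sqrt mm.scaleR_left matrix_mul_assoc)
        also have "p.r ?s ** p.r sqi = bunit D j" by (simp add: sq_sqi p.r(6) flip: p.r(4))
        finally show ?thesis by (simp add: p.B.unit)
      qed
      have e2: "p.l sqi ** p.V ** p.r ?s = exp (freq D j / 2) *\<^sub>R p.V"
      proof -
        have "exp (freq D j / 2) *\<^sub>R (p.l sqi ** (p.l ?s ** p.V)) = p.l sqi ** p.V ** p.r ?s"
          by (simp add: p.dens_sqrt mm.scaleR_right matrix_mul_assoc flip: exp_add)
        moreover have "p.l sqi ** (p.l ?s ** p.V) = p.V"
          by (simp add: matrix_mul_assoc sq_sqi p.l(6) p.B.unit flip: p.l(4))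
        ultimately show ?thesis by simp
      qed
      have "p.l ?s ** p.d ?Y ** p.r ?s = p.l ?s ** p.V ** (p.r ?Y ** p.r ?s) - (p.l ?s ** p.l ?Y) ** p.V ** p.r ?s"
        unfolding pderiv_op_def by (simp add: mm.diff_left mm.diff_right matrix_mul_assoc)
      also have "\<dots> = (p.l ?s ** p.V ** p.r sqi) ** p.r \<rho> - p.l \<rho> ** (p.l sqi ** p.V ** p.r ?s)"
        unfolding l1 r1 by (simp add: matrix_mul_assoc)
      also have "\<dots> = Qop j \<rho>" unfolding e1 e2 Qop_def by (simp add: mm.scaleR_left mm.scaleR_right)
      finally have Q: "p.l ?s ** p.d ?Y ** p.r ?s = Qop j \<rho>" .
      have "btr D j ((adj (p.d ?Y) ** p.l ?s ** p.d Z) ** p.r ?s) = btr D j (p.r ?s ** (adj (p.d ?Y) ** p.l ?s ** p.d Z))"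
        using Y Z by (intro p.B.tr_cyc) auto
      also have "p.r ?s ** (adj (p.d ?Y) ** p.l ?s ** p.d Z) = adj (p.l ?s ** p.d ?Y ** p.r ?s) ** p.d Z"
        by (simp add: adj_mult adjlr matrix_mul_assoc)
      finally show "btr D j (adj (p.d ?Y) ** p.l ?s ** p.d Z ** p.r ?s) = btr D j (adj (Qop j \<rho>) ** p.d Z)"
        unfolding Q .
    qed
    finally show "tr D (adj (generator_adj D \<rho>) ** Z) = tr D (adj (Lop \<rho>) ** Z)"
      using \<rho> Z by (simp add: Lop_trace)
  qed (use ga \<rho> in auto)
qed

text \<open>The gradient flow identity, by the chain rule for each index. The potential is minus the
  differential of the entropy; its trace need not vanish, which is corrected when its cost is
  computed.\<close>

lemma Lop_K:
  assumes \<rho>: "\<rho> \<in> pos_states D"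
  shows "Lop \<rho> = K_op D \<rho> (fcalc ln (dens D) - fcalc ln \<rho>)"
proof -
  note r = pos_statesD[OF \<rho>]
  let ?X = "fcalc ln \<rho> - fcalc ln (dens D)"
  have X: "?X \<in> alg D" using r by auto
  have "K_op D \<rho> ((-1) *\<^sub>R ?X) = (-1) *\<^sub>R K_op D \<rho> ?X" using K_scaleR[OF r(1,2) X] .
  moreover have "K_op D \<rho> ?X = (\<Sum>j\<in>idx D. pderiv_adj D j (Qop j \<rho>))"
    unfolding K_alt[OF r(1,2)] using dstruct_j.hat_d_log[OF J \<rho>] by (intro sum.cong refl) simp
  ultimately show ?thesis unfolding Lop_def by simp
qed

lemma Lop_dens: "Lop (dens D) = 0"
  using Lop_K[OF dens_pos_states] K_scaleR[of "dens D" 0 0] by simp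

end

lemma subspace_endo_surj:
  fixes f :: "'a::euclidean_space \<Rightarrow> 'a"
  assumes S: "subspace S" and add: "\<And>x y. x \<in> S \<Longrightarrow> y \<in> S \<Longrightarrow> f (x + y) = f x + f y"
    and scale: "\<And>c x. x \<in> S \<Longrightarrow> f (c *\<^sub>R x) = c *\<^sub>R f x"
    and mem: "\<And>x. x \<in> S \<Longrightarrow> f x \<in> S" and inj: "\<And>x. x \<in> S \<Longrightarrow> f x = 0 \<Longrightarrow> x = 0" and y: "y \<in> S"
  shows "\<exists>x\<in>S. f x = y"
proof -
  obtain g where g: "linear g" "\<And>x. x \<in> S \<Longrightarrow> g x = f x" using linear_extension[OF S add scale] by metis
  have "inj_on g (span S)"
    using linear_inj_on_iff_eq_0[OF g(1) S] g(2) inj S by (metis span_eq_iff)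
  then have "dim (g ` S) = dim S" by (rule dim_image_eq[OF g(1)])
  moreover have "g ` S \<subseteq> S" using g(2) mem by auto
  ultimately have "g ` S = S" using subspace_dim_equal[OF linear_subspace_image[OF g(1) S] S] by simp
  then show ?thesis using y g(2) by (metis imageE)
qed

section \<open>Ergodicity, coercivity and the inverse of \<open>K_op\<close>\<close>

locale dstruct_erg = dstruct D for D :: "('n::finite, 'm::finite, 'j) diff_struct" +
  assumes erg: "ergodic D"
begin

lemma d_linear_ext: "j \<in> idx D \<Longrightarrow> \<exists>T. bounded_linear T \<and> (\<forall>X\<in>alg D. pderiv_op D j X = T X)"
  using linear_extension[OF A.sub, of "pderiv_op D j"] dstruct_j.d_add[OF J] dstruct_j.d_scaleR[OF J]
    linear_conv_bounded_linear by metis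

lemma d'_linear_ext:
  assumes j: "j \<in> idx D"
  shows "\<exists>T. bounded_linear T \<and> (\<forall>X\<in>balg D j. pderiv_adj D j X = T X)"
proof -
  interpret p: dstruct_j D j by (rule J[OF j])
  show ?thesis using linear_extension[OF p.B.sub, of p.d'] p.d'_add p.d'_scaleR
    linear_conv_bounded_linear by metis
qed

text \<open>If all derivatives vanish then so does the generator, and ergodicity leaves a multiple
  of the unit, whose trace is nonzero unless the multiple is 0.\<close>

lemma kernel_d:
  assumes X: "X \<in> traceless D" and z: "\<And>j. j \<in> idx D \<Longrightarrow> pderiv_op D j X = 0"
  shows "X = 0"
proof -
  note X' = tracelessD[OF X]
  have d0: "pderiv_adj D j 0 = 0" if j: "j \<in> idx D" for j
  proof -
    interpret p: dstruct_j D j by (rule J[OF j])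
    show ?thesis using p.d'_scaleR[of 0 0] by simp
  qed
  have "gform X = 0" unfolding gform_def using z d0 by simp
  then have "generator D X = 0" using generator_eq[OF X'(1)] by simp
  then obtain c where c: "X = cscale c (mat 1)" using erg X'(1) unfolding ergodic_def by blast
  have "c * tr D (mat 1) = 0" using X'(3) unfolding c by (simp add: A.tr_cscale)
  moreover have "tr D (mat 1) \<noteq> 0"
  proof
    assume "tr D (mat 1) = 0"
    then have "(mat 1 :: complex^'n^'n) = 0" using A.tr_faithful[of "mat 1"] A.mem(1) by simp
    then show False by (simp add: mat_def vec_eq_iff) (metis zero_neq_one)
  qed
  ultimately show ?thesis unfolding c by (simp add: cscale_def vec_eq_iff)
qed

text \<open>A Poincare inequality: by ergodicity the sum of the squared derivatives is positive on
  the compact unit sphere of traceless elements.\<close>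

lemma dirichlet_lower:
  "\<exists>\<delta>>0. \<forall>X\<in>traceless D. \<delta> * (norm X)\<^sup>2 \<le>
     (\<Sum>j\<in>idx D. Re (btr D j (adj (pderiv_op D j X) ** pderiv_op D j X)))"
proof (cases "traceless D = {0}")
  case True
  have "0 \<le> (\<Sum>j\<in>idx D. Re (btr D j (adj (pderiv_op D j 0) ** pderiv_op D j 0)))"
  proof (intro sum_nonneg)
    fix j assume j: "j \<in> idx D"
    interpret p: dstruct_j D j by (rule J[OF j])
    show "0 \<le> Re (btr D j (adj (p.d 0) ** p.d 0))" by (rule p.B.tr_pos) auto
  qed
  then show ?thesis using True by (intro exI[of _ 1]) auto
next
  case False
  have "\<exists>c>0. \<forall>C\<in>balg D j. c * (norm C)\<^sup>2 \<le> Re (btr D j (adj C ** C))" if "j \<in> idx D" for j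
  proof -
    interpret p: dstruct_j D j by (rule J[OF that])
    show ?thesis by (rule p.B.tr_norm_lower)
  qed
  then obtain c where c: "\<And>j. j \<in> idx D \<Longrightarrow> 0 < c j"
    "\<And>j C. j \<in> idx D \<Longrightarrow> C \<in> balg D j \<Longrightarrow> c j * (norm C)\<^sup>2 \<le> Re (btr D j (adj C ** C))" by metis
  obtain T where T: "\<And>j. j \<in> idx D \<Longrightarrow> bounded_linear (T j)"
    "\<And>j X. j \<in> idx D \<Longrightarrow> X \<in> alg D \<Longrightarrow> pderiv_op D j X = T j X" using d_linear_ext by metis
  \<comment> \<open>The traces are bounded below by matrix norms of globally linear extensions, so
    that continuity is evident.\<close>
  define G where "G X = (\<Sum>j\<in>idx D. c j * (norm (T j X))\<^sup>2)" for X
  have "compact (traceless D \<inter> sphere 0 1)"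
    using closed_subspace[OF traceless_subspace] by (intro closed_Int_compact compact_sphere)
  moreover have "traceless D \<inter> sphere 0 1 \<noteq> {}"
  proof -
    obtain X0 where "X0 \<in> traceless D" "X0 \<noteq> 0" using False subspace_0[OF traceless_subspace] by blast
    then have "X0 /\<^sub>R norm X0 \<in> traceless D \<inter> sphere 0 1"
      using subspace_scale[OF traceless_subspace] by auto
    then show ?thesis by blast
  qed
  moreover have "continuous_on (traceless D \<inter> sphere 0 1) G"
    unfolding G_def by (intro continuous_intros bounded_linear.continuous_on[OF T(1)])
  ultimately have "\<exists>X\<in>traceless D \<inter> sphere 0 1. \<forall>Y\<in>traceless D \<inter> sphere 0 1. G X \<le> G Y"
    by (rule continuous_attains_inf)
  then obtain X where X: "X \<in> traceless D" "norm X = 1" "\<And>Y. Y \<in> traceless D \<Longrightarrow> norm Y = 1 \<Longrightarrow> G X \<le> G Y"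
    by auto
  have G0: "0 \<le> c j * (norm (T j X))\<^sup>2" if "j \<in> idx D" for j X
    using c(1)[OF that] by simp
  have "G X \<noteq> 0"
  proof
    assume "G X = 0"
    then have "\<forall>j\<in>idx D. c j * (norm (T j X))\<^sup>2 = 0"
      unfolding G_def using G0 fin_idx by (subst (asm) sum_nonneg_eq_0_iff) auto
    then have "pderiv_op D j X = 0" if "j \<in> idx D" for j
      using c(1)[OF that] T(2)[OF that] tracelessD(1)[OF X(1)] that by auto
    then have "X = 0" by (rule kernel_d[OF X(1)])
    then show False using X(2) by simp
  qed
  moreover have "0 \<le> G X" unfolding G_def using G0 by (intro sum_nonneg)
  ultimately have pos: "0 < G X" by simp
  have "G X * (norm Y)\<^sup>2 \<le> (\<Sum>j\<in>idx D. Re (btr D j (adj (pderiv_op D j Y) ** pderiv_op D j Y)))"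
    if Y: "Y \<in> traceless D" for Y
  proof -
    have "G X * (norm Y)\<^sup>2 \<le> G Y"
    proof (cases "Y = 0")
      case False
      have "G X \<le> G (Y /\<^sub>R norm Y)"
        using False Y subspace_scale[OF traceless_subspace] by (intro X(3)) auto
      also have "\<dots> = G Y / (norm Y)\<^sup>2"
        unfolding G_def sum_divide_distrib
        by (intro sum.cong refl) (simp add: linear_scale[OF bounded_linear.linear[OF T(1)]] power_mult_distrib power_inverse divide_inverse)
      finally show ?thesis using False by (simp add: field_simps)
    next
      case True
      then show ?thesis unfolding G_def using G0 by (simp add: sum_nonneg)
    qed
    also have "\<dots> \<le> (\<Sum>j\<in>idx D. Re (btr D j (adj (pderiv_op D j Y) ** pderiv_op D j Y)))"
      unfolding G_def
    proof (rule sum_mono)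
      fix j assume j: "j \<in> idx D"
      interpret p: dstruct_j D j by (rule J[OF j])
      show "c j * (norm (T j Y))\<^sup>2 \<le> Re (btr D j (adj (p.d Y) ** p.d Y))"
        using c(2)[OF j p.d_mem[OF tracelessD(1)[OF Y]]] T(2)[OF j tracelessD(1)[OF Y]] by simp
    qed
    finally show ?thesis .
  qed
  then show ?thesis using pos by blast
qed

text \<open>Each symbol \<open>theta\<close> lies above the smaller of its two weighted arguments,
  hence above \<kappa> m. The Poincare inequality does the rest.\<close>

lemma K_coercive:
  "\<exists>\<kappa>>0. \<forall>\<rho>\<in>pos_states D. \<forall>m>0. lb m \<rho> \<longrightarrow> (\<forall>X\<in>traceless D. \<kappa> * m * (norm X)\<^sup>2 \<le> Re (tr D (X ** K_op D \<rho> X)))"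
proof -
  obtain \<delta> where d: "\<delta> > 0" "\<And>X. X \<in> traceless D \<Longrightarrow> \<delta> * (norm X)\<^sup>2 \<le>
     (\<Sum>j\<in>idx D. Re (btr D j (adj (pderiv_op D j X) ** pderiv_op D j X)))" using dirichlet_lower by blast
  \<comment> \<open>The worst of the weights exp (\<plusminus> \<omega> / 2) over all indices; the
    inserted 1 keeps the minimum defined for an empty index set.\<close>
  define \<kappa> where "\<kappa> = Min (insert 1 ((\<lambda>j. exp (- \<bar>freq D j\<bar> / 2)) ` idx D))"
  have k0: "\<kappa> > 0" unfolding \<kappa>_def using fin_idx by auto
  have kj: "\<kappa> \<le> exp (- \<bar>freq D j\<bar> / 2)" if "j \<in> idx D" for j unfolding \<kappa>_def using fin_idx that by auto
  have "\<delta> * \<kappa> * m * (norm X)\<^sup>2 \<le> Re (tr D (X ** K_op D \<rho> X))"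
    if \<rho>: "\<rho> \<in> pos_states D" and m: "m > 0" "lb m \<rho>" and X: "X \<in> traceless D" for \<rho> m X
  proof -
    note r = pos_statesD[OF \<rho>] and X' = tracelessD[OF X]
    have th: "\<kappa> * m \<le> theta D j a b" if j: "j \<in> idx D" and "a \<in> spec \<rho>" "b \<in> spec \<rho>" for j a b
    proof -
      have ab: "m \<le> a" "m \<le> b" using lb_spec[OF m(2)] that by auto
      have "\<kappa> * m \<le> exp (freq D j / 2) * a" "\<kappa> * m \<le> exp (- freq D j / 2) * b"
        using k0 m ab by (intro mult_mono order.trans[OF kj[OF j]]; simp)+
      then have "\<kappa> * m \<le> min (exp (freq D j / 2) * a) (exp (- freq D j / 2) * b)" by simp
      also have "\<dots> \<le> theta D j a b" unfolding theta_def using m ab by (intro log_mean_ge_min) auto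
      finally show ?thesis .
    qed
    have "\<delta> * \<kappa> * m * (norm X)\<^sup>2 = (\<kappa> * m) * (\<delta> * (norm X)\<^sup>2)" by simp
    also have "\<dots> \<le> (\<kappa> * m) * (\<Sum>j\<in>idx D. Re (btr D j (adj (pderiv_op D j X) ** pderiv_op D j X)))"
      using d(2)[OF X] k0 m by (intro mult_left_mono) auto
    also have "\<dots> \<le> (\<Sum>j\<in>idx D. Re (Kform j \<rho> X X))"
      unfolding sum_distrib_left
    proof (rule sum_mono)
      fix j assume j: "j \<in> idx D"
      interpret p: dstruct_j D j by (rule J[OF j])
      show "\<kappa> * m * Re (btr D j (adj (p.d X) ** p.d X)) \<le> Re (Kform j \<rho> X X)"
        unfolding Kform_def using th[OF j] X' r by (intro p.dop_lower) auto
    qed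
    also have "\<dots> = Re (tr D (X ** K_op D \<rho> X))"
      using K_trace[OF r(1,2) X'(1) X'(1)] X'(2) by simp
    finally show ?thesis .
  qed
  then show ?thesis using d(1) k0 by (intro exI[of _ "\<delta> * \<kappa>"]) auto
qed

lemma pos_states_lb: "\<rho> \<in> pos_states D \<Longrightarrow> \<exists>m>0. lb m \<rho>"
  unfolding pos_states_def pos_def_lb by auto

lemma K_inj:
  assumes \<rho>: "\<rho> \<in> pos_states D" and X: "X \<in> traceless D" "K_op D \<rho> X = 0"
  shows "X = 0"
proof -
  obtain m where m: "m > 0" "lb m \<rho>" using pos_states_lb[OF \<rho>] by blast
  obtain \<kappa> where k: "\<kappa> > 0" "\<kappa> * m * (norm X)\<^sup>2 \<le> Re (tr D (X ** K_op D \<rho> X))"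
    using K_coercive \<rho> m X(1) by blast
  have "\<kappa> * m * (norm X)\<^sup>2 \<le> 0" using k(2) X(2) by simp
  then show ?thesis using k(1) m(1) by (simp add: mult_le_0_iff)
qed

lemma K_bij:
  assumes \<rho>: "\<rho> \<in> pos_states D" and y: "y \<in> traceless D"
  shows "\<exists>!X. X \<in> traceless D \<and> K_op D \<rho> X = y"
proof -
  note r = pos_statesD[OF \<rho>]
  have "\<exists>X\<in>traceless D. K_op D \<rho> X = y"
    by (rule subspace_endo_surj[OF traceless_subspace])
      (auto intro: K_inj[OF \<rho>] y simp: tracelessD K_add[OF r(1,2)] K_scaleR[OF r(1,2)] K_traceless[OF r(1,2)])
  then obtain X where X: "X \<in> traceless D" "K_op D \<rho> X = y" by blast
  have "Y = X" if Y: "Y \<in> traceless D" "K_op D \<rho> Y = y" for Y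
  proof -
    have "K_op D \<rho> (Y - X) = K_op D \<rho> Y - K_op D \<rho> X"
      using K_add[OF r(1,2), of "Y - X" X] X Y tracelessD by simp
    then have "Y - X = 0" using X Y by (intro K_inj[OF \<rho> subspace_diff[OF traceless_subspace]]) auto
    then show ?thesis by simp
  qed
  then show ?thesis using X by blast
qed

definition Kinv :: "complex^'n^'n \<Rightarrow> complex^'n^'n \<Rightarrow> complex^'n^'n" where
  "Kinv \<rho> y = (THE X. X \<in> traceless D \<and> K_op D \<rho> X = y)"

lemma Kinv:
  assumes "\<rho> \<in> pos_states D" "y \<in> traceless D"
  shows "Kinv \<rho> y \<in> traceless D" "K_op D \<rho> (Kinv \<rho> y) = y"
  using theI'[OF K_bij[OF assms]] unfolding Kinv_def by auto

lemma Kinv_unique: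
  assumes "\<rho> \<in> pos_states D" "X \<in> traceless D"
  shows "Kinv \<rho> (K_op D \<rho> X) = X"
proof -
  have "K_op D \<rho> X \<in> traceless D" using assms pos_statesD tracelessD by (intro K_traceless) auto
  with K_bij[OF assms(1) this] Kinv[OF assms(1) this] assms(2) show ?thesis by blast
qed

lemma Kinv_scaleR:
  assumes "\<rho> \<in> pos_states D" "y \<in> traceless D"
  shows "Kinv \<rho> (c *\<^sub>R y) = c *\<^sub>R Kinv \<rho> y"
proof -
  note k = Kinv[OF assms] and r = pos_statesD[OF assms(1)]
  have "K_op D \<rho> (c *\<^sub>R Kinv \<rho> y) = c *\<^sub>R y"
    using K_scaleR[OF r(1,2)] k tracelessD by simp
  moreover have "c *\<^sub>R Kinv \<rho> y \<in> traceless D" using k subspace_scale[OF traceless_subspace] by blast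
  ultimately show ?thesis using Kinv_unique[OF assms(1)] by metis
qed

text \<open>\<open>cost \<rho> y\<close> is \<open>g\<^sub>\<rho>(y, y)\<close>.\<close>

definition cost :: "complex^'n^'n \<Rightarrow> complex^'n^'n \<Rightarrow> real" where
  "cost \<rho> y = Re (tr D (Kinv \<rho> y ** y))"

lemma cost_nonneg:
  assumes "\<rho> \<in> pos_states D" "y \<in> traceless D"
  shows "0 \<le> cost \<rho> y"
proof -
  obtain m where m: "m > 0" "lb m \<rho>" using pos_states_lb[OF assms(1)] by blast
  obtain \<kappa> where k: "\<kappa> > 0" "\<kappa> * m * (norm (Kinv \<rho> y))\<^sup>2 \<le> Re (tr D (Kinv \<rho> y ** K_op D \<rho> (Kinv \<rho> y)))"
    using K_coercive assms(1) m Kinv[OF assms] by blast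
  have "0 \<le> \<kappa> * m * (norm (Kinv \<rho> y))\<^sup>2" using k m by simp
  then show ?thesis using k(2) unfolding cost_def by (simp add: Kinv[OF assms])
qed

lemma cost_scaleR:
  assumes "\<rho> \<in> pos_states D" "y \<in> traceless D"
  shows "cost \<rho> (c *\<^sub>R y) = c\<^sup>2 * cost \<rho> y"
  unfolding cost_def Kinv_scaleR[OF assms] using Kinv[OF assms] assms(2) tracelessD
  by (simp add: mm.scaleR_left mm.scaleR_right A.tr_scaleR power2_eq_square)

text \<open>For the potential X of y, coercivity gives \<kappa> m |X|^2 \<le> tr (X y) \<le> C |X|
  |y|. So the metric blows up at most like 1 / m towards singular states.\<close>

lemma cost_upper:
  "\<exists>C>0. \<forall>\<rho>\<in>pos_states D. \<forall>m>0. \<forall>y\<in>traceless D. lb m \<rho> \<longrightarrow> cost \<rho> y \<le> C * (norm y)\<^sup>2 / m"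
proof -
  obtain \<kappa> where k: "\<kappa> > 0" "\<And>\<rho> m X. \<rho> \<in> pos_states D \<Longrightarrow> m > 0 \<Longrightarrow> lb m \<rho> \<Longrightarrow> X \<in> traceless D \<Longrightarrow>
      \<kappa> * m * (norm X)\<^sup>2 \<le> Re (tr D (X ** K_op D \<rho> X))"
    using K_coercive by blast
  obtain C where C: "C > 0" "\<And>X Y. X \<in> alg D \<Longrightarrow> Y \<in> alg D \<Longrightarrow> \<bar>Re (tr D (X ** Y))\<bar> \<le> C * norm X * norm Y"
    using A.tr_norm_upper by blast
  have "cost \<rho> y \<le> (C\<^sup>2 / \<kappa>) * (norm y)\<^sup>2 / m"
    if \<rho>: "\<rho> \<in> pos_states D" and m: "m > 0" "lb m \<rho>" and y: "y \<in> traceless D" for \<rho> m y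
  proof -
    let ?X = "Kinv \<rho> y"
    note X = Kinv[OF \<rho> y]
    have "\<kappa> * m * (norm ?X)\<^sup>2 \<le> C * norm ?X * norm y"
      using k(2)[OF \<rho> m X(1)] C(2)[of ?X y] X y tracelessD by fastforce
    then have "norm ?X * (\<kappa> * m * norm ?X) \<le> norm ?X * (C * norm y)"
      by (simp add: power2_eq_square algebra_simps)
    then have "\<kappa> * m * norm ?X \<le> C * norm y"
      using C(1) by (cases "?X = 0") auto
    then have "norm ?X \<le> C * norm y / (\<kappa> * m)" using k(1) m(1) by (simp add: field_simps)
    then have "C * norm y * norm ?X \<le> C * norm y * (C * norm y / (\<kappa> * m))"
      using C(1) by (intro mult_left_mono) auto
    moreover have "cost \<rho> y \<le> C * norm ?X * norm y"
      unfolding cost_def using C(2)[of ?X y] X y tracelessD by fastforce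
    ultimately show ?thesis by (simp add: power2_eq_square algebra_simps)
  qed
  then show ?thesis using k(1) C(1) by (intro exI[of _ "C\<^sup>2 / \<kappa>"]) auto
qed

end

section \<open>Smooth dependence of the metric on the state\<close>

lemma integral_inverse_affine:
  assumes "0 < x" "0 < (y::real)"
  shows "((\<lambda>u. 1 / ((1 - u) * x + u * y)) has_integral 1 / log_mean x y) {0..1}"
proof (cases "x = y")
  case True
  have "((\<lambda>u. 1 / x) has_integral (1 / x)) {0..1::real}"
    using has_integral_const_real[of "1 / x" 0 1] by simp
  moreover have "1 / ((1 - u) * x + u * y) = 1 / x" for u using True by (simp add: algebra_simps)
  ultimately show ?thesis using True assms by (simp add: log_mean_def)
next
  case False
  have pos: "0 < (1 - u) * x + u * y" if "u \<in> {0..1}" for u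
    using that assms by (cases "u = 0") (auto intro: add_nonneg_pos)
  have "((\<lambda>u. 1 / ((1 - u) * x + u * y)) has_integral
     (ln ((1 - 1) * x + 1 * y) / (y - x) - ln ((1 - 0) * x + 0 * y) / (y - x))) {0..1}"
  proof (rule fundamental_theorem_of_calculus)
    fix u :: real assume u: "u \<in> {0..1}"
    have "((\<lambda>u. ln ((1 - u) * x + u * y)) has_real_derivative (y - x) / ((1 - u) * x + u * y)) (at u)"
      using pos[OF u] by (auto intro!: derivative_eq_intros simp: divide_inverse algebra_simps)
    from DERIV_cdivide[OF this, of "y - x"] False
    have "((\<lambda>u. ln ((1 - u) * x + u * y) / (y - x)) has_real_derivative 1 / ((1 - u) * x + u * y)) (at u)"
      by simp
    then show "((\<lambda>u. ln ((1 - u) * x + u * y) / (y - x)) has_vector_derivative 1 / ((1 - u) * x + u * y)) (at u within {0..1})"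
      by (simp add: has_real_derivative_iff_has_vector_derivative has_vector_derivative_at_within)
  qed simp
  moreover have "ln y / (y - x) - ln x / (y - x) = 1 / log_mean x y"
    using False assms unfolding log_mean_def
    by (simp add: diff_divide_distrib[symmetric]) (metis minus_diff_eq minus_divide_divide)
  ultimately show ?thesis by simp
qed

lemma inner_projection_left:
  fixes P Y :: "complex^'n^'n"
  assumes "adj P = P" "P ** P = P"
  shows "Y \<bullet> (P ** Y) = (norm (P ** Y))\<^sup>2" "Y \<bullet> (Y ** P) = (norm (Y ** P))\<^sup>2"
proof -
  have "Y \<bullet> (P ** Y) = Y \<bullet> (P ** (P ** Y))" using assms(2) by (simp add: matrix_mul_assoc)
  then show "Y \<bullet> (P ** Y) = (norm (P ** Y))\<^sup>2" using assms(1) by (simp add: inner_mm_left[of Y] power2_norm_eq_inner)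
  have "Y \<bullet> (Y ** P) = Y \<bullet> (Y ** P ** P)" using assms(2) by (simp add: matrix_mul_assoc[symmetric])
  then show "Y \<bullet> (Y ** P) = (norm (Y ** P))\<^sup>2" using assms(1) by (simp add: inner_mm_right[of Y] power2_norm_eq_inner)
qed

context dstruct_j
begin

definition pl :: "complex^'n^'n \<Rightarrow> complex^'m^'m" where
  "pl \<rho> = exp (freq D j / 2) *\<^sub>R l \<rho> + (mat 1 - bunit D j)"

definition pr :: "complex^'n^'n \<Rightarrow> complex^'m^'m" where
  "pr \<rho> = exp (- freq D j / 2) *\<^sub>R r \<rho> + (mat 1 - bunit D j)"

text \<open>The inverse of the logarithmic mean of \<open>x\<close> and \<open>y\<close> is the integral of \<open>1 / ((1 - u) x + u y)\<close> over the
  unit interval. Hence the inverse of the hat multiplication is the integral over \<open>u\<close> of the inverses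
  of the operators \<open>mix \<rho> u\<close>, which are affine in \<open>\<rho>\<close>: this gives smoothness in \<open>\<rho>\<close>. The complement of
  the unit of \<open>B\<close> is added to make them invertible on all matrices.\<close>

definition mix :: "complex^'n^'n \<Rightarrow> real \<Rightarrow> complex^'m^'m \<Rightarrow> complex^'m^'m" where
  "mix \<rho> u Y = (1 - u) *\<^sub>R (pl \<rho> ** Y) + u *\<^sub>R (Y ** pr \<rho>)"

lemma linear_mix: "linear (mix \<rho> u)"
  unfolding mix_def
  by (intro linearI) (simp_all add: mm.add_left mm.add_right mm.scaleR_left mm.scaleR_right algebra_simps)

context
  fixes \<rho> assumes \<rho>: "\<rho> \<in> pos_states D"
begin

lemma complement: "adj (mat 1 - bunit D j) = mat 1 - bunit D j"
  "(mat 1 - bunit D j) ** (mat 1 - bunit D j) = mat 1 - bunit D j"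
  by (auto simp: adj_diff B.adj_e mm.diff_left mm.diff_right B.unit)

lemma sum_ep: "(\<Sum>a\<in>spec \<rho>. l (eproj \<rho> a)) = bunit D j" "(\<Sum>a\<in>spec \<rho>. r (eproj \<rho> a)) = bunit D j"
  using l_fcalc[OF pos_statesD(1,2)[OF \<rho>], of "\<lambda>_. 1"] r_fcalc[OF pos_statesD(1,2)[OF \<rho>], of "\<lambda>_. 1"]
  by (simp_all add: fcalc_one[OF pos_statesD(2)[OF \<rho>]] l r)

lemma inner_pl_pos:
  fixes Y :: "complex^'m^'m"
  assumes "Y \<noteq> 0"
  shows "0 < Y \<bullet> (pl \<rho> ** Y)"
proof -
  note rr = pos_statesD[OF \<rho>]
  have "l \<rho> = (\<Sum>a\<in>spec \<rho>. a *\<^sub>R l (eproj \<rho> a))"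
    using l_fcalc[OF rr(1,2), of "\<lambda>a. a"] by (simp add: fcalc_id[OF rr(2)])
  then have eq: "Y \<bullet> (pl \<rho> ** Y) = exp (freq D j / 2) * (\<Sum>a\<in>spec \<rho>. a * (norm (l (eproj \<rho> a) ** Y))\<^sup>2)
      + (norm ((mat 1 - bunit D j) ** Y))\<^sup>2"
    unfolding pl_def
    by (simp add: mm.add_left mm.scaleR_left mm.sum_left inner_add_right inner_sum_right
        inner_projection_left ep_adj[OF rr(1,2)] ep_mult[OF rr(1,2)] complement)
  have nn: "0 \<le> (\<Sum>a\<in>spec \<rho>. a * (norm (l (eproj \<rho> a) ** Y))\<^sup>2)"
    using rr(4) by (intro sum_nonneg mult_nonneg_nonneg) (auto intro: less_imp_le)
  have "Y \<bullet> (pl \<rho> ** Y) \<noteq> 0"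
  proof
    assume "Y \<bullet> (pl \<rho> ** Y) = 0"
    then have z: "exp (freq D j / 2) * (\<Sum>a\<in>spec \<rho>. a * (norm (l (eproj \<rho> a) ** Y))\<^sup>2) = 0"
      "(norm ((mat 1 - bunit D j) ** Y))\<^sup>2 = 0"
      unfolding eq using nn by (subst (asm) add_nonneg_eq_0_iff; simp)+
    then have "\<forall>a\<in>spec \<rho>. a * (norm (l (eproj \<rho> a) ** Y))\<^sup>2 = 0"
      using rr(4) finite_spec[OF rr(2)] by (simp, subst (asm) sum_nonneg_eq_0_iff) (auto simp: zero_le_mult_iff dest!: rr(4))
    then have "\<forall>a\<in>spec \<rho>. l (eproj \<rho> a) ** Y = 0" using rr(4) by fastforce
    then have "bunit D j ** Y = 0" unfolding sum_ep(1)[symmetric] by (simp add: mm.sum_left)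
    then have "Y = 0" using z(2) by (simp add: mm.diff_left)
    then show False using assms by simp
  qed
  moreover have "0 \<le> Y \<bullet> (pl \<rho> ** Y)" unfolding eq using nn by simp
  ultimately show ?thesis by simp
qed

lemma inner_pr_pos:
  fixes Y :: "complex^'m^'m"
  assumes "Y \<noteq> 0"
  shows "0 < Y \<bullet> (Y ** pr \<rho>)"
proof -
  note rr = pos_statesD[OF \<rho>]
  have "r \<rho> = (\<Sum>a\<in>spec \<rho>. a *\<^sub>R r (eproj \<rho> a))"
    using r_fcalc[OF rr(1,2), of "\<lambda>a. a"] by (simp add: fcalc_id[OF rr(2)])
  then have eq: "Y \<bullet> (Y ** pr \<rho>) = exp (- freq D j / 2) * (\<Sum>a\<in>spec \<rho>. a * (norm (Y ** r (eproj \<rho> a)))\<^sup>2)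
      + (norm (Y ** (mat 1 - bunit D j)))\<^sup>2"
    unfolding pr_def
    by (simp add: mm.add_right mm.scaleR_right mm.sum_right inner_add_right inner_sum_right
        inner_projection_left ep_adj[OF rr(1,2)] ep_mult[OF rr(1,2)] complement)
  have nn: "0 \<le> (\<Sum>a\<in>spec \<rho>. a * (norm (Y ** r (eproj \<rho> a)))\<^sup>2)"
    using rr(4) by (intro sum_nonneg mult_nonneg_nonneg) (auto intro: less_imp_le)
  have "Y \<bullet> (Y ** pr \<rho>) \<noteq> 0"
  proof
    assume "Y \<bullet> (Y ** pr \<rho>) = 0"
    then have z: "exp (- freq D j / 2) * (\<Sum>a\<in>spec \<rho>. a * (norm (Y ** r (eproj \<rho> a)))\<^sup>2) = 0"
      "(norm (Y ** (mat 1 - bunit D j)))\<^sup>2 = 0"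
      unfolding eq using nn by (subst (asm) add_nonneg_eq_0_iff; simp)+
    then have "\<forall>a\<in>spec \<rho>. a * (norm (Y ** r (eproj \<rho> a)))\<^sup>2 = 0"
      using rr(4) finite_spec[OF rr(2)] by (simp, subst (asm) sum_nonneg_eq_0_iff) (auto simp: zero_le_mult_iff dest!: rr(4))
    then have "\<forall>a\<in>spec \<rho>. Y ** r (eproj \<rho> a) = 0" using rr(4) by fastforce
    then have "Y ** bunit D j = 0" unfolding sum_ep(2)[symmetric] by (simp add: mm.sum_right)
    then have "Y = 0" using z(2) by (simp add: mm.diff_right)
    then show False using assms by simp
  qed
  moreover have "0 \<le> Y \<bullet> (Y ** pr \<rho>)" unfolding eq using nn by simp
  ultimately show ?thesis by simp
qed

lemma inner_mix_pos:
  assumes "Y \<noteq> 0" "u \<in> {0..1}"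
  shows "0 < Y \<bullet> mix \<rho> u Y"
proof -
  have "Y \<bullet> mix \<rho> u Y = (1 - u) * (Y \<bullet> (pl \<rho> ** Y)) + u * (Y \<bullet> (Y ** pr \<rho>))"
    unfolding mix_def by (simp add: inner_add_right)
  moreover have "0 < \<dots>"
    using inner_pl_pos[OF assms(1)] inner_pr_pos[OF assms(1)] assms(2)
    by (cases "u = 0") (auto intro: add_nonneg_pos)
  ultimately show ?thesis by simp
qed

lemma mix_inj: "u \<in> {0..1} \<Longrightarrow> mix \<rho> u Y = 0 \<Longrightarrow> Y = 0"
  using inner_mix_pos[of Y u] by fastforce

lemma mix_surj:
  assumes "u \<in> {0..1}"
  shows "\<exists>Y. mix \<rho> u Y = C"
proof -
  have "inj (mix \<rho> u)" using mix_inj[OF assms] linear_injective_0[OF linear_mix] by blast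
  then have "surj (mix \<rho> u)" by (rule linear_inj_imp_surj[OF linear_mix])
  then show ?thesis by (metis surjD)
qed

end

definition imix :: "complex^'n^'n \<Rightarrow> real \<Rightarrow> complex^'m^'m \<Rightarrow> complex^'m^'m" where
  "imix \<rho> u C = (SOME Y. mix \<rho> u Y = C)"

lemma mix_imix: "\<rho> \<in> pos_states D \<Longrightarrow> u \<in> {0..1} \<Longrightarrow> mix \<rho> u (imix \<rho> u C) = C"
  unfolding imix_def by (rule someI_ex[OF mix_surj])

lemma imix_eqI:
  assumes "\<rho> \<in> pos_states D" "u \<in> {0..1}" "mix \<rho> u Y = C"
  shows "imix \<rho> u C = Y"
proof -
  have "mix \<rho> u (imix \<rho> u C - Y) = 0"
    using mix_imix[OF assms(1,2), of C] assms(3) by (simp add: linear_diff[OF linear_mix])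
  then have "imix \<rho> u C - Y = 0" by (rule mix_inj[OF assms(1,2)])
  then show ?thesis by simp
qed

lemma imix_dop:
  assumes \<rho>: "\<rho> \<in> pos_states D" and u: "u \<in> {0..1}" and C: "C \<in> B"
  shows "imix \<rho> u C = dop j \<rho> (\<lambda>a b. 1 / ((1 - u) * (exp (freq D j / 2) * a) + u * (exp (- freq D j / 2) * b))) C"
proof (rule imix_eqI[OF \<rho> u])
  note rr = pos_statesD[OF \<rho>]
  let ?g = "\<lambda>a b. 1 / ((1 - u) * (exp (freq D j / 2) * a) + u * (exp (- freq D j / 2) * b))"
  let ?Y = "dop j \<rho> ?g C"
  have Y: "?Y \<in> B" using C rr by (intro dop_mem) auto
  have "pl \<rho> ** ?Y = exp (freq D j / 2) *\<^sub>R (l \<rho> ** ?Y)" "?Y ** pr \<rho> = exp (- freq D j / 2) *\<^sub>R (?Y ** r \<rho>)"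
    unfolding pl_def pr_def using Y
    by (simp_all add: mm.add_left mm.add_right mm.scaleR_left mm.scaleR_right mm.diff_left mm.diff_right B.unit)
  then have "mix \<rho> u ?Y = ((1 - u) * exp (freq D j / 2)) *\<^sub>R dop j \<rho> (\<lambda>a b. a) ?Y + (u * exp (- freq D j / 2)) *\<^sub>R dop j \<rho> (\<lambda>a b. b) ?Y"
    unfolding mix_def using dop_left[OF rr(1,2) Y, of "\<lambda>a. a"] dop_right[OF rr(1,2) Y, of "\<lambda>a. a"]
    by (simp add: fcalc_id[OF rr(2)])
  also have "\<dots> = dop j \<rho> (\<lambda>a b. ((1 - u) * exp (freq D j / 2)) * a + (u * exp (- freq D j / 2)) * b) ?Y"
    by (simp only: dop_add[OF rr(1,2)] dop_scale[OF rr(1,2)])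
  also have "\<dots> = dop j \<rho> (\<lambda>a b. (((1 - u) * exp (freq D j / 2)) * a + (u * exp (- freq D j / 2)) * b) * ?g a b) C"
    by (rule dop_dop[OF rr(1,2) C])
  also have "\<dots> = dop j \<rho> (\<lambda>a b. 1) C"
  proof (rule dop_cong[OF rr(1,2)])
    fix a b assume "a \<in> spec \<rho>" "b \<in> spec \<rho>"
    then have "0 < a" "0 < b" using rr(4) by auto
    then have "0 < (1 - u) * (exp (freq D j / 2) * a) + u * (exp (- freq D j / 2) * b)"
      using u by (cases "u = 0") (auto intro: add_nonneg_pos)
    then show "(((1 - u) * exp (freq D j / 2)) * a + (u * exp (- freq D j / 2)) * b) * ?g a b = 1"
      by (simp add: mult.assoc)
  qed
  also have "\<dots> = C" using dop_one[OF rr(1,2) C, of 1] by simp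
  finally show "mix \<rho> u ?Y = C" .
qed

text \<open>Both maps act block by block: the integral contributes the reciprocal of the logarithmic
  mean, the hat multiplication the mean itself.\<close>

lemma integral_imix_hat:
  assumes \<rho>: "\<rho> \<in> pos_states D" and C: "C \<in> B"
  shows "integral {0..1} (\<lambda>u. imix \<rho> u (dop j \<rho> (theta D j) C)) = C"
proof (rule integral_unique)
  note rr = pos_statesD[OF \<rho>]
  let ?x = "\<lambda>a. exp (freq D j / 2) * a" and ?y = "\<lambda>b. exp (- freq D j / 2) * b"
  let ?g = "\<lambda>u a b. 1 / ((1 - u) * ?x a + u * ?y b)"
  let ?E = "\<lambda>a b. l (eproj \<rho> a) ** C ** r (eproj \<rho> b)"
  have "((\<lambda>u. \<Sum>a\<in>spec \<rho>. \<Sum>b\<in>spec \<rho>. ?g u a b *\<^sub>R (theta D j a b *\<^sub>R ?E a b)) has_integral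
      (\<Sum>a\<in>spec \<rho>. \<Sum>b\<in>spec \<rho>. (1 / log_mean (?x a) (?y b)) *\<^sub>R (theta D j a b *\<^sub>R ?E a b))) {0..1}"
  proof (intro has_integral_sum finite_spec[OF rr(2)] has_integral_scaleR_left)
    fix a b assume "a \<in> spec \<rho>" "b \<in> spec \<rho>"
    then show "((\<lambda>u. ?g u a b) has_integral 1 / log_mean (?x a) (?y b)) {0..1}"
      using rr(4) by (intro integral_inverse_affine) auto
  qed
  moreover have "(\<Sum>a\<in>spec \<rho>. \<Sum>b\<in>spec \<rho>. (1 / log_mean (?x a) (?y b)) *\<^sub>R (theta D j a b *\<^sub>R ?E a b)) = dop j \<rho> (\<lambda>a b. 1) C"
    unfolding dop_def
  proof (intro sum.cong refl)
    fix a b assume "a \<in> spec \<rho>" "b \<in> spec \<rho>"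
    then have "0 < ?x a" "0 < ?y b" using rr(4) by auto
    then have "0 < log_mean (?x a) (?y b)" using log_mean_ge_min by (metis less_le_trans min_less_iff_conj)
    then show "(1 / log_mean (?x a) (?y b)) *\<^sub>R (theta D j a b *\<^sub>R ?E a b) = 1 *\<^sub>R ?E a b"
      unfolding theta_def by simp
  qed
  moreover have "dop j \<rho> (\<lambda>a b. 1) C = C" using dop_one[OF rr(1,2) C, of 1] by simp
  ultimately have h: "((\<lambda>u. \<Sum>a\<in>spec \<rho>. \<Sum>b\<in>spec \<rho>. ?g u a b *\<^sub>R (theta D j a b *\<^sub>R ?E a b)) has_integral C) {0..1}"
    by simp
  show "((\<lambda>u. imix \<rho> u (dop j \<rho> (theta D j) C)) has_integral C) {0..1}"
  proof (rule has_integral_eq[OF _ h])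
    fix u :: real assume u: "u \<in> {0..1}"
    have W: "dop j \<rho> (theta D j) C \<in> B" using C rr by (intro dop_mem) auto
    show "(\<Sum>a\<in>spec \<rho>. \<Sum>b\<in>spec \<rho>. ?g u a b *\<^sub>R (theta D j a b *\<^sub>R ?E a b)) = imix \<rho> u (dop j \<rho> (theta D j) C)"
      unfolding imix_dop[OF \<rho> u W] dop_dop[OF rr(1,2) C] by (simp add: dop_def)
  qed
qed

lemma lr_linear_ext: "\<exists>T. bounded_linear T \<and> (\<forall>X\<in>alg D. l X = T X)" "\<exists>T. bounded_linear T \<and> (\<forall>X\<in>alg D. r X = T X)"
  using linear_extension[OF A.sub, of l] linear_extension[OF A.sub, of r] l(2) r(2) l_scaleR r_scaleR
    linear_conv_bounded_linear by metis+

context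
  fixes \<rho> :: "real \<Rightarrow> complex^'n^'n"
  assumes \<rho>: "\<And>t. t \<in> {0..1} \<Longrightarrow> \<rho> t \<in> pos_states D" and Ck\<rho>: "\<And>k. Ck k (\<lambda>t u. \<rho> t)"
begin

lemma Ck_mix: "Ck k (\<lambda>t u. mix (\<rho> t) u Y)"
proof -
  obtain L where L: "bounded_linear L" "\<And>X. X \<in> alg D \<Longrightarrow> l X = L X" using lr_linear_ext(1) by blast
  obtain R where R: "bounded_linear R" "\<And>X. X \<in> alg D \<Longrightarrow> r X = R X" using lr_linear_ext(2) by blast
  have pl: "Ck k (\<lambda>t u. pl (\<rho> t))"
    by (rule Ck_cong[of k "\<lambda>t u. exp (freq D j / 2) *\<^sub>R L (\<rho> t) + (mat 1 - bunit D j)"])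
      (auto simp: pl_def L(2) pos_statesD(1)[OF \<rho>] intro!: Ck_add Ck_scaleR Ck_const Ck_bounded_linear[OF L(1)] Ck\<rho>)
  have pr: "Ck k (\<lambda>t u. pr (\<rho> t))"
    by (rule Ck_cong[of k "\<lambda>t u. exp (- freq D j / 2) *\<^sub>R R (\<rho> t) + (mat 1 - bunit D j)"])
      (auto simp: pr_def R(2) pos_statesD(1)[OF \<rho>] intro!: Ck_add Ck_scaleR Ck_const Ck_bounded_linear[OF R(1)] Ck\<rho>)
  show ?thesis unfolding mix_def
    by (intro Ck_add Ck_scaleR Ck_diff Ck_const Ck_snd Ck_bilinear[OF mm.bounded_bilinear_axioms] pl pr)
qed

lemma Ck_imix: "Ck k (\<lambda>t u. imix (\<rho> t) u C)"
  by (rule Ck_solve[of "\<lambda>t u. mix (\<rho> t) u", OF linear_mix Ck_mix Ck_const[of k C]])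
    (auto intro: mix_inj[OF \<rho>] mix_imix[OF \<rho>])

lemma imix_cont: "t \<in> {0..1} \<Longrightarrow> continuous_on {0..1} (\<lambda>u. imix (\<rho> t) u C)"
proof -
  assume t: "t \<in> {0..1}"
  have "continuous_on {0..1} (\<lambda>u::real. (t, u))" by (intro continuous_intros)
  from continuous_on_compose2[OF Ck_cont[OF Ck_imix[of 0 C]] this] show ?thesis
    using t by (simp add: image_subset_iff)
qed

text \<open>The solution principle is used twice: to invert the affine operators, giving
  \<open>imix\<close>, and to invert the integral of \<open>imix\<close> over u, giving the hat
  multiplication.\<close>

lemma Ck_hat:
  assumes C: "C \<in> B"
  shows "Ck k (\<lambda>t u. dop j (\<rho> t) (theta D j) C)"
proof (rule Ck_solve[of "\<lambda>t u C. integral {0..1} (\<lambda>u. imix (\<rho> t) u C)", OF _ Ck_integral[OF Ck_imix] Ck_const[of k C]])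
  fix t assume t: "t \<in> {0..1::real}"
  note cont = imix_cont[OF t]
  have int: "(\<lambda>u. imix (\<rho> t) u C) integrable_on {0..1}" for C
    using cont by (rule integrable_continuous_real)
  show "linear (\<lambda>C. integral {0..1} (\<lambda>u. imix (\<rho> t) u C))"
  proof (rule linearI)
    fix C C' :: "complex^'m^'m"
    have "integral {0..1} (\<lambda>u. imix (\<rho> t) u (C + C')) = integral {0..1} (\<lambda>u. imix (\<rho> t) u C + imix (\<rho> t) u C')"
      by (rule integral_cong) (rule imix_eqI[OF \<rho>[OF t]], auto simp: linear_add[OF linear_mix] mix_imix[OF \<rho>[OF t]])
    then show "integral {0..1} (\<lambda>u. imix (\<rho> t) u (C + C')) = integral {0..1} (\<lambda>u. imix (\<rho> t) u C) + integral {0..1} (\<lambda>u. imix (\<rho> t) u C')"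
      using int by (simp add: integral_add)
  next
    fix c and C :: "complex^'m^'m"
    have "integral {0..1} (\<lambda>u. imix (\<rho> t) u (c *\<^sub>R C)) = integral {0..1} (\<lambda>u. c *\<^sub>R imix (\<rho> t) u C)"
      by (rule integral_cong) (rule imix_eqI[OF \<rho>[OF t]], auto simp: linear_scale[OF linear_mix] mix_imix[OF \<rho>[OF t]])
    then show "integral {0..1} (\<lambda>u. imix (\<rho> t) u (c *\<^sub>R C)) = c *\<^sub>R integral {0..1} (\<lambda>u. imix (\<rho> t) u C)"
      by simp
  qed
  show "C = 0" if z: "integral {0..1} (\<lambda>u. imix (\<rho> t) u C) = 0" for C :: "complex^'m^'m"
  proof -
    \<comment> \<open>Pairing with \<open>C\<close> makes the integrand the quadratic form of
      \<open>mix\<close> at \<open>imix\<close>, which is nonnegative and continuous. A vanishing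
      integral thus makes it vanish at every u, in particular at u = 0.\<close>
    have eq: "C \<bullet> imix (\<rho> t) u C = imix (\<rho> t) u C \<bullet> mix (\<rho> t) u (imix (\<rho> t) u C)" if "u \<in> {0..1}" for u
      by (simp add: mix_imix[OF \<rho>[OF t] that] inner_commute)
    have nn: "0 \<le> C \<bullet> imix (\<rho> t) u C" if "u \<in> {0..1}" for u
      unfolding eq[OF that] using inner_mix_pos[OF \<rho>[OF t] _ that] by (cases "imix (\<rho> t) u C = 0") (auto intro: less_imp_le)
    have "integral {0..1} (\<lambda>u. C \<bullet> imix (\<rho> t) u C) = C \<bullet> integral {0..1} (\<lambda>u. imix (\<rho> t) u C)"
      using integral_linear[OF int bounded_linear_inner_right[of C]] by (simp add: o_def)
    then have "integral {0..1} (\<lambda>u. C \<bullet> imix (\<rho> t) u C) = 0" using z by simp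
    moreover have "continuous_on {0..1} (\<lambda>u. C \<bullet> imix (\<rho> t) u C)"
      by (intro continuous_on_inner continuous_on_const cont)
    ultimately have "\<forall>u\<in>{0..1}. C \<bullet> imix (\<rho> t) u C = 0"
      using integral_eq_0_iff[of 0 1 "\<lambda>u. C \<bullet> imix (\<rho> t) u C"] nn by simp
    then have "C \<bullet> imix (\<rho> t) 0 C = 0" by simp
    then have "imix (\<rho> t) 0 C = 0" using eq[of 0] inner_mix_pos[OF \<rho>[OF t], of "imix (\<rho> t) 0 C" 0] by fastforce
    then show "C = 0" using mix_imix[OF \<rho>[OF t], of 0 C] by (simp add: linear_0[OF linear_mix])
  qed
  show "integral {0..1} (\<lambda>u. imix (\<rho> t) u (dop j (\<rho> t) (theta D j) C)) = C"
    by (rule integral_imix_hat[OF \<rho>[OF t] C])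
qed

end

end

context dstruct_erg
begin

text \<open>\<open>K_op\<close> is invertible on traceless elements only. Composed with a linear
  projection \<open>P\<close> onto them and completed by \<open>x - P x\<close>, it becomes
  injective on all matrices, as the solution principle requires.\<close>

lemma Kinv_smooth:
  assumes \<rho>: "\<And>t. t \<in> {0..1} \<Longrightarrow> \<rho> t \<in> pos_states D" and Ck\<rho>: "\<And>k. Ck k (\<lambda>t u. \<rho> t)"
    and y: "\<And>t. t \<in> {0..1} \<Longrightarrow> y t \<in> traceless D" and Cky: "\<And>k. Ck k (\<lambda>t u. y t)"
  shows "Ck k (\<lambda>t u. Kinv (\<rho> t) (y t))"
proof -
  obtain T where T: "\<And>j. j \<in> idx D \<Longrightarrow> bounded_linear (T j)"
    "\<And>j X. j \<in> idx D \<Longrightarrow> X \<in> balg D j \<Longrightarrow> pderiv_adj D j X = T j X" using d'_linear_ext by metis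
  have CkK: "Ck k (\<lambda>t u. K_op D (\<rho> t) X)" if X: "X \<in> alg D" for X k
  proof (rule Ck_cong[of k "\<lambda>t u. \<Sum>j\<in>idx D. T j (dop j (\<rho> t) (theta D j) (pderiv_op D j X))"])
    show "Ck k (\<lambda>t u. \<Sum>j\<in>idx D. T j (dop j (\<rho> t) (theta D j) (pderiv_op D j X)))"
    proof (rule Ck_sum, rule Ck_bounded_linear[OF T(1)])
      fix j assume j: "j \<in> idx D"
      interpret p: dstruct_j D j by (rule J[OF j])
      show "Ck k (\<lambda>t u. dop j (\<rho> t) (theta D j) (p.d X))" using X by (intro p.Ck_hat[OF \<rho> Ck\<rho>]) auto
    qed
    fix t :: real assume t: "t \<in> {0..1}"
    note rr = pos_statesD[OF \<rho>[OF t]]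
    show "K_op D (\<rho> t) X = (\<Sum>j\<in>idx D. T j (dop j (\<rho> t) (theta D j) (pderiv_op D j X)))"
      unfolding K_alt[OF rr(1,2)] by (intro sum.cong refl T(2) hat_mem[OF rr(1,2)] X)
  qed
  have "\<exists>g. g ` UNIV \<subseteq> traceless D \<and> linear g \<and> (\<forall>v\<in>traceless D. g (id v) = v)"
    by (rule linear_exists_left_inverse_on[OF linear_id traceless_subspace]) simp
  then obtain P where P: "\<And>x. P x \<in> traceless D" "linear P" "\<And>x. x \<in> traceless D \<Longrightarrow> P x = x" by auto
  show ?thesis
  proof (rule Ck_solve[of "\<lambda>t u x. K_op D (\<rho> t) (P x) + (x - P x)", OF _ _ Cky])
    show "Ck k (\<lambda>t u. K_op D (\<rho> t) (P b) + (b - P b))" for b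
      by (intro Ck_add CkK Ck_const) (use P(1) tracelessD in blast)
    fix t :: real assume t: "t \<in> {0..1}"
    note rr = pos_statesD[OF \<rho>[OF t]]
    have Pm: "P x \<in> alg D" "adj (P x) = P x" for x using P(1) tracelessD by blast+
    show "linear (\<lambda>x. K_op D (\<rho> t) (P x) + (x - P x))"
      by (rule linearI) (simp_all add: linear_add[OF P(2)] linear_scale[OF P(2)] K_add[OF rr(1,2)] K_scaleR[OF rr(1,2)] Pm scaleR_add_right scaleR_diff_right)
    show "K_op D (\<rho> t) (P (Kinv (\<rho> t) (y t))) + (Kinv (\<rho> t) (y t) - P (Kinv (\<rho> t) (y t))) = y t"
      using Kinv[OF \<rho>[OF t] y[OF t]] by (simp add: P(3))
    fix x assume z: "K_op D (\<rho> t) (P x) + (x - P x) = 0"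
    have Km: "K_op D (\<rho> t) (P x) \<in> traceless D" using Pm by (intro K_traceless[OF rr(1,2)])
    have "P (K_op D (\<rho> t) (P x) + (x - P x)) = K_op D (\<rho> t) (P x)"
      by (simp add: linear_add[OF P(2)] linear_diff[OF P(2)] P(3)[OF Km] P(3)[OF P(1)])
    then have "K_op D (\<rho> t) (P x) = 0" using z by (simp add: linear_0[OF P(2)])
    moreover from this have "P x = 0" by (rule K_inj[OF \<rho>[OF t] P(1)])
    ultimately show "x = 0" using z by simp
  qed
qed

end

section \<open>Curves and the transport distance\<close>

lemma real_le_mult_eps:
  assumes "\<And>\<epsilon>. 0 < \<epsilon> \<Longrightarrow> a \<le> (1 + \<epsilon>) * (b::real)"
  shows "a \<le> b"
proof (rule field_le_epsilon)
  fix e :: real assume e: "0 < e"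
  have "a \<le> (1 + e / (\<bar>b\<bar> + 1)) * b" using e by (intro assms) (auto intro: divide_pos_pos)
  also have "\<dots> = b + e * (b / (\<bar>b\<bar> + 1))" by (simp add: algebra_simps)
  also have "\<dots> \<le> b + e * 1" using e by (intro add_left_mono mult_left_mono) (auto simp: field_simps)
  finally show "a \<le> b + e" by simp
qed

lemma smooth_affine:
  fixes G :: "nat \<Rightarrow> real \<Rightarrow> real"
  assumes "\<And>k s. (G k has_real_derivative G (Suc k) s) (at s)"
  shows "Ck k (\<lambda>t u. G 0 (c * t + d))"
proof (rule smooth01_Ck)
  have "((\<lambda>t. c ^ k * G k (c * t + d)) has_vector_derivative c ^ Suc k * G (Suc k) (c * t + d)) (at t within {0..1})" for k t
  proof -
    have "((\<lambda>t. G k (c * t + d)) has_real_derivative G (Suc k) (c * t + d) * c) (at t)"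
      by (rule DERIV_chain2[OF assms]) (auto intro!: derivative_eq_intros)
    from DERIV_cmult[OF this, of "c ^ k"]
    show ?thesis
      by (simp add: has_real_derivative_iff_has_vector_derivative has_vector_derivative_at_within mult.commute mult.left_commute mult.assoc)
  qed
  then show "smooth01 (\<lambda>t. G 0 (c * t + d))"
    unfolding smooth01_def by (intro exI[of _ "\<lambda>k t. c ^ k * G k (c * t + d)"]) auto
qed

lemma has_vector_derivative_compose_01:
  fixes f :: "real \<Rightarrow> 'a::real_normed_vector"
  assumes f: "\<And>t. t \<in> {0..1} \<Longrightarrow> (f has_vector_derivative f' t) (at t within {0..1})"
    and \<phi>: "(\<phi> has_real_derivative p) (at s)" and im: "\<And>s. \<phi> s \<in> {0..1}"
  shows "((\<lambda>s. f (\<phi> s)) has_vector_derivative p *\<^sub>R f' (\<phi> s)) (at s within S)"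
proof -
  have "(f has_derivative (\<lambda>x. x *\<^sub>R f' (\<phi> s))) (at (\<phi> s) within \<phi> ` S)"
    using has_vector_derivative_within_subset[OF f[OF im], of "\<phi> ` S"] im
    unfolding has_vector_derivative_def by blast
  moreover have "(\<phi> has_vector_derivative p) (at s within S)"
    using \<phi> by (simp add: has_real_derivative_iff_has_vector_derivative has_vector_derivative_at_within)
  ultimately show ?thesis using vector_derivative_diff_chain_within[of \<phi> p s S f] by (simp add: o_def)
qed

context dstruct_erg
begin

lemma pos_states_diff: "\<rho> \<in> pos_states D \<Longrightarrow> \<rho>' \<in> pos_states D \<Longrightarrow> \<rho> - \<rho>' \<in> traceless D"
  using pos_statesD(1-3) unfolding traceless_def by (simp add: adj_diff A.tr_diff)

lemma pos_statesI: "\<rho> \<in> alg D \<Longrightarrow> adj \<rho> = \<rho> \<Longrightarrow> tr D \<rho> = 1 \<Longrightarrow> 0 < m \<Longrightarrow> lb m \<rho> \<Longrightarrow> \<rho> \<in> pos_states D"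
  unfolding pos_states_def pos_def_lb by auto

text \<open>Records a path and its velocity instead of its potential: at positive states each
  determines the other, and velocities are easier to compute for explicit paths. Smoothness of the
  velocity follows from that of the path.\<close>

definition curve :: "complex^'n^'n \<Rightarrow> complex^'n^'n \<Rightarrow> (real \<Rightarrow> complex^'n^'n) \<Rightarrow> (real \<Rightarrow> complex^'n^'n) \<Rightarrow> bool" where
  "curve a b \<rho> \<rho>' \<longleftrightarrow> (\<forall>k. Ck k (\<lambda>t u. \<rho> t)) \<and> (\<forall>t\<in>{0..1}. \<rho> t \<in> pos_states D) \<and>
     (\<forall>t\<in>{0..1}. (\<rho> has_vector_derivative \<rho>' t) (at t within {0..1})) \<and> \<rho> 0 = a \<and> \<rho> 1 = b"

context
  fixes a b \<rho> \<rho>' assumes p: "curve a b \<rho> \<rho>'"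
begin

lemma curve_velocity_traceless:
  assumes t: "t \<in> {0..1}"
  shows "\<rho>' t \<in> traceless D"
proof -
  have l: "((\<lambda>s. (\<rho> s - \<rho> t) /\<^sub>R (s - t)) \<longlongrightarrow> \<rho>' t) (at t within {0..1})"
    using p t unfolding curve_def has_vector_derivative_quotient[symmetric] by blast
  have "\<forall>\<^sub>F s in at t within {0..1}. (\<rho> s - \<rho> t) /\<^sub>R (s - t) \<in> traceless D"
    unfolding eventually_at_filter using p t pos_states_diff subspace_scale[OF traceless_subspace]
    by (intro always_eventually) (auto simp: curve_def)
  moreover have "at t within {0..1} \<noteq> bot" using t by (simp add: trivial_limit_within islimpt_Icc)
  ultimately show ?thesis by (rule Lim_in_closed_set[OF closed_subspace[OF traceless_subspace] _ _ l])
qed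

lemma curve_velocity_Ck: "Ck k (\<lambda>t u. \<rho>' t)"
proof -
  have "Ck (Suc k) (\<lambda>t u. \<rho> t)" using p unfolding curve_def by blast
  then obtain f' where f': "\<And>t u. t \<in> {0..1} \<Longrightarrow> u \<in> {0..1} \<Longrightarrow> (\<rho> has_vector_derivative f' t u) (at t within {0..1})"
    "Ck k f'" by (rule Ck_SucE) blast
  show ?thesis
  proof (rule Ck_cong[OF f'(2)])
    fix t u :: real assume tu: "t \<in> {0..1}" "u \<in> {0..1}"
    then have "(\<rho> has_vector_derivative \<rho>' t) (at t within {0..1})" using p unfolding curve_def by blast
    then show "\<rho>' t = f' t u"
      using f'(1)[OF tu] vector_derivative_within_closed_interval[of 0 1 t \<rho>] tu by (metis zero_less_one)
  qed
qed

lemma curve_potential_Ck: "Ck k (\<lambda>t u. Kinv (\<rho> t) (\<rho>' t))"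
  using p curve_velocity_traceless curve_velocity_Ck unfolding curve_def by (intro Kinv_smooth) auto

lemma curve_cost_cont: "continuous_on {0..1} (\<lambda>t. cost (\<rho> t) (\<rho>' t))"
proof -
  obtain T where T: "bounded_linear T" "\<And>X. X \<in> alg D \<Longrightarrow> tr D X = T X" using A.tr_linear_ext by metis
  have c: "continuous_on {0..1} f" if "Ck 0 (\<lambda>t u. f t)" for f :: "real \<Rightarrow> complex^'n^'n"
  proof -
    have "continuous_on {0..1} (\<lambda>t::real. (t, 0::real))" by (intro continuous_intros)
    from continuous_on_compose2[OF Ck_cont[OF that] this] show ?thesis by (simp add: image_subset_iff)
  qed
  have "continuous_on {0..1} (\<lambda>t. Re (T (Kinv (\<rho> t) (\<rho>' t) ** \<rho>' t)))"
    by (intro continuous_on_Re bounded_linear.continuous_on[OF T(1)] mm.continuous_on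
        c[OF curve_potential_Ck] c[OF curve_velocity_Ck])
  then show ?thesis
    by (rule continuous_on_eq)
      (use p curve_velocity_traceless T(2) Kinv tracelessD in \<open>simp add: cost_def curve_def\<close>)
qed

lemma curve_admissible: "admissible D a b \<rho> (\<lambda>t. Kinv (\<rho> t) (\<rho>' t))"
  unfolding admissible_def
  using p curve_velocity_traceless Kinv curve_potential_Ck
  by (auto simp: curve_def intro!: Ck_smooth01)

lemma curve_action: "action D \<rho> (\<lambda>t. Kinv (\<rho> t) (\<rho>' t)) = integral {0..1} (\<lambda>t. cost (\<rho> t) (\<rho>' t))"
  unfolding action_def cost_def using p curve_velocity_traceless Kinv
  by (intro integral_cong) (simp add: curve_def)

lemma curve_cost_nonneg: "t \<in> {0..1} \<Longrightarrow> 0 \<le> cost (\<rho> t) (\<rho>' t)"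
  using p curve_velocity_traceless cost_nonneg unfolding curve_def by blast

end

lemma admissible_curve:
  assumes "admissible D a b \<rho> A"
  shows "curve a b \<rho> (\<lambda>t. K_op D (\<rho> t) (A t))" "action D \<rho> A = integral {0..1} (\<lambda>t. cost (\<rho> t) (K_op D (\<rho> t) (A t)))"
proof -
  show "curve a b \<rho> (\<lambda>t. K_op D (\<rho> t) (A t))"
    using assms smooth01_Ck[of \<rho>] unfolding admissible_def curve_def by blast
  show "action D \<rho> A = integral {0..1} (\<lambda>t. cost (\<rho> t) (K_op D (\<rho> t) (A t)))"
    unfolding action_def cost_def using assms Kinv_unique
    by (intro integral_cong) (simp add: admissible_def)
qed

text \<open>\<open>Kinv\<close> and \<open>K_op\<close> translate between potentials and velocities
  without changing the action.\<close>

lemma riem_dist_alt: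
  "riem_dist D a b = sqrt (Inf {integral {0..1} (\<lambda>t. cost (\<rho> t) (\<rho>' t)) |\<rho> \<rho>'. curve a b \<rho> \<rho>'})"
proof -
  have "{action D \<rho> A |\<rho> A. admissible D a b \<rho> A} = {integral {0..1} (\<lambda>t. cost (\<rho> t) (\<rho>' t)) |\<rho> \<rho>'. curve a b \<rho> \<rho>'}"
  proof (rule set_eqI, rule iffI)
    fix E assume "E \<in> {action D \<rho> A |\<rho> A. admissible D a b \<rho> A}"
    then obtain \<rho> A where "E = action D \<rho> A" "admissible D a b \<rho> A" by blast
    with admissible_curve[of a b \<rho> A]
    have "E = integral {0..1} (\<lambda>t. cost (\<rho> t) (K_op D (\<rho> t) (A t))) \<and> curve a b \<rho> (\<lambda>t. K_op D (\<rho> t) (A t))"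
      by simp
    then show "E \<in> {integral {0..1} (\<lambda>t. cost (\<rho> t) (\<rho>' t)) |\<rho> \<rho>'. curve a b \<rho> \<rho>'}"
      by (intro CollectI exI[of _ \<rho>] exI[of _ "\<lambda>t. K_op D (\<rho> t) (A t)"])
  next
    fix E assume "E \<in> {integral {0..1} (\<lambda>t. cost (\<rho> t) (\<rho>' t)) |\<rho> \<rho>'. curve a b \<rho> \<rho>'}"
    then obtain \<rho> \<rho>' where "E = integral {0..1} (\<lambda>t. cost (\<rho> t) (\<rho>' t))" "curve a b \<rho> \<rho>'" by blast
    with curve_action[OF this(2)] curve_admissible[OF this(2)] show "E \<in> {action D \<rho> A |\<rho> A. admissible D a b \<rho> A}"
      by (metis (mono_tags, lifting) mem_Collect_eq)
  qed
  then show ?thesis unfolding riem_dist_def by simp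
qed

lemma curve_energy_nonneg: "curve a b \<rho> \<rho>' \<Longrightarrow> 0 \<le> integral {0..1} (\<lambda>t. cost (\<rho> t) (\<rho>' t))"
  using curve_cost_nonneg curve_cost_cont by (intro integral_nonneg integrable_continuous_real) blast+

lemma riem_dist_le:
  assumes p: "curve a b \<rho> \<rho>'" and g: "\<And>t. t \<in> {0..1} \<Longrightarrow> cost (\<rho> t) (\<rho>' t) \<le> g t" "(g has_integral E) {0..1}"
  shows "riem_dist D a b \<le> sqrt E"
proof -
  have "Inf {integral {0..1} (\<lambda>t. cost (\<rho> t) (\<rho>' t)) |\<rho> \<rho>'. curve a b \<rho> \<rho>'} \<le> integral {0..1} (\<lambda>t. cost (\<rho> t) (\<rho>' t))"
    using curve_energy_nonneg p by (intro cInf_lower bdd_belowI[of _ 0]) blast+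
  also have "\<dots> \<le> E"
    using integrable_continuous_real[OF curve_cost_cont[OF p]] g
    by (intro has_integral_le[OF integrable_integral g(2)]) auto
  finally show ?thesis unfolding riem_dist_alt by simp
qed

lemma riem_dist_nonneg_ex:
  assumes "curve a b \<rho> \<rho>'" "riem_dist D a b < x"
  shows "0 \<le> riem_dist D a b" "\<exists>\<rho> \<rho>'. curve a b \<rho> \<rho>' \<and> integral {0..1} (\<lambda>t. cost (\<rho> t) (\<rho>' t)) < x\<^sup>2"
proof -
  let ?S = "{integral {0..1} (\<lambda>t. cost (\<rho> t) (\<rho>' t)) |\<rho> \<rho>'. curve a b \<rho> \<rho>'}"
  have ne: "?S \<noteq> {}" using assms(1) by blast
  have "0 \<le> Inf ?S" using curve_energy_nonneg by (intro cInf_greatest[OF ne]) blast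
  then show 0: "0 \<le> riem_dist D a b" unfolding riem_dist_alt by simp
  have "sqrt (Inf ?S) < x" using assms(2) unfolding riem_dist_alt .
  then have "(sqrt (Inf ?S))\<^sup>2 < x\<^sup>2" using 0 unfolding riem_dist_alt by (intro power_strict_mono) auto
  then have "Inf ?S < x\<^sup>2" using \<open>0 \<le> Inf ?S\<close> by simp
  from cInf_lessD[OF ne this] show "\<exists>\<rho> \<rho>'. curve a b \<rho> \<rho>' \<and> integral {0..1} (\<lambda>t. cost (\<rho> t) (\<rho>' t)) < x\<^sup>2"
    by blast
qed

section \<open>Bounded state space and Hoelder continuity of the distance\<close>

lemma states_bounded: "\<exists>R>0. \<forall>\<rho>\<in>states D. norm \<rho> \<le> R"
proof -
  obtain c where c: "c > 0" "\<And>X. X \<in> alg D \<Longrightarrow> c * (norm X)\<^sup>2 \<le> Re (tr D (adj X ** X))"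
    using A.tr_norm_lower by blast
  have "\<exists>K>0. \<forall>(X :: complex^'n^'n) (Y :: complex^'n^'n). norm (X ** Y) \<le> norm X * norm Y * K" by (rule mm.pos_bounded)
  then obtain K where K: "K > 0" "\<And>(X :: complex^'n^'n) (Y :: complex^'n^'n). norm (X ** Y) \<le> norm X * norm Y * K"
    by blast
  have "norm \<rho> \<le> K / c" if "\<rho> \<in> states D" for \<rho>
  proof -
    have r: "\<rho> \<in> alg D" "adj \<rho> = \<rho>" "tr D \<rho> = 1" "\<And>a. a \<in> spec \<rho> \<Longrightarrow> 0 \<le> a"
      using that spec_nonneg unfolding states_def pos_semidef_def by auto
    \<comment> \<open>The squared trace norm of the square root is the trace of \<rho>, namely 1; a
      bound on the root bounds its square \<rho>.\<close>
    let ?q = "fcalc sqrt \<rho>"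
    have q: "?q ** ?q = \<rho>"
      unfolding fcalc_mult[OF r(2)] using fcalc_cong[of \<rho> "\<lambda>a. sqrt a * sqrt a" "\<lambda>a. a"] r(4) fcalc_id[OF r(2)] by simp
    have "c * (norm ?q)\<^sup>2 \<le> 1"
      using c(2)[of ?q] r q by (simp add: adj_fcalc)
    then have "(norm ?q)\<^sup>2 \<le> 1 / c" using c(1) by (simp add: field_simps)
    then have "(norm ?q)\<^sup>2 * K \<le> 1 / c * K" using K(1) by (intro mult_right_mono) auto
    then show ?thesis using K(2)[of ?q ?q] q by (simp add: power2_eq_square)
  qed
  then show ?thesis using K(1) c(1) by (intro exI[of _ "K / c"]) auto
qed

lemma pos_states_states: "pos_states D \<subseteq> states D"
  unfolding pos_states_def states_def pos_def_lb pos_semidef_lb by (auto intro: lb_mono less_imp_le)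

lemma states_mix_lb:
  assumes a: "a \<in> states D" and b: "b \<in> states D" and t: "t \<in> {0..1}" and "lb m a" "lb n b"
  shows "(1 - t) *\<^sub>R a + t *\<^sub>R b \<in> states D" "lb ((1 - t) * m + t * n) ((1 - t) *\<^sub>R a + t *\<^sub>R b)"
proof -
  show l: "lb ((1 - t) * m + t * n) ((1 - t) *\<^sub>R a + t *\<^sub>R b)"
    using assms by (intro lb_add lb_scale) auto
  have "lb ((1 - t) * 0 + t * 0) ((1 - t) *\<^sub>R a + t *\<^sub>R b)"
    using assms unfolding states_def pos_semidef_lb by (intro lb_add lb_scale) auto
  then show "(1 - t) *\<^sub>R a + t *\<^sub>R b \<in> states D"
    using a b unfolding states_def pos_semidef_lb
    by (auto simp: adj_add adj_scaleR A.tr_add A.tr_scaleR scaleR_conv_of_real[of _ "_ :: complex"])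
qed

lemma pos_statesI': "\<rho> \<in> states D \<Longrightarrow> 0 < m \<Longrightarrow> lb m \<rho> \<Longrightarrow> \<rho> \<in> pos_states D"
  unfolding states_def pos_semidef_lb using pos_statesI by blast

lemma states_mix_pos:
  assumes a: "a \<in> states D" and b: "b \<in> pos_states D" and t: "0 < t" "t \<le> 1"
  shows "(1 - t) *\<^sub>R a + t *\<^sub>R b \<in> pos_states D"
proof -
  obtain m where m: "m > 0" "lb m b" using pos_states_lb[OF b] by blast
  have "lb 0 a" using a unfolding states_def pos_semidef_lb by auto
  from states_mix_lb[OF a subsetD[OF pos_states_states b] _ this m(2), of t] t m
  show ?thesis by (intro pos_statesI'[of _ "t * m"]) auto
qed

text \<open>Between nearby states, move linearly while pushing the curve by \<open>\<eta>\<close> into the interior, where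
  the metric is at most of order \<open>1 / \<eta>\<close>; the velocity vanishes at the same rate as \<open>sqrt \<eta>\<close>
  at both ends.\<close>

lemma hoelder_curve:
  assumes "0 \<le> d" "d \<le> 1" and \<mu>: "\<mu> \<in> pos_states D" and \<nu>: "\<nu> \<in> pos_states D"
  defines "\<beta> \<equiv> \<lambda>s::real. 3 * (s * s) - 2 * (s * (s * s))" and "\<eta> \<equiv> \<lambda>s::real. d * ((s * (1 - s)) * (s * (1 - s)))"
  defines "x \<equiv> \<lambda>s. (1 - \<beta> s) *\<^sub>R \<mu> + \<beta> s *\<^sub>R \<nu>"
  defines "\<gamma> \<equiv> \<lambda>s. (1 - \<eta> s) *\<^sub>R x s + \<eta> s *\<^sub>R dens D"
  defines "\<gamma>' \<equiv> \<lambda>s. (s * (1 - s)) *\<^sub>R ((1 - \<eta> s) *\<^sub>R (6 *\<^sub>R (\<nu> - \<mu>)) + (2 * d * (1 - 2 * s)) *\<^sub>R (dens D - x s))"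
  shows "curve \<mu> \<nu> \<gamma> \<gamma>'" "\<And>s. s \<in> {0..1} \<Longrightarrow> x s \<in> states D" "\<And>s. s \<in> {0..1} \<Longrightarrow> 0 \<le> \<eta> s \<and> \<eta> s \<le> 1"
    "\<And>s m. s \<in> {0..1} \<Longrightarrow> lb m (dens D) \<Longrightarrow> lb (\<eta> s * m) (\<gamma> s)"
proof -
  have b01: "\<beta> s \<in> {0..1}" if "s \<in> {0..1}" for s
  proof -
    have "\<beta> s = s * s * (3 - 2 * s)" "1 - \<beta> s = (1 - s) * (1 - s) * (1 + 2 * s)"
      unfolding \<beta>_def by (auto simp: algebra_simps)
    moreover have "0 \<le> s * s * (3 - 2 * s)" "0 \<le> (1 - s) * (1 - s) * (1 + 2 * s)"
      using that by (intro mult_nonneg_nonneg; simp)+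
    ultimately show ?thesis by simp
  qed
  show e01: "0 \<le> \<eta> s \<and> \<eta> s \<le> 1" if "s \<in> {0..1}" for s
  proof -
    have 1: "0 \<le> s * (1 - s)" "s * (1 - s) \<le> 1" using that by (auto intro: mult_le_one)
    have "(s * (1 - s)) * (s * (1 - s)) \<le> 1" by (rule mult_le_one[OF 1(2) 1(1) 1(2)])
    with 1 show ?thesis unfolding \<eta>_def using assms(1,2) by (auto intro: mult_le_one)
  qed
  have xp: "x s \<in> pos_states D" if s: "s \<in> {0..1}" for s
  proof (cases "\<beta> s = 0")
    case True
    then show ?thesis unfolding x_def using \<mu> by simp
  next
    case False
    then show ?thesis unfolding x_def using states_mix_pos[OF subsetD[OF pos_states_states \<mu>] \<nu>, of "\<beta> s"] b01[OF s] by auto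
  qed
  then show xs: "x s \<in> states D" if "s \<in> {0..1}" for s using that pos_states_states by blast
  show "lb (\<eta> s * m) (\<gamma> s)" if "s \<in> {0..1}" "lb m (dens D)" for s m
    using states_mix_lb(2)[OF xs[OF that(1)] subsetD[OF pos_states_states dens_pos_states], of "\<eta> s" 0 m] e01[OF that(1)] xs[OF that(1)] that(2)
    unfolding \<gamma>_def by (auto simp: states_def pos_semidef_lb)
  have gp: "\<gamma> s \<in> pos_states D" if s: "s \<in> {0..1}" for s
  proof (cases "\<eta> s = 0")
    case True
    then show ?thesis unfolding \<gamma>_def using xp[OF s] by simp
  next
    case False
    then show ?thesis unfolding \<gamma>_def using states_mix_pos[OF xs[OF s] dens_pos_states, of "\<eta> s"] e01[OF s] by auto
  qed
  have mulC: "Ck k (\<lambda>t u. f t * g t)" if "Ck k (\<lambda>t u. f t)" "Ck k (\<lambda>t u. g t)" for f g :: "real \<Rightarrow> real" and k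
    using Ck_scaleR[OF that] by simp
  have Cb: "Ck k (\<lambda>t u. \<beta> t)" and Ce: "Ck k (\<lambda>t u. \<eta> t)" for k
    unfolding \<beta>_def \<eta>_def by (intro Ck_diff mulC Ck_const Ck_fst)+
  have Cg: "Ck k (\<lambda>t u. \<gamma> t)" for k
    unfolding \<gamma>_def x_def by (intro Ck_add Ck_scaleR Ck_diff Ck_const Cb Ce)
  have db: "(\<beta> has_real_derivative 6 * (s * (1 - s))) (at s)" for s
    unfolding \<beta>_def by (auto intro!: derivative_eq_intros simp: algebra_simps)
  have de: "(\<eta> has_real_derivative 2 * d * (1 - 2 * s) * (s * (1 - s))) (at s)" for s
    unfolding \<eta>_def by (auto intro!: derivative_eq_intros simp: algebra_simps)
  have dx: "(x has_vector_derivative (6 * (s * (1 - s))) *\<^sub>R (\<nu> - \<mu>)) (at s within {0..1})" for s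
  proof -
    have "(x has_vector_derivative (0 *\<^sub>R \<mu> - (6 * (s * (1 - s))) *\<^sub>R \<mu>) + (6 * (s * (1 - s))) *\<^sub>R \<nu>) (at s within {0..1})"
      unfolding x_def
      by (auto intro!: derivative_eq_intros has_field_derivative_at_within[OF db] simp: algebra_simps)
    then show ?thesis by (simp add: algebra_simps)
  qed
  have dg: "(\<gamma> has_vector_derivative \<gamma>' s) (at s within {0..1})" for s
  proof -
    have "(\<gamma> has_vector_derivative ((1 - \<eta> s) *\<^sub>R ((6 * (s * (1 - s))) *\<^sub>R (\<nu> - \<mu>)) + (0 - 2 * d * (1 - 2 * s) * (s * (1 - s))) *\<^sub>R x s)
       + (2 * d * (1 - 2 * s) * (s * (1 - s))) *\<^sub>R dens D) (at s within {0..1})"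
      unfolding \<gamma>_def
      by (intro has_vector_derivative_add has_vector_derivative_scaleR dx DERIV_diff DERIV_const
          has_field_derivative_at_within[OF de] has_vector_derivative_scaleR[where g = "\<lambda>_. dens D" and g' = 0, simplified])
    moreover have "((1 - \<eta> s) *\<^sub>R ((6 * (s * (1 - s))) *\<^sub>R (\<nu> - \<mu>)) + (0 - 2 * d * (1 - 2 * s) * (s * (1 - s))) *\<^sub>R x s)
       + (2 * d * (1 - 2 * s) * (s * (1 - s))) *\<^sub>R dens D = \<gamma>' s"
    proof -
      define k where "k = 2 * d * (1 - 2 * s) * (s * (1 - s))"
      have 1: "(0 - k) *\<^sub>R x s + k *\<^sub>R dens D = (s * (1 - s)) *\<^sub>R ((2 * d * (1 - 2 * s)) *\<^sub>R (dens D - x s))"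
        unfolding k_def by (simp add: scaleR_diff_right mult.commute)
      have 2: "(1 - \<eta> s) *\<^sub>R ((6 * (s * (1 - s))) *\<^sub>R (\<nu> - \<mu>)) = (s * (1 - s)) *\<^sub>R ((1 - \<eta> s) *\<^sub>R (6 *\<^sub>R (\<nu> - \<mu>)))"
        unfolding scaleR_scaleR by (rule arg_cong[where f = "\<lambda>c. c *\<^sub>R (\<nu> - \<mu>)"]) (simp only: mult_ac)
      show ?thesis unfolding \<gamma>'_def k_def[symmetric] scaleR_add_right 1[symmetric] 2 by (simp only: add.assoc)
    qed
    ultimately show ?thesis by simp
  qed
  show "curve \<mu> \<nu> \<gamma> \<gamma>'"
    unfolding curve_def using Cg gp dg by (auto simp: \<gamma>_def x_def \<beta>_def \<eta>_def)
qed

text \<open>With the push d chosen as norm (\<mu> - \<nu>), the velocity is of order d s (1 - s),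
  while the state stays above a multiple of d (s (1 - s))^2. By the 1 / m bound the cost is then of
  order d, uniformly in s.\<close>

lemma riem_dist_hoelder:
  "\<exists>C>0. \<forall>\<mu>\<in>pos_states D. \<forall>\<nu>\<in>pos_states D. norm (\<mu> - \<nu>) \<le> 1 \<longrightarrow> riem_dist D \<mu> \<nu> \<le> C * sqrt (norm (\<mu> - \<nu>))"
proof -
  obtain R where R: "R > 0" "\<And>\<rho>. \<rho> \<in> states D \<Longrightarrow> norm \<rho> \<le> R" using states_bounded by blast
  obtain m where m: "m > 0" "lb m (dens D)" using pos_states_lb[OF dens_pos_states] by blast
  obtain C where C: "C > 0" "\<And>\<rho> m y. \<rho> \<in> pos_states D \<Longrightarrow> m > 0 \<Longrightarrow> y \<in> traceless D \<Longrightarrow> lb m \<rho> \<Longrightarrow> cost \<rho> y \<le> C * (norm y)\<^sup>2 / m"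
    using cost_upper by blast
  \<comment> \<open>The velocity is at most s (1 - s) d (6 + 4 R): 6 from the reparametrized
    segment, 4 R from the push, as two states differ by at most 2 R in norm.\<close>
  define c where "c = C * (6 + 4 * R)\<^sup>2 / m"
  have c0: "c > 0" unfolding c_def using C m R by auto
  have "riem_dist D \<mu> \<nu> \<le> sqrt c * sqrt (norm (\<mu> - \<nu>))"
    if \<mu>: "\<mu> \<in> pos_states D" and \<nu>: "\<nu> \<in> pos_states D" and n: "norm (\<mu> - \<nu>) \<le> 1" for \<mu> \<nu>
  proof -
    define d where "d = norm (\<mu> - \<nu>)"
    have d: "0 \<le> d" "d \<le> 1" unfolding d_def using n by auto
    define \<beta> where "\<beta> = (\<lambda>s::real. 3 * (s * s) - 2 * (s * (s * s)))"
    define \<eta> where "\<eta> = (\<lambda>s::real. d * ((s * (1 - s)) * (s * (1 - s))))"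
    define x where "x = (\<lambda>s. (1 - \<beta> s) *\<^sub>R \<mu> + \<beta> s *\<^sub>R \<nu>)"
    define \<gamma> where "\<gamma> = (\<lambda>s. (1 - \<eta> s) *\<^sub>R x s + \<eta> s *\<^sub>R dens D)"
    define \<gamma>' where "\<gamma>' = (\<lambda>s. (s * (1 - s)) *\<^sub>R ((1 - \<eta> s) *\<^sub>R (6 *\<^sub>R (\<nu> - \<mu>)) + (2 * d * (1 - 2 * s)) *\<^sub>R (dens D - x s)))"
    have h: "curve \<mu> \<nu> \<gamma> \<gamma>'" "\<And>s. s \<in> {0..1} \<Longrightarrow> x s \<in> states D" "\<And>s. s \<in> {0..1} \<Longrightarrow> 0 \<le> \<eta> s \<and> \<eta> s \<le> 1"
      "\<And>s m. s \<in> {0..1} \<Longrightarrow> lb m (dens D) \<Longrightarrow> lb (\<eta> s * m) (\<gamma> s)"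
      unfolding \<gamma>_def \<gamma>'_def x_def \<beta>_def \<eta>_def by (fact hoelder_curve[OF d \<mu> \<nu>])+
    have cost_le: "cost (\<gamma> s) (\<gamma>' s) \<le> c * d" if s: "s \<in> {0..1}" for s
    \<comment> \<open>Without a push, either the end points coincide or s is 0 or 1; the velocity
      vanishes in each case.\<close>
    proof (cases "\<eta> s = 0")
      case True
      then have "d = 0 \<or> s * (1 - s) = 0" unfolding \<eta>_def by auto
      then have "\<gamma>' s = 0" unfolding \<gamma>'_def using d_def by auto
      then show ?thesis unfolding cost_def using c0 d by simp
    next
      case False
      then have e: "0 < \<eta> s" using h(3)[OF s] by simp
      have "norm ((1 - \<eta> s) *\<^sub>R (6 *\<^sub>R (\<nu> - \<mu>)) + (2 * d * (1 - 2 * s)) *\<^sub>R (dens D - x s)) \<le> 6 * d + 2 * d * (R + R)"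
      proof (rule norm_triangle_le[OF add_mono])
        have "norm ((1 - \<eta> s) *\<^sub>R (6 *\<^sub>R (\<nu> - \<mu>))) = (1 - \<eta> s) * (6 * d)"
          using h(3)[OF s] unfolding d_def by (simp add: norm_minus_commute)
        also have "\<dots> \<le> 1 * (6 * d)" using h(3)[OF s] d by (intro mult_right_mono) auto
        finally show "norm ((1 - \<eta> s) *\<^sub>R (6 *\<^sub>R (\<nu> - \<mu>))) \<le> 6 * d" by simp
        have "norm (dens D - x s) \<le> R + R"
          using R(2)[OF subsetD[OF pos_states_states dens_pos_states]] R(2)[OF h(2)[OF s]]
          by (intro order.trans[OF norm_triangle_ineq4] add_mono)
        moreover have "\<bar>2 * d * (1 - 2 * s)\<bar> \<le> 2 * d"
        proof -
          have "\<bar>1 - 2 * s\<bar> \<le> 1" using s by (auto simp: abs_le_iff)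
          then show ?thesis using d mult_left_mono[of "\<bar>1 - 2 * s\<bar>" 1 "2 * d"] by (simp add: abs_mult)
        qed
        ultimately show "norm ((2 * d * (1 - 2 * s)) *\<^sub>R (dens D - x s)) \<le> 2 * d * (R + R)"
          unfolding norm_scaleR using d by (intro mult_mono) auto
      qed
      then have "norm (\<gamma>' s) \<le> (s * (1 - s)) * (d * (6 + 4 * R))"
      proof -
        assume n: "norm ((1 - \<eta> s) *\<^sub>R (6 *\<^sub>R (\<nu> - \<mu>)) + (2 * d * (1 - 2 * s)) *\<^sub>R (dens D - x s)) \<le> 6 * d + 2 * d * (R + R)"
        have "\<bar>s * (1 - s)\<bar> = s * (1 - s)" "0 \<le> s * (1 - s)" using s by auto
        moreover have "6 * d + 2 * d * (R + R) = d * (6 + 4 * R)" by (simp add: algebra_simps)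
        ultimately show ?thesis unfolding \<gamma>'_def norm_scaleR using mult_left_mono[OF n] by metis
      qed
      then have "(norm (\<gamma>' s))\<^sup>2 \<le> ((s * (1 - s)) * (d * (6 + 4 * R)))\<^sup>2" by (intro power_mono) auto
      also have "\<dots> = \<eta> s * (d * (6 + 4 * R)\<^sup>2)" unfolding \<eta>_def by (simp add: power2_eq_square)
      finally have n2: "(norm (\<gamma>' s))\<^sup>2 \<le> \<eta> s * (d * (6 + 4 * R)\<^sup>2)" .
      have "cost (\<gamma> s) (\<gamma>' s) \<le> C * (norm (\<gamma>' s))\<^sup>2 / (\<eta> s * m)"
        using h(1) s e m h(4)[OF s m(2)] curve_velocity_traceless[OF h(1) s] by (intro C(2)) (auto simp: curve_def)
      also have "\<dots> \<le> C * (\<eta> s * (d * (6 + 4 * R)\<^sup>2)) / (\<eta> s * m)"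
        using n2 C e m by (intro divide_right_mono mult_left_mono) auto
      also have "\<dots> = c * d" unfolding c_def using e by simp
      finally show ?thesis .
    qed
    have "riem_dist D \<mu> \<nu> \<le> sqrt (c * d)"
      using has_integral_const_real[of "c * d" 0 1] by (intro riem_dist_le[OF h(1) cost_le]) auto
    then show ?thesis unfolding d_def by (simp add: real_sqrt_mult)
  qed
  then show ?thesis using c0 by (intro exI[of _ "sqrt c"]) auto
qed

text \<open>The push 0 gives the reparametrized segment, which stays within positive states.\<close>

lemma curve_exists: "\<mu> \<in> pos_states D \<Longrightarrow> \<nu> \<in> pos_states D \<Longrightarrow> \<exists>\<rho> \<rho>'. curve \<mu> \<nu> \<rho> \<rho>'"
  using hoelder_curve(1)[of 0 \<mu> \<nu>] by fastforce

lemma riem_dist_nonneg: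
  assumes "\<mu> \<in> pos_states D" "\<nu> \<in> pos_states D"
  shows "0 \<le> riem_dist D \<mu> \<nu>"
proof -
  obtain \<rho> \<rho>' where "curve \<mu> \<nu> \<rho> \<rho>'" using curve_exists[OF assms] by blast
  from riem_dist_nonneg_ex(1)[OF this, of "riem_dist D \<mu> \<nu> + 1"] show ?thesis by simp
qed

end

section \<open>Concatenation, triangle inequality and singular states\<close>

context dstruct_erg
begin

text \<open>The two summands of the concatenated curve take turns in being constant.\<close>

lemma curve_concat:
  assumes p: "curve a b \<rho>\<^sub>1 \<rho>\<^sub>1'" and q: "curve b c \<rho>\<^sub>2 \<rho>\<^sub>2'" and \<alpha>: "0 < \<alpha>" "\<alpha> < 1" and \<epsilon>: "0 < \<epsilon>"
  shows "riem_dist D a c \<le> sqrt ((1 + \<epsilon>) *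
     (integral {0..1} (\<lambda>t. cost (\<rho>\<^sub>1 t) (\<rho>\<^sub>1' t)) / \<alpha> + integral {0..1} (\<lambda>t. cost (\<rho>\<^sub>2 t) (\<rho>\<^sub>2' t)) / (1 - \<alpha>)))"
proof -
  obtain G :: "nat \<Rightarrow> real \<Rightarrow> real" where G: "\<And>k s. (G k has_real_derivative G (Suc k) s) (at s)"
    "\<And>s. s \<le> 0 \<Longrightarrow> G 0 s = 0" "\<And>s. s \<ge> 1 \<Longrightarrow> G 0 s = 1"
    "\<And>s. 0 \<le> G 1 s" "\<And>s. G 1 s \<le> 1 + \<epsilon>" "\<And>s. s \<le> 0 \<Longrightarrow> G 1 s = 0" "\<And>s. s \<ge> 1 \<Longrightarrow> G 1 s = 0"
    using flat_reparametrization[OF \<epsilon>] by blast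
  have G01: "G 0 s \<in> {0..1}" for s
  proof -
    have d: "\<exists>y. (G 0 has_real_derivative y) (at x) \<and> 0 \<le> y" for x
      using G(1)[of 0 x] G(4)[of x] by auto
    have "G 0 (min s 0) \<le> G 0 s" "G 0 s \<le> G 0 (max s 1)"
      by (rule DERIV_nonneg_imp_nondecreasing; use d in auto)+
    then show ?thesis using G(2)[of "min s 0"] G(3)[of "max s 1"] by simp
  qed
  define f where "f s = s / \<alpha>" for s
  define g where "g s = (s - \<alpha>) / (1 - \<alpha>)" for s
  have ff: "f = (\<lambda>s. (1 / \<alpha>) * s + 0)" and gg: "g = (\<lambda>s. (1 / (1 - \<alpha>)) * s + (- \<alpha> / (1 - \<alpha>)))"
    unfolding f_def g_def by (auto simp: diff_divide_distrib)
  have df: "((\<lambda>s. G 0 (f s)) has_real_derivative G 1 (f s) / \<alpha>) (at s)" for s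
  proof -
    have "(f has_real_derivative 1 / \<alpha>) (at s)" unfolding f_def using \<alpha> by (auto intro!: derivative_eq_intros)
    from DERIV_chain2[OF G(1)[of 0] this] show ?thesis by simp
  qed
  have dg: "((\<lambda>s. G 0 (g s)) has_real_derivative G 1 (g s) / (1 - \<alpha>)) (at s)" for s
  proof -
    have "(g has_real_derivative 1 / (1 - \<alpha>)) (at s)" unfolding g_def using \<alpha> by (auto intro!: derivative_eq_intros)
    from DERIV_chain2[OF G(1)[of 0] this] show ?thesis by simp
  qed
  have left: "G 0 (g s) = 0" "G 1 (g s) = 0" if "s \<le> \<alpha>" for s
  proof -
    have "g s \<le> 0" using that \<alpha> unfolding g_def by (simp add: divide_nonpos_pos)
    then show "G 0 (g s) = 0" "G 1 (g s) = 0" by (rule G(2), rule G(6))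
  qed
  have right: "G 0 (f s) = 1" "G 1 (f s) = 0" if "\<alpha> \<le> s" for s
  proof -
    have "1 \<le> f s" using that \<alpha> unfolding f_def by simp
    then show "G 0 (f s) = 1" "G 1 (f s) = 0" by (rule G(3), rule G(7))
  qed
  define \<rho> where "\<rho> s = \<rho>\<^sub>1 (G 0 (f s)) + \<rho>\<^sub>2 (G 0 (g s)) - b" for s
  define \<rho>' where "\<rho>' s = (G 1 (f s) / \<alpha>) *\<^sub>R \<rho>\<^sub>1' (G 0 (f s)) + (G 1 (g s) / (1 - \<alpha>)) *\<^sub>R \<rho>\<^sub>2' (G 0 (g s))" for s
  have ends: "\<rho>\<^sub>1 1 = b" "\<rho>\<^sub>2 0 = b" "\<rho>\<^sub>1 0 = a" "\<rho>\<^sub>2 1 = c" using p q unfolding curve_def by auto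
  have mem: "\<rho>\<^sub>1 (G 0 s) \<in> pos_states D" "\<rho>\<^sub>2 (G 0 s) \<in> pos_states D" for s
    using p q G01 unfolding curve_def by blast+
  have tl: "\<rho>\<^sub>1' (G 0 s) \<in> traceless D" "\<rho>\<^sub>2' (G 0 s) \<in> traceless D" for s
    using curve_velocity_traceless[OF p G01] curve_velocity_traceless[OF q G01] by auto
  have rl: "\<rho> s = \<rho>\<^sub>1 (G 0 (f s))" "\<rho>' s = (G 1 (f s) / \<alpha>) *\<^sub>R \<rho>\<^sub>1' (G 0 (f s))" if "s \<le> \<alpha>" for s
    unfolding \<rho>_def \<rho>'_def using left[OF that] ends by auto
  have rr: "\<rho> s = \<rho>\<^sub>2 (G 0 (g s))" "\<rho>' s = (G 1 (g s) / (1 - \<alpha>)) *\<^sub>R \<rho>\<^sub>2' (G 0 (g s))" if "\<alpha> \<le> s" for s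
    unfolding \<rho>_def \<rho>'_def using right[OF that] ends by auto
  have cur: "curve a c \<rho> \<rho>'"
    unfolding curve_def
  proof (intro conjI allI ballI)
    fix k
    have A1: "Ck k (\<lambda>t u. \<rho>\<^sub>1 (G 0 (x * t + y)))" and A2: "Ck k (\<lambda>t u. \<rho>\<^sub>2 (G 0 (x * t + y)))" for x y
      using p q G01 Ck_compose[where f = "\<lambda>t u. \<rho>\<^sub>1 t", OF _ smooth_affine[where G = G, OF G(1)]]
        Ck_compose[where f = "\<lambda>t u. \<rho>\<^sub>2 t", OF _ smooth_affine[where G = G, OF G(1)]]
      unfolding curve_def by (simp_all add: image_subset_iff)
    have "Ck k (\<lambda>t u. \<rho>\<^sub>1 (G 0 (f t)))" unfolding ff by (rule A1)
    moreover have "Ck k (\<lambda>t u. \<rho>\<^sub>2 (G 0 (g t)))" unfolding gg by (rule A2)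
    ultimately show "Ck k (\<lambda>t u. \<rho> t)" unfolding \<rho>_def by (intro Ck_diff Ck_add Ck_const)
    show "\<rho> s \<in> pos_states D" for s
      using rl(1)[of s] rr(1)[of s] mem by (cases "s \<le> \<alpha>") auto
    show "(\<rho> has_vector_derivative \<rho>' s) (at s within {0..1})" for s
    proof -
      have "((\<lambda>s. \<rho>\<^sub>1 (G 0 (f s))) has_vector_derivative (G 1 (f s) / \<alpha>) *\<^sub>R \<rho>\<^sub>1' (G 0 (f s))) (at s within {0..1})"
        using p unfolding curve_def by (intro has_vector_derivative_compose_01[OF _ df G01]) auto
      moreover have "((\<lambda>s. \<rho>\<^sub>2 (G 0 (g s))) has_vector_derivative (G 1 (g s) / (1 - \<alpha>)) *\<^sub>R \<rho>\<^sub>2' (G 0 (g s))) (at s within {0..1})"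
        using q unfolding curve_def by (intro has_vector_derivative_compose_01[OF _ dg G01]) auto
      ultimately have "((\<lambda>s. \<rho>\<^sub>1 (G 0 (f s)) + \<rho>\<^sub>2 (G 0 (g s)) - b) has_vector_derivative \<rho>' s - 0) (at s within {0..1})"
        unfolding \<rho>'_def by (intro has_vector_derivative_diff has_vector_derivative_add has_vector_derivative_const)
      then show ?thesis unfolding \<rho>_def[abs_def] by simp
    qed
    show "\<rho> 0 = a" using rl(1)[of 0] \<alpha> ends G(2)[of 0] by (simp add: f_def)
    show "\<rho> 1 = c" using rr(1)[of 1] \<alpha> ends G(3)[of 1] by (simp add: g_def)
  qed
  define c1 where "c1 t = cost (\<rho>\<^sub>1 t) (\<rho>\<^sub>1' t)" for t
  define c2 where "c2 t = cost (\<rho>\<^sub>2 t) (\<rho>\<^sub>2' t)" for t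
  have c1: "continuous_on {0..1} c1" and c2: "continuous_on {0..1} c2"
    unfolding c1_def c2_def by (rule curve_cost_cont[OF p], rule curve_cost_cont[OF q])
  have nn: "0 \<le> c1 (G 0 s)" "0 \<le> c2 (G 0 s)" for s
    unfolding c1_def c2_def using curve_cost_nonneg[OF p G01] curve_cost_nonneg[OF q G01] by auto
  define V1 where "V1 t = integral {0..t} c1" for t
  define V2 where "V2 t = integral {0..t} c2" for t
  have dV1: "(V1 has_vector_derivative c1 t) (at t within {0..1})" if "t \<in> {0..1}" for t
    unfolding V1_def using integral_has_vector_derivative[OF c1 that] .
  have dV2: "(V2 has_vector_derivative c2 t) (at t within {0..1})" if "t \<in> {0..1}" for t
    unfolding V2_def using integral_has_vector_derivative[OF c2 that] .
  \<comment> \<open>One of the two factors of the speed \<open>G 1\<close> is bounded by 1 +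
    \<epsilon>; the other is kept, since it makes \<open>h\<close> the exact derivative of the
    accumulated costs \<open>V1\<close> and \<open>V2\<close> along the two clocks.\<close>
  define h where "h s = (1 + \<epsilon>) * ((G 1 (f s) / \<alpha> * c1 (G 0 (f s))) / \<alpha> + (G 1 (g s) / (1 - \<alpha>) * c2 (G 0 (g s))) / (1 - \<alpha>))" for s
  have int: "(h has_integral ((1 + \<epsilon>) * (V1 (G 0 (f 1)) / \<alpha> + V2 (G 0 (g 1)) / (1 - \<alpha>)) -
      (1 + \<epsilon>) * (V1 (G 0 (f 0)) / \<alpha> + V2 (G 0 (g 0)) / (1 - \<alpha>)))) {0..1}"
  proof (rule fundamental_theorem_of_calculus)
    fix s :: real
    have "((\<lambda>s. V1 (G 0 (f s))) has_vector_derivative (G 1 (f s) / \<alpha>) *\<^sub>R c1 (G 0 (f s))) (at s within {0..1})"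
      by (rule has_vector_derivative_compose_01[OF dV1 df G01])
    moreover have "((\<lambda>s. V2 (G 0 (g s))) has_vector_derivative (G 1 (g s) / (1 - \<alpha>)) *\<^sub>R c2 (G 0 (g s))) (at s within {0..1})"
      by (rule has_vector_derivative_compose_01[OF dV2 dg G01])
    ultimately show "((\<lambda>s. (1 + \<epsilon>) * (V1 (G 0 (f s)) / \<alpha> + V2 (G 0 (g s)) / (1 - \<alpha>))) has_vector_derivative h s) (at s within {0..1})"
      unfolding has_real_derivative_iff_has_vector_derivative[symmetric] h_def
      using \<alpha> by (auto intro!: derivative_eq_intros)
  qed simp
  have val: "G 0 (f 1) = 1" "G 0 (f 0) = 0" "G 0 (g 1) = 1" "G 0 (g 0) = 0"
    using right(1)[of 1] left(1)[of 0] G(2)[of "f 0"] G(3)[of "g 1"] \<alpha> by (auto simp: f_def g_def)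
  have int': "(h has_integral (1 + \<epsilon>) * (integral {0..1} c1 / \<alpha> + integral {0..1} c2 / (1 - \<alpha>))) {0..1}"
    using int unfolding val by (simp add: V1_def V2_def)
  have sq: "x * x * k \<le> (1 + \<epsilon>) * (x * k)" if "0 \<le> x" "x \<le> 1 + \<epsilon>" "0 \<le> k" for x k :: real
    using mult_right_mono[OF that(2), of "x * k"] that by simp
  have cost_le: "cost (\<rho> s) (\<rho>' s) \<le> h s" if s: "s \<in> {0..1}" for s
  proof (cases "s \<le> \<alpha>")
    case True
    have "cost (\<rho> s) (\<rho>' s) = (G 1 (f s) / \<alpha>)\<^sup>2 * c1 (G 0 (f s))"
      unfolding rl[OF True] c1_def by (rule cost_scaleR[OF mem(1) tl(1)])
    also have "\<dots> = (G 1 (f s) * G 1 (f s) * c1 (G 0 (f s))) / (\<alpha> * \<alpha>)" by (simp add: power2_eq_square)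
    also have "\<dots> \<le> ((1 + \<epsilon>) * (G 1 (f s) * c1 (G 0 (f s)))) / (\<alpha> * \<alpha>)"
      using sq[OF G(4,5) nn(1)] \<alpha> by (intro divide_right_mono) auto
    also have "\<dots> = h s" unfolding h_def left[OF True] by simp
    finally show ?thesis .
  next
    case False
    then have t: "\<alpha> \<le> s" by simp
    have "cost (\<rho> s) (\<rho>' s) = (G 1 (g s) / (1 - \<alpha>))\<^sup>2 * c2 (G 0 (g s))"
      unfolding rr[OF t] c2_def by (rule cost_scaleR[OF mem(2) tl(2)])
    also have "\<dots> = (G 1 (g s) * G 1 (g s) * c2 (G 0 (g s))) / ((1 - \<alpha>) * (1 - \<alpha>))" by (simp add: power2_eq_square)
    also have "\<dots> \<le> ((1 + \<epsilon>) * (G 1 (g s) * c2 (G 0 (g s)))) / ((1 - \<alpha>) * (1 - \<alpha>))"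
      using sq[OF G(4,5) nn(2)] \<alpha> by (intro divide_right_mono) auto
    also have "\<dots> = h s" unfolding h_def right[OF t] by simp
    finally show ?thesis .
  qed
  show ?thesis using riem_dist_le[OF cur cost_le int'] unfolding c1_def[abs_def] c2_def[abs_def] .
qed

lemma riem_dist_triangle:
  assumes "a \<in> pos_states D" "b \<in> pos_states D" "c \<in> pos_states D"
  shows "riem_dist D a c \<le> riem_dist D a b + riem_dist D b c"
proof -
  have lt: "riem_dist D a c \<le> x + y" if x: "riem_dist D a b < x" and y: "riem_dist D b c < y" for x y
  proof (rule real_le_mult_eps)
    fix \<epsilon> :: real assume e: "0 < \<epsilon>"
    have x0: "0 < x" "0 < y" using riem_dist_nonneg assms x y by (meson le_less_trans)+
    obtain r1 r1' where 1: "curve a b r1 r1'" "integral {0..1} (\<lambda>t. cost (r1 t) (r1' t)) < x\<^sup>2"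
      using curve_exists[OF assms(1,2)] riem_dist_nonneg_ex(2)[OF _ x] by blast
    obtain r2 r2' where 2: "curve b c r2 r2'" "integral {0..1} (\<lambda>t. cost (r2 t) (r2' t)) < y\<^sup>2"
      using curve_exists[OF assms(2,3)] riem_dist_nonneg_ex(2)[OF _ y] by blast
    \<comment> \<open>Time is split in proportion to the lengths, which makes x^2 / \<alpha> + y^2 /
      (1 - \<alpha>) equal to (x + y)^2.\<close>
    define \<alpha> where "\<alpha> = x / (x + y)"
    have a: "0 < \<alpha>" "\<alpha> < 1" "1 - \<alpha> = y / (x + y)" unfolding \<alpha>_def using x0 by (auto simp: field_simps)
    have "riem_dist D a c \<le> sqrt ((1 + \<epsilon>) *
     (integral {0..1} (\<lambda>t. cost (r1 t) (r1' t)) / \<alpha> + integral {0..1} (\<lambda>t. cost (r2 t) (r2' t)) / (1 - \<alpha>)))"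
      by (rule curve_concat[OF 1(1) 2(1) a(1,2) e])
    also have "\<dots> \<le> sqrt ((1 + \<epsilon>) * (x\<^sup>2 / \<alpha> + y\<^sup>2 / (1 - \<alpha>)))"
      using 1 2 a e by (intro real_sqrt_le_mono mult_left_mono add_mono divide_right_mono) auto
    also have "x\<^sup>2 / \<alpha> + y\<^sup>2 / (1 - \<alpha>) = (x + y)\<^sup>2"
    proof -
      have "x\<^sup>2 / \<alpha> = x * (x + y)" "y\<^sup>2 / (1 - \<alpha>) = y * (x + y)"
        unfolding a(3) unfolding \<alpha>_def using x0 by (simp_all add: power2_eq_square)
      then show ?thesis by (simp add: power2_eq_square algebra_simps)
    qed
    also have "sqrt ((1 + \<epsilon>) * (x + y)\<^sup>2) = sqrt (1 + \<epsilon>) * (x + y)" using x0 by (simp add: real_sqrt_mult)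
    also have "\<dots> \<le> (1 + \<epsilon>) * (x + y)"
    proof (rule mult_right_mono)
      have "1 + \<epsilon> \<le> (1 + \<epsilon>)\<^sup>2" using e by (simp add: power2_eq_square algebra_simps)
      then have "sqrt (1 + \<epsilon>) \<le> sqrt ((1 + \<epsilon>)\<^sup>2)" by (rule real_sqrt_le_mono)
      then show "sqrt (1 + \<epsilon>) \<le> 1 + \<epsilon>" using e by simp
    qed (use x0 in simp)
    finally show "riem_dist D a c \<le> (1 + \<epsilon>) * (x + y)" .
  qed
  show ?thesis
  proof (rule field_le_epsilon)
    fix e :: real assume "0 < e"
    then show "riem_dist D a c \<le> riem_dist D a b + riem_dist D b c + e"
      using lt[of "riem_dist D a b + e / 2" "riem_dist D b c + e / 2"] by simp
  qed
qed

text \<open>\<open>Lim\<close> can be evaluated only for an existing limit along a nontrivial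
  filter. The triangle inequality and the Hoelder bound make the distance uniformly continuous; its
  limit is identified along the segment towards the density, where the bound \<open>K\<close>
  holds.\<close>

lemma transport_dist_le_limit:
  assumes \<rho>: "\<rho> \<in> states D" "\<rho> \<notin> pos_states D"
    and le: "\<And>\<mu> t. 0 < t \<Longrightarrow> t \<le> 1 \<Longrightarrow> riem_dist D ((1 - t) *\<^sub>R \<rho> + t *\<^sub>R dens D) (dens D) \<le> K"
  shows "transport_dist D \<rho> (dens D) \<le> K"
proof -
  obtain C where C: "C > 0" "\<And>\<mu> \<nu>. \<mu> \<in> pos_states D \<Longrightarrow> \<nu> \<in> pos_states D \<Longrightarrow> norm (\<mu> - \<nu>) \<le> 1 \<Longrightarrow>
      riem_dist D \<mu> \<nu> \<le> C * sqrt (norm (\<mu> - \<nu>))" using riem_dist_hoelder by blast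
  have tri: "\<bar>riem_dist D \<mu> \<nu> - riem_dist D \<mu>' \<nu>'\<bar> \<le> C * sqrt (norm (\<mu> - \<mu>')) + C * sqrt (norm (\<nu> - \<nu>'))"
    if m: "\<mu> \<in> pos_states D" "\<nu> \<in> pos_states D" "\<mu>' \<in> pos_states D" "\<nu>' \<in> pos_states D"
      "norm (\<mu> - \<mu>') \<le> 1" "norm (\<nu> - \<nu>') \<le> 1" for \<mu> \<nu> \<mu>' \<nu>'
  proof -
    have *: "riem_dist D \<mu> \<nu> \<le> riem_dist D \<mu>' \<nu>' + (C * sqrt (norm (\<mu> - \<mu>')) + C * sqrt (norm (\<nu> - \<nu>')))"
      if m: "\<mu> \<in> pos_states D" "\<nu> \<in> pos_states D" "\<mu>' \<in> pos_states D" "\<nu>' \<in> pos_states D"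
      "norm (\<mu> - \<mu>') \<le> 1" "norm (\<nu> - \<nu>') \<le> 1" for \<mu> \<nu> \<mu>' \<nu>'
    proof -
      have "riem_dist D \<mu> \<nu> \<le> riem_dist D \<mu> \<mu>' + (riem_dist D \<mu>' \<nu>' + riem_dist D \<nu>' \<nu>)"
        using riem_dist_triangle[of \<mu> \<mu>' \<nu>] riem_dist_triangle[of \<mu>' \<nu>' \<nu>] m by linarith
      moreover have "riem_dist D \<mu> \<mu>' \<le> C * sqrt (norm (\<mu> - \<mu>'))" using m by (intro C(2))
      moreover have "riem_dist D \<nu>' \<nu> \<le> C * sqrt (norm (\<nu> - \<nu>'))"
        using C(2)[of \<nu>' \<nu>] m by (simp add: norm_minus_commute)
      ultimately show ?thesis by linarith
    qed
    from *[of \<mu> \<nu> \<mu>' \<nu>'] *[of \<mu>' \<nu>' \<mu> \<nu>] m show ?thesis by (simp add: norm_minus_commute abs_le_iff)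
  qed
  \<comment> \<open>The weight 1 / (n + 2) lies strictly between 0 and 1.\<close>
  define \<mu> where "\<mu> n = (1 - 1 / (real n + 2)) *\<^sub>R \<rho> + (1 / (real n + 2)) *\<^sub>R dens D" for n
  have \<mu>p: "\<mu> n \<in> pos_states D" for n
    unfolding \<mu>_def by (rule states_mix_pos[OF \<rho>(1) dens_pos_states]) auto
  have \<mu>lim: "\<mu> \<longlonglongrightarrow> \<rho>"
  proof -
    have l: "(\<lambda>n. 1 / (real n + 2)) \<longlonglongrightarrow> 0" by real_asymp
    have "(\<lambda>n. (1 - 1 / (real n + 2)) *\<^sub>R \<rho> + (1 / (real n + 2)) *\<^sub>R dens D) \<longlonglongrightarrow> (1 - 0) *\<^sub>R \<rho> + 0 *\<^sub>R dens D"
      by (intro tendsto_intros l)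
    then show ?thesis unfolding \<mu>_def[abs_def] by simp
  qed
  define w where "w n = riem_dist D (\<mu> n) (dens D)" for n
  have "Cauchy w"
  proof (rule CauchyI)
    fix e :: real assume e: "0 < e"
    define d where "d = min 1 ((e / (2 * C))\<^sup>2)"
    have d: "0 < d" unfolding d_def using e C by simp
    from LIMSEQ_imp_Cauchy[OF \<mu>lim, THEN CauchyD, OF d] obtain N where N: "\<And>m n. m \<ge> N \<Longrightarrow> n \<ge> N \<Longrightarrow> norm (\<mu> m - \<mu> n) < d"
      by blast
    have "norm (w m - w n) < e" if "m \<ge> N" "n \<ge> N" for m n
    proof -
      have n: "norm (\<mu> m - \<mu> n) < d" using N that by blast
      have "\<bar>w m - w n\<bar> \<le> C * sqrt (norm (\<mu> m - \<mu> n)) + C * sqrt (norm (dens D - dens D))"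
        unfolding w_def using n by (intro tri \<mu>p dens_pos_states) (auto simp: d_def)
      also have "\<dots> \<le> C * sqrt ((e / (2 * C))\<^sup>2)"
      proof -
        have "sqrt (norm (\<mu> m - \<mu> n)) \<le> sqrt ((e / (2 * C))\<^sup>2)"
          using n unfolding d_def by (intro real_sqrt_le_mono) simp
        from mult_left_mono[OF this, of C] C(1) show ?thesis by simp
      qed
      also have "\<dots> = e / 2"
      proof -
        have "sqrt ((e / (2 * C))\<^sup>2) = e / (2 * C)" unfolding real_sqrt_abs using e C(1) by simp
        then show ?thesis using C(1) by simp
      qed
      finally show ?thesis using e by simp
    qed
    then show "\<exists>M. \<forall>m\<ge>M. \<forall>n\<ge>M. norm (w m - w n) < e" by blast
  qed
  then obtain L where L: "w \<longlonglongrightarrow> L" using Cauchy_convergent convergent_def by blast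
  have LK: "L \<le> K"
  proof (rule LIMSEQ_le_const2[OF L])
    show "\<exists>N. \<forall>n\<ge>N. w n \<le> K" unfolding w_def \<mu>_def by (intro exI allI impI le) auto
  qed
  have near: "\<bar>riem_dist D \<nu> \<nu>' - L\<bar> \<le> C * sqrt (norm (\<nu> - \<rho>)) + C * sqrt (norm (\<nu>' - dens D))"
    if n: "\<nu> \<in> pos_states D" "\<nu>' \<in> pos_states D" "norm (\<nu> - \<rho>) < 1" "norm (\<nu>' - dens D) \<le> 1" for \<nu> \<nu>'
  proof (rule tendsto_le[OF sequentially_bot])
    show "(\<lambda>n. C * sqrt (norm (\<nu> - \<mu> n)) + C * sqrt (norm (\<nu>' - dens D))) \<longlonglongrightarrow> C * sqrt (norm (\<nu> - \<rho>)) + C * sqrt (norm (\<nu>' - dens D))"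
      by (intro tendsto_intros \<mu>lim)
    show "(\<lambda>n. \<bar>riem_dist D \<nu> \<nu>' - w n\<bar>) \<longlonglongrightarrow> \<bar>riem_dist D \<nu> \<nu>' - L\<bar>" by (intro tendsto_intros L)
    have "(\<lambda>n. norm (\<nu> - \<mu> n)) \<longlonglongrightarrow> norm (\<nu> - \<rho>)" by (intro tendsto_intros \<mu>lim)
    then have "\<forall>\<^sub>F n in sequentially. norm (\<nu> - \<mu> n) < 1" using n(3) by (rule order_tendstoD)
    then show "\<forall>\<^sub>F n in sequentially. \<bar>riem_dist D \<nu> \<nu>' - w n\<bar> \<le> C * sqrt (norm (\<nu> - \<mu> n)) + C * sqrt (norm (\<nu>' - dens D))"
      by eventually_elim (use n \<mu>p dens_pos_states in \<open>auto simp: w_def intro!: tri\<close>)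
  qed
  let ?F = "at (\<rho>, dens D) within pos_states D \<times> pos_states D"
  have "((\<lambda>q. riem_dist D (fst q) (snd q) - L) \<longlongrightarrow> 0) ?F"
  proof (rule Lim_null_comparison)
    have "((\<lambda>q. C * sqrt (norm (fst q - \<rho>)) + C * sqrt (norm (snd q - dens D))) \<longlongrightarrow>
       C * sqrt (norm (fst (\<rho>, dens D) - \<rho>)) + C * sqrt (norm (snd (\<rho>, dens D) - dens D))) ?F"
      by (intro tendsto_intros)
    then show "((\<lambda>q. C * sqrt (norm (fst q - \<rho>)) + C * sqrt (norm (snd q - dens D))) \<longlongrightarrow> 0) ?F" by simp
    have "((\<lambda>q. norm (fst q - \<rho>)) \<longlongrightarrow> norm (fst (\<rho>, dens D) - \<rho>)) ?F" "((\<lambda>q. norm (snd q - dens D)) \<longlongrightarrow> norm (snd (\<rho>, dens D) - dens D)) ?F"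
      by (intro tendsto_intros)+
    then have "\<forall>\<^sub>F q in ?F. norm (fst q - \<rho>) < 1" "\<forall>\<^sub>F q in ?F. norm (snd q - dens D) < 1"
      by (auto intro: order_tendstoD)
    moreover have "\<forall>\<^sub>F q in ?F. q \<in> pos_states D \<times> pos_states D" by (auto simp: eventually_at_filter)
    ultimately show "\<forall>\<^sub>F q in ?F. norm (riem_dist D (fst q) (snd q) - L) \<le> C * sqrt (norm (fst q - \<rho>)) + C * sqrt (norm (snd q - dens D))"
      by eventually_elim (auto intro!: near)
  qed
  then have lim: "((\<lambda>(\<mu>, \<nu>). riem_dist D \<mu> \<nu>) \<longlongrightarrow> L) ?F"
    by (simp add: LIM_zero_iff case_prod_unfold)
  \<comment> \<open>A limit point must be approached by other points; these differ from it because
    \<rho> is singular.\<close>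
  have "\<forall>n. (\<mu> n, dens D) \<in> pos_states D \<times> pos_states D - {(\<rho>, dens D)}"
    using \<mu>p dens_pos_states \<rho>(2) by auto
  moreover have "(\<lambda>n. (\<mu> n, dens D)) \<longlonglongrightarrow> (\<rho>, dens D)" by (intro tendsto_intros \<mu>lim)
  ultimately have "(\<rho>, dens D) islimpt pos_states D \<times> pos_states D"
    unfolding islimpt_sequential by (intro exI[of _ "\<lambda>n. (\<mu> n, dens D)"] conjI)
  then have nt: "?F \<noteq> bot" by (simp add: trivial_limit_within)
  have "transport_dist D \<rho> (dens D) = L"
    unfolding transport_dist_def using \<rho>(2) tendsto_Lim[OF nt lim] by simp
  then show ?thesis using LK by simp
qed

end

section \<open>Entropy\<close>

text \<open>The exponential series of \<open>L\<close> applied to \<open>x0\<close>, differentiated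
  in each coordinate as a real power series. Its partial sums lie in every invariant subspace that
  contains \<open>x0\<close>, and subspaces are closed.\<close>

lemma linear_ode_solution:
  fixes L :: "'a::euclidean_space \<Rightarrow> 'a"
  assumes L: "bounded_linear L"
  shows "\<exists>x. x 0 = x0 \<and> (\<forall>t. (x has_vector_derivative L (x t)) (at t)) \<and>
    (\<forall>S. subspace S \<longrightarrow> x0 \<in> S \<longrightarrow> (\<forall>y\<in>S. L y \<in> S) \<longrightarrow> (\<forall>t. x t \<in> S))"
proof -
  define a where "a k = (L ^^ k) x0" for k
  have aS: "a (Suc k) = L (a k)" for k unfolding a_def by simp
  obtain K where K: "K > 0" "\<And>y. norm (L y) \<le> norm y * K" using bounded_linear.pos_bounded[OF L] by blast
  have na: "norm (a k) \<le> K ^ k * norm x0" for k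
  proof (induction k)
    case (Suc k)
    have "norm (a (Suc k)) \<le> norm (a k) * K" unfolding aS by (rule K)
    also have "\<dots> \<le> (K ^ k * norm x0) * K" using Suc K by (intro mult_right_mono) auto
    finally show ?case by (simp add: mult_ac)
  qed (simp add: a_def)
  have sm: "summable (\<lambda>k. (t ^ k / fact k) *\<^sub>R a k)" for t :: real
  proof (rule summable_comparison_test)
    have "summable (\<lambda>k. norm x0 * (inverse (fact k) * (\<bar>t\<bar> * K) ^ k))"
      by (intro summable_mult summable_exp)
    then show "summable (\<lambda>k. (\<bar>t\<bar> ^ k / fact k) * (K ^ k * norm x0))"
      by (simp add: power_mult_distrib divide_inverse mult_ac)
    show "\<exists>N. \<forall>n\<ge>N. norm ((t ^ n / fact n) *\<^sub>R a n) \<le> (\<bar>t\<bar> ^ n / fact n) * (K ^ n * norm x0)"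
      using na by (auto simp: power_abs intro!: divide_right_mono mult_left_mono)
  qed
  define x where "x t = (\<Sum>k. (t ^ k / fact k) *\<^sub>R a k)" for t :: real
  have comp: "x t \<bullet> b = (\<Sum>k. (a k \<bullet> b / fact k) * t ^ k)" "summable (\<lambda>k. (a k \<bullet> b / fact k) * t ^ k)" for t b
    using bounded_linear.suminf[OF bounded_linear_inner_left[of b] sm[of t]]
      bounded_linear.summable[OF bounded_linear_inner_left[of b] sm[of t]]
    unfolding x_def by (simp_all add: mult_ac)
  have Lcomp: "L (x t) \<bullet> b = (\<Sum>k. diffs (\<lambda>k. a k \<bullet> b / fact k) k * t ^ k)" for t b
  proof -
    have l1: "L (x t) = (\<Sum>k. (t ^ k / fact k) *\<^sub>R a (Suc k))"
      unfolding x_def aS using bounded_linear.suminf[OF L sm, of t] by (simp add: linear_scale[OF bounded_linear.linear[OF L]])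
    have l2: "summable (\<lambda>k. (t ^ k / fact k) *\<^sub>R a (Suc k))"
      using bounded_linear.summable[OF L sm, of t] unfolding aS by (simp add: linear_scale[OF bounded_linear.linear[OF L]])
    have "L (x t) \<bullet> b = (\<Sum>k. ((t ^ k / fact k) *\<^sub>R a (Suc k)) \<bullet> b)"
      by (simp only: l1 bounded_linear.suminf[OF bounded_linear_inner_left l2])
    also have "\<dots> = (\<Sum>k. diffs (\<lambda>k. a k \<bullet> b / fact k) k * t ^ k)"
    proof (rule suminf_cong)
      fix k
      show "((t ^ k / fact k) *\<^sub>R a (Suc k)) \<bullet> b = diffs (\<lambda>k. a k \<bullet> b / fact k) k * t ^ k"
        unfolding diffs_def fact_Suc by (simp add: field_simps del: of_nat_Suc)
    qed
    finally show ?thesis .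
  qed
  have dx: "(x has_vector_derivative L (x t)) (at t)" for t
    unfolding has_vector_derivative_def
  proof (subst has_derivative_componentwise_within, intro ballI)
    fix b :: 'a
    have "((\<lambda>t. x t \<bullet> b) has_real_derivative L (x t) \<bullet> b) (at t)"
      unfolding comp(1) Lcomp by (rule termdiffs_strong_converges_everywhere[OF comp(2)])
    then show "((\<lambda>t. x t \<bullet> b) has_derivative (\<lambda>s. s *\<^sub>R L (x t) \<bullet> b)) (at t)"
      by (simp add: has_field_derivative_def mult_commute_abs)
  qed
  have "x 0 = a 0"
  proof -
    have "(\<lambda>k. (0 ^ k / fact k) *\<^sub>R a k) sums (\<Sum>k\<in>{0}. (0 ^ k / fact k :: real) *\<^sub>R a k)"
      by (rule sums_finite) auto
    then show ?thesis unfolding x_def using sums_unique by fastforce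
  qed
  moreover have "x t \<in> S" if S: "subspace S" "x0 \<in> S" "\<And>y. y \<in> S \<Longrightarrow> L y \<in> S" for t S
  proof -
    have aS: "a k \<in> S" for k by (induction k) (use S in \<open>auto simp: a_def\<close>)
    have "(\<lambda>n. \<Sum>k<n. (t ^ k / fact k) *\<^sub>R a k) \<longlonglongrightarrow> x t"
      unfolding x_def by (rule summable_LIMSEQ[OF sm])
    moreover have "(\<Sum>k<n. (t ^ k / fact k) *\<^sub>R a k) \<in> S" for n
      using aS S(1) by (intro subspace_sum subspace_scale)
    ultimately show ?thesis using closed_sequentially[OF closed_subspace[OF S(1)]] by metis
  qed
  ultimately show ?thesis using dx unfolding a_def by (intro exI[of _ x]) auto
qed

text \<open>From ln z \<le> z - 1 at z = a / b. The case b = 0, with value 0 for b ln b, covers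
  singular states.\<close>

lemma xlnx_klein:
  assumes "0 < a" "0 \<le> (b::real)"
  shows "0 \<le> b * ln b - a * ln a - (ln a + 1) * (b - a)"
proof (cases "b = 0")
  case False
  then have b: "0 < b" using assms by simp
  have "ln (a / b) \<le> a / b - 1" using assms b by (intro ln_le_minus_one) auto
  then have "b * (ln a - ln b) \<le> b * (a / b - 1)" using assms b by (intro mult_left_mono) (auto simp: ln_div)
  then show ?thesis using b by (simp add: algebra_simps)
qed (use assms in \<open>simp add: algebra_simps\<close>)

text \<open>The second derivative of x ln x is at least 1 / M on the interval up to
  \<open>M\<close>; the auxiliary \<open>h\<close> is therefore smallest at
  \<open>a\<close>.\<close>

lemma xlnx_klein_quadratic:
  assumes "0 < a" "0 < (b::real)" "a \<le> M" "b \<le> M"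
  shows "1 / (2 * M) * (a - b)\<^sup>2 \<le> b * ln b - a * ln a - (ln a + 1) * (b - a)"
proof -
  define h where "h b = b * ln b - a * ln a - (ln a + 1) * (b - a) - 1 / (2 * M) * (a - b)\<^sup>2" for b
  have d: "(h has_real_derivative ln x - ln a - (x - a) / M) (at x)" if "0 < x" for x
    unfolding h_def using that assms by (auto intro!: derivative_eq_intros simp: field_simps)
  have lnd: "(y - x) / M \<le> ln y - ln x" if "0 < x" "x \<le> y" "y \<le> M" for x y
  proof -
    have "ln (x / y) \<le> x / y - 1" using that by (intro ln_le_minus_one) auto
    then have "(y - x) / y \<le> ln y - ln x" using that by (simp add: ln_div diff_divide_distrib)
    moreover have "(y - x) / M \<le> (y - x) / y" using that by (intro divide_left_mono) auto
    ultimately show ?thesis by simp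
  qed
  have "h a \<le> h b"
  proof (cases "a \<le> b")
    case True
    show ?thesis
    proof (rule DERIV_nonneg_imp_nondecreasing[OF True])
      fix x assume "a \<le> x" "x \<le> b"
      then show "\<exists>y. (h has_real_derivative y) (at x) \<and> 0 \<le> y"
        using d[of x] lnd[of a x] assms by (intro exI[of _ "ln x - ln a - (x - a) / M"]) auto
    qed
  next
    case False
    then have "b \<le> a" by simp
    then show ?thesis
    proof (rule DERIV_nonpos_imp_nonincreasing)
      fix x assume x: "b \<le> x" "x \<le> a"
      have "(a - x) / M \<le> ln a - ln x" using x assms by (intro lnd) auto
      then have "ln x - ln a - (x - a) / M \<le> 0" by (simp add: diff_divide_distrib)
      then show "\<exists>y. (h has_real_derivative y) (at x) \<and> y \<le> 0" using d[of x] x assms by (intro exI[of _ "ln x - ln a - (x - a) / M"]) auto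
    qed
  qed
  then show ?thesis unfolding h_def by simp
qed

lemma ln_lipschitz:
  assumes "0 < m" "m \<le> a" "m \<le> (b::real)"
  shows "\<bar>ln a - ln b\<bar> \<le> 1 / m * \<bar>a - b\<bar>"
proof -
  have *: "ln a - ln b \<le> 1 / m * (a - b)" if "m \<le> b" "b \<le> a" for a b :: real
  proof -
    have "ln (a / b) \<le> a / b - 1" using that assms(1) by (intro ln_le_minus_one) auto
    then have "ln a - ln b \<le> (a - b) / b" using that assms(1) by (simp add: ln_div diff_divide_distrib)
    also have "\<dots> \<le> (a - b) / m" using that assms(1) by (intro divide_left_mono) auto
    finally show ?thesis by simp
  qed
  show ?thesis
  proof (cases "b \<le> a")
    case True
    then show ?thesis using *[of b a] assms by simp
  next
    case False
    then show ?thesis using *[of a b] assms by (simp add: abs_minus_commute)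
  qed
qed

lemma inverse_lipschitz:
  assumes "0 < m" "m \<le> a" "m \<le> (b::real)"
  shows "\<bar>- inverse a - - inverse b\<bar> \<le> inverse (m * m) * \<bar>a - b\<bar>"
proof -
  have e: "- inverse a - - inverse b = inverse (a * b) * (a - b)" using assms by (simp add: field_simps)
  have "inverse (a * b) \<le> inverse (m * m)" using assms by (intro le_imp_inverse_le mult_mono) auto
  moreover have "\<bar>- inverse a - - inverse b\<bar> = inverse (a * b) * \<bar>a - b\<bar>" unfolding e using assms by (simp add: abs_mult)
  ultimately show ?thesis by (simp add: mult_right_mono)
qed

section \<open>Differentiation of trace functionals\<close>

context tracial1
begin

text \<open>Klein's inequality at \<open>X\<close> and at \<open>Y\<close> places the remainder
  between 0 and the trace of (f'(Y) - f'(X)) (Y - X), which is quadratic by the Lipschitz bound for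
  f'.\<close>

lemma trace_fun_quadratic:
  assumes m: "0 < m" and conv: "\<And>a b. m \<le> a \<Longrightarrow> m \<le> b \<Longrightarrow> 0 \<le> f b - f a - f' a * (b - a)"
    and lip: "\<And>a b. m \<le> a \<Longrightarrow> m \<le> b \<Longrightarrow> \<bar>f' a - f' b\<bar> \<le> L * \<bar>a - b\<bar>"
  shows "\<exists>C. \<forall>X\<in>M. \<forall>Y\<in>M. adj X = X \<longrightarrow> adj Y = Y \<longrightarrow> lb m X \<longrightarrow> lb m Y \<longrightarrow>
    \<bar>Re (\<tau> (fcalc f Y)) - Re (\<tau> (fcalc f X)) - Re (\<tau> (fcalc f' X ** (Y - X)))\<bar> \<le> C * (norm (Y - X))\<^sup>2"
proof -
  obtain C where C: "C > 0" "\<And>X Y. X \<in> M \<Longrightarrow> Y \<in> M \<Longrightarrow> \<bar>Re (\<tau> (X ** Y))\<bar> \<le> C * norm X * norm Y"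
    using tr_norm_upper by blast
  obtain c where c: "c > 0" "\<And>X. X \<in> M \<Longrightarrow> c * (norm X)\<^sup>2 \<le> Re (\<tau> (adj X ** X))"
    using tr_norm_lower by blast
  define K where "K = C * sqrt (L\<^sup>2 * C / c)"
  have "\<bar>Re (\<tau> (fcalc f Y)) - Re (\<tau> (fcalc f X)) - Re (\<tau> (fcalc f' X ** (Y - X)))\<bar> \<le> K * (norm (Y - X))\<^sup>2"
    if X: "X \<in> M" "adj X = X" "lb m X" and Y: "Y \<in> M" "adj Y = Y" "lb m Y" for X Y
  proof -
    have sX: "\<And>a. a \<in> spec X \<Longrightarrow> m \<le> a" and sY: "\<And>a. a \<in> spec Y \<Longrightarrow> m \<le> a"
      using lb_spec X(3) Y(3) by blast+
    have 1: "Re (\<tau> (fcalc f' X ** (Y - X))) \<le> Re (\<tau> (fcalc f Y)) - Re (\<tau> (fcalc f X))"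
      using klein[OF X(1,2) Y(1,2), of 0 f f'] conv sX sY by simp
    have 2: "Re (\<tau> (fcalc f' Y ** (X - Y))) \<le> Re (\<tau> (fcalc f X)) - Re (\<tau> (fcalc f Y))"
      using klein[OF Y(1,2) X(1,2), of 0 f f'] conv sX sY by simp
    let ?Z = "fcalc f' Y - fcalc f' X"
    have Z: "?Z \<in> M" "adj ?Z = ?Z" using X Y by (auto simp: adj_diff adj_fcalc)
    have "?Z ** (Y - X) = - (fcalc f' Y ** (X - Y)) - fcalc f' X ** (Y - X)"
      by (simp add: mm.diff_left mm.diff_right)
    then have e: "Re (\<tau> (?Z ** (Y - X))) = - Re (\<tau> (fcalc f' Y ** (X - Y))) - Re (\<tau> (fcalc f' X ** (Y - X)))"
      using X Y by (simp add: tr_diff tr_minus)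
    have "c * (norm ?Z)\<^sup>2 \<le> Re (\<tau> (?Z ** ?Z))" using c(2)[OF Z(1)] Z(2) by simp
    also have "\<dots> \<le> L\<^sup>2 * Re (\<tau> ((Y - X) ** (Y - X)))"
      using lip sX sY by (intro fcalc_lipschitz X Y) auto
    also have "\<dots> \<le> L\<^sup>2 * (C * norm (Y - X) * norm (Y - X))"
      using C(2)[of "Y - X" "Y - X"] X Y by (intro mult_left_mono) auto
    finally have "(norm ?Z)\<^sup>2 \<le> (L\<^sup>2 * C / c) * (norm (Y - X))\<^sup>2"
      using c(1) by (simp add: field_simps power2_eq_square)
    then have "norm ?Z \<le> sqrt ((L\<^sup>2 * C / c) * (norm (Y - X))\<^sup>2)" by (rule real_le_rsqrt)
    then have nZ: "norm ?Z \<le> sqrt (L\<^sup>2 * C / c) * norm (Y - X)" by (simp only: real_sqrt_mult real_sqrt_abs abs_norm_cancel)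
    have "Re (\<tau> (?Z ** (Y - X))) \<le> C * norm ?Z * norm (Y - X)"
      using C(2)[OF Z(1), of "Y - X"] X Y by auto
    also have "\<dots> \<le> C * (sqrt (L\<^sup>2 * C / c) * norm (Y - X)) * norm (Y - X)"
      using nZ C(1) by (intro mult_right_mono mult_left_mono) auto
    also have "\<dots> = K * (norm (Y - X))\<^sup>2" unfolding K_def by (simp add: power2_eq_square)
    finally show ?thesis using 1 2 e by (simp add: abs_le_iff)
  qed
  then show ?thesis by blast
qed

text \<open>The trace is differentiated through its quadratic remainder, so the noncommutative
  derivative of f(\<rho>) itself never arises.\<close>

lemma trace_fun_deriv:
  assumes conv: "\<And>a b. 0 < a \<Longrightarrow> 0 < b \<Longrightarrow> 0 \<le> f b - f a - f' a * (b - a)"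
    and lip: "\<And>m. 0 < m \<Longrightarrow> \<exists>L. \<forall>a b. m \<le> a \<longrightarrow> m \<le> b \<longrightarrow> \<bar>f' a - f' b\<bar> \<le> L * \<bar>a - b\<bar>"
    and \<rho>: "\<And>s. \<rho> s \<in> M" "\<And>s. adj (\<rho> s) = \<rho> s" and m: "0 < m" "lb m (\<rho> t)"
    and d: "(\<rho> has_vector_derivative \<rho>') (at t)"
  shows "((\<lambda>s. Re (\<tau> (fcalc f (\<rho> s)))) has_real_derivative Re (\<tau> (fcalc f' (\<rho> t) ** \<rho>'))) (at t)"
proof -
  obtain T where T: "bounded_linear T" "\<And>X. X \<in> M \<Longrightarrow> \<tau> X = T X" using tr_linear_ext by metis
  \<comment> \<open>Half of \<open>m\<close> leaves room for the nearby states \<rho> s, which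
    satisfy only a slightly weaker lower bound.\<close>
  obtain L where L: "\<And>a b. m / 2 \<le> a \<Longrightarrow> m / 2 \<le> b \<Longrightarrow> \<bar>f' a - f' b\<bar> \<le> L * \<bar>a - b\<bar>"
    using lip[of "m / 2"] m by auto
  have "\<exists>C. \<forall>X\<in>M. \<forall>Y\<in>M. adj X = X \<longrightarrow> adj Y = Y \<longrightarrow> lb (m / 2) X \<longrightarrow> lb (m / 2) Y \<longrightarrow>
    \<bar>Re (\<tau> (fcalc f Y)) - Re (\<tau> (fcalc f X)) - Re (\<tau> (fcalc f' X ** (Y - X)))\<bar> \<le> C * (norm (Y - X))\<^sup>2"
    using m conv L by (intro trace_fun_quadratic) auto
  then obtain C where C: "\<And>X Y. X \<in> M \<Longrightarrow> Y \<in> M \<Longrightarrow> adj X = X \<Longrightarrow> adj Y = Y \<Longrightarrow> lb (m / 2) X \<Longrightarrow> lb (m / 2) Y \<Longrightarrow>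
    \<bar>Re (\<tau> (fcalc f Y)) - Re (\<tau> (fcalc f X)) - Re (\<tau> (fcalc f' X ** (Y - X)))\<bar> \<le> C * (norm (Y - X))\<^sup>2" by blast
  have M': "\<rho>' \<in> M"
  proof (rule Lim_in_closed_set[OF closed_M])
    show "((\<lambda>s. (\<rho> s - \<rho> t) /\<^sub>R (s - t)) \<longlongrightarrow> \<rho>') (at t)"
      using d by (simp add: has_vector_derivative_quotient)
  qed (use \<rho> in auto)
  obtain K where K: "K > 0" "\<And>(X :: complex^'n^'n) Y m. lb m X \<Longrightarrow> lb (m - K * norm (X - Y)) Y"
    using lb_perturb by blast
  have lim: "(\<rho> \<longlongrightarrow> \<rho> t) (at t)"
    using has_vector_derivative_continuous[OF d] by (simp add: continuous_at)
  have ev: "\<forall>\<^sub>F s in at t. lb (m / 2) (\<rho> s)"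
  proof -
    have "((\<lambda>s. norm (\<rho> t - \<rho> s)) \<longlongrightarrow> norm (\<rho> t - \<rho> t)) (at t)" by (intro tendsto_intros lim)
    then have "\<forall>\<^sub>F s in at t. norm (\<rho> t - \<rho> s) < m / (2 * K)" using m K by (intro order_tendstoD) auto
    then show ?thesis
    proof eventually_elim
      case (elim s)
      then have "K * norm (\<rho> t - \<rho> s) \<le> m / 2" using K(1) by (simp add: field_simps)
      then show ?case using K(2)[OF m(2), of "\<rho> s"] by (auto intro: lb_mono)
    qed
  qed
  let ?g = "\<lambda>s. Re (\<tau> (fcalc f (\<rho> s)))" and ?l = "\<lambda>Y. Re (T (fcalc f' (\<rho> t) ** Y))"
  have bl: "bounded_linear ?l"
    by (intro bounded_linear_compose[OF bounded_linear_Re] bounded_linear_compose[OF T(1)] mm.bounded_linear_right)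
  have lt: "lb (m / 2) (\<rho> t)" using m by (auto intro: lb_mono)
  have q: "((\<lambda>s. (\<rho> s - \<rho> t) /\<^sub>R (s - t)) \<longlongrightarrow> \<rho>') (at t)"
    using d by (simp add: has_vector_derivative_quotient)
  have "((\<lambda>s. (?g s - ?g t) /\<^sub>R (s - t) - ?l ((\<rho> s - \<rho> t) /\<^sub>R (s - t))) \<longlongrightarrow> 0) (at t)"
  proof (rule Lim_null_comparison)
    have "((\<lambda>s. \<bar>C\<bar> * norm (\<rho> s - \<rho> t) * norm ((\<rho> s - \<rho> t) /\<^sub>R (s - t))) \<longlongrightarrow> \<bar>C\<bar> * norm (\<rho> t - \<rho> t) * norm \<rho>') (at t)"
      by (intro tendsto_mult tendsto_const tendsto_norm tendsto_diff lim q)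
    then show "((\<lambda>s. \<bar>C\<bar> * norm (\<rho> s - \<rho> t) * norm ((\<rho> s - \<rho> t) /\<^sub>R (s - t))) \<longlongrightarrow> 0) (at t)" by simp
    show "\<forall>\<^sub>F s in at t. norm ((?g s - ?g t) /\<^sub>R (s - t) - ?l ((\<rho> s - \<rho> t) /\<^sub>R (s - t))) \<le>
        \<bar>C\<bar> * norm (\<rho> s - \<rho> t) * norm ((\<rho> s - \<rho> t) /\<^sub>R (s - t))"
      using ev
    proof eventually_elim
      case (elim s)
      have "?l (\<rho> s - \<rho> t) = Re (\<tau> (fcalc f' (\<rho> t) ** (\<rho> s - \<rho> t)))" using T(2) \<rho> by simp
      then have "\<bar>?g s - ?g t - ?l (\<rho> s - \<rho> t)\<bar> \<le> C * (norm (\<rho> s - \<rho> t))\<^sup>2"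
        using C[OF \<rho>(1) \<rho>(1) \<rho>(2) \<rho>(2) lt elim] by simp
      also have "\<dots> \<le> \<bar>C\<bar> * (norm (\<rho> s - \<rho> t))\<^sup>2" by (intro mult_right_mono) auto
      finally have b: "\<bar>?g s - ?g t - ?l (\<rho> s - \<rho> t)\<bar> \<le> \<bar>C\<bar> * (norm (\<rho> s - \<rho> t))\<^sup>2" .
      have "(?g s - ?g t) /\<^sub>R (s - t) - ?l ((\<rho> s - \<rho> t) /\<^sub>R (s - t)) = (?g s - ?g t - ?l (\<rho> s - \<rho> t)) /\<^sub>R (s - t)"
        unfolding linear_scale[OF bounded_linear.linear[OF bl]] by (simp add: algebra_simps)
      then have "norm ((?g s - ?g t) /\<^sub>R (s - t) - ?l ((\<rho> s - \<rho> t) /\<^sub>R (s - t))) = \<bar>?g s - ?g t - ?l (\<rho> s - \<rho> t)\<bar> * inverse \<bar>s - t\<bar>"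
        by (simp add: abs_mult)
      also have "\<dots> \<le> \<bar>C\<bar> * (norm (\<rho> s - \<rho> t))\<^sup>2 * inverse \<bar>s - t\<bar>" using b by (intro mult_right_mono) auto
      finally show ?case by (simp add: power2_eq_square mult_ac)
    qed
  qed
  moreover have "((\<lambda>s. ?l ((\<rho> s - \<rho> t) /\<^sub>R (s - t))) \<longlongrightarrow> ?l \<rho>') (at t)"
    by (rule bounded_linear.tendsto[OF bl q])
  ultimately have "((\<lambda>s. ((?g s - ?g t) /\<^sub>R (s - t) - ?l ((\<rho> s - \<rho> t) /\<^sub>R (s - t))) + ?l ((\<rho> s - \<rho> t) /\<^sub>R (s - t))) \<longlongrightarrow> 0 + ?l \<rho>') (at t)"
    by (rule tendsto_add)
  then have "((\<lambda>s. (?g s - ?g t) /\<^sub>R (s - t)) \<longlongrightarrow> ?l \<rho>') (at t)" by simp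
  then have "(?g has_vector_derivative ?l \<rho>') (at t)" by (simp only: has_vector_derivative_quotient)
  moreover have "?l \<rho>' = Re (\<tau> (fcalc f' (\<rho> t) ** \<rho>'))" using T(2) \<rho> M' by simp
  ultimately show ?thesis by (simp add: has_real_derivative_iff_has_vector_derivative)
qed

lemma trace_xlnx_deriv:
  assumes "\<And>s. \<rho> s \<in> M" "\<And>s. adj (\<rho> s) = \<rho> s" "0 < m" "lb m (\<rho> t)" "(\<rho> has_vector_derivative \<rho>') (at t)"
  shows "((\<lambda>s. Re (\<tau> (fcalc (\<lambda>a. a * ln a) (\<rho> s)))) has_real_derivative Re (\<tau> (fcalc (\<lambda>a. ln a + 1) (\<rho> t) ** \<rho>'))) (at t)"
  by (rule trace_fun_deriv[OF _ _ assms(1-5)])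
    (use xlnx_klein ln_lipschitz in \<open>fastforce intro!: exI[of _ "1 / _"]\<close>)+

lemma trace_ln_deriv:
  assumes "\<And>s. \<rho> s \<in> M" "\<And>s. adj (\<rho> s) = \<rho> s" "0 < m" "lb m (\<rho> t)" "(\<rho> has_vector_derivative \<rho>') (at t)"
  shows "((\<lambda>s. Re (\<tau> (fcalc (\<lambda>a. - ln a) (\<rho> s)))) has_real_derivative Re (\<tau> (fcalc (\<lambda>a. - inverse a) (\<rho> t) ** \<rho>'))) (at t)"
proof (rule trace_fun_deriv[OF _ _ assms(1-5)])
  fix a b :: real assume "0 < a" "0 < b"
  then show "0 \<le> - ln b - - ln a - - inverse a * (b - a)"
    using ln_le_minus_one[of "b / a"] by (simp add: ln_div field_simps)
next
  fix m :: real assume "0 < m"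
  then show "\<exists>L. \<forall>a b. m \<le> a \<longrightarrow> m \<le> b \<longrightarrow> \<bar>- inverse a - - inverse b\<bar> \<le> L * \<bar>a - b\<bar>"
    using inverse_lipschitz by blast
qed

end

section \<open>The gradient flow of the entropy\<close>

context dstruct_j
begin

lemma cform_nonneg:
  assumes "p \<in> alg D" "q \<in> alg D" "adj p = p" "adj q = q"
  shows "0 \<le> Re (cform j (p ** p) (q ** q))"
proof -
  let ?W = "l p ** V ** r q"
  have a: "adj (l p) = l p" "adj (r q) = r q" using l(5)[of p] r(5)[of q] assms by simp_all
  have "cform j (p ** p) (q ** q) = btr D j ((adj V ** l p ** l p ** V ** r q) ** r q)"
    unfolding cform_def using assms by (simp add: l(4) r(4) matrix_mul_assoc)
  also have "\<dots> = btr D j (r q ** (adj V ** l p ** l p ** V ** r q))" using assms by (intro B.tr_cyc) auto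
  also have "r q ** (adj V ** l p ** l p ** V ** r q) = adj ?W ** ?W"
    by (simp add: adj_mult a matrix_mul_assoc)
  finally show ?thesis using B.tr_pos[of ?W] assms by simp
qed

text \<open>With \<open>Y\<close> inverse to \<open>X\<close>, the products on the same side
  collapse and leave the squared norm of \<open>V\<close>. The mixed terms enter with a negative
  sign and are nonnegative when \<open>X\<close> is positive, so the sum is bounded above however
  singular \<open>X\<close> may be.\<close>

lemma Q_inverse:
  assumes X: "X \<in> alg D" "adj X = X" and Y: "Y \<in> alg D" "X ** Y = mat 1" "Y ** X = mat 1"
  shows "btr D j (adj (Qop j X) ** d Y) =
    of_real (exp (- freq D j / 2) + exp (freq D j / 2)) * btr D j (adj V ** V)
    - of_real (exp (- freq D j / 2)) * cform j Y X - of_real (exp (freq D j / 2)) * cform j X Y"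
proof -
  let ?p = "exp (- freq D j / 2)" and ?q = "exp (freq D j / 2)"
  have a: "adj (l X) = l X" "adj (r X) = r X" using l(5)[of X] r(5)[of X] X by simp_all
  have inv: "l X ** l Y = bunit D j" "r Y ** r X = bunit D j" using X Y by (simp_all add: l(6) r(6) flip: l(4) r(4))
  have "adj (Qop j X) = ?p *\<^sub>R (r X ** adj V) - ?q *\<^sub>R (adj V ** l X)"
    unfolding Qop_def by (simp add: adj_diff adj_scaleR adj_mult a)
  then have "adj (Qop j X) ** d Y = ?p *\<^sub>R (r X ** (adj V ** V ** r Y)) - ?p *\<^sub>R (r X ** (adj V ** l Y ** V))
     - ?q *\<^sub>R (adj V ** l X ** V ** r Y) + ?q *\<^sub>R (adj V ** (l X ** l Y) ** V)"
    unfolding pderiv_op_def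
    by (simp add: mm.diff_left mm.diff_right mm.scaleR_left mm.scaleR_right scaleR_diff_right matrix_mul_assoc)
  then have "btr D j (adj (Qop j X) ** d Y) = ?p *\<^sub>R btr D j (r X ** (adj V ** V ** r Y)) - ?p *\<^sub>R btr D j (r X ** (adj V ** l Y ** V))
     - ?q *\<^sub>R btr D j (adj V ** l X ** V ** r Y) + ?q *\<^sub>R btr D j (adj V ** (l X ** l Y) ** V)"
    using X Y by (simp add: B.tr_add B.tr_diff B.tr_scaleR)
  moreover have "btr D j (r X ** (adj V ** V ** r Y)) = btr D j (adj V ** V)"
    using X Y B.tr_cyc[of "r X" "adj V ** V ** r Y"] by (simp add: matrix_mul_assoc[symmetric] inv B.unit)
  moreover have "btr D j (r X ** (adj V ** l Y ** V)) = cform j Y X"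
    using X Y B.tr_cyc[of "r X" "adj V ** l Y ** V"] unfolding cform_def by simp
  ultimately show ?thesis
    unfolding inv cform_def[symmetric] by (simp add: B.unit scaleR_conv_of_real algebra_simps)
qed

end

section \<open>Existence and positivity of the flow\<close>

context dstruct_erg
begin

lemma traceless_step:
  assumes x: "x \<in> traceless D"
  shows "\<exists>\<epsilon>>0. dens D + \<epsilon> *\<^sub>R x \<in> pos_states D"
proof -
  obtain m where m: "m > 0" "lb m (dens D)" using pos_states_lb[OF dens_pos_states] by blast
  obtain K where K: "K > 0" "\<And>(X :: complex^'n^'n) Y m. lb m X \<Longrightarrow> lb (m - K * norm (X - Y)) Y"
    using lb_perturb by blast
  define \<epsilon> where "\<epsilon> = m / (2 * K * (norm x + 1))"
  have p: "0 < norm x + 1" by (simp add: add_nonneg_pos)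
  have e: "\<epsilon> > 0" unfolding \<epsilon>_def using m K p by simp
  have "K * norm (dens D - (dens D + \<epsilon> *\<^sub>R x)) = K * \<epsilon> * norm x" using e by simp
  also have "\<dots> = m / 2 * (norm x / (norm x + 1))" unfolding \<epsilon>_def using K by simp
  also have "\<dots> \<le> m / 2 * 1" using m p by (intro mult_left_mono) auto
  finally have "lb (m / 2) (dens D + \<epsilon> *\<^sub>R x)" using K(2)[OF m(2), of "dens D + \<epsilon> *\<^sub>R x"] by (auto intro: lb_mono)
  then have "dens D + \<epsilon> *\<^sub>R x \<in> pos_states D"
    using m tracelessD[OF x] by (intro pos_statesI[of _ "m / 2"]) (auto simp: adj_add adj_scaleR A.tr_add A.tr_scaleR)
  then show ?thesis using e by blast
qed

lemma Lop_pos_states_traceless: "\<rho> \<in> pos_states D \<Longrightarrow> Lop \<rho> \<in> traceless D"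
  unfolding Lop_K using pos_statesD[of \<rho>] by (intro K_traceless) (auto simp: adj_diff adj_fcalc)

text \<open>A small multiple of \<open>x\<close> added to the density gives a positive state, where
  the representation by \<open>K_op\<close> applies; \<open>Lop\<close> vanishes at the density, so
  linearity transfers the conclusion to \<open>x\<close>.\<close>

lemma Lop_traceless:
  assumes x: "x \<in> traceless D"
  shows "Lop x \<in> traceless D"
proof -
  obtain \<epsilon> where e: "\<epsilon> > 0" "dens D + \<epsilon> *\<^sub>R x \<in> pos_states D" using traceless_step[OF x] by blast
  have "Lop (dens D + \<epsilon> *\<^sub>R x) = \<epsilon> *\<^sub>R Lop x"
    using tracelessD[OF x] by (simp add: Lop_add Lop_scaleR Lop_dens)
  then have "Lop x = (1 / \<epsilon>) *\<^sub>R Lop (dens D + \<epsilon> *\<^sub>R x)" using e by simp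
  then show ?thesis using subspace_scale[OF traceless_subspace Lop_pos_states_traceless[OF e(2)]] by metis
qed

text \<open>Since \<open>Lop\<close> vanishes at the density, the deviation from it solves a linear
  equation and remains in the invariant subspace of traceless elements. The affine time change in
  the last conjunct prepares the restriction to a time step.\<close>

lemma flow_exists:
  assumes \<rho>0: "\<rho>0 \<in> pos_states D"
  shows "\<exists>\<rho>. \<rho> 0 = \<rho>0 \<and> (\<forall>t. \<rho> t - dens D \<in> traceless D) \<and> (\<forall>t. (\<rho> has_vector_derivative Lop (\<rho> t)) (at t)) \<and>
    (\<forall>k t h. Ck k (\<lambda>s u. \<rho> (t + h * s)))"
proof -
  obtain L where L: "linear L" "\<And>x. x \<in> traceless D \<Longrightarrow> L x = Lop x"
    using linear_extension[OF traceless_subspace, of Lop] Lop_add Lop_scaleR tracelessD(1) by metis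
  have bL: "bounded_linear L" using L(1) linear_conv_bounded_linear by blast
  have LT: "L x \<in> traceless D" if "x \<in> traceless D" for x using L(2)[OF that] Lop_traceless[OF that] by simp
  have x0: "\<rho>0 - dens D \<in> traceless D" by (rule pos_states_diff[OF \<rho>0 dens_pos_states])
  obtain x where x: "x 0 = \<rho>0 - dens D" "\<And>t. (x has_vector_derivative L (x t)) (at t)"
    "\<And>S. subspace S \<Longrightarrow> \<rho>0 - dens D \<in> S \<Longrightarrow> (\<forall>y\<in>S. L y \<in> S) \<Longrightarrow> \<forall>t. x t \<in> S"
    using linear_ode_solution[OF bL, of "\<rho>0 - dens D"] by blast
  have xT: "x t \<in> traceless D" for t using x(3)[OF traceless_subspace x0] LT by blast
  define \<rho> where "\<rho> t = dens D + x t" for t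
  have "L (x t) = Lop (\<rho> t)" for t
    unfolding \<rho>_def using tracelessD(1)[OF xT] by (simp add: L(2)[OF xT] Lop_add Lop_dens)
  then have "(\<rho> has_vector_derivative Lop (\<rho> t)) (at t)" for t
    using has_vector_derivative_add[OF has_vector_derivative_const[of "dens D"] x(2)[of t]] unfolding \<rho>_def[abs_def] by simp
  moreover have "Ck k (\<lambda>s u. \<rho> (t + h * s))" for k t h
  proof -
    have lk: "bounded_linear ((L ^^ k))" for k
      by (induction k) (auto intro: bounded_linear_compose[OF bL] simp: o_def bounded_linear_ident id_def)
    have "smooth01 (\<lambda>s. x (t + h * s))"
      unfolding smooth01_def
    proof (intro exI[of _ "\<lambda>k s. h ^ k *\<^sub>R (L ^^ k) (x (t + h * s))"] conjI ballI allI)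
      fix k and s :: real
      have "((\<lambda>s. t + h * s) has_vector_derivative h) (at s within {0..1})"
        by (auto intro!: derivative_eq_intros simp: has_real_derivative_iff_has_vector_derivative[symmetric])
      from vector_derivative_diff_chain_within[OF this, of x "\<lambda>y. y *\<^sub>R L (x (t + h * s))"]
      have "((\<lambda>s. x (t + h * s)) has_vector_derivative h *\<^sub>R L (x (t + h * s))) (at s within {0..1})"
        using has_vector_derivative_at_within[OF x(2)[of "t + h * s"]] by (simp add: o_def has_vector_derivative_def)
      from bounded_linear.has_vector_derivative[OF bounded_linear_compose[OF bounded_linear_scaleR_right lk] this, of "h ^ k" k]
      show "((\<lambda>s. h ^ k *\<^sub>R (L ^^ k) (x (t + h * s))) has_vector_derivative h ^ Suc k *\<^sub>R (L ^^ Suc k) (x (t + h * s))) (at s within {0..1})"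
        by (simp add: linear_scale[OF bounded_linear.linear[OF lk]] funpow_swap1 mult.commute)
    qed simp
    from Ck_add[OF Ck_const[of k "dens D"] smooth01_Ck[OF this]] show ?thesis unfolding \<rho>_def .
  qed
  moreover have "\<rho> 0 = \<rho>0" unfolding \<rho>_def x(1) by simp
  moreover have "\<rho> t - dens D \<in> traceless D" for t unfolding \<rho>_def using xT by simp
  ultimately show ?thesis by blast
qed

text \<open>The right-hand side is the derivative of the trace of log \<rho> along the flow.
  Dropping the nonnegative mixed terms leaves a bound that depends only on the weights and on
  \<open>V\<close>.\<close>

lemma log_trace_dissipation:
  "\<exists>c. \<forall>\<rho>\<in>pos_states D. - c \<le> Re (tr D (fcalc inverse \<rho> ** Lop \<rho>))"
proof -
  define c where "c = (\<Sum>j\<in>idx D. (exp (- freq D j / 2) + exp (freq D j / 2)) * Re (btr D j (adj (vee D j) ** vee D j)))"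
  have "- c \<le> Re (tr D (fcalc inverse \<rho> ** Lop \<rho>))" if \<rho>: "\<rho> \<in> pos_states D" for \<rho>
  proof -
    note rr = pos_statesD[OF \<rho>]
    let ?Y = "fcalc inverse \<rho>"
    have Y: "?Y \<in> alg D" "adj ?Y = ?Y" using rr by (auto intro: adj_fcalc)
    have sq: "fcalc sqrt \<rho> ** fcalc sqrt \<rho> = \<rho>" "fcalc (\<lambda>a. inverse (sqrt a)) \<rho> ** fcalc (\<lambda>a. inverse (sqrt a)) \<rho> = ?Y"
      unfolding fcalc_mult[OF rr(2)]
      using fcalc_cong[of \<rho> "\<lambda>a. sqrt a * sqrt a" "\<lambda>a. a"] fcalc_id[OF rr(2)] less_imp_le[OF rr(4)]
        fcalc_cong[of \<rho> "\<lambda>a. inverse (sqrt a) * inverse (sqrt a)" inverse]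
      by (simp_all add: inverse_mult_distrib[symmetric] del: inverse_mult_distrib)
    have inv: "\<rho> ** ?Y = mat 1" "?Y ** \<rho> = mat 1"
      using fcalc_mult[OF rr(2), of "\<lambda>a. a" inverse] fcalc_mult[OF rr(2), of inverse "\<lambda>a. a"]
        fcalc_cong[of \<rho> "\<lambda>a. a * inverse a" "\<lambda>a. 1"] fcalc_cong[of \<rho> "\<lambda>a. inverse a * a" "\<lambda>a. 1"] rr(4)
      by (simp_all add: fcalc_id[OF rr(2)] fcalc_one[OF rr(2)] less_imp_neq[symmetric])
    have "Re (tr D (?Y ** Lop \<rho>)) = Re (tr D (adj (Lop \<rho>) ** ?Y))"
      using A.tr_adj[of "?Y ** Lop \<rho>"] Y rr by (simp add: adj_mult)
    also have "\<dots> = - (\<Sum>j\<in>idx D. Re (btr D j (adj (Qop j \<rho>) ** pderiv_op D j ?Y)))"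
      using Lop_trace[OF rr(1) Y(1)] by simp
    finally have e: "Re (tr D (?Y ** Lop \<rho>)) = - (\<Sum>j\<in>idx D. Re (btr D j (adj (Qop j \<rho>) ** pderiv_op D j ?Y)))" .
    have "(\<Sum>j\<in>idx D. Re (btr D j (adj (Qop j \<rho>) ** pderiv_op D j ?Y))) \<le> c"
      unfolding c_def
    proof (rule sum_mono)
      fix j assume j: "j \<in> idx D"
      interpret p: dstruct_j D j by (rule J[OF j])
      have s: "fcalc sqrt \<rho> \<in> alg D" "fcalc (\<lambda>a. inverse (sqrt a)) \<rho> \<in> alg D"
        "adj (fcalc sqrt \<rho>) = fcalc sqrt \<rho>" "adj (fcalc (\<lambda>a. inverse (sqrt a)) \<rho>) = fcalc (\<lambda>a. inverse (sqrt a)) \<rho>"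
        using rr by (auto intro: adj_fcalc)
      have "0 \<le> Re (cform j ?Y \<rho>)" "0 \<le> Re (cform j \<rho> ?Y)"
        using p.cform_nonneg[OF s(2,1,4,3)] p.cform_nonneg[OF s(1,2,3,4)] unfolding sq by auto
      then have "0 \<le> exp (- freq D j / 2) * Re (cform j ?Y \<rho>) + exp (freq D j / 2) * Re (cform j \<rho> ?Y)"
        by (intro add_nonneg_nonneg mult_nonneg_nonneg) auto
      then show "Re (btr D j (adj (Qop j \<rho>) ** p.d ?Y)) \<le> (exp (- freq D j / 2) + exp (freq D j / 2)) * Re (btr D j (adj p.V ** p.V))"
        unfolding p.Q_inverse[OF rr(1,2) Y(1) inv] by simp
    qed
    then show ?thesis unfolding e by simp
  qed
  then show ?thesis by blast
qed

text \<open>Eigenvalues other than \<open>a\<close> contribute at most 1 to the trace of log \<rho>,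
  since ln b \<le> b and \<rho> has trace 1. As every spectral projection has trace at least
  \<kappa>, a tiny \<open>a\<close> would push the total below \<open>G\<close>.\<close>

lemma log_trace_lb:
  "\<exists>m>0. \<forall>\<rho>\<in>pos_states D. G \<le> Re (tr D (fcalc ln \<rho>)) \<longrightarrow> lb m \<rho>"
proof -
  obtain c where c: "c > 0" "\<And>X. X \<in> alg D \<Longrightarrow> c * (norm X)\<^sup>2 \<le> Re (tr D (adj X ** X))"
    using A.tr_norm_lower by blast
  have "\<exists>K>0. \<forall>(X :: complex^'n^'n) (Y :: complex^'n^'n). norm (X ** Y) \<le> norm X * norm Y * K" by (rule mm.pos_bounded)
  then obtain K where K: "K > 0" "\<And>(X :: complex^'n^'n) (Y :: complex^'n^'n). norm (X ** Y) \<le> norm X * norm Y * K"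
    by blast
  \<comment> \<open>A nonzero idempotent E = E ** E has norm at least 1 / K.\<close>
  define \<kappa> where "\<kappa> = c * (1 / K)\<^sup>2"
  have k0: "\<kappa> > 0" unfolding \<kappa>_def using c K by simp
  \<comment> \<open>The 1 pays for the other eigenvalues; a negative value makes the comparison
    trivial when ln a is nonnegative.\<close>
  define g where "g = min G 0 - 1"
  have g: "g < 0" "g \<le> G - 1" unfolding g_def by auto
  have "lb (exp (g / \<kappa>)) \<rho>" if \<rho>: "\<rho> \<in> pos_states D" and G: "G \<le> Re (tr D (fcalc ln \<rho>))" for \<rho>
  proof (rule lbI_spec)
    note rr = pos_statesD[OF \<rho>]
    show "adj \<rho> = \<rho>" by (rule rr)
    fix a assume a: "a \<in> spec \<rho>"
    define w where "w b = Re (tr D (eproj \<rho> b))" for b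
    have w: "\<kappa> \<le> w b" if "b \<in> spec \<rho>" for b
    proof -
      let ?E = "eproj \<rho> b"
      have E: "?E \<in> alg D" "adj ?E = ?E" "?E ** ?E = ?E" "?E \<noteq> 0"
        using rr that eproj_nonzero eproj_mult[OF rr(2), of b b] by (auto intro: adj_eproj)
      have "norm ?E \<le> norm ?E * norm ?E * K" using K(2)[of ?E ?E] E(3) by simp
      then have "1 / K \<le> norm ?E" using E(4) K(1) by (simp add: field_simps)
      then have "\<kappa> \<le> c * (norm ?E)\<^sup>2" unfolding \<kappa>_def using c K by (intro mult_left_mono power_mono) auto
      also have "\<dots> \<le> w b" unfolding w_def using c(2)[OF E(1)] E(2,3) by simp
      finally show ?thesis .
    qed
    have tr: "Re (tr D (fcalc f \<rho>)) = (\<Sum>b\<in>spec \<rho>. f b * w b)" for f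
      unfolding fcalc_eq w_def using rr by (simp add: A.tr_sum A.tr_scaleR)
    have one: "(\<Sum>b\<in>spec \<rho>. b * w b) = 1" using tr[of "\<lambda>a. a"] rr by (simp add: fcalc_id[OF rr(2)])
    have fin: "finite (spec \<rho>)" by (rule finite_spec[OF rr(2)])
    have "G \<le> (\<Sum>b\<in>spec \<rho>. ln b * w b)" using G tr by simp
    also have "\<dots> = ln a * w a + (\<Sum>b\<in>spec \<rho> - {a}. ln b * w b)" by (rule sum.remove[OF fin a])
    also have "(\<Sum>b\<in>spec \<rho> - {a}. ln b * w b) \<le> (\<Sum>b\<in>spec \<rho> - {a}. b * w b)"
    proof (intro sum_mono mult_right_mono)
      fix b assume b: "b \<in> spec \<rho> - {a}"
      show "ln b \<le> b" using ln_le_minus_one[of b] rr(4)[of b] b by simp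
      show "0 \<le> w b" using w[of b] b k0 by simp
    qed
    also have "(\<Sum>b\<in>spec \<rho> - {a}. b * w b) \<le> (\<Sum>b\<in>spec \<rho>. b * w b)"
    proof (rule sum_mono2[OF fin])
      show "0 \<le> b * w b" if "b \<in> spec \<rho> - (spec \<rho> - {a})" for b
        using that w[of b] rr(4)[of b] k0 by (intro mult_nonneg_nonneg) auto
    qed auto
    finally have "G \<le> ln a * w a + 1" using one by simp
    then have ga: "g \<le> ln a * w a" using g by simp
    have "g / \<kappa> \<le> ln a"
    proof (cases "0 \<le> ln a")
      case True
      have "g / \<kappa> < 0" using g k0 by (simp add: divide_neg_pos)
      then show ?thesis using True by simp
    next
      case False
      then have "ln a * w a \<le> ln a * \<kappa>" using w[OF a] by (intro mult_left_mono_neg) auto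
      then show ?thesis using ga k0 by (simp add: divide_le_eq)
    qed
    then show "exp (g / \<kappa>) \<le> a" using rr(4)[OF a] by (metis exp_le_cancel_iff exp_ln)
  qed
  then show ?thesis by (intro exI[of _ "exp (g / \<kappa>)"]) auto
qed

text \<open>At the first exit time the state is still bounded below, by the bound on the trace of
  the logarithm; positivity is an open condition, so it persists a little longer, a
  contradiction.\<close>

lemma flow_pos:
  assumes \<rho>: "\<rho> 0 \<in> pos_states D" "\<And>t. \<rho> t - dens D \<in> traceless D"
    "\<And>t. (\<rho> has_vector_derivative Lop (\<rho> t)) (at t)" and t: "0 \<le> t"
  shows "\<rho> t \<in> pos_states D"
proof (rule ccontr)
  assume nt: "\<rho> t \<notin> pos_states D"
  have mem: "\<rho> s \<in> alg D" "adj (\<rho> s) = \<rho> s" "tr D (\<rho> s) = 1" for s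
  proof -
    have "\<rho> s = dens D + (\<rho> s - dens D)" by simp
    moreover note tracelessD[OF \<rho>(2)[of s]]
    ultimately show "\<rho> s \<in> alg D" "adj (\<rho> s) = \<rho> s" "tr D (\<rho> s) = 1"
      using A.mem(3)[OF dens(1), of "\<rho> s - dens D"] adj_add[of "dens D" "\<rho> s - dens D"]
        A.tr_add[OF dens(1), of "\<rho> s - dens D"] by (metis dens(2), metis dens(2), metis add.right_neutral dens(3))
  qed
  have cont: "continuous_on UNIV \<rho>"
    using \<rho>(3) has_vector_derivative_continuous continuous_at_imp_continuous_on by blast
  define bad where "bad = {s. 0 \<le> s \<and> \<rho> s \<notin> pos_states D}"
  have bad: "t \<in> bad" "bdd_below bad" unfolding bad_def using nt t by (auto intro: bdd_belowI[of _ 0])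
  define T where "T = Inf bad"
  have T0: "0 \<le> T" unfolding T_def using bad by (intro cInf_greatest) (auto simp: bad_def)
  have good: "\<rho> s \<in> pos_states D" if "0 \<le> s" "s < T" for s
  proof (rule ccontr)
    assume "\<rho> s \<notin> pos_states D"
    then have "T \<le> s" unfolding T_def using that bad by (intro cInf_lower) (auto simp: bad_def)
    then show False using that by simp
  qed
  obtain c where c: "\<And>\<rho>. \<rho> \<in> pos_states D \<Longrightarrow> - c \<le> Re (tr D (fcalc inverse \<rho> ** Lop \<rho>))"
    using log_trace_dissipation by blast
  define g where "g s = Re (tr D (fcalc ln (\<rho> s)))" for s
  have dg: "(g has_real_derivative Re (tr D (fcalc inverse (\<rho> s) ** Lop (\<rho> s)))) (at s)" if "\<rho> s \<in> pos_states D" for s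
  proof -
    obtain m where m: "m > 0" "lb m (\<rho> s)" using pos_states_lb[OF \<open>\<rho> s \<in> pos_states D\<close>] by blast
    have neg: "fcalc (\<lambda>a. - f a) X = - fcalc f X" for f X unfolding fcalc_eq by (simp add: sum_negf)
    have "((\<lambda>s. Re (tr D (fcalc (\<lambda>a. - ln a) (\<rho> s)))) has_real_derivative Re (tr D (fcalc (\<lambda>a. - inverse a) (\<rho> s) ** Lop (\<rho> s)))) (at s)"
      by (rule A.trace_ln_deriv[OF mem(1,2) m \<rho>(3)])
    then have "((\<lambda>s. - g s) has_real_derivative - Re (tr D (fcalc inverse (\<rho> s) ** Lop (\<rho> s)))) (at s)"
      unfolding neg g_def using mem by (simp add: A.tr_minus mm.minus_left)
    from DERIV_minus[OF this] show ?thesis by simp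
  qed
  \<comment> \<open>On the interval before the exit the trace of the logarithm loses at most |c| T,
    so all states there share one positive lower bound.\<close>
  have gl: "g 0 - \<bar>c\<bar> * T \<le> g s" if s: "0 \<le> s" "s < T" for s
  proof (cases "s = 0")
    case False
    then have "0 < s" using s by simp
    then obtain z where z: "0 < z" "z < s" "g s - g 0 = (s - 0) * Re (tr D (fcalc inverse (\<rho> z) ** Lop (\<rho> z)))"
      using MVT2[of 0 s g "\<lambda>s. Re (tr D (fcalc inverse (\<rho> s) ** Lop (\<rho> s)))"] dg good s by auto
    have "s * (- \<bar>c\<bar>) \<le> s * Re (tr D (fcalc inverse (\<rho> z) ** Lop (\<rho> z)))"
      using c[OF good[of z]] z s by (intro mult_left_mono) auto
    moreover have "T * (- \<bar>c\<bar>) \<le> s * (- \<bar>c\<bar>)" using s by (intro mult_right_mono_neg) auto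
    ultimately show ?thesis using z(3) by (simp add: mult.commute)
  qed (use T0 in auto)
  obtain m where m: "m > 0" "\<And>\<rho>. \<rho> \<in> pos_states D \<Longrightarrow> g 0 - \<bar>c\<bar> * T \<le> Re (tr D (fcalc ln \<rho>)) \<Longrightarrow> lb m \<rho>"
    using log_trace_lb[of "g 0 - \<bar>c\<bar> * T"] by blast
  have "\<rho> T \<in> pos_states D"
  proof (cases "T = 0")
    case False
    then have T: "0 < T" using T0 by simp
    \<comment> \<open>The common bound is a closed condition and passes to the limit from the
      left.\<close>
    have "lb m (\<rho> T)"
      unfolding lb_def
    proof
      fix v :: "complex^'n"
      have "(\<rho> \<longlongrightarrow> \<rho> T) (at_left T)"
        using cont by (meson UNIV_I at_within_open continuous_on_def filterlim_at_within_closure_implies_filterlim open_UNIV tendsto_within_subset subset_UNIV)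
      then have "((\<lambda>s. v \<bullet> (\<rho> s *v v)) \<longlongrightarrow> v \<bullet> (\<rho> T *v v)) (at_left T)"
        by (intro tendsto_inner tendsto_const mv.tendsto)
      moreover have "\<forall>\<^sub>F s in at_left T. m * (v \<bullet> v) \<le> v \<bullet> (\<rho> s *v v)"
        using eventually_at_left_real[OF T]
      proof eventually_elim
        case (elim s)
        then have "lb m (\<rho> s)" using m(2)[OF good[of s]] gl[of s] unfolding g_def by auto
        then show ?case unfolding lb_def by blast
      qed
      ultimately show "m * (v \<bullet> v) \<le> v \<bullet> (\<rho> T *v v)"
        by (rule tendsto_lowerbound) simp
    qed
    then show ?thesis using mem m(1) by (intro pos_statesI)
  qed (use \<rho>(1) in simp)
  then obtain n where n: "n > 0" "lb n (\<rho> T)" using pos_states_lb by blast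
  obtain K where K: "K > 0" "\<And>(X :: complex^'n^'n) Y m. lb m X \<Longrightarrow> lb (m - K * norm (X - Y)) Y"
    using lb_perturb by blast
  have "isCont \<rho> T" using cont by (simp add: continuous_on_eq_continuous_at)
  then obtain \<delta> where \<delta>: "\<delta> > 0" "\<And>s. dist s T < \<delta> \<Longrightarrow> dist (\<rho> s) (\<rho> T) < n / (2 * K)"
    unfolding continuous_at_eps_delta using n K by (metis divide_pos_pos mult_pos_pos zero_less_numeral)
  have "s \<ge> T + \<delta>" if s: "s \<in> bad" for s
  proof (rule ccontr)
    assume "\<not> T + \<delta> \<le> s"
    moreover have "T \<le> s" unfolding T_def using s bad by (intro cInf_lower)
    ultimately have "dist s T < \<delta>" by (simp add: dist_real_def)
    then have "dist (\<rho> s) (\<rho> T) < n / (2 * K)" by (rule \<delta>(2))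
    then have "norm (\<rho> T - \<rho> s) < n / (2 * K)" by (simp add: dist_norm norm_minus_commute)
    then have "K * norm (\<rho> T - \<rho> s) \<le> n / 2" using K(1) by (simp add: field_simps)
    then have "lb (n / 2) (\<rho> s)" using K(2)[OF n(2), of "\<rho> s"] by (auto intro: lb_mono)
    then have "\<rho> s \<in> pos_states D" using mem n(1) by (intro pos_statesI[of _ "n / 2"]) auto
    then show False using s unfolding bad_def by simp
  qed
  then have "T + \<delta> \<le> T" using bad(1) unfolding T_def by (intro cInf_greatest) auto
  then show False using \<delta>(1) by simp
qed

definition fisher :: "complex^'n^'n \<Rightarrow> real" where
  "fisher \<rho> = - Re (tr D ((fcalc ln \<rho> - fcalc ln (dens D)) ** Lop \<rho>))"

text \<open>\<open>K_op\<close> annihilates the unit, so the entropy potential may be shifted to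
  trace 0 without changing its image; the shift also drops out of the cost, because
  \<open>Lop \<rho>\<close> has trace 0.\<close>

lemma cost_Lop:
  assumes \<rho>: "\<rho> \<in> pos_states D"
  shows "cost \<rho> (Lop \<rho>) = fisher \<rho>"
proof -
  note rr = pos_statesD[OF \<rho>]
  let ?Y = "fcalc ln (dens D) - fcalc ln \<rho>"
  define c where "c = - Re (tr D ?Y) / Re (tr D (mat 1))"
  define X where "X = ?Y + c *\<^sub>R mat 1"
  have Y: "?Y \<in> alg D" "adj ?Y = ?Y" using rr by (auto simp: adj_diff adj_fcalc)
  have one: "mat 1 \<in> alg D" by (rule A.mem(1))
  have r1: "Im (tr D Z) = 0" if "Z \<in> alg D" "adj Z = Z" for Z
    using A.tr_adj[OF that(1)] that(2) by (metis cnj.simps(2) equal_neg_zero)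
  have "Re (tr D (mat 1)) \<noteq> 0"
  proof
    assume "Re (tr D (mat 1)) = 0"
    then have "(mat 1 :: complex^'n^'n) = 0" using A.tr_pos_eq0[OF one] by simp
    then show False by (simp add: mat_def vec_eq_iff) (metis zero_neq_one)
  qed
  then have "tr D X = 0"
  proof -
    assume n: "Re (tr D (mat 1)) \<noteq> 0"
    have e: "tr D X = tr D ?Y + c *\<^sub>R tr D (mat 1)"
      unfolding X_def using Y one by (subst A.tr_add) (auto simp: A.tr_scaleR)
    have "c * Re (tr D (mat 1)) = - Re (tr D ?Y)" unfolding c_def using n by simp
    moreover have "adj (mat 1 :: complex^'n^'n) = mat 1" by simp
    ultimately show ?thesis unfolding e complex_eq_iff plus_complex.sel scaleR_complex.sel r1[OF Y] r1[OF one \<open>adj (mat 1) = mat 1\<close>] by simp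
  qed
  then have X: "X \<in> traceless D" unfolding traceless_def X_def using Y one by (simp add: adj_add adj_scaleR)
  have "K_op D \<rho> (mat 1) = 0"
  proof -
    have "pderiv_adj D j (dop j \<rho> (theta D j) (pderiv_op D j (mat 1))) = 0" if j: "j \<in> idx D" for j
    proof -
      interpret p: dstruct_j D j by (rule J[OF j])
      show ?thesis unfolding p.d_one using p.d'_scaleR[of 0 0] by (simp add: dop_def)
    qed
    then show ?thesis unfolding K_alt[OF rr(1,2)] by simp
  qed
  then have "K_op D \<rho> X = Lop \<rho>"
    unfolding X_def Lop_K[OF \<rho>] using Y one by (simp add: K_add[OF rr(1,2)] K_scaleR[OF rr(1,2)])
  then have "Kinv \<rho> (Lop \<rho>) = X" using Kinv_unique[OF \<rho> X] by simp
  then have "cost \<rho> (Lop \<rho>) = Re (tr D (?Y ** Lop \<rho> + c *\<^sub>R Lop \<rho>))"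
    unfolding cost_def X_def by (simp add: mm.add_left mm.scaleR_left)
  also have "\<dots> = Re (tr D (?Y ** Lop \<rho>))"
    using Y rr tracelessD(3)[OF Lop_pos_states_traceless[OF \<rho>]] by (simp add: A.tr_add A.tr_scaleR)
  also have "?Y ** Lop \<rho> = - ((fcalc ln \<rho> - fcalc ln (dens D)) ** Lop \<rho>)"
    by (simp add: mm.minus_left[symmetric])
  finally show ?thesis unfolding fisher_def using rr by (simp add: A.tr_minus)
qed

section \<open>Convexity and positivity of the entropy\<close>

abbreviation Ent :: "complex^'n^'n \<Rightarrow> real" where "Ent \<equiv> rel_ent D"

lemma Ent_alt:
  assumes "\<rho> \<in> alg D" "adj \<rho> = \<rho>"
  shows "Ent \<rho> = Re (tr D (fcalc (\<lambda>a. a * ln a) \<rho>)) - Re (tr D (\<rho> ** fcalc ln (dens D)))"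
  unfolding rel_ent_def using assms fcalc_mult[OF assms(2), of "\<lambda>a. a" ln]
  by (simp add: mm.diff_right A.tr_diff fcalc_id[OF assms(2)])

lemma fcalc_ln_plus: "adj X = X \<Longrightarrow> fcalc (\<lambda>a. ln a + 1) X = fcalc ln X + mat 1"
  using fcalc_one[of X] unfolding fcalc_eq by (simp add: scaleR_add_left sum.distrib)

lemma statesD: "\<rho> \<in> states D \<Longrightarrow> \<rho> \<in> alg D" "\<rho> \<in> states D \<Longrightarrow> adj \<rho> = \<rho>" "\<rho> \<in> states D \<Longrightarrow> tr D \<rho> = 1"
  "\<rho> \<in> states D \<Longrightarrow> a \<in> spec \<rho> \<Longrightarrow> 0 \<le> a"
  using spec_nonneg unfolding states_def pos_semidef_def by auto

text \<open>Klein's inequality for x ln x; the summand 1 in its derivative disappears because both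
  states have trace 1.\<close>

lemma Ent_tangent:
  assumes \<rho>: "\<rho> \<in> states D" and \<mu>: "\<mu> \<in> pos_states D"
  shows "Re (tr D (fcalc ln \<mu> ** (\<rho> - \<mu>))) \<le> Re (tr D (fcalc (\<lambda>a. a * ln a) \<rho>)) - Re (tr D (fcalc (\<lambda>a. a * ln a) \<mu>))"
proof -
  note r = statesD[OF \<rho>] and m = pos_statesD[OF \<mu>]
  have "Re (tr D (fcalc (\<lambda>a. ln a + 1) \<mu> ** (\<rho> - \<mu>))) \<le> Re (tr D (fcalc (\<lambda>a. a * ln a) \<rho>)) - Re (tr D (fcalc (\<lambda>a. a * ln a) \<mu>))"
    using A.klein[OF m(1,2) r(1,2), of 0 "\<lambda>a. a * ln a" "\<lambda>a. ln a + 1"] xlnx_klein r(4) m(4) by simp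
  moreover have "tr D (\<rho> - \<mu>) = 0" using r m by (simp add: A.tr_diff)
  ultimately show ?thesis unfolding fcalc_ln_plus[OF m(2)] using r m by (simp add: mm.add_left A.tr_add)
qed

lemma Ent_dens: "Ent (dens D) = 0"
  unfolding rel_ent_def by simp

text \<open>The tangent at the mixture is tested at both end points with the weights of the mixture;
  the first-order terms cancel, and the entropy of the density is 0.\<close>

lemma Ent_mix:
  assumes \<rho>: "\<rho> \<in> states D" and t: "0 < t" "t \<le> 1"
  shows "Ent ((1 - t) *\<^sub>R \<rho> + t *\<^sub>R dens D) \<le> (1 - t) * Ent \<rho>"
proof -
  let ?H = "\<lambda>X. Re (tr D (fcalc (\<lambda>a. a * ln a) X))" and ?g = "\<lambda>X. Re (tr D (X ** fcalc ln (dens D)))"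
  let ?\<mu> = "(1 - t) *\<^sub>R \<rho> + t *\<^sub>R dens D"
  have \<mu>: "?\<mu> \<in> pos_states D" by (rule states_mix_pos[OF \<rho> dens_pos_states t])
  note r = statesD[OF \<rho>] and m = pos_statesD[OF \<mu>]
  have 1: "(1 - t) * Re (tr D (fcalc ln ?\<mu> ** (\<rho> - ?\<mu>))) \<le> (1 - t) * (?H \<rho> - ?H ?\<mu>)"
    using Ent_tangent[OF \<rho> \<mu>] t by (intro mult_left_mono) auto
  have 2: "t * Re (tr D (fcalc ln ?\<mu> ** (dens D - ?\<mu>))) \<le> t * (?H (dens D) - ?H ?\<mu>)"
    using Ent_tangent[OF subsetD[OF pos_states_states dens_pos_states] \<mu>] t by (intro mult_left_mono) auto
  have e1: "\<rho> - ?\<mu> = t *\<^sub>R (\<rho> - dens D)" and e2: "dens D - ?\<mu> = (1 - t) *\<^sub>R (dens D - \<rho>)"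
    by (simp_all add: algebra_simps)
  have "(1 - t) * Re (tr D (fcalc ln ?\<mu> ** (\<rho> - ?\<mu>))) + t * Re (tr D (fcalc ln ?\<mu> ** (dens D - ?\<mu>))) = 0"
  proof -
    have "(1 - t) * Re (tr D (L ** (t *\<^sub>R (\<rho> - dens D)))) + t * Re (tr D (L ** ((1 - t) *\<^sub>R (dens D - \<rho>)))) = 0"
      if L: "L \<in> alg D" for L
      using L r by (simp add: mm.scaleR_right mm.diff_right A.tr_scaleR A.tr_diff) (simp add: algebra_simps)
    then show ?thesis unfolding e1 e2 using m by blast
  qed
  then have H: "?H ?\<mu> \<le> (1 - t) * ?H \<rho> + t * ?H (dens D)" using 1 2 by (simp add: algebra_simps)
  have g: "?g ?\<mu> = (1 - t) * ?g \<rho> + t * ?g (dens D)"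
    using r by (simp add: mm.add_left mm.scaleR_left A.tr_add A.tr_scaleR)
  have "Ent ?\<mu> \<le> (1 - t) * (?H \<rho> - ?g \<rho>) + t * (?H (dens D) - ?g (dens D))"
    unfolding Ent_alt[OF m(1,2)] g using H by (simp add: algebra_simps)
  then show ?thesis using Ent_alt[OF r(1,2)] Ent_alt[OF dens(1,2)] Ent_dens by simp
qed

lemma Ent_nonneg:
  assumes "\<rho> \<in> states D"
  shows "0 \<le> Ent \<rho>"
proof -
  note r = statesD[OF assms]
  have "Re (tr D (fcalc ln (dens D) ** (\<rho> - dens D))) = Re (tr D (\<rho> ** fcalc ln (dens D))) - Re (tr D (dens D ** fcalc ln (dens D)))"
    using r A.tr_cyc[of "fcalc ln (dens D)" \<rho>] A.tr_cyc[of "fcalc ln (dens D)" "dens D"] by (simp add: mm.diff_right A.tr_diff)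
  then show ?thesis
    using Ent_tangent[OF assms dens_pos_states] Ent_alt[OF r(1,2)] Ent_alt[OF dens(1,2)] Ent_dens by simp
qed

text \<open>The spectra of all states lie below a common \<open>M\<close>, where x ln x is strongly
  convex; the quadratic term of Klein's inequality survives and makes convergence of the entropy
  imply convergence of states.\<close>

lemma pinsker: "\<exists>c>0. \<forall>\<rho>\<in>pos_states D. c * (norm (\<rho> - dens D))\<^sup>2 \<le> Ent \<rho>"
proof -
  obtain c where c: "c > 0" "\<And>X. X \<in> alg D \<Longrightarrow> c * (norm X)\<^sup>2 \<le> Re (tr D (adj X ** X))"
    using A.tr_norm_lower by blast
  obtain R where R: "R > 0" "\<And>\<rho>. \<rho> \<in> states D \<Longrightarrow> norm \<rho> \<le> R" using states_bounded by blast
  have "\<exists>K>0. \<forall>(X :: complex^'n^'n) (v :: complex^'n). norm (X *v v) \<le> norm X * norm v * K"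
    by (rule mv.pos_bounded)
  then obtain K where K: "K > 0" "\<And>(X :: complex^'n^'n) (v :: complex^'n). norm (X *v v) \<le> norm X * norm v * K"
    by blast
  define M where "M = R * K"
  have M0: "M > 0" unfolding M_def using R K by simp
  have sM: "a \<le> M" if \<rho>: "\<rho> \<in> states D" and a: "a \<in> spec \<rho>" for \<rho> a
  proof -
    obtain v where v: "v \<noteq> 0" "\<rho> *v v = a *\<^sub>R v" using a unfolding spec_eq by blast
    have "\<bar>a\<bar> * norm v \<le> norm \<rho> * norm v * K" using K(2)[of \<rho> v] v(2) by simp
    then have "norm v * \<bar>a\<bar> \<le> norm v * (norm \<rho> * K)" by (simp add: mult_ac)
    then have "\<bar>a\<bar> \<le> norm \<rho> * K" using v(1) by simp
    also have "\<dots> \<le> M" unfolding M_def using R(2)[OF \<rho>] K(1) by (intro mult_right_mono) auto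
    finally show ?thesis by simp
  qed
  have "(c / (2 * M)) * (norm (\<rho> - dens D))\<^sup>2 \<le> Ent \<rho>" if \<rho>: "\<rho> \<in> pos_states D" for \<rho>
  proof -
    note r = pos_statesD[OF \<rho>] and d = pos_statesD[OF dens_pos_states]
    have st: "\<rho> \<in> states D" "dens D \<in> states D" using \<rho> dens_pos_states pos_states_states by blast+
    have k: "Re (tr D (fcalc (\<lambda>a. ln a + 1) (dens D) ** (\<rho> - dens D))) + 1 / (2 * M) * Re (tr D ((dens D - \<rho>) ** (dens D - \<rho>)))
        \<le> Re (tr D (fcalc (\<lambda>a. a * ln a) \<rho>)) - Re (tr D (fcalc (\<lambda>a. a * ln a) (dens D)))"
      by (rule A.klein[OF d(1,2) r(1,2)]) (use xlnx_klein_quadratic sM st r(4) d(4) in blast)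
    have "tr D (\<rho> - dens D) = 0" using r d by (simp add: A.tr_diff)
    then have l: "Re (tr D (fcalc (\<lambda>a. ln a + 1) (dens D) ** (\<rho> - dens D))) =
       Re (tr D (\<rho> ** fcalc ln (dens D))) - Re (tr D (dens D ** fcalc ln (dens D)))"
      unfolding fcalc_ln_plus[OF d(2)]
      using r A.tr_cyc[of "fcalc ln (dens D)" \<rho>] A.tr_cyc[of "fcalc ln (dens D)" "dens D"]
      by (simp add: mm.add_left mm.diff_right A.tr_add A.tr_diff)
    have "1 / (2 * M) * Re (tr D ((dens D - \<rho>) ** (dens D - \<rho>))) \<le> Ent \<rho>"
      using k l Ent_alt[OF r(1,2)] Ent_alt[OF d(1,2)] Ent_dens by simp
    moreover have "c * (norm (\<rho> - dens D))\<^sup>2 \<le> Re (tr D ((dens D - \<rho>) ** (dens D - \<rho>)))"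
      using c(2)[of "dens D - \<rho>"] r d by (simp add: adj_diff norm_minus_commute)
    then have "1 / (2 * M) * (c * (norm (\<rho> - dens D))\<^sup>2) \<le> 1 / (2 * M) * Re (tr D ((dens D - \<rho>) ** (dens D - \<rho>)))"
      using M0 by (intro mult_left_mono) auto
    ultimately show ?thesis by simp
  qed
  then show ?thesis using c(1) M0 by (intro exI[of _ "c / (2 * M)"]) auto
qed

end

text \<open>The square of sqrt a + sqrt b is at most 4 a = 4 b + 4 (a - b), and the hypothesis
  bounds 4 h b by (2 / l) (a - b). Writing a - b as (sqrt a - sqrt b) (sqrt a + sqrt b) and
  cancelling the sum gives the claim.\<close>

lemma sqrt_step_le:
  assumes l: "0 < l" and h: "0 \<le> h" and b: "0 \<le> b" and le: "2 * l * h * b \<le> a - (b::real)"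
  shows "sqrt (h * (a - b)) \<le> sqrt (2 / l + 4 * h) * (sqrt a - sqrt b)"
proof (cases "a = b")
  case False
  have "0 \<le> 2 * l * h * b" using l h b by simp
  then have ba: "b < a" using le False by linarith
  define d where "d = sqrt a - sqrt b"
  define s where "s = sqrt a + sqrt b"
  have d: "0 < d" unfolding d_def using ba by simp
  have s: "0 < s" unfolding s_def using ba b by (simp add: add_pos_nonneg)
  have ds: "d * s = a - b" unfolding d_def s_def using ba b by (simp add: algebra_simps)
  have "s \<le> sqrt a + sqrt a" unfolding s_def using ba by simp
  then have "s * s \<le> (sqrt a + sqrt a) * (sqrt a + sqrt a)" using s ba b by (intro mult_mono) auto
  also have "\<dots> = 4 * a" using ba b by (simp add: algebra_simps)
  finally have ss: "s * s \<le> 4 * a" .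
  have hb: "4 * (h * b) \<le> (2 / l) * (a - b)" using le l by (simp add: field_simps)
  have "h * (s * s) \<le> h * (4 * a)" using ss h by (rule mult_left_mono)
  also have "\<dots> = 4 * (h * b) + 4 * h * (a - b)" by (simp add: algebra_simps)
  also have "\<dots> \<le> (2 / l) * (a - b) + 4 * h * (a - b)" using hb by simp
  also have "\<dots> = (2 / l + 4 * h) * d * s" unfolding mult.assoc ds by (simp add: algebra_simps)
  finally have "s * (h * s) \<le> s * ((2 / l + 4 * h) * d)" by (simp add: mult_ac)
  then have "h * s \<le> (2 / l + 4 * h) * d" using s by simp
  then have "(h * s) * d \<le> ((2 / l + 4 * h) * d) * d" using d by (intro mult_right_mono) auto
  then have "h * (a - b) \<le> (2 / l + 4 * h) * d\<^sup>2" unfolding ds[symmetric] by (simp add: power2_eq_square mult_ac)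
  then have "sqrt (h * (a - b)) \<le> sqrt ((2 / l + 4 * h) * d\<^sup>2)" by (rule real_sqrt_le_mono)
  also have "\<dots> = sqrt (2 / l + 4 * h) * d" using d by (simp add: real_sqrt_mult)
  finally show ?thesis unfolding d_def .
qed simp

section \<open>The transport inequality along the flow\<close>

context dstruct_erg
begin

lemma Ent_flow_deriv:
  assumes \<rho>: "\<And>s. \<rho> s - dens D \<in> traceless D" "\<And>s. (\<rho> has_vector_derivative Lop (\<rho> s)) (at s)"
    and t: "\<rho> t \<in> pos_states D"
  shows "((\<lambda>s. Ent (\<rho> s)) has_real_derivative - fisher (\<rho> t)) (at t)"
proof -
  have mem: "\<rho> s \<in> alg D" "adj (\<rho> s) = \<rho> s" for s
  proof -
    have e: "\<rho> s = dens D + (\<rho> s - dens D)" by simp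
    show "\<rho> s \<in> alg D" by (subst e) (use tracelessD[OF \<rho>(1)[of s]] in blast)
    show "adj (\<rho> s) = \<rho> s" by (subst e, subst adj_add) (simp add: tracelessD[OF \<rho>(1)[of s]])
  qed
  note r = pos_statesD[OF t]
  obtain T where T: "bounded_linear T" "\<And>X. X \<in> alg D \<Longrightarrow> tr D X = T X" using A.tr_linear_ext by metis
  obtain m where m: "m > 0" "lb m (\<rho> t)" using pos_states_lb[OF t] by blast
  let ?L = "fcalc ln (dens D)"
  have "bounded_linear (\<lambda>X. Re (T (X ** ?L)))"
    by (intro bounded_linear_compose[OF bounded_linear_Re] bounded_linear_compose[OF T(1)] mm.bounded_linear_left)
  from bounded_linear.has_vector_derivative[OF this \<rho>(2)[of t]]
  have 1: "((\<lambda>s. Re (tr D (\<rho> s ** ?L))) has_real_derivative Re (tr D (Lop (\<rho> t) ** ?L))) (at t)"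
    using T(2) mem by (simp add: has_real_derivative_iff_has_vector_derivative)
  have 2: "((\<lambda>s. Re (tr D (fcalc (\<lambda>a. a * ln a) (\<rho> s)))) has_real_derivative Re (tr D (fcalc (\<lambda>a. ln a + 1) (\<rho> t) ** Lop (\<rho> t)))) (at t)"
    by (rule A.trace_xlnx_deriv[OF mem m \<rho>(2)])
  have "Re (tr D (fcalc (\<lambda>a. ln a + 1) (\<rho> t) ** Lop (\<rho> t))) - Re (tr D (Lop (\<rho> t) ** ?L)) = - fisher (\<rho> t)"
    unfolding fcalc_ln_plus[OF r(2)] fisher_def
    using r tracelessD(3)[OF Lop_pos_states_traceless[OF t]] A.tr_cyc[of "Lop (\<rho> t)" ?L]
    by (simp add: mm.add_left mm.diff_left A.tr_add A.tr_diff)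
  then show ?thesis
    unfolding Ent_alt[OF mem] using DERIV_diff[OF 2 1] by simp
qed

text \<open>Rescaling a step to unit time multiplies the squared speed by h^2. One factor h is
  absorbed by the substitution in the integral, so the action is h times the entropy drop.\<close>

lemma flow_dist:
  assumes \<rho>: "\<And>s. \<rho> s - dens D \<in> traceless D" "\<And>s. (\<rho> has_vector_derivative Lop (\<rho> s)) (at s)"
    "\<And>k t h. Ck k (\<lambda>s u. \<rho> (t + h * s))" "\<And>s. 0 \<le> s \<Longrightarrow> \<rho> s \<in> pos_states D" and t: "0 \<le> t" and h: "0 \<le> h"
  shows "riem_dist D (\<rho> t) (\<rho> (t + h)) \<le> sqrt (h * (Ent (\<rho> t) - Ent (\<rho> (t + h))))"
proof (rule riem_dist_le)
  let ?\<gamma> = "\<lambda>s. \<rho> (t + h * s)"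
  have pos: "?\<gamma> s \<in> pos_states D" if "s \<in> {0..1}" for s using \<rho>(4) t h that by simp
  have aff: "((\<lambda>s. t + h * s) has_real_derivative h) (at s)" for s
    by (auto intro!: derivative_eq_intros)
  show "curve (\<rho> t) (\<rho> (t + h)) ?\<gamma> (\<lambda>s. h *\<^sub>R Lop (?\<gamma> s))"
    unfolding curve_def
  proof (intro conjI allI ballI)
    fix s :: real assume "s \<in> {0..1}"
    have "((\<lambda>s. t + h * s) has_vector_derivative h) (at s within {0..1})"
      using aff[of s] by (simp add: has_real_derivative_iff_has_vector_derivative has_vector_derivative_at_within)
    from vector_derivative_diff_chain_within[OF this, of \<rho> "\<lambda>y. y *\<^sub>R Lop (\<rho> (t + h * s))"]
    show "(?\<gamma> has_vector_derivative h *\<^sub>R Lop (?\<gamma> s)) (at s within {0..1})"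
      using has_vector_derivative_at_within[OF \<rho>(2)[of "t + h * s"]] by (simp add: o_def has_vector_derivative_def)
  qed (use \<rho>(3) pos in auto)
  show "cost (?\<gamma> s) (h *\<^sub>R Lop (?\<gamma> s)) \<le> h\<^sup>2 * fisher (?\<gamma> s)" if "s \<in> {0..1}" for s
    using cost_scaleR[OF pos[OF that] Lop_pos_states_traceless[OF pos[OF that]]] cost_Lop[OF pos[OF that]] by simp
  have "((\<lambda>s. h\<^sup>2 * fisher (?\<gamma> s)) has_integral (- h * Ent (?\<gamma> 1) - - h * Ent (?\<gamma> 0))) {0..1}"
  proof (rule fundamental_theorem_of_calculus)
    fix s :: real assume s: "s \<in> {0..1}"
    have "((\<lambda>s. Ent (?\<gamma> s)) has_real_derivative - fisher (?\<gamma> s) * h) (at s)"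
      by (rule DERIV_chain2[OF Ent_flow_deriv[OF \<rho>(1,2) pos[OF s]] aff])
    from DERIV_cmult[OF this, of "- h"]
    show "((\<lambda>s. - h * Ent (?\<gamma> s)) has_vector_derivative h\<^sup>2 * fisher (?\<gamma> s)) (at s within {0..1})"
      by (simp add: has_real_derivative_iff_has_vector_derivative has_vector_derivative_at_within power2_eq_square mult_ac)
  qed simp
  then show "((\<lambda>s. h\<^sup>2 * fisher (?\<gamma> s)) has_integral h * (Ent (\<rho> t) - Ent (\<rho> (t + h)))) {0..1}"
    by (simp add: algebra_simps)
qed

context
  fixes lam :: real
  assumes lam: "0 < lam" and mlsi: "MLSI D lam"
begin

lemma fisher_lower:
  assumes \<rho>: "\<rho> \<in> pos_states D"
  shows "2 * lam * Ent \<rho> \<le> fisher \<rho>"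
proof -
  have "ereal (Ent \<rho>) \<le> ereal (1 / (2 * lam)) * fisher_info D \<rho>"
    using mlsi pos_states_states \<rho> unfolding MLSI_def by blast
  then have "Ent \<rho> \<le> 1 / (2 * lam) * fisher \<rho>"
    using \<rho> pos_statesD[OF \<rho>] unfolding fisher_info_def fisher_def by (simp add: generator_adj_eq)
  then show ?thesis using lam by (simp add: field_simps)
qed

lemma riem_dist_dens:
  assumes \<rho>0: "\<rho>0 \<in> pos_states D"
  shows "riem_dist D \<rho>0 (dens D) \<le> sqrt (2 / lam * Ent \<rho>0)"
proof -
  obtain \<rho> where \<rho>: "\<rho> 0 = \<rho>0" "\<And>t. \<rho> t - dens D \<in> traceless D" "\<And>t. (\<rho> has_vector_derivative Lop (\<rho> t)) (at t)"
    "\<And>k t h. Ck k (\<lambda>s u. \<rho> (t + h * s))" using flow_exists[OF \<rho>0] by blast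
  have pos: "\<rho> t \<in> pos_states D" if "0 \<le> t" for t
    using flow_pos[OF _ \<rho>(2,3) that] \<rho>(1) \<rho>0 by simp
  define F where "F t = Ent (\<rho> t)" for t
  have F0: "0 \<le> F t" if "0 \<le> t" for t unfolding F_def using pos[OF that] Ent_nonneg pos_states_states by blast
  have dF: "(F has_real_derivative - fisher (\<rho> t)) (at t)" if "0 \<le> t" for t
    unfolding F_def[abs_def] by (rule Ent_flow_deriv[OF \<rho>(2,3) pos[OF that]])
  have fl: "2 * lam * F t \<le> fisher (\<rho> t)" if "0 \<le> t" for t
    unfolding F_def by (rule fisher_lower[OF pos[OF that]])
  have dec: "F t \<le> F s" if "0 \<le> s" "s \<le> t" for s t
  proof (rule DERIV_nonpos_imp_nonincreasing[OF that(2)])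
    fix x assume x: "s \<le> x" "x \<le> t"
    then have "0 \<le> x" using that by simp
    moreover from this have "0 \<le> 2 * lam * F x" using F0 lam by simp
    ultimately show "\<exists>y. (F has_real_derivative y) (at x) \<and> y \<le> 0"
      using dF[of x] fl[of x] by (intro exI[of _ "- fisher (\<rho> x)"]) auto
  qed
  \<comment> \<open>By the mean value theorem the drop is h times the Fisher information at an
    intermediate time z, which is at least 2 \<lambda> F(z), and F(z) dominates F at the later end
    point.\<close>
  have step: "2 * lam * h * F (t + h) \<le> F t - F (t + h)" if "0 \<le> t" "0 < h" for t h
  proof -
    have lt: "t < t + h" using that by simp
    have dx: "(F has_real_derivative - fisher (\<rho> x)) (at x)" if "t \<le> x" "x \<le> t + h" for x
      using dF[of x] that \<open>0 \<le> t\<close> by simp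
    obtain z where z: "t < z" "z < t + h" "F (t + h) - F t = (t + h - t) * (- fisher (\<rho> z))"
      using MVT2[OF lt dx] by blast
    have "2 * lam * F (t + h) \<le> 2 * lam * F z" using dec[of z "t + h"] z that lam by simp
    also have "\<dots> \<le> fisher (\<rho> z)" using fl[of z] z that by simp
    finally have "h * (2 * lam * F (t + h)) \<le> h * fisher (\<rho> z)" using that by (intro mult_left_mono) auto
    then show ?thesis using z(3) by (simp add: algebra_simps)
  qed
  obtain C where C: "C > 0" "\<And>\<mu> \<nu>. \<mu> \<in> pos_states D \<Longrightarrow> \<nu> \<in> pos_states D \<Longrightarrow> norm (\<mu> - \<nu>) \<le> 1 \<Longrightarrow>
      riem_dist D \<mu> \<nu> \<le> C * sqrt (norm (\<mu> - \<nu>))" using riem_dist_hoelder by blast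
  obtain p where p: "p > 0" "\<And>\<rho>. \<rho> \<in> pos_states D \<Longrightarrow> p * (norm (\<rho> - dens D))\<^sup>2 \<le> Ent \<rho>" using pinsker by blast
  have main: "riem_dist D \<rho>0 (dens D) \<le> sqrt (2 / lam + 4 * h) * sqrt (F 0)" if h: "0 < h" for h
  proof -
    let ?k = "sqrt (2 / lam + 4 * h)"
    have tele: "riem_dist D \<rho>0 (\<rho> (real n * h)) \<le> ?k * (sqrt (F 0) - sqrt (F (real n * h)))" for n
    proof (induction n)
      case 0
      show ?case using C(2)[OF \<rho>0 \<rho>0] \<rho>(1) by simp
    next
      case (Suc n)
      let ?t = "real n * h"
      have t: "0 \<le> ?t" and tS: "real (Suc n) * h = ?t + h" using h by (auto simp: algebra_simps)
      have "riem_dist D \<rho>0 (\<rho> (?t + h)) \<le> riem_dist D \<rho>0 (\<rho> ?t) + riem_dist D (\<rho> ?t) (\<rho> (?t + h))"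
        using t h by (intro riem_dist_triangle \<rho>0 pos) auto
      also have "riem_dist D (\<rho> ?t) (\<rho> (?t + h)) \<le> sqrt (h * (F ?t - F (?t + h)))"
        unfolding F_def using flow_dist[OF \<rho>(2,3,4) pos t, of h] h by simp
      also have "\<dots> \<le> ?k * (sqrt (F ?t) - sqrt (F (?t + h)))"
        using lam h t by (intro sqrt_step_le step F0) auto
      finally show ?case unfolding tS using Suc by (simp add: algebra_simps)
    qed
    \<comment> \<open>An implicit Euler step for F' = - 2 \<lambda> F: iterating \<open>step\<close>
      gives geometric decay along the grid.\<close>
    have geo: "F (real n * h) \<le> F 0 * (1 / (1 + 2 * lam * h)) ^ n" for n
    proof (induction n)
      case (Suc n)
      let ?t = "real n * h"
      have t: "0 \<le> ?t" and tS: "real (Suc n) * h = ?t + h" using h by (auto simp: algebra_simps)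
      have k: "0 < 1 + 2 * lam * h" using lam h by (simp add: add_pos_pos)
      have "F (?t + h) * (1 + 2 * lam * h) \<le> F ?t" using step[OF t h] by (simp add: algebra_simps)
      then have "F (?t + h) \<le> F ?t * (1 / (1 + 2 * lam * h))" using k by (simp add: field_simps)
      also have "\<dots> \<le> (F 0 * (1 / (1 + 2 * lam * h)) ^ n) * (1 / (1 + 2 * lam * h))"
        using Suc k by (intro mult_right_mono) auto
      finally show ?case unfolding tS by (simp add: mult_ac)
    qed simp
    have Flim: "(\<lambda>n. F (real n * h)) \<longlonglongrightarrow> 0"
    proof (rule tendsto_sandwich[of "\<lambda>_. 0" _ _ "\<lambda>n. F 0 * (1 / (1 + 2 * lam * h)) ^ n"])
      have "(\<lambda>n. F 0 * (1 / (1 + 2 * lam * h)) ^ n) \<longlonglongrightarrow> F 0 * 0"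
        using lam h by (intro tendsto_mult tendsto_const LIMSEQ_power_zero) (simp add: add_pos_pos)
      then show "(\<lambda>n. F 0 * (1 / (1 + 2 * lam * h)) ^ n) \<longlonglongrightarrow> 0" by simp
    qed (use F0 h geo in \<open>auto intro!: always_eventually\<close>)
    have nlim: "(\<lambda>n. norm (\<rho> (real n * h) - dens D)) \<longlonglongrightarrow> 0"
    proof (rule tendsto_sandwich[of "\<lambda>_. 0" _ _ "\<lambda>n. sqrt (F (real n * h) / p)"])
      have "(\<lambda>n. sqrt (F (real n * h) / p)) \<longlonglongrightarrow> sqrt (0 / p)"
        using p(1) by (intro tendsto_intros Flim) auto
      then show "(\<lambda>n. sqrt (F (real n * h) / p)) \<longlonglongrightarrow> 0" by simp
      have "norm (\<rho> (real n * h) - dens D) \<le> sqrt (F (real n * h) / p)" for n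
      proof (rule real_le_rsqrt)
        show "(norm (\<rho> (real n * h) - dens D))\<^sup>2 \<le> F (real n * h) / p"
          unfolding F_def using p(2)[OF pos[of "real n * h"]] h p(1) by (simp add: field_simps)
      qed
      then show "\<forall>\<^sub>F n in sequentially. norm (\<rho> (real n * h) - dens D) \<le> sqrt (F (real n * h) / p)" by simp
    qed auto
    have "\<forall>\<^sub>F n in sequentially. norm (\<rho> (real n * h) - dens D) < 1"
      using nlim by (rule order_tendstoD) simp
    \<comment> \<open>The grid never has to reach the density: the remaining distance is controlled
      by the Hoelder bound and tends to 0.\<close>
    then have "\<forall>\<^sub>F n in sequentially. riem_dist D \<rho>0 (dens D) \<le> ?k * sqrt (F 0) + C * sqrt (norm (\<rho> (real n * h) - dens D))"
    proof eventually_elim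
      case (elim n)
      have pn: "\<rho> (real n * h) \<in> pos_states D" using h by (intro pos) simp
      have "riem_dist D \<rho>0 (dens D) \<le> riem_dist D \<rho>0 (\<rho> (real n * h)) + riem_dist D (\<rho> (real n * h)) (dens D)"
        by (rule riem_dist_triangle[OF \<rho>0 pn dens_pos_states])
      moreover have "riem_dist D (\<rho> (real n * h)) (dens D) \<le> C * sqrt (norm (\<rho> (real n * h) - dens D))"
        using elim by (intro C(2) pn dens_pos_states) simp
      moreover have "?k * (sqrt (F 0) - sqrt (F (real n * h))) \<le> ?k * sqrt (F 0)"
        using F0[of "real n * h"] h lam by (intro mult_left_mono) auto
      ultimately show ?case using tele[of n] by linarith
    qed
    moreover have "(\<lambda>n. ?k * sqrt (F 0) + C * sqrt (norm (\<rho> (real n * h) - dens D))) \<longlonglongrightarrow> ?k * sqrt (F 0) + C * sqrt 0"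
      by (intro tendsto_intros nlim)
    ultimately show ?thesis using tendsto_lowerbound[OF _ _ sequentially_bot] by fastforce
  qed
  have "riem_dist D \<rho>0 (dens D) \<le> sqrt (2 / lam) * sqrt (F 0)"
  proof (rule tendsto_lowerbound)
    have "((\<lambda>h. sqrt (2 / lam + 4 * h) * sqrt (F 0)) \<longlongrightarrow> sqrt (2 / lam + 4 * 0) * sqrt (F 0)) (at_right 0)"
      by (intro tendsto_intros)
    then show "((\<lambda>h. sqrt (2 / lam + 4 * h) * sqrt (F 0)) \<longlongrightarrow> sqrt (2 / lam) * sqrt (F 0)) (at_right 0)" by simp
    show "\<forall>\<^sub>F h in at_right 0. riem_dist D \<rho>0 (dens D) \<le> sqrt (2 / lam + 4 * h) * sqrt (F 0)"
      using main by (auto simp: eventually_at_filter)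
  qed simp
  then show ?thesis unfolding F_def \<rho>(1) by (simp add: real_sqrt_mult real_sqrt_divide)
qed

lemma talagrand_inequality: "talagrand D lam"
  unfolding talagrand_def
proof
  fix \<rho> assume \<rho>: "\<rho> \<in> states D"
  show "transport_dist D \<rho> (dens D) \<le> sqrt (2 / lam * Ent \<rho>)"
  proof (cases "\<rho> \<in> pos_states D")
    case True
    then show ?thesis unfolding transport_dist_def using dens_pos_states riem_dist_dens by simp
  next
    case False
    show ?thesis
    proof (rule transport_dist_le_limit[OF \<rho> False])
      \<comment> \<open>Convexity keeps the entropy of the mixture below that of \<rho>, so the
        bound for positive states is uniform as t tends to 0.\<close>
      fix t :: real assume t: "0 < t" "t \<le> 1"
      let ?\<mu> = "(1 - t) *\<^sub>R \<rho> + t *\<^sub>R dens D"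
      have "riem_dist D ?\<mu> (dens D) \<le> sqrt (2 / lam * Ent ?\<mu>)"
        by (rule riem_dist_dens[OF states_mix_pos[OF \<rho> dens_pos_states t]])
      also have "\<dots> \<le> sqrt (2 / lam * Ent \<rho>)"
      proof (intro real_sqrt_le_mono mult_left_mono)
        have "(1 - t) * Ent \<rho> \<le> 1 * Ent \<rho>" using t Ent_nonneg[OF \<rho>] by (intro mult_right_mono) auto
        then show "Ent ?\<mu> \<le> Ent \<rho>" using Ent_mix[OF \<rho> t] by simp
      qed (use lam in simp)
      finally show "riem_dist D ?\<mu> (dens D) \<le> sqrt (2 / lam * Ent \<rho>)" .
    qed
  qed
qed

end

end

theorem theorem11p5:
  fixes D :: "('n::finite, 'm::finite, 'j) diff_struct" and lam :: real
  assumes "differential_structure D" and "ergodic D"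
    and "lam > 0" and "MLSI D lam"
  shows "talagrand D lam"
proof -
  interpret dstruct_erg D by unfold_locales (rule assms)+
  show ?thesis by (rule talagrand_inequality[OF assms(3,4)])
qed

end
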